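(* Suppose that a $(k_1,k_2)$-mode Hopf--steady state bifurcation occurs for $$\dot u(t)=D(\alpha)\Delta u(t)+L(\alpha)u_t+G(u_t,\alpha)$$ at the trivial equilibrium when $\alpha=(0,0)$ (all hypotheses are listed in the context). Ignoring the effect of the perturbation parameter $\alpha$ in terms of order $\ge 3$, the normal form of this equation restricted to the center manifold, up to third order, is $$\begin{aligned} \dot z_1&=a_1(\alpha)z_1+a_{11}z_1^2+a_{23}z_2\bar z_2+a_{111}z_1^3+a_{123}z_1z_2\bar z_2+h.o.t.,\\ \dot z_2&=\mathrm i\omega_0z_2+b_2(\alpha)z_2+b_{12}z_1z_2+b_{112}z_1^2z_2+b_{223}z_2^2\bar z_2+h.o.t.,\\ \dot{\bar z}_2&=-\mathrm i\omega_0\bar z_2+\overline{b_2(\alpha)}\bar z_2+\overline{b_{12}}z_1\bar z_2+\overline{b_{112}}z_1^2\bar z_2+\overline{b_{223}}z_2\bar z_2^2+h.o.t., \end{aligned}$$ where $$a_1(\alpha)=\tfrac12\psi_1(0)\big(L_1(\alpha)\phi_1-\mu_{k_1}D_1(\alpha)\phi_1(0)\big),\qquad b_2(\alpha)=\tfrac12\psi_2(0)\big(L_1(\alpha)\phi_2-\mu_{k_2}D_1(\alpha)\phi_2(0)\big),$$ $$a_{11}=\tfrac12\psi_1(0)Q_{\phi_1\phi_1}\langle\beta_{k_1}^2,\beta_{k_1}\rangle,\quad a_{23}=\psi_1(0)Q_{\phi_2\bar\phi_2}\langle\beta_{k_2}^2,\beta_{k_1}\rangle,\quad b_{12}=\psi_2(0)Q_{\phi_1\phi_2}\langle\beta_{k_1}\beta_{k_2},\beta_{k_2}\rangle,$$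 $$\begin{aligned} a_{111}=&\tfrac16\psi_1(0)C_{\phi_1\phi_1\phi_1}\langle\beta_{k_1}^3,\beta_{k_1}\rangle+\psi_1(0)\langle Q_{\phi_1h_{200}}\beta_{k_1},\beta_{k_1}\rangle\\ &+\tfrac1{2\mathrm i\omega_0}\psi_1(0)[-Q_{\phi_1\phi_2}\psi_2(0)+Q_{\phi_1\bar\phi_2}\bar\psi_2(0)]Q_{\phi_1\phi_1}\langle\beta_{k_1}\beta_{k_2},\beta_{k_1}\rangle\langle\beta_{k_1}^2,\beta_{k_2}\rangle, \end{aligned}$$ $$\begin{aligned} a_{123}=&\psi_1(0)C_{\phi_1\phi_2\bar\phi_2}\langle\beta_{k_1}\beta_{k_2}^2,\beta_{k_1}\rangle\\ &+\tfrac1{\mathrm i\omega_0}\psi_1(0)\Big\{[-Q_{\phi_1\phi_2}\psi_2(0)+Q_{\phi_1\bar\phi_2}\bar\psi_2(0)]Q_{\phi_2\bar\phi_2}\langle\beta_{k_1}\beta_{k_2},\beta_{k_1}\rangle\langle\beta_{k_2}^2,\beta_{k_2}\rangle\\ &\qquad+\tfrac12[-Q_{\phi_2\phi_2}\psi_2(0)Q_{\phi_1\bar\phi_2}+Q_{\bar\phi_2\bar\phi_2}\bar\psi_2(0)Q_{\phi_1\phi_2}]\langle\beta_{k_1}\beta_{k_2},\beta_{k_2}\rangle\langle\beta_{k_2}^2,\beta_{k_1}\rangle\Big\}\\ &+\psi_1(0)\big(\langle Q_{\phi_1h_{011}}\beta_{k_1},\beta_{k_1}\rangle+\langle Q_{\phi_2h_{101}}\beta_{k_2},\beta_{k_1}\rangle+\langle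 Q_{\bar\phi_2h_{110}}\beta_{k_2},\beta_{k_1}\rangle\big), \end{aligned}$$ $$\begin{aligned} b_{112}=&\tfrac12\psi_2(0)C_{\phi_1\phi_1\phi_2}\langle\beta_{k_1}^2\beta_{k_2},\beta_{k_2}\rangle\\ &+\tfrac1{2\mathrm i\omega_0}\psi_2(0)\Big\{[2Q_{\phi_1\phi_1}\psi_1(0)\langle\beta_{k_1}\beta_{k_2},\beta_{k_1}\rangle\langle\beta_{k_1}^2,\beta_{k_2}\rangle+Q_{\phi_1\bar\phi_2}\bar\psi_2(0)\langle\beta_{k_1}\beta_{k_2},\beta_{k_2}\rangle^2]Q_{\phi_1\phi_2}\\ &\qquad+[-Q_{\phi_2\phi_2}\psi_2(0)+Q_{\phi_2\bar\phi_2}\bar\psi_2(0)]Q_{\phi_1\phi_1}\langle\beta_{k_1}^2,\beta_{k_2}\rangle\langle\beta_{k_2}^2,\beta_{k_2}\rangle\Big\}\\ &+\psi_2(0)\big(\langle Q_{\phi_1h_{110}}\beta_{k_1},\beta_{k_2}\rangle+\langle Q_{\phi_2h_{200}}\beta_{k_2},\beta_{k_2}\rangle\big), \end{aligned}$$ $$\begin{aligned} b_{223}=&\tfrac12\psi_2(0)C_{\phi_2\phi_2\bar\phi_2}\langle\beta_{k_2}^3,\beta_{k_2}\rangle\\ &+\tfrac1{4\mathrm i\omega_0}\psi_2(0)\Big\{Q_{\phi_1\bar\phi_2}\psi_1(0)Q_{\phi_2\phi_2}\langle\beta_{k_1}\beta_{k_2},\beta_{k_2}\rangle\langle\beta_{k_2}^2,\beta_{k_1}\rangle+\tfrac23Q_{\bar\phi_2\bar\phi_2}\bar\psi_2(0)Q_{\phi_2\phi_2}\langle\beta_{k_2}^2,\beta_{k_2}\rangle^2\\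 &\qquad+[-2Q_{\phi_2\phi_2}\psi_2(0)+4Q_{\phi_2\bar\phi_2}\bar\psi_2(0)]Q_{\phi_2\bar\phi_2}\langle\beta_{k_2}^2,\beta_{k_2}\rangle^2\Big\}\\ &+\psi_2(0)\big(\langle Q_{\phi_2h_{011}}\beta_{k_2},\beta_{k_2}\rangle+\langle Q_{\bar\phi_2h_{020}}\beta_{k_2},\beta_{k_2}\rangle\big). \end{aligned}$$ Here $h_{200},h_{020},h_{002},h_{110},h_{101},h_{011}\in\mathcal Q^1$ are determined by the following relations. For $\theta\in[-r,0]$, $$\begin{aligned} h_{200}(\theta)=&h_{200}(0)+\tfrac12\Big\{\theta\phi_1(0)\psi_1(0)Q_{\phi_1\phi_1}\langle\beta_{k_1}^2,\beta_{k_1}\rangle\beta_{k_1}\\ &+\tfrac1{\mathrm i\omega_0}[(e^{\mathrm i\omega_0\theta}-1)\phi_2(0)\psi_2(0)-(e^{-\mathrm i\omega_0\theta}-1)\bar\phi_2(0)\bar\psi_2(0)]Q_{\phi_1\phi_1}\langle\beta_{k_1}^2,\beta_{k_2}\rangle\beta_{k_2}\Big\},\\ h_{011}(\theta)=&h_{011}(0)+\theta\phi_1(0)\psi_1(0)Q_{\phi_2\bar\phi_2}\langle\beta_{k_2}^2,\beta_{k_1}\rangle\beta_{k_1}\\ &+\tfrac1{\mathrm i\omega_0}[(e^{\mathrm i\omega_0\theta}-1)\phi_2(0)\psi_2(0)-(e^{-\mathrm i\omega_0\theta}-1)\bar\phi_2(0)\bar\psi_2(0)]Q_{\phi_2\bar\phi_2}\langle\beta_{k_2}^2,\beta_{k_2}\rangle\beta_{k_2},\\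 h_{020}(\theta)=&h_{020}(0)e^{2\mathrm i\omega_0\theta}+\tfrac1{2\mathrm i\omega_0}\Big\{\tfrac12(e^{2\mathrm i\omega_0\theta}-1)\phi_1(0)\psi_1(0)Q_{\phi_2\phi_2}\langle\beta_{k_2}^2,\beta_{k_1}\rangle\beta_{k_1}\\ &+[(e^{2\mathrm i\omega_0\theta}-e^{\mathrm i\omega_0\theta})\phi_2(0)\psi_2(0)+\tfrac13(e^{2\mathrm i\omega_0\theta}-e^{-\mathrm i\omega_0\theta})\bar\phi_2(0)\bar\psi_2(0)]Q_{\phi_2\phi_2}\langle\beta_{k_2}^2,\beta_{k_2}\rangle\beta_{k_2}\Big\},\\ h_{110}(\theta)=&h_{110}(0)e^{\mathrm i\omega_0\theta}+\tfrac1{\mathrm i\omega_0}(e^{\mathrm i\omega_0\theta}-1)\phi_1(0)\psi_1(0)Q_{\phi_1\phi_2}\langle\beta_{k_1}\beta_{k_2},\beta_{k_1}\rangle\beta_{k_1}\\ &+[\theta e^{\mathrm i\omega_0\theta}\phi_2(0)\psi_2(0)+\tfrac1{2\mathrm i\omega_0}(e^{\mathrm i\omega_0\theta}-e^{-\mathrm i\omega_0\theta})\bar\phi_2(0)\bar\psi_2(0)]Q_{\phi_1\phi_2}\langle\beta_{k_1}\beta_{k_2},\beta_{k_2}\rangle\beta_{k_2},\\ h_{002}(\theta)=&\overline{h_{020}(\theta)},\qquad h_{101}(\theta)=\overline{h_{110}(\theta)}, \end{aligned}$$ and $$\begin{aligned} L_0(h_{200})+D_0\Delta h_{200}(0)=&\tfrac12\big[-Q_{\phi_1\phi_1}\beta_{k_1}^2+\phi_1(0)\psi_1(0)Q_{\phi_1\phi_1}\langle\beta_{k_1}^2,\beta_{k_1}\rangle\beta_{k_1}\\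 &+(\phi_2(0)\psi_2(0)+\bar\phi_2(0)\bar\psi_2(0))Q_{\phi_1\phi_1}\langle\beta_{k_1}^2,\beta_{k_2}\rangle\beta_{k_2}\big],\\ L_0(h_{011})+D_0\Delta h_{011}(0)=&-Q_{\phi_2\bar\phi_2}\beta_{k_2}^2+\phi_1(0)\psi_1(0)Q_{\phi_2\bar\phi_2}\langle\beta_{k_2}^2,\beta_{k_1}\rangle\beta_{k_1}\\ &+(\phi_2(0)\psi_2(0)+\bar\phi_2(0)\bar\psi_2(0))Q_{\phi_2\bar\phi_2}\langle\beta_{k_2}^2,\beta_{k_2}\rangle\beta_{k_2},\\ -2\mathrm i\omega_0h_{020}(0)+L_0(h_{020})+D_0\Delta h_{020}(0)=&\tfrac12\big[-Q_{\phi_2\phi_2}\beta_{k_2}^2+\phi_1(0)\psi_1(0)Q_{\phi_2\phi_2}\langle\beta_{k_2}^2,\beta_{k_1}\rangle\beta_{k_1}\\ &+(\phi_2(0)\psi_2(0)+\bar\phi_2(0)\bar\psi_2(0))Q_{\phi_2\phi_2}\langle\beta_{k_2}^2,\beta_{k_2}\rangle\beta_{k_2}\big],\\ -\mathrm i\omega_0h_{110}(0)+L_0(h_{110})+D_0\Delta h_{110}(0)=&-Q_{\phi_1\phi_2}\beta_{k_1}\beta_{k_2}+\phi_1(0)\psi_1(0)Q_{\phi_1\phi_2}\langle\beta_{k_1}\beta_{k_2},\beta_{k_1}\rangle\beta_{k_1}\\ &+(\phi_2(0)\psi_2(0)+\bar\phi_2(0)\bar\psi_2(0))Q_{\phi_1\phi_2}\langle\beta_{k_1}\beta_{k_2},\beta_{k_2}\rangle\beta_{k_2}.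 \end{aligned}$$
   Context: **Equation.** $\Omega\subset\mathbb R^n$ is bounded, open, with smooth boundary; $X$ is a Hilbert space of complex-valued functions on $\bar\Omega$ with inner product $\langle\cdot,\cdot\rangle$. Either homogeneous Neumann conditions (then $\mathbb N_B=\mathbb N\cup\{0\}$) or homogeneous Dirichlet conditions (then $\mathbb N_B=\mathbb N$) are imposed; $\mu_k$ ($k\in\mathbb N_B$) are the eigenvalues of $-\Delta$ with this boundary condition, in nondecreasing order, with (real) eigenfunctions $\beta_k$, $\Delta\beta_k+\mu_k\beta_k=0$, forming an orthonormal basis of $X$. Fix $m\in\mathbb N$, $r>0$; $\mathcal C=C([-r,0];X^m)$ and $C([-r,0];\mathbb C^m)$ carry the sup norm. $u_t(\theta)=u(t+\theta)$. $dom(\Delta)=Y^m$, with $Y$ the set of $u\in W^{2,2}(\Omega)$ satisfying the boundary condition. $D(\alpha)=\mathrm{diag}(d_1(\alpha),\dots,d_m(\alpha))$, $d_i(0)>0$; $\alpha=(\alpha_1,\alpha_2)$ lies in a neighborhood $V$ of $0\in\mathbb R^2$; $\alpha\mapsto L(\alpha)$ is a $C^1$ map into bounded linear operators $\mathcal C\to X^m$; $G:\mathcal C\times V\to X^m$ is $C^k$, $k\ge3$, with $G(0,\alpha)=0$ and $D_\varphi G(0,\alpha)=0$. $L$ and $G$ are real on real functions. $L_0=L(0)$, $D_0=D(0)$. Formal Taylor expansions: $L(\alpha)=L_0+\frac12L_1(\alpha)+\cdots$, $D(\alpha)=D_0+\frac12D_1(\alpha)+\cdots$ with $L_1,D_1$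 linear in $\alpha$, and $G(v,0)=\frac1{2!}Q(v,v)+\frac1{3!}C(v,v,v)+O(|v|^4)$ with $Q,C$ symmetric multilinear (extended complex-multilinearly). Write $Q_{XY}=Q(X,Y)$, $C_{XYZ}=C(X,Y,Z)$. These operators act pointwise in the space variable: $L(\alpha)(\varphi\beta)=(L(\alpha)\varphi)\beta$, $Q(\varphi\beta,\psi\beta')=Q(\varphi,\psi)\beta\beta'$, and similarly for $C$, for $\varphi,\psi\in C([-r,0];\mathbb C^m)$ and scalar functions $\beta,\beta'$ of $x$. For $h\in\mathcal C$, $Q_{\phi h}\beta$ means $Q(\phi\beta,h)$. For vector functions $\langle v,\beta_k\rangle$ is taken componentwise. **Definition ($(k_1,k_2)$-mode Hopf--steady state bifurcation).** The following four hypotheses hold. (H1) $D_0\Delta$ generates a $C_0$-semigroup $T(t)$ on $X^m$ with $|T(t)|\le Me^{\omega t}$, $t\ge0$, for some $M\ge1$, $\omega\in\mathbb R$, and $T(t)$ is compact for every $t>0$. (H2) $L_0$ extends to a bounded linear operator from $B\mathcal C$ to $X^m$, where $B\mathcal C$ is the space (sup norm) of functions $[-r,0]\to X^m$ continuous on $[-r,0)$ with a limit as $\theta\to0^-$. (H3) For each $k\in\mathbb N_B$, $L_0$ maps $\mathcal B_k=\{\langle v(\cdot),\beta_k\rangle\beta_k:v\in\mathcal C\}$ into $\mathrm{span}\{e_i\beta_k:1\le i\le m\}$, $e_i$ the canonical basis. (H4) For $\alpha\in V$, the characteristic equation $\det(\lambda I+\mu_kD(\alpha)-L(\alpha)(e^{\lambda\cdot}I))=0$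 with $k=k_1\in\mathbb N_B$ has a simple real root $\gamma(\alpha)$ with $\gamma(0)=0$, $\frac{\partial\gamma}{\partial\alpha_2}(0)\ne0$; with $k=k_2\in\mathbb N_B$ it has a pair of simple complex conjugate roots $\nu(\alpha)\pm\mathrm i\omega(\alpha)$ with $\nu(0)=0$, $\omega(0)=\omega_0>0$, $\frac{\partial\nu}{\partial\alpha_1}(0)\ne0$; all other eigenvalues (over all $k\in\mathbb N_B$) have nonzero real part. **Bases.** $\eta_k$ is the $m\times m$ matrix function of bounded variation with $-\mu_kD_0\psi(0)+L_0\psi=\int_{-r}^0d\eta_k(\theta)\psi(\theta)$ for $\psi\in C([-r,0];\mathbb C^m)$. For $\psi\in C([0,r];\mathbb C^{m*})$ (row vectors), $(\psi,\varphi)_k=\psi(0)\varphi(0)-\int_{-r}^0\int_0^\theta\psi(\xi-\theta)\,d\eta_k(\theta)\varphi(\xi)\,d\xi$. $\phi_1(\theta)\equiv\phi_1(0)$ (real) spans the eigenspace for $\lambda=0$ of $\dot z=-\mu_{k_1}D_0z+L_0z_t$; $\phi_2(\theta)=\phi_2(0)e^{\mathrm i\omega_0\theta}$ that for $\mathrm i\omega_0$ of $\dot z=-\mu_{k_2}D_0z+L_0z_t$; $\psi_1(s)\equiv\psi_1(0)$ (real) and $\psi_2(s)=\psi_2(0)e^{-\mathrm i\omega_0s}$ are the corresponding adjoint eigenvectors. With $\Phi_1=\phi_1$, $\Psi_1=\psi_1$, $\Phi_2=(\phi_2,\bar\phi_2)$, $\Psi_2=(\psi_2,\bar\psi_2)^T$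 one normalizes $(\Psi_i,\Phi_i)_{k_i}=I$. **Reduction.** $\pi\phi=\sum_{i=1,2}\Phi_i(\Psi_i,\langle\phi(\cdot),\beta_{k_i}\rangle)_{k_i}\beta_{k_i}$ (extended to $B\mathcal C$); $X_0(\theta)=0$ for $\theta<0$, $X_0(0)=I$; $\mathcal Q^1=\{\phi\in\mathcal C:\dot\phi\in\mathcal C,\ \phi(0)\in dom(\Delta),\ \pi\phi=0\}$; $A_1\phi=\dot\phi+X_0[L_0\phi+D_0\Delta\phi(0)-\dot\phi(0)]$ on $\mathcal Q^1$. Writing the solution as $w(z)+y$, $w(z)=\phi_1z_1\beta_{k_1}+(\phi_2z_2+\bar\phi_2\bar z_2)\beta_{k_2}$, $z=(z_1,z_2,\bar z_2)$, $y\in\mathcal Q^1$, the equation becomes $\dot z=Bz+\frac1{2!}f_2^1+\frac1{3!}f_3^1+\cdots$, $\dot y=A_1y+\frac1{2!}f_2^2+\cdots$, with $B=\mathrm{diag}(0,\mathrm i\omega_0,-\mathrm i\omega_0)$, $F_2(v,\alpha)=L_1(\alpha)v+D_1(\alpha)\Delta v(0)+Q(v,v)$, $F_3(v,0)=C(v,v,v)$, $f_j^1$ having components $\psi_1(0)\langle F_j,\beta_{k_1}\rangle$, $\psi_2(0)\langle F_j,\beta_{k_2}\rangle$, $\bar\psi_2(0)\langle F_j,\beta_{k_2}\rangle$, and $f_2^2=(I-\pi)X_0F_2$, all evaluated at $v=w(z)+y$. **Normal form.** Let $(M_j^1p)(z,\alpha)=D_zp\,Bz-Bp$ on homogeneous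 $\mathbb C^3$-valued polynomials of degree $j$. The complement of $\mathrm{Im}(M_2^1)$ is spanned by $z_1^2e_1,z_2\bar z_2e_1,z_1\alpha_ie_1,z_1z_2e_2,z_2\alpha_ie_2,z_1\bar z_2e_3,\bar z_2\alpha_ie_3$ and that of $\mathrm{Im}(M_3^1)$ (with $\alpha=0$) by $z_1^3e_1,z_1z_2\bar z_2e_1,z_1^2z_2e_2,z_2^2\bar z_2e_2,z_1^2\bar z_2e_3,z_2\bar z_2^2e_3$; $\mathrm{Proj}$ is projection onto these complements along the remaining monomials. $U_2^1$ is the combination of the remaining quadratic monomials in $z$ with $M_2^1U_2^1=f_2^1(z,0,0)-\mathrm{Proj}f_2^1(z,0,0)$; $U_2^2=2h$, where $h(z)=h_{200}z_1^2+h_{020}z_2^2+h_{002}\bar z_2^2+h_{110}z_1z_2+h_{101}z_1\bar z_2+h_{011}z_2\bar z_2$ has coefficients in $\mathcal Q^1$ and is the unique solution of $D_zh(z)Bz-A_1h(z)=\frac12f_2^2(z,0,0)$. After $(z,y)=(\hat z,\hat y)+\frac1{2!}U_2(\hat z)$, $U_2=(U_2^1,U_2^2)$, the normal form on the local center manifold is $\dot z=Bz+\frac12g_2^1(z,0,\alpha)+\frac1{3!}g_3^1(z,0,0)+h.o.t.$, $g_2^1(z,0,\alpha)=\mathrm{Proj}f_2^1(z,0,\alpha)$, $g_3^1(z,0,0)=\mathrm{Proj}\{f_3^1(z,0,0)+\frac32[(D_{(z,y)}f_2^1(z,y,0))_{y=0}U_2(z)-D_zU_2^1(z)g_2^1(z,0,0)]\}$.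 Here $h.o.t.$ stands for terms of order $\ge4$ in $(z,\alpha)$ and all terms of order $\ge3$ that involve $\alpha$. *)

theory Defs
  imports "HOL-Analysis.Analysis"
begin

section \<open>Complex Hilbert spaces\<close>

text \<open>The inner product is linear in its first argument, so that \<open>cinner v \<beta>\<close> is the
  coefficient of \<open>v\<close> along \<open>\<beta>\<close>.\<close>

class complex_hilbert = real_inner + complete_space +
  fixes scaleC :: "complex \<Rightarrow> 'a \<Rightarrow> 'a" (infixr "*\<^sub>C" 75)
    and cinner :: "'a \<Rightarrow> 'a \<Rightarrow> complex"
  assumes scaleC_add_right: "scaleC c (x + y) = scaleC c x + scaleC c y"
    and scaleC_add_left: "scaleC (c + d) x = scaleC c x + scaleC d x"
    and scaleC_scaleC: "scaleC c (scaleC d x) = scaleC (c * d) x"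
    and scaleC_of_real: "scaleC (complex_of_real t) x = t *\<^sub>R x"
    and cinner_add_left: "cinner (x + y) z = cinner x z + cinner y z"
    and cinner_scaleC_left: "cinner (scaleC c x) y = c * cinner x y"
    and cinner_commute: "cinner x y = cnj (cinner y x)"
    and Re_cinner: "Re (cinner x y) = inner x y"

instantiation vec :: (complex_hilbert, finite) complex_hilbert
begin

definition scaleC_vec :: "complex \<Rightarrow> 'a ^ 'b \<Rightarrow> 'a ^ 'b"
  where "scaleC_vec c v = (\<chi> i. c *\<^sub>C (v $ i))"

definition cinner_vec :: "'a ^ 'b \<Rightarrow> 'a ^ 'b \<Rightarrow> complex"
  where "cinner_vec u v = (\<Sum>i\<in>UNIV. cinner (u $ i) (v $ i))"

instance
proof
  fix c d :: complex and t :: real and x y z :: "'a ^ 'b"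
  show "c *\<^sub>C (x + y) = c *\<^sub>C x + c *\<^sub>C y"
    by (simp add: scaleC_vec_def vec_eq_iff scaleC_add_right)
  show "(c + d) *\<^sub>C x = c *\<^sub>C x + d *\<^sub>C x"
    by (simp add: scaleC_vec_def vec_eq_iff scaleC_add_left)
  show "c *\<^sub>C d *\<^sub>C x = (c * d) *\<^sub>C x"
    by (simp add: scaleC_vec_def vec_eq_iff scaleC_scaleC)
  show "complex_of_real t *\<^sub>C x = t *\<^sub>R x"
    by (simp add: scaleC_vec_def vec_eq_iff scaleC_of_real)
  show "cinner (x + y) z = cinner x z + cinner y z"
    by (simp add: cinner_vec_def cinner_add_left sum.distrib)
  show "cinner (c *\<^sub>C x) y = c * cinner x y"
    by (simp add: cinner_vec_def scaleC_vec_def cinner_scaleC_left sum_distrib_left)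
  show "cinner x y = cnj (cinner y x)"
    unfolding cinner_vec_def cnj_sum by (rule sum.cong[OF refl], rule cinner_commute)
  show "Re (cinner x y) = inner x y"
    by (simp add: cinner_vec_def inner_vec_def Re_cinner)
qed

end

definition comp_ip :: "'x::complex_hilbert ^ 'm \<Rightarrow> 'x \<Rightarrow> complex ^ 'm"
  where "comp_ip v b = (\<chi> i. cinner (v $ i) b)"

definition tens :: "complex ^ 'm \<Rightarrow> 'x::complex_hilbert \<Rightarrow> 'x ^ 'm"  (infix "\<otimes>" 68)
  where "v \<otimes> b = (\<chi> i. (v $ i) *\<^sub>C b)"

definition htens :: "(real \<Rightarrow> complex ^ 'm) \<Rightarrow> 'x::complex_hilbert \<Rightarrow> real \<Rightarrow> 'x ^ 'm"
  where "htens \<phi> b = (\<lambda>\<theta>. \<phi> \<theta> \<otimes> b)"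

definition cvec :: "complex ^ 'm \<Rightarrow> complex ^ 'm"
  where "cvec v = (\<chi> i. cnj (v $ i))"

text \<open>Elements of \<open>\<complex>\<^sup>m\<close> also serve as row vectors: \<open>rowmul q v\<close> is the product of the row \<open>q\<close>
  and the column \<open>v\<close> (no conjugation), \<open>outer v q\<close> the product of the column \<open>v\<close> and the row \<open>q\<close>.\<close>

definition rowmul :: "complex ^ 'm \<Rightarrow> complex ^ 'm \<Rightarrow> complex"  (infix "\<cdot>" 68)
  where "q \<cdot> v = (\<Sum>i\<in>UNIV. q $ i * v $ i)"

definition outer :: "complex ^ 'm \<Rightarrow> complex ^ 'm \<Rightarrow> complex ^ 'm ^ 'm"
  where "outer v q = (\<chi> i j. v $ i * q $ j)"


section \<open>The Laplacian with boundary conditions\<close>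

definition pd :: "'n \<Rightarrow> (real ^ 'n \<Rightarrow> 'b::real_normed_vector) \<Rightarrow> real ^ 'n \<Rightarrow> 'b"
  where "pd i f x = frechet_derivative f (at x) (axis i 1)"

primrec iter_pd :: "'n list \<Rightarrow> (real ^ 'n \<Rightarrow> 'b::real_normed_vector) \<Rightarrow> real ^ 'n \<Rightarrow> 'b"
  where "iter_pd [] f = f"
  | "iter_pd (i # is) f = pd i (iter_pd is f)"

definition smooth_on :: "(real ^ 'n) set \<Rightarrow> (real ^ 'n \<Rightarrow> 'b::real_normed_vector) \<Rightarrow> bool"
  where "smooth_on U f \<longleftrightarrow> open U \<and> (\<forall>is. iter_pd is f differentiable_on U)"

definition gradient :: "(real ^ 'n \<Rightarrow> real) \<Rightarrow> real ^ 'n \<Rightarrow> real ^ 'n"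
  where "gradient f x = (\<chi> i. pd i f x)"

definition local_defining_fun ::
    "(real ^ 'n) set \<Rightarrow> real ^ 'n \<Rightarrow> (real ^ 'n) set \<Rightarrow> (real ^ 'n \<Rightarrow> real) \<Rightarrow> bool"
  where "local_defining_fun \<Omega> p U \<rho> \<longleftrightarrow>
    open U \<and> p \<in> U \<and> smooth_on U \<rho> \<and> (\<forall>x\<in>U. gradient \<rho> x \<noteq> 0) \<and> \<Omega> \<inter> U = {x \<in> U. \<rho> x < 0}"

definition smooth_boundary :: "(real ^ 'n) set \<Rightarrow> bool"
  where "smooth_boundary \<Omega> \<longleftrightarrow> (\<forall>p\<in>frontier \<Omega>. \<exists>U \<rho>. local_defining_fun \<Omega> p U \<rho>)"

definition outward_normal :: "(real ^ 'n) set \<Rightarrow> real ^ 'n \<Rightarrow> real ^ 'n \<Rightarrow> bool"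
  where "outward_normal \<Omega> p \<nu> \<longleftrightarrow>
    (\<exists>U \<rho>. local_defining_fun \<Omega> p U \<rho> \<and> \<nu> = gradient \<rho> p /\<^sub>R norm (gradient \<rho> p))"

definition L2_on :: "(real ^ 'n) set \<Rightarrow> (real ^ 'n \<Rightarrow> complex) \<Rightarrow> bool"
  where "L2_on \<Omega> f \<longleftrightarrow> f \<in> borel_measurable (lebesgue_on \<Omega>) \<and>
    integrable (lebesgue_on \<Omega>) (\<lambda>x. (cmod (f x))\<^sup>2)"

definition test_fun :: "(real ^ 'n) set \<Rightarrow> (real ^ 'n \<Rightarrow> complex) \<Rightarrow> bool"
  where "test_fun \<Omega> \<phi> \<longleftrightarrow>
    smooth_on UNIV \<phi> \<and> compact (closure {x. \<phi> x \<noteq> 0}) \<and> closure {x. \<phi> x \<noteq> 0} \<subseteq> \<Omega>"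

definition weak_pd ::
    "(real ^ 'n) set \<Rightarrow> 'n \<Rightarrow> (real ^ 'n \<Rightarrow> complex) \<Rightarrow> (real ^ 'n \<Rightarrow> complex) \<Rightarrow> bool"
  where "weak_pd \<Omega> i f g \<longleftrightarrow> L2_on \<Omega> f \<and> L2_on \<Omega> g \<and>
    (\<forall>\<phi>. test_fun \<Omega> \<phi> \<longrightarrow>
      (LINT x|lebesgue_on \<Omega>. f x * pd i \<phi> x) = - (LINT x|lebesgue_on \<Omega>. g x * \<phi> x))"

text \<open>\<open>W\<^sup>2\<^sup>,\<^sup>2(\<Omega>)\<close>, and \<open>W\<^sub>0\<^sup>1\<^sup>,\<^sup>2(\<Omega>)\<close>, the functions in \<open>W\<^sup>1\<^sup>,\<^sup>2(\<Omega>)\<close> with vanishing trace on the boundary.\<close>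

definition W22 :: "(real ^ 'n) set \<Rightarrow> (real ^ 'n \<Rightarrow> complex) \<Rightarrow> bool"
  where "W22 \<Omega> f \<longleftrightarrow>
    L2_on \<Omega> f \<and> (\<exists>g H. \<forall>i. weak_pd \<Omega> i f (g i) \<and> (\<forall>j. weak_pd \<Omega> j (g i) (H i j)))"

definition W12_0 :: "(real ^ 'n) set \<Rightarrow> (real ^ 'n \<Rightarrow> complex) \<Rightarrow> bool"
  where "W12_0 \<Omega> f \<longleftrightarrow> L2_on \<Omega> f \<and>
    (\<exists>g \<phi>. (\<forall>i. weak_pd \<Omega> i f (g i)) \<and> (\<forall>n::nat. test_fun \<Omega> (\<phi> n)) \<and>
      (\<lambda>n. LINT x|lebesgue_on \<Omega>. (cmod (\<phi> n x - f x))\<^sup>2) \<longlonglongrightarrow> 0 \<and>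
      (\<forall>i. (\<lambda>n. LINT x|lebesgue_on \<Omega>. (cmod (pd i (\<phi> n) x - g i x))\<^sup>2) \<longlonglongrightarrow> 0))"

definition weak_laplacian ::
    "(real ^ 'n) set \<Rightarrow> (real ^ 'n \<Rightarrow> complex) \<Rightarrow> (real ^ 'n \<Rightarrow> complex) \<Rightarrow> bool"
  where "weak_laplacian \<Omega> f l \<longleftrightarrow>
    (\<exists>g H. (\<forall>i. weak_pd \<Omega> i f (g i) \<and> weak_pd \<Omega> i (g i) (H i)) \<and>
      (AE x in lebesgue_on \<Omega>. l x = (\<Sum>i\<in>UNIV. H i x)))"

datatype bdry_cond = Neumann | Dirichlet

definition modes :: "bdry_cond \<Rightarrow> nat set"
  where "modes bc = (case bc of Neumann \<Rightarrow> UNIV | Dirichlet \<Rightarrow> {1..})"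

text \<open>The Neumann condition says that \<open>\<partial>f/\<partial>\<nu> = \<nu> \<cdot> \<nabla>f\<close> has vanishing trace; as \<open>\<nu>\<close> lives on the boundary
  only, it is replaced by a smooth field \<open>N\<close> that extends it.\<close>

definition bc_space :: "bdry_cond \<Rightarrow> (real ^ 'n) set \<Rightarrow> (real ^ 'n \<Rightarrow> complex) \<Rightarrow> bool"
  where "bc_space bc \<Omega> f \<longleftrightarrow> W22 \<Omega> f \<and>
    (case bc of
       Dirichlet \<Rightarrow> W12_0 \<Omega> f
     | Neumann \<Rightarrow> (\<exists>g N. (\<forall>i. weak_pd \<Omega> i f (g i)) \<and> smooth_on UNIV N \<and>
         (\<forall>p\<in>frontier \<Omega>. outward_normal \<Omega> p (N p)) \<and>
         W12_0 \<Omega> (\<lambda>x. \<Sum>i\<in>UNIV. of_real (N x $ i) * g i x)))"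

definition bc_eigenvalue :: "bdry_cond \<Rightarrow> (real ^ 'n) set \<Rightarrow> real \<Rightarrow> bool"
  where "bc_eigenvalue bc \<Omega> \<mu> \<longleftrightarrow>
    (\<exists>f. bc_space bc \<Omega> f \<and> \<not> (AE x in lebesgue_on \<Omega>. f x = 0) \<and>
      weak_laplacian \<Omega> f (\<lambda>x. - of_real \<mu> * f x))"


section \<open>Spaces of histories\<close>

text \<open>Histories are functions on \<open>\<real>\<close> of which only the restriction to \<open>[-r, 0]\<close> matters.\<close>

definition Cspace :: "real \<Rightarrow> (real \<Rightarrow> 'a::topological_space) set"
  where "Cspace r = {v. continuous_on {-r..0} v}"

definition BCspace :: "real \<Rightarrow> (real \<Rightarrow> 'a::topological_space) set"
  where "BCspace r = {v. continuous_on {-r..<0} v \<and> (\<exists>l. (v \<longlongrightarrow> l) (at_left 0))}"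

definition supnorm :: "real \<Rightarrow> (real \<Rightarrow> 'a::real_normed_vector) \<Rightarrow> real"
  where "supnorm r v = (SUP \<theta>\<in>{-r..0}. norm (v \<theta>))"

definition hderiv :: "real \<Rightarrow> (real \<Rightarrow> 'a::real_normed_vector) \<Rightarrow> real \<Rightarrow> 'a"
  where "hderiv r v = (\<lambda>\<theta>. vector_derivative v (at \<theta> within {-r..0}))"

definition bdd_linear_on ::
    "real \<Rightarrow> (real \<Rightarrow> 'a::complex_hilbert) set \<Rightarrow> ((real \<Rightarrow> 'a) \<Rightarrow> 'b::complex_hilbert) \<Rightarrow> bool"
  where "bdd_linear_on r F T \<longleftrightarrow>
    (\<forall>v\<in>F. \<forall>w\<in>F. T (\<lambda>\<theta>. v \<theta> + w \<theta>) = T v + T w) \<and>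
    (\<forall>c. \<forall>v\<in>F. T (\<lambda>\<theta>. c *\<^sub>C v \<theta>) = c *\<^sub>C T v) \<and>
    (\<exists>K. \<forall>v\<in>F. norm (T v) \<le> K * supnorm r v)"

definition sym_bilinear ::
    "real \<Rightarrow> ((real \<Rightarrow> 'a::complex_hilbert) \<Rightarrow> (real \<Rightarrow> 'a) \<Rightarrow> 'b::complex_hilbert) \<Rightarrow> bool"
  where "sym_bilinear r Q \<longleftrightarrow>
    (\<forall>w\<in>Cspace r. bdd_linear_on r (Cspace r) (\<lambda>v. Q v w)) \<and>
    (\<forall>v\<in>Cspace r. \<forall>w\<in>Cspace r. Q v w = Q w v) \<and>
    (\<exists>K. \<forall>v\<in>Cspace r. \<forall>w\<in>Cspace r. norm (Q v w) \<le> K * supnorm r v * supnorm r w)"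

definition sym_trilinear ::
    "real \<Rightarrow> ((real \<Rightarrow> 'a::complex_hilbert) \<Rightarrow> (real \<Rightarrow> 'a) \<Rightarrow> (real \<Rightarrow> 'a) \<Rightarrow> 'b::complex_hilbert) \<Rightarrow> bool"
  where "sym_trilinear r C \<longleftrightarrow>
    (\<forall>v\<in>Cspace r. \<forall>w\<in>Cspace r. bdd_linear_on r (Cspace r) (\<lambda>u. C u v w)) \<and>
    (\<forall>u\<in>Cspace r. \<forall>v\<in>Cspace r. \<forall>w\<in>Cspace r. C u v w = C v u w \<and> C u v w = C u w v) \<and>
    (\<exists>K. \<forall>u\<in>Cspace r. \<forall>v\<in>Cspace r. \<forall>w\<in>Cspace r.
      norm (C u v w) \<le> K * supnorm r u * supnorm r v * supnorm r w)"

text \<open>\<open>L\<close> is \<open>C\<^sup>1\<close> on \<open>V\<close> with respect to the operator norm, with derivative \<open>L'\<close>.\<close>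

definition C1_family ::
    "real \<Rightarrow> (real ^ 2) set \<Rightarrow> (real ^ 2 \<Rightarrow> (real \<Rightarrow> 'a::complex_hilbert) \<Rightarrow> 'b::complex_hilbert) \<Rightarrow> bool"
  where "C1_family r V L \<longleftrightarrow>
    (\<exists>L'. (\<forall>\<alpha>\<in>V. \<forall>\<kappa>. bdd_linear_on r (Cspace r) (L' \<alpha> \<kappa>)) \<and>
      (\<forall>\<alpha>\<in>V. \<forall>v\<in>Cspace r. linear (\<lambda>\<kappa>. L' \<alpha> \<kappa> v)) \<and>
      (\<forall>\<alpha>\<in>V. \<forall>\<epsilon>>0. \<exists>\<delta>>0. \<forall>\<alpha>'\<in>V. norm (\<alpha>' - \<alpha>) < \<delta> \<longrightarrow> (\<forall>v\<in>Cspace r.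
        norm (L \<alpha>' v - L \<alpha> v - L' \<alpha> (\<alpha>' - \<alpha>) v) \<le> \<epsilon> * norm (\<alpha>' - \<alpha>) * supnorm r v)) \<and>
      (\<forall>\<alpha>\<in>V. \<forall>\<epsilon>>0. \<exists>\<delta>>0. \<forall>\<alpha>'\<in>V. norm (\<alpha>' - \<alpha>) < \<delta> \<longrightarrow> (\<forall>\<kappa>. \<forall>v\<in>Cspace r.
        norm (L' \<alpha>' \<kappa> v - L' \<alpha> \<kappa> v) \<le> \<epsilon> * norm \<kappa> * supnorm r v)))"

text \<open>\<open>G\<close> is \<open>C\<^sup>k\<close> on \<open>C([-r,0]) \<times> V\<close> in the sense of Frechet: \<open>D j (\<phi>, \<alpha>)\<close> is its \<open>j\<close>-th derivative,
  a bounded real-multilinear map that takes the list of its \<open>j\<close> arguments.\<close>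

definition pnorm :: "real \<Rightarrow> (real \<Rightarrow> 'a::real_normed_vector) \<times> (real ^ 2) \<Rightarrow> real"
  where "pnorm r x = max (supnorm r (fst x)) (norm (snd x))"

definition plin ::
    "real \<Rightarrow> (real \<Rightarrow> 'a::real_normed_vector) \<times> (real ^ 2) \<Rightarrow> real \<Rightarrow> (real \<Rightarrow> 'a) \<times> (real ^ 2)
      \<Rightarrow> (real \<Rightarrow> 'a) \<times> (real ^ 2)"
  where "plin a x b y = (\<lambda>\<theta>. a *\<^sub>R fst x \<theta> + b *\<^sub>R fst y \<theta>, a *\<^sub>R snd x + b *\<^sub>R snd y)"

definition Ck_map ::
    "nat \<Rightarrow> real \<Rightarrow> (real ^ 2) set \<Rightarrow>
      ((real \<Rightarrow> 'a::real_normed_vector) \<Rightarrow> real ^ 2 \<Rightarrow> 'b::real_normed_vector) \<Rightarrow> bool"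
  where "Ck_map k r V G \<longleftrightarrow>
    (\<exists>D :: nat \<Rightarrow> (real \<Rightarrow> 'a) \<times> (real ^ 2) \<Rightarrow> ((real \<Rightarrow> 'a) \<times> (real ^ 2)) list \<Rightarrow> 'b.
      let U = Cspace r \<times> V; E = Cspace r \<times> (UNIV :: (real ^ 2) set) in
      (\<forall>\<phi> \<alpha>. (\<phi>, \<alpha>) \<in> U \<longrightarrow> D 0 (\<phi>, \<alpha>) [] = G \<phi> \<alpha>) \<and>
      (\<forall>j\<le>k. \<forall>x\<in>U.
        (\<forall>vs i a b. \<forall>u\<in>E. \<forall>w\<in>E. length vs = j \<and> set vs \<subseteq> E \<and> i < j \<longrightarrow>
          D j x (vs[i := plin a u b w]) = a *\<^sub>R D j x (vs[i := u]) + b *\<^sub>R D j x (vs[i := w])) \<and>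
        (\<exists>K. \<forall>vs. length vs = j \<and> set vs \<subseteq> E \<longrightarrow>
          norm (D j x vs) \<le> K * prod_list (map (pnorm r) vs))) \<and>
      (\<forall>j<k. \<forall>x\<in>U. \<forall>\<epsilon>>0. \<exists>\<delta>>0. \<forall>y\<in>U. pnorm r (plin 1 y (-1) x) < \<delta> \<longrightarrow>
        (\<forall>vs. length vs = j \<and> set vs \<subseteq> E \<longrightarrow>
          norm (D j y vs - D j x vs - D (Suc j) x (plin 1 y (-1) x # vs))
            \<le> \<epsilon> * pnorm r (plin 1 y (-1) x) * prod_list (map (pnorm r) vs))) \<and>
      (\<forall>x\<in>U. \<forall>\<epsilon>>0. \<exists>\<delta>>0. \<forall>y\<in>U. pnorm r (plin 1 y (-1) x) < \<delta> \<longrightarrow>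
        (\<forall>vs. length vs = k \<and> set vs \<subseteq> E \<longrightarrow>
          norm (D k y vs - D k x vs) \<le> \<epsilon> * prod_list (map (pnorm r) vs))))"


section \<open>Riemann--Stieltjes integrals\<close>

definition rs_partition :: "real \<Rightarrow> real \<Rightarrow> nat \<Rightarrow> (nat \<Rightarrow> real) \<Rightarrow> bool"
  where "rs_partition a b n t \<longleftrightarrow> t 0 = a \<and> t n = b \<and> (\<forall>i<n. t i \<le> t (Suc i))"

definition has_rs_integral ::
    "(real \<Rightarrow> complex) \<Rightarrow> (real \<Rightarrow> real) \<Rightarrow> real \<Rightarrow> real \<Rightarrow> complex \<Rightarrow> bool"
  where "has_rs_integral f g a b I \<longleftrightarrow>
    (\<forall>\<epsilon>>0. \<exists>\<delta>>0. \<forall>n t \<xi>. rs_partition a b n t \<and>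
      (\<forall>i<n. t (Suc i) - t i < \<delta> \<and> \<xi> i \<in> {t i..t (Suc i)}) \<longrightarrow>
      norm ((\<Sum>i<n. f (\<xi> i) * of_real (g (t (Suc i)) - g (t i))) - I) < \<epsilon>)"

definition rs_integral :: "(real \<Rightarrow> complex) \<Rightarrow> (real \<Rightarrow> real) \<Rightarrow> real \<Rightarrow> real \<Rightarrow> complex"
  where "rs_integral f g a b = (THE I. has_rs_integral f g a b I)"

definition bounded_variation :: "(real \<Rightarrow> real) \<Rightarrow> real \<Rightarrow> real \<Rightarrow> bool"
  where "bounded_variation g a b \<longleftrightarrow>
    (\<exists>K. \<forall>n t. rs_partition a b n t \<longrightarrow> (\<Sum>i<n. \<bar>g (t (Suc i)) - g (t i)\<bar>) \<le> K)"


section \<open>The equation and its standing assumptions\<close>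

text \<open>The data of \<open>u' = D(\<alpha>) \<Delta>u + L(\<alpha>) u\<^sub>t + G(u\<^sub>t, \<alpha>)\<close>, together with those of the
  bifurcation. The type \<open>'x\<close> is the Hilbert space \<open>X\<close>; \<open>fn u\<close> is the function on the closure of
  \<open>\<Omega>\<close> that the element \<open>u\<close> stands for, determined up to null sets. \<open>\<complex>\<^sup>m\<close>-valued histories have their
  own copies \<open>Lvec\<close>, \<open>L1vec\<close>, \<open>Qvec\<close>, \<open>Cvec\<close> of the operators, as these act pointwise in space.
  \<open>diffc \<alpha>\<close> is the diagonal of \<open>D(\<alpha>)\<close>, and \<open>diffc1 \<alpha>\<close> that of \<open>D\<^sub>1(\<alpha>)\<close>. The vectors \<open>p1\<close>, \<open>p2\<close>, \<open>q1\<close>,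
  \<open>q2\<close> are \<open>\<phi>\<^sub>1(0)\<close>, \<open>\<phi>\<^sub>2(0)\<close>, \<open>\<psi>\<^sub>1(0)\<close>, \<open>\<psi>\<^sub>2(0)\<close>.\<close>

record ('n, 'x, 'm) pfde =
  Omega :: "(real ^ 'n) set"
  bcond :: bdry_cond
  fn :: "'x \<Rightarrow> real ^ 'n \<Rightarrow> complex"
  mu :: "nat \<Rightarrow> real"
  eigf :: "nat \<Rightarrow> 'x"
  delay :: real
  params :: "(real ^ 2) set"
  diffc :: "real ^ 2 \<Rightarrow> real ^ 'm"
  diffc1 :: "real ^ 2 \<Rightarrow> real ^ 'm"
  Lop :: "real ^ 2 \<Rightarrow> (real \<Rightarrow> 'x ^ 'm) \<Rightarrow> 'x ^ 'm"
  L1op :: "real ^ 2 \<Rightarrow> (real \<Rightarrow> 'x ^ 'm) \<Rightarrow> 'x ^ 'm"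
  Gop :: "(real \<Rightarrow> 'x ^ 'm) \<Rightarrow> real ^ 2 \<Rightarrow> 'x ^ 'm"
  Qop :: "(real \<Rightarrow> 'x ^ 'm) \<Rightarrow> (real \<Rightarrow> 'x ^ 'm) \<Rightarrow> 'x ^ 'm"
  Cop :: "(real \<Rightarrow> 'x ^ 'm) \<Rightarrow> (real \<Rightarrow> 'x ^ 'm) \<Rightarrow> (real \<Rightarrow> 'x ^ 'm) \<Rightarrow> 'x ^ 'm"
  Lvec :: "real ^ 2 \<Rightarrow> (real \<Rightarrow> complex ^ 'm) \<Rightarrow> complex ^ 'm"
  L1vec :: "real ^ 2 \<Rightarrow> (real \<Rightarrow> complex ^ 'm) \<Rightarrow> complex ^ 'm"
  Qvec :: "(real \<Rightarrow> complex ^ 'm) \<Rightarrow> (real \<Rightarrow> complex ^ 'm) \<Rightarrow> complex ^ 'm"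
  Cvec :: "(real \<Rightarrow> complex ^ 'm) \<Rightarrow> (real \<Rightarrow> complex ^ 'm) \<Rightarrow> (real \<Rightarrow> complex ^ 'm) \<Rightarrow> complex ^ 'm"
  k1 :: nat
  k2 :: nat
  om0 :: real
  eta :: "nat \<Rightarrow> real \<Rightarrow> real ^ 'm ^ 'm"
  p1 :: "complex ^ 'm"
  p2 :: "complex ^ 'm"
  q1 :: "complex ^ 'm"
  q2 :: "complex ^ 'm"

definition is_conj :: "('n::finite, 'x::complex_hilbert, 'm::finite) pfde \<Rightarrow> 'x \<Rightarrow> 'x \<Rightarrow> bool"
  where "is_conj S u v \<longleftrightarrow> (AE x in lebesgue_on (Omega S). fn S v x = cnj (fn S u x))"

definition conjv :: "('n::finite, 'x::complex_hilbert, 'm::finite) pfde \<Rightarrow> 'x ^ 'm \<Rightarrow> 'x ^ 'm"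
  where "conjv S u = (\<chi> i. THE v. is_conj S (u $ i) v)"

definition real_vec :: "('n::finite, 'x::complex_hilbert, 'm::finite) pfde \<Rightarrow> 'x ^ 'm \<Rightarrow> bool"
  where "real_vec S u \<longleftrightarrow> (\<forall>i. is_conj S (u $ i) (u $ i))"

definition real_hist :: "('n::finite, 'x::complex_hilbert, 'm::finite) pfde \<Rightarrow> (real \<Rightarrow> 'x ^ 'm) \<Rightarrow> bool"
  where "real_hist S v \<longleftrightarrow> (\<forall>\<theta>\<in>{-delay S..0}. real_vec S (v \<theta>))"

text \<open>The element of \<open>X\<close> which is the pointwise product of the given functions.\<close>

definition prodX :: "('n::finite, 'x::complex_hilbert, 'm::finite) pfde \<Rightarrow> 'x list \<Rightarrow> 'x"
  where "prodX S us =
    (THE w. AE x in lebesgue_on (Omega S). fn S w x = prod_list (map (\<lambda>u. fn S u x) us))"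

text \<open>\<open>\<Delta>\<close> as an operator in \<open>X\<close>. Its domain consists of the elements of \<open>X\<close> that are in \<open>W\<^sup>2\<^sup>,\<^sup>2(\<Omega>)\<close>, satisfy
  the boundary condition and have their Laplacian in \<open>X\<close>; the last condition is void for \<open>X = L\<^sup>2(\<Omega>)\<close>.\<close>

definition lap_rel :: "('n::finite, 'x::complex_hilbert, 'm::finite) pfde \<Rightarrow> 'x \<Rightarrow> 'x \<Rightarrow> bool"
  where "lap_rel S u v \<longleftrightarrow>
    bc_space (bcond S) (Omega S) (fn S u) \<and> weak_laplacian (Omega S) (fn S u) (fn S v)"

definition dom_lap :: "('n::finite, 'x::complex_hilbert, 'm::finite) pfde \<Rightarrow> ('x ^ 'm) set"
  where "dom_lap S = {u. \<forall>i. \<exists>v. lap_rel S (u $ i) v}"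

definition lap :: "('n::finite, 'x::complex_hilbert, 'm::finite) pfde \<Rightarrow> 'x ^ 'm \<Rightarrow> 'x ^ 'm"
  where "lap S u = (\<chi> i. THE v. lap_rel S (u $ i) v)"

definition diag_mul :: "real ^ 'm \<Rightarrow> 'x::real_vector ^ 'm \<Rightarrow> 'x ^ 'm"
  where "diag_mul d u = (\<chi> i. d $ i *\<^sub>R u $ i)"

definition function_hilbert_space :: "('n::finite, 'x::complex_hilbert, 'm::finite) pfde \<Rightarrow> bool"
  where "function_hilbert_space S \<longleftrightarrow>
    (\<forall>c u v. AE x in lebesgue_on (Omega S). fn S (c *\<^sub>C u + v) x = c * fn S u x + fn S v x) \<and>
    (\<forall>u. (AE x in lebesgue_on (Omega S). fn S u x = 0) \<longleftrightarrow> u = 0) \<and>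
    (\<forall>u. \<exists>v. is_conj S u v \<and> norm v = norm u)"

definition eigenbasis :: "('n::finite, 'x::complex_hilbert, 'm::finite) pfde \<Rightarrow> bool"
  where "eigenbasis S \<longleftrightarrow>
    (\<forall>\<mu>. bc_eigenvalue (bcond S) (Omega S) \<mu> \<longleftrightarrow> \<mu> \<in> mu S ` modes (bcond S)) \<and>
    mono_on (modes (bcond S)) (mu S) \<and>
    (\<forall>k\<in>modes (bcond S). lap_rel S (eigf S k) (- mu S k *\<^sub>R eigf S k) \<and> is_conj S (eigf S k) (eigf S k)) \<and>
    (\<forall>j\<in>modes (bcond S). \<forall>k\<in>modes (bcond S). cinner (eigf S j) (eigf S k) = (if j = k then 1 else 0)) \<and>
    (\<forall>u. (\<forall>k\<in>modes (bcond S). cinner u (eigf S k) = 0) \<longrightarrow> u = 0)"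

text \<open>The expansion of \<open>G\<close> is required with remainder \<open>o(|v|\<^sup>3)\<close> only, which is what \<open>C\<^sup>3\<close> provides and
  which follows from \<open>O(|v|\<^sup>4)\<close>.\<close>

definition coefficient_maps :: "('n::finite, 'x::complex_hilbert, 'm::finite) pfde \<Rightarrow> bool"
  where "coefficient_maps S \<longleftrightarrow>
    (let r = delay S; V = params S; E = (Cspace r :: (real \<Rightarrow> 'x ^ 'm) set) in
    (\<forall>i. diffc S 0 $ i > 0) \<and>
    (diffc S has_derivative (\<lambda>\<alpha>. (1/2) *\<^sub>R diffc1 S \<alpha>)) (at 0) \<and>
    (\<forall>\<alpha>\<in>V. bdd_linear_on r E (Lop S \<alpha>)) \<and> C1_family r V (Lop S) \<and>
    (\<forall>\<alpha>\<in>V. \<forall>v\<in>E. real_hist S v \<longrightarrow> real_vec S (Lop S \<alpha> v)) \<and>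
    (\<forall>\<alpha>. bdd_linear_on r E (L1op S \<alpha>)) \<and> (\<forall>v\<in>E. linear (\<lambda>\<alpha>. L1op S \<alpha> v)) \<and>
    (\<forall>\<epsilon>>0. \<exists>\<delta>>0. \<forall>\<alpha>\<in>V. norm \<alpha> < \<delta> \<longrightarrow> (\<forall>v\<in>E.
      norm (Lop S \<alpha> v - Lop S 0 v - (1/2) *\<^sub>R L1op S \<alpha> v) \<le> \<epsilon> * norm \<alpha> * supnorm r v)) \<and>
    (\<exists>k\<ge>3. Ck_map k r V (Gop S)) \<and>
    (\<forall>\<alpha>\<in>V. \<forall>v\<in>E. real_hist S v \<longrightarrow> real_vec S (Gop S v \<alpha>)) \<and>
    (\<forall>\<alpha>\<in>V. Gop S (\<lambda>\<theta>. 0) \<alpha> = 0) \<and>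
    (\<forall>\<alpha>\<in>V. \<forall>\<epsilon>>0. \<exists>\<delta>>0. \<forall>v\<in>E. supnorm r v < \<delta> \<longrightarrow> norm (Gop S v \<alpha>) \<le> \<epsilon> * supnorm r v) \<and>
    sym_bilinear r (Qop S) \<and> sym_trilinear r (Cop S) \<and>
    (\<forall>\<epsilon>>0. \<exists>\<delta>>0. \<forall>v\<in>E. real_hist S v \<and> supnorm r v < \<delta> \<longrightarrow>
      norm (Gop S v 0 - (1/2) *\<^sub>R Qop S v v - (1/6) *\<^sub>R Cop S v v v) \<le> \<epsilon> * supnorm r v ^ 3))"

definition act_pointwise :: "('n::finite, 'x::complex_hilbert, 'm::finite) pfde \<Rightarrow> bool"
  where "act_pointwise S \<longleftrightarrow>
    (let E = (Cspace (delay S) :: (real \<Rightarrow> complex ^ 'm) set) in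
    (\<forall>\<alpha>\<in>params S. \<forall>\<phi>\<in>E. \<forall>b. Lop S \<alpha> (htens \<phi> b) = Lvec S \<alpha> \<phi> \<otimes> b) \<and>
    (\<forall>\<alpha>. \<forall>\<phi>\<in>E. \<forall>b. L1op S \<alpha> (htens \<phi> b) = L1vec S \<alpha> \<phi> \<otimes> b) \<and>
    (\<forall>\<phi>\<in>E. \<forall>\<phi>'\<in>E. \<forall>b b' i. AE x in lebesgue_on (Omega S).
      fn S (Qop S (htens \<phi> b) (htens \<phi>' b') $ i) x = Qvec S \<phi> \<phi>' $ i * (fn S b x * fn S b' x)) \<and>
    (\<forall>\<phi>\<in>E. \<forall>\<phi>'\<in>E. \<forall>\<zeta>\<in>E. \<forall>b b' b'' i. AE x in lebesgue_on (Omega S).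
      fn S (Cop S (htens \<phi> b) (htens \<phi>' b') (htens \<zeta> b'') $ i) x
        = Cvec S \<phi> \<phi>' \<zeta> $ i * (fn S b x * fn S b' x * fn S b'' x)))"

definition setting :: "('n::finite, 'x::complex_hilbert, 'm::finite) pfde \<Rightarrow> bool"
  where "setting S \<longleftrightarrow>
    open (Omega S) \<and> bounded (Omega S) \<and> smooth_boundary (Omega S) \<and>
    delay S > 0 \<and> open (params S) \<and> 0 \<in> params S \<and>
    function_hilbert_space S \<and> eigenbasis S \<and> coefficient_maps S \<and> act_pointwise S"


section \<open>Hopf--steady state bifurcation\<close>

text \<open>The generator of \<open>T\<close> is given as a relation, so that no choice of a value of \<open>\<Delta>\<close> outside of its
  domain enters.\<close>

definition hyp_H1 :: "('n::finite, 'x::complex_hilbert, 'm::finite) pfde \<Rightarrow> bool"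
  where "hyp_H1 S \<longleftrightarrow>
    (\<exists>(T :: real \<Rightarrow> 'x ^ 'm \<Rightarrow> 'x ^ 'm) M \<omega>. M \<ge> 1 \<and>
      (\<forall>u. T 0 u = u) \<and> (\<forall>s\<ge>0. \<forall>t\<ge>0. \<forall>u. T (s + t) u = T s (T t u)) \<and>
      (\<forall>t\<ge>0. bounded_linear (T t) \<and> (\<forall>c u. T t (c *\<^sub>C u) = c *\<^sub>C T t u)) \<and>
      (\<forall>t\<ge>0. \<forall>u. norm (T t u) \<le> M * exp (\<omega> * t) * norm u) \<and>
      (\<forall>u. continuous_on {0..} (\<lambda>t. T t u)) \<and>
      (\<forall>t>0. compact (closure (T t ` cball 0 1))) \<and>
      (\<forall>u w. ((\<lambda>t. (T t u - u) /\<^sub>R t) \<longlongrightarrow> w) (at_right 0) \<longleftrightarrow>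
        (\<exists>l. (\<forall>i. lap_rel S (u $ i) (l $ i)) \<and> w = diag_mul (diffc S 0) l)))"

definition hyp_H2 :: "('n::finite, 'x::complex_hilbert, 'm::finite) pfde \<Rightarrow> bool"
  where "hyp_H2 S \<longleftrightarrow>
    (\<exists>T. bdd_linear_on (delay S) (BCspace (delay S)) T \<and> (\<forall>v\<in>Cspace (delay S). T v = Lop S 0 v))"

definition hyp_H3 :: "('n::finite, 'x::complex_hilbert, 'm::finite) pfde \<Rightarrow> bool"
  where "hyp_H3 S \<longleftrightarrow>
    (\<forall>k\<in>modes (bcond S). \<forall>v\<in>Cspace (delay S).
      \<exists>c. Lop S 0 (\<lambda>\<theta>. comp_ip (v \<theta>) (eigf S k) \<otimes> eigf S k) = c \<otimes> eigf S k)"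

definition charfun ::
    "('n::finite, 'x::complex_hilbert, 'm::finite) pfde \<Rightarrow> nat \<Rightarrow> real ^ 2 \<Rightarrow> complex \<Rightarrow> complex"
  where "charfun S k \<alpha> z =
    det (\<chi> i j. (if i = j then z + of_real (mu S k * diffc S \<alpha> $ i) else 0)
      - Lvec S \<alpha> (\<lambda>\<theta>. exp (z * of_real \<theta>) *s axis j 1) $ i)"

definition simple_root :: "(complex \<Rightarrow> complex) \<Rightarrow> complex \<Rightarrow> bool"
  where "simple_root f z \<longleftrightarrow> f z = 0 \<and> deriv f z \<noteq> 0"

definition hyp_H4 :: "('n::finite, 'x::complex_hilbert, 'm::finite) pfde \<Rightarrow> bool"
  where "hyp_H4 S \<longleftrightarrow> k1 S \<in> modes (bcond S) \<and> k2 S \<in> modes (bcond S) \<and> om0 S > 0 \<and>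
    (\<exists>\<gamma> \<nu> \<omega> :: real ^ 2 \<Rightarrow> real.
      \<gamma> 0 = 0 \<and> \<nu> 0 = 0 \<and> \<omega> 0 = om0 S \<and>
      (\<exists>g. ((\<lambda>t. \<gamma> (axis 2 t)) has_real_derivative g) (at 0) \<and> g \<noteq> 0) \<and>
      (\<exists>g. ((\<lambda>t. \<nu> (axis 1 t)) has_real_derivative g) (at 0) \<and> g \<noteq> 0) \<and>
      (\<forall>\<alpha>\<in>params S. \<omega> \<alpha> \<noteq> 0 \<and>
        simple_root (charfun S (k1 S) \<alpha>) (of_real (\<gamma> \<alpha>)) \<and>
        simple_root (charfun S (k2 S) \<alpha>) (Complex (\<nu> \<alpha>) (\<omega> \<alpha>)) \<and>
        simple_root (charfun S (k2 S) \<alpha>) (Complex (\<nu> \<alpha>) (- \<omega> \<alpha>)) \<and>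
        (\<forall>k\<in>modes (bcond S). \<forall>z. charfun S k \<alpha> z = 0 \<and>
          (k, z) \<notin> {(k1 S, of_real (\<gamma> \<alpha>)), (k2 S, Complex (\<nu> \<alpha>) (\<omega> \<alpha>)), (k2 S, Complex (\<nu> \<alpha>) (- \<omega> \<alpha>))}
          \<longrightarrow> Re z \<noteq> 0)))"

definition hopf_steady_state :: "('n::finite, 'x::complex_hilbert, 'm::finite) pfde \<Rightarrow> bool"
  where "hopf_steady_state S \<longleftrightarrow> hyp_H1 S \<and> hyp_H2 S \<and> hyp_H3 S \<and> hyp_H4 S"


section \<open>Bases of the center space\<close>

definition phi1 :: "('n::finite, 'x::complex_hilbert, 'm::finite) pfde \<Rightarrow> real \<Rightarrow> complex ^ 'm"
  where "phi1 S = (\<lambda>\<theta>. p1 S)"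

definition phi2 :: "('n::finite, 'x::complex_hilbert, 'm::finite) pfde \<Rightarrow> real \<Rightarrow> complex ^ 'm"
  where "phi2 S = (\<lambda>\<theta>. exp (\<i> * of_real (om0 S * \<theta>)) *s p2 S)"

definition phi2c :: "('n::finite, 'x::complex_hilbert, 'm::finite) pfde \<Rightarrow> real \<Rightarrow> complex ^ 'm"
  where "phi2c S = (\<lambda>\<theta>. cvec (phi2 S \<theta>))"

definition psi1 :: "('n::finite, 'x::complex_hilbert, 'm::finite) pfde \<Rightarrow> real \<Rightarrow> complex ^ 'm"
  where "psi1 S = (\<lambda>s. q1 S)"

definition psi2 :: "('n::finite, 'x::complex_hilbert, 'm::finite) pfde \<Rightarrow> real \<Rightarrow> complex ^ 'm"
  where "psi2 S = (\<lambda>s. exp (- \<i> * of_real (om0 S * s)) *s q2 S)"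

definition psi2c :: "('n::finite, 'x::complex_hilbert, 'm::finite) pfde \<Rightarrow> real \<Rightarrow> complex ^ 'm"
  where "psi2c S = (\<lambda>s. cvec (psi2 S s))"

definition eta_represents :: "('n::finite, 'x::complex_hilbert, 'm::finite) pfde \<Rightarrow> nat \<Rightarrow> bool"
  where "eta_represents S k \<longleftrightarrow>
    (\<forall>a b. bounded_variation (\<lambda>\<theta>. eta S k \<theta> $ a $ b) (- delay S) 0) \<and>
    (\<forall>\<psi>\<in>Cspace (delay S). \<forall>a. \<exists>J.
      (\<forall>b. has_rs_integral (\<lambda>\<theta>. \<psi> \<theta> $ b) (\<lambda>\<theta>. eta S k \<theta> $ a $ b) (- delay S) 0 (J b)) \<and>
      - of_real (mu S k * diffc S 0 $ a) * \<psi> 0 $ a + Lvec S 0 \<psi> $ a = (\<Sum>b\<in>UNIV. J b))"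

text \<open>Here \<open>\<integral>\<^sub>0\<^sup>\<theta>\<close> with \<open>\<theta> \<le> 0\<close> is written as \<open>- \<integral>\<^sub>\<theta>\<^sup>0\<close>.\<close>

definition pairing ::
    "('n::finite, 'x::complex_hilbert, 'm::finite) pfde \<Rightarrow> nat \<Rightarrow> (real \<Rightarrow> complex ^ 'm) \<Rightarrow>
      (real \<Rightarrow> complex ^ 'm) \<Rightarrow> complex"
  where "pairing S k \<psi> \<phi> = (\<psi> 0 \<cdot> \<phi> 0) -
    (\<Sum>a\<in>UNIV. \<Sum>b\<in>UNIV. rs_integral
      (\<lambda>\<theta>. - integral {\<theta>..0} (\<lambda>\<xi>. \<psi> (\<xi> - \<theta>) $ a * \<phi> \<xi> $ b))
      (\<lambda>\<theta>. eta S k \<theta> $ a $ b) (- delay S) 0)"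

text \<open>Eigenfunctions for \<open>z' = - \<mu>\<^sub>k D\<^sub>0 z + L\<^sub>0 z\<^sub>t\<close>, i.e. of the operator \<open>\<phi> \<mapsto> \<phi>'\<close> with domain condition
  \<open>\<phi>'(0) = - \<mu>\<^sub>k D\<^sub>0 \<phi>(0) + L\<^sub>0 \<phi>\<close>, and of its formal adjoint \<open>\<psi> \<mapsto> - \<psi>'\<close> with domain condition
  \<open>- \<psi>'(0) = \<integral> \<psi>(-\<theta>) d\<eta>\<^sub>k(\<theta>)\<close>.\<close>

definition eigenfunction ::
    "('n::finite, 'x::complex_hilbert, 'm::finite) pfde \<Rightarrow> nat \<Rightarrow> complex \<Rightarrow> (real \<Rightarrow> complex ^ 'm) \<Rightarrow> bool"
  where "eigenfunction S k z \<phi> \<longleftrightarrow>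
    (\<forall>\<theta>\<in>{-delay S..0}. (\<phi> has_vector_derivative (z *s \<phi> \<theta>)) (at \<theta> within {-delay S..0})) \<and>
    (\<forall>a. z * \<phi> 0 $ a = - of_real (mu S k * diffc S 0 $ a) * \<phi> 0 $ a + Lvec S 0 \<phi> $ a)"

definition adjoint_eigenfunction ::
    "('n::finite, 'x::complex_hilbert, 'm::finite) pfde \<Rightarrow> nat \<Rightarrow> complex \<Rightarrow> (real \<Rightarrow> complex ^ 'm) \<Rightarrow> bool"
  where "adjoint_eigenfunction S k z \<psi> \<longleftrightarrow>
    (\<forall>s\<in>{0..delay S}. (\<psi> has_vector_derivative - (z *s \<psi> s)) (at s within {0..delay S})) \<and>
    (\<forall>b. z * \<psi> 0 $ b = (\<Sum>a\<in>UNIV. rs_integral (\<lambda>\<theta>. \<psi> (- \<theta>) $ a) (\<lambda>\<theta>. eta S k \<theta> $ a $ b) (- delay S) 0))"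

definition spans_eigenspace ::
    "('n::finite, 'x::complex_hilbert, 'm::finite) pfde \<Rightarrow> nat \<Rightarrow> complex \<Rightarrow> (real \<Rightarrow> complex ^ 'm) \<Rightarrow> bool"
  where "spans_eigenspace S k z \<phi> \<longleftrightarrow>
    (\<forall>f. eigenfunction S k z f \<longleftrightarrow> (\<exists>c. \<forall>\<theta>\<in>{-delay S..0}. f \<theta> = c *s \<phi> \<theta>))"

definition center_bases :: "('n::finite, 'x::complex_hilbert, 'm::finite) pfde \<Rightarrow> bool"
  where "center_bases S \<longleftrightarrow>
    (\<forall>k\<in>modes (bcond S). eta_represents S k) \<and>
    cvec (p1 S) = p1 S \<and> cvec (q1 S) = q1 S \<and>
    spans_eigenspace S (k1 S) 0 (phi1 S) \<and>
    spans_eigenspace S (k2 S) (\<i> * of_real (om0 S)) (phi2 S) \<and>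
    adjoint_eigenfunction S (k1 S) 0 (psi1 S) \<and>
    adjoint_eigenfunction S (k2 S) (\<i> * of_real (om0 S)) (psi2 S) \<and>
    pairing S (k1 S) (psi1 S) (phi1 S) = 1 \<and>
    pairing S (k2 S) (psi2 S) (phi2 S) = 1 \<and> pairing S (k2 S) (psi2 S) (phi2c S) = 0 \<and>
    pairing S (k2 S) (psi2c S) (phi2 S) = 0 \<and> pairing S (k2 S) (psi2c S) (phi2c S) = 1"


section \<open>Reduction\<close>

definition beta1 :: "('n::finite, 'x::complex_hilbert, 'm::finite) pfde \<Rightarrow> 'x" where "beta1 S = eigf S (k1 S)"

definition beta2 :: "('n::finite, 'x::complex_hilbert, 'm::finite) pfde \<Rightarrow> 'x" where "beta2 S = eigf S (k2 S)"

definition proj_center ::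
    "('n::finite, 'x::complex_hilbert, 'm::finite) pfde \<Rightarrow> (real \<Rightarrow> 'x ^ 'm) \<Rightarrow> real \<Rightarrow> 'x ^ 'm"
  where "proj_center S v \<theta> =
    (let v1 = (\<lambda>s. comp_ip (v s) (beta1 S)); v2 = (\<lambda>s. comp_ip (v s) (beta2 S)) in
      (pairing S (k1 S) (psi1 S) v1 *s phi1 S \<theta>) \<otimes> beta1 S +
      (pairing S (k2 S) (psi2 S) v2 *s phi2 S \<theta> + pairing S (k2 S) (psi2c S) v2 *s phi2c S \<theta>) \<otimes> beta2 S)"

definition X0 :: "'a \<Rightarrow> real \<Rightarrow> 'a::zero"
  where "X0 u \<theta> = (if \<theta> = 0 then u else 0)"

definition Q1_space :: "('n::finite, 'x::complex_hilbert, 'm::finite) pfde \<Rightarrow> (real \<Rightarrow> 'x ^ 'm) set"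
  where "Q1_space S = {v \<in> Cspace (delay S).
    (\<forall>\<theta>\<in>{-delay S..0}. v differentiable (at \<theta> within {-delay S..0})) \<and>
    hderiv (delay S) v \<in> Cspace (delay S) \<and> v 0 \<in> dom_lap S \<and>
    (\<forall>\<theta>\<in>{-delay S..0}. proj_center S v \<theta> = 0)}"

definition A1 :: "('n::finite, 'x::complex_hilbert, 'm::finite) pfde \<Rightarrow> (real \<Rightarrow> 'x ^ 'm) \<Rightarrow> real \<Rightarrow> 'x ^ 'm"
  where "A1 S v \<theta> = hderiv (delay S) v \<theta> +
    X0 (Lop S 0 v + diag_mul (diffc S 0) (lap S (v 0)) - hderiv (delay S) v 0) \<theta>"

text \<open>From here on \<open>z \<in> \<complex>\<^sup>3\<close> stands for \<open>(z\<^sub>1, z\<^sub>2, z\<^sub>2\<^sup>*)\<close>, where \<open>z\<^sub>2\<^sup>*\<close> is the conjugate of \<open>z\<^sub>2\<close>; polynomials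
  treat the three components as independent.\<close>

definition w_center ::
    "('n::finite, 'x::complex_hilbert, 'm::finite) pfde \<Rightarrow> complex ^ 3 \<Rightarrow> real \<Rightarrow> 'x ^ 'm"
  where "w_center S z \<theta> = (z $ 1 *s phi1 S \<theta>) \<otimes> beta1 S + (z $ 2 *s phi2 S \<theta> + z $ 3 *s phi2c S \<theta>) \<otimes> beta2 S"

definition F2 ::
    "('n::finite, 'x::complex_hilbert, 'm::finite) pfde \<Rightarrow> (real \<Rightarrow> 'x ^ 'm) \<Rightarrow> real ^ 2 \<Rightarrow> 'x ^ 'm"
  where "F2 S v \<alpha> = L1op S \<alpha> v + diag_mul (diffc1 S \<alpha>) (lap S (v 0)) + Qop S v v"

definition F3 :: "('n::finite, 'x::complex_hilbert, 'm::finite) pfde \<Rightarrow> (real \<Rightarrow> 'x ^ 'm) \<Rightarrow> 'x ^ 'm"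
  where "F3 S v = Cop S v v v"

definition center_comps :: "('n::finite, 'x::complex_hilbert, 'm::finite) pfde \<Rightarrow> 'x ^ 'm \<Rightarrow> complex ^ 3"
  where "center_comps S u = vector
    [psi1 S 0 \<cdot> comp_ip u (beta1 S), psi2 S 0 \<cdot> comp_ip u (beta2 S), psi2c S 0 \<cdot> comp_ip u (beta2 S)]"

definition f21 ::
    "('n::finite, 'x::complex_hilbert, 'm::finite) pfde \<Rightarrow> complex ^ 3 \<Rightarrow> (real \<Rightarrow> 'x ^ 'm) \<Rightarrow> real ^ 2 \<Rightarrow> complex ^ 3"
  where "f21 S z y \<alpha> = center_comps S (F2 S (\<lambda>\<theta>. w_center S z \<theta> + y \<theta>) \<alpha>)"

definition f31 :: "('n::finite, 'x::complex_hilbert, 'm::finite) pfde \<Rightarrow> complex ^ 3 \<Rightarrow> complex ^ 3"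
  where "f31 S z = center_comps S (F3 S (w_center S z))"

definition f22 :: "('n::finite, 'x::complex_hilbert, 'm::finite) pfde \<Rightarrow> complex ^ 3 \<Rightarrow> real \<Rightarrow> 'x ^ 'm"
  where "f22 S z \<theta> =
    (let F = X0 (F2 S (w_center S z) 0) in F \<theta> - proj_center S F \<theta>)"


section \<open>Normal form\<close>

definition Bmat :: "('n::finite, 'x::complex_hilbert, 'm::finite) pfde \<Rightarrow> complex ^ 3 \<Rightarrow> complex ^ 3"
  where "Bmat S z = vector [0, \<i> * of_real (om0 S) * z $ 2, - \<i> * of_real (om0 S) * z $ 3]"

text \<open>The index \<open>(a, b, c, d, e, i)\<close> stands for the monomial \<open>z\<^sub>1\<^sup>a z\<^sub>2\<^sup>b z\<^sub>3\<^sup>c \<alpha>\<^sub>1\<^sup>d \<alpha>\<^sub>2\<^sup>e e\<^sub>i\<close>.\<close>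

type_synonym mono_index = "nat \<times> nat \<times> nat \<times> nat \<times> nat \<times> 3"

definition vmonom :: "mono_index \<Rightarrow> complex ^ 3 \<Rightarrow> real ^ 2 \<Rightarrow> complex ^ 3"
  where "vmonom = (\<lambda>(a, b, c, d, e, i) z \<alpha>.
    axis i (z $ 1 ^ a * z $ 2 ^ b * z $ 3 ^ c * of_real (\<alpha> $ 1 ^ d * \<alpha> $ 2 ^ e)))"

definition monom_span :: "mono_index set \<Rightarrow> (complex ^ 3 \<Rightarrow> real ^ 2 \<Rightarrow> complex ^ 3) set"
  where "monom_span I = {p. \<exists>c. p = (\<lambda>z \<alpha>. \<Sum>s\<in>I. c s *s vmonom s z \<alpha>)}"

definition monoms2 :: "mono_index set"
  where "monoms2 = {(a, b, c, d, e, i). a + b + c + d + e = 2}"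

definition monoms2_z :: "mono_index set"
  where "monoms2_z = {(a, b, c, d, e, i). a + b + c = 2 \<and> d = 0 \<and> e = 0}"

definition monoms3_z :: "mono_index set"
  where "monoms3_z = {(a, b, c, d, e, i). a + b + c = 3 \<and> d = 0 \<and> e = 0}"

definition res2 :: "mono_index set"
  where "res2 =
    {(2,0,0,0,0,1), (0,1,1,0,0,1), (1,0,0,1,0,1), (1,0,0,0,1,1),
     (1,1,0,0,0,2), (0,1,0,1,0,2), (0,1,0,0,1,2),
     (1,0,1,0,0,3), (0,0,1,1,0,3), (0,0,1,0,1,3)}"

definition res3 :: "mono_index set"
  where "res3 = {(3,0,0,0,0,1), (1,1,1,0,0,1), (2,1,0,0,0,2), (0,2,1,0,0,2), (2,0,1,0,0,3), (0,1,2,0,0,3)}"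

definition proj_res ::
    "mono_index set \<Rightarrow> mono_index set \<Rightarrow> (complex ^ 3 \<Rightarrow> real ^ 2 \<Rightarrow> complex ^ 3) \<Rightarrow>
      complex ^ 3 \<Rightarrow> real ^ 2 \<Rightarrow> complex ^ 3"
  where "proj_res I R p =
    (THE g. g \<in> monom_span R \<and> (\<lambda>z \<alpha>. p z \<alpha> - g z \<alpha>) \<in> monom_span (I - R))"

definition M1 ::
    "('n::finite, 'x::complex_hilbert, 'm::finite) pfde \<Rightarrow> (complex ^ 3 \<Rightarrow> real ^ 2 \<Rightarrow> complex ^ 3) \<Rightarrow> complex ^ 3 \<Rightarrow> real ^ 2 \<Rightarrow> complex ^ 3"
  where "M1 S p z \<alpha> = frechet_derivative (\<lambda>z. p z \<alpha>) (at z) (Bmat S z) - Bmat S (p z \<alpha>)"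

definition g21 ::
    "('n::finite, 'x::complex_hilbert, 'm::finite) pfde \<Rightarrow> complex ^ 3 \<Rightarrow> real ^ 2 \<Rightarrow> complex ^ 3"
  where "g21 S = proj_res monoms2 res2 (\<lambda>z \<alpha>. f21 S z (\<lambda>\<theta>. 0) \<alpha>)"

text \<open>\<open>U\<^sub>2\<^sup>1\<close>; its elements of \<open>monom_span\<close> do not depend on \<open>\<alpha>\<close>.\<close>

definition U21 ::
    "('n::finite, 'x::complex_hilbert, 'm::finite) pfde \<Rightarrow> complex ^ 3 \<Rightarrow> complex ^ 3"
  where "U21 S = (\<lambda>z. (THE U. U \<in> monom_span (monoms2_z - res2) \<and>
    (\<forall>z. M1 S U z 0 = f21 S z (\<lambda>\<theta>. 0) 0 - g21 S z 0)) z 0)"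

text \<open>\<open>h a b c\<close> is the coefficient \<open>h\<^sub>a\<^sub>b\<^sub>c\<close>.\<close>

definition h_index :: "(nat \<times> nat \<times> nat) set"
  where "h_index = {(2,0,0), (0,2,0), (0,0,2), (1,1,0), (1,0,1), (0,1,1)}"

definition h_poly ::
    "(nat \<Rightarrow> nat \<Rightarrow> nat \<Rightarrow> real \<Rightarrow> 'x::complex_hilbert ^ 'm) \<Rightarrow> complex ^ 3 \<Rightarrow> real \<Rightarrow> 'x ^ 'm"
  where "h_poly h z \<theta> = (\<Sum>(a, b, c)\<in>h_index. (z $ 1 ^ a * z $ 2 ^ b * z $ 3 ^ c) *\<^sub>C h a b c \<theta>)"

definition h_in_Q1 ::
    "('n::finite, 'x::complex_hilbert, 'm::finite) pfde \<Rightarrow> (nat \<Rightarrow> nat \<Rightarrow> nat \<Rightarrow> real \<Rightarrow> 'x ^ 'm) \<Rightarrow> bool"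
  where "h_in_Q1 S h \<longleftrightarrow> (\<forall>(a, b, c)\<in>h_index. h a b c \<in> Q1_space S)"

definition h_solution ::
    "('n::finite, 'x::complex_hilbert, 'm::finite) pfde \<Rightarrow> (nat \<Rightarrow> nat \<Rightarrow> nat \<Rightarrow> real \<Rightarrow> 'x ^ 'm) \<Rightarrow> bool"
  where "h_solution S h \<longleftrightarrow> h_in_Q1 S h \<and>
    (\<forall>z. \<forall>\<theta>\<in>{-delay S..0}.
      frechet_derivative (\<lambda>z. h_poly h z \<theta>) (at z) (Bmat S z) - A1 S (h_poly h z) \<theta> = (1/2) *\<^sub>R f22 S z \<theta>)"

text \<open>The derivative of \<open>f\<^sub>2\<^sup>1\<close> with respect to \<open>(z, y)\<close>, at \<open>(z, 0)\<close> and in the direction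
  \<open>U\<^sub>2(z) = (U\<^sub>2\<^sup>1(z), 2 h(z))\<close>, is taken along the line in this direction.\<close>

definition g31 ::
    "('n::finite, 'x::complex_hilbert, 'm::finite) pfde \<Rightarrow> (nat \<Rightarrow> nat \<Rightarrow> nat \<Rightarrow> real \<Rightarrow> 'x ^ 'm) \<Rightarrow>
      complex ^ 3 \<Rightarrow> complex ^ 3"
  where "g31 S h = (\<lambda>z. proj_res monoms3_z res3
    (\<lambda>z \<alpha>. f31 S z + (3/2) *\<^sub>R
      (vector_derivative (\<lambda>t. f21 S (z + t *\<^sub>R U21 S z) (\<lambda>\<theta>. t *\<^sub>R (2 *\<^sub>R h_poly h z \<theta>)) 0) (at 0)
       - frechet_derivative (U21 S) (at z) (g21 S z 0))) z 0)"

text \<open>Terms of order at least 4 in \<open>(z, \<alpha>)\<close>, and of order at least 3 involving \<open>\<alpha>\<close>.\<close>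

definition hot :: "(real \<Rightarrow> complex \<Rightarrow> real ^ 2 \<Rightarrow> complex ^ 3) \<Rightarrow> bool"
  where "hot R \<longleftrightarrow>
    (\<exists>K. \<exists>\<delta>>0. \<forall>z1 z2 \<alpha>. norm (z1, z2, \<alpha>) < \<delta> \<longrightarrow>
      norm (R z1 z2 \<alpha>) \<le> K * (norm (z1, z2, \<alpha>) ^ 4 + norm \<alpha> * norm (z1, z2, \<alpha>) ^ 2))"

text \<open>\<open>z' = N(z\<^sub>1, z\<^sub>2, \<alpha>)\<close> is the normal form up to third order on the local center manifold; on real
  solutions \<open>z\<^sub>1\<close> is real and the third component of \<open>z\<close> is the conjugate of \<open>z\<^sub>2\<close>.\<close>

definition normal_form ::
    "('n::finite, 'x::complex_hilbert, 'm::finite) pfde \<Rightarrow> (nat \<Rightarrow> nat \<Rightarrow> nat \<Rightarrow> real \<Rightarrow> 'x ^ 'm) \<Rightarrow>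
      (real \<Rightarrow> complex \<Rightarrow> real ^ 2 \<Rightarrow> complex ^ 3) \<Rightarrow> bool"
  where "normal_form S h N \<longleftrightarrow>
    hot (\<lambda>z1 z2 \<alpha>. let z = vector [of_real z1, z2, cnj z2] in
      N z1 z2 \<alpha> - (Bmat S z + (1/2) *\<^sub>R g21 S z \<alpha> + (1/6) *\<^sub>R g31 S h z))"


section \<open>The relations for the coefficients of h\<close>

definition h_relations ::
    "('n::finite, 'x::complex_hilbert, 'm::finite) pfde \<Rightarrow> (nat \<Rightarrow> nat \<Rightarrow> nat \<Rightarrow> real \<Rightarrow> 'x ^ 'm) \<Rightarrow> bool"
  where "h_relations S h \<longleftrightarrow>
    (let \<beta>1 = beta1 S; \<beta>2 = beta2 S; iw = \<i> * complex_of_real (om0 S);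
      e = (\<lambda>c \<theta>. exp (c * iw * complex_of_real \<theta>));
      Q11 = Qvec S (phi1 S) (phi1 S); Q22c = Qvec S (phi2 S) (phi2c S);
      Q22 = Qvec S (phi2 S) (phi2 S); Q12 = Qvec S (phi1 S) (phi2 S);
      s11_1 = cinner (prodX S [\<beta>1, \<beta>1]) \<beta>1; s11_2 = cinner (prodX S [\<beta>1, \<beta>1]) \<beta>2;
      s22_1 = cinner (prodX S [\<beta>2, \<beta>2]) \<beta>1; s22_2 = cinner (prodX S [\<beta>2, \<beta>2]) \<beta>2;
      s12_1 = cinner (prodX S [\<beta>1, \<beta>2]) \<beta>1; s12_2 = cinner (prodX S [\<beta>1, \<beta>2]) \<beta>2;
      P1 = outer (p1 S) (q1 S); P2 = outer (p2 S) (q2 S); P2c = outer (cvec (p2 S)) (cvec (q2 S));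
      scale = (\<lambda>c M. (\<chi> i j. c * M $ i $ j) :: complex ^ 'm ^ 'm);
      DL = (\<lambda>v. Lop S 0 v + diag_mul (diffc S 0) (lap S (v 0))) in
    (\<forall>\<theta>\<in>{-delay S..0}.
      h 2 0 0 \<theta> = h 2 0 0 0 + (1/2) *\<^sub>C
        ((of_real \<theta> * s11_1) *s (P1 *v Q11) \<otimes> \<beta>1
         + (1 / iw * s11_2) *s ((scale (e 1 \<theta> - 1) P2 - scale (e (-1) \<theta> - 1) P2c) *v Q11) \<otimes> \<beta>2) \<and>
      h 0 1 1 \<theta> = h 0 1 1 0
        + (of_real \<theta> * s22_1) *s (P1 *v Q22c) \<otimes> \<beta>1
        + (1 / iw * s22_2) *s ((scale (e 1 \<theta> - 1) P2 - scale (e (-1) \<theta> - 1) P2c) *v Q22c) \<otimes> \<beta>2 \<and>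
      h 0 2 0 \<theta> = e 2 \<theta> *\<^sub>C h 0 2 0 0 + (1 / (2 * iw)) *\<^sub>C
        ((1/2 * (e 2 \<theta> - 1) * s22_1) *s (P1 *v Q22) \<otimes> \<beta>1
         + s22_2 *s ((scale (e 2 \<theta> - e 1 \<theta>) P2 + scale (1/3 * (e 2 \<theta> - e (-1) \<theta>)) P2c) *v Q22) \<otimes> \<beta>2) \<and>
      h 1 1 0 \<theta> = e 1 \<theta> *\<^sub>C h 1 1 0 0
        + (1 / iw * (e 1 \<theta> - 1) * s12_1) *s (P1 *v Q12) \<otimes> \<beta>1
        + s12_2 *s ((scale (of_real \<theta> * e 1 \<theta>) P2
            + scale (1 / (2 * iw) * (e 1 \<theta> - e (-1) \<theta>)) P2c) *v Q12) \<otimes> \<beta>2 \<and>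
      h 0 0 2 \<theta> = conjv S (h 0 2 0 \<theta>) \<and>
      h 1 0 1 \<theta> = conjv S (h 1 1 0 \<theta>)) \<and>
    DL (h 2 0 0) = (1/2) *\<^sub>C
      (- (Q11 \<otimes> prodX S [\<beta>1, \<beta>1]) + s11_1 *s (P1 *v Q11) \<otimes> \<beta>1 + s11_2 *s ((P2 + P2c) *v Q11) \<otimes> \<beta>2) \<and>
    DL (h 0 1 1) =
      - (Q22c \<otimes> prodX S [\<beta>2, \<beta>2]) + s22_1 *s (P1 *v Q22c) \<otimes> \<beta>1 + s22_2 *s ((P2 + P2c) *v Q22c) \<otimes> \<beta>2 \<and>
    - (2 * iw) *\<^sub>C h 0 2 0 0 + DL (h 0 2 0) = (1/2) *\<^sub>C
      (- (Q22 \<otimes> prodX S [\<beta>2, \<beta>2]) + s22_1 *s (P1 *v Q22) \<otimes> \<beta>1 + s22_2 *s ((P2 + P2c) *v Q22) \<otimes> \<beta>2) \<and>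
    - iw *\<^sub>C h 1 1 0 0 + DL (h 1 1 0) =
      - (Q12 \<otimes> prodX S [\<beta>1, \<beta>2]) + s12_1 *s (P1 *v Q12) \<otimes> \<beta>1 + s12_2 *s ((P2 + P2c) *v Q12) \<otimes> \<beta>2)"

end

theory Submission
  imports Defs
begin

text \<open>Everything takes place on three objects: the center functions \<open>e\<^sub>1 = \<phi>\<^sub>1\<beta>\<^sub>1\<close>, \<open>e\<^sub>2 = \<phi>\<^sub>2\<beta>\<^sub>2\<close> and the conjugate \<open>e\<^sub>3\<close> of
  \<open>e\<^sub>2\<close> (writing \<open>\<beta>\<^sub>1\<close> and \<open>\<beta>\<^sub>2 = \<beta>\<^sub>3\<close> for the critical eigenfunctions of the
  Laplacian, and \<open>\<psi>\<^sub>3\<close> for the conjugate of \<open>\<psi>\<^sub>2\<close>), the functionals \<open>\<Lambda>\<^sub>i u = \<psi>\<^sub>i(0)\<langle>u, \<beta>\<^sub>i\<rangle>\<close> that extract the components of the reduced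
  equation, and the field \<open>w(z) = \<Sum>\<^sub>j z\<^sub>j e\<^sub>j\<close>. The reduced quadratic and cubic terms are the numbers
  \<open>q\<^sub>i\<^sub>j\<^sub>k = \<Lambda>\<^sub>i Q(e\<^sub>j, e\<^sub>k)\<close> and \<open>c\<^sub>i\<^sub>j\<^sub>k\<^sub>l = \<Lambda>\<^sub>i C(e\<^sub>j, e\<^sub>k, e\<^sub>l)\<close> with monomials attached, and the normal form is a
  computation with such numbers.

  The operator \<open>M p = D\<^sub>zp Bz - Bp\<close> is diagonal on vector monomials: \<open>z\<^sub>1\<^sup>a z\<^sub>2\<^sup>b z\<^sub>3\<^sup>c e\<^sub>i\<close> has the eigenvalue
  \<open>\<i>\<omega>\<^sub>0(b - c - \<epsilon>\<^sub>i)\<close> with \<open>\<epsilon> = (0, 1, -1)\<close> (\<open>vmonom_deriv\<close>). The complements onto which \<open>Proj\<close> projects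
  consist of the monomials of eigenvalue 0 that involve \<open>z\<close>, and \<open>U\<^sub>2\<^sup>1\<close> is the nonresonant part of \<open>f\<^sub>2\<^sup>1\<close> with each
  coefficient divided by its eigenvalue (\<open>U21_eq\<close>). That these descriptions determine \<open>Proj\<close> and \<open>U\<^sub>2\<^sup>1\<close>
  rests on the linear independence of the monomials (\<open>vmonoms_independent\<close>). At third order there are
  three contributions besides \<open>C(w, w, w)\<close>: the polarizations \<open>Q(w, w(U\<^sub>2\<^sup>1))\<close> and \<open>Q(w, h)\<close>, which give
  the terms in \<open>1/(\<i>\<omega>\<^sub>0)\<close> and the terms in \<open>h\<close>, and \<open>D\<^sub>zU\<^sub>2\<^sup>1 g\<^sub>2\<^sup>1\<close>. The last drops out under \<open>Proj\<close>: a
  nonresonant field differentiated along a resonant one is nonresonant. Reading off coefficients is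
  \<open>g31_eq\<close> and \<open>cubic_coef_values\<close>.

  For \<open>h\<close>, comparing the coefficients of \<open>z\<^sub>1\<^sup>a z\<^sub>2\<^sup>b z\<^sub>3\<^sup>c\<close> in its defining equation gives
  \<open>(l - A\<^sub>1)h\<^sub>a\<^sub>b\<^sub>c = (I - \<pi>)X\<^sub>0y\<close> with \<open>l = \<i>\<omega>\<^sub>0(b - c)\<close> and \<open>y\<close> a multiple of some \<open>Q(e\<^sub>j, e\<^sub>k)\<close>. For \<open>\<theta> < 0\<close> this is a
  linear ordinary differential equation forced by the exponentials \<open>e\<^sub>j\<close>, solved by variation of
  constants; at \<open>\<theta> = 0\<close> it is the boundary relation (\<open>resolvent_relI\<close>). Together with the conjugation
  relations below, these are exactly the listed relations. They determine \<open>h\<close> within \<open>Q\<^sup>1\<close> because \<open>A\<^sub>1\<close> has no eigenvalue on the imaginary axis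
  (\<open>A1_kernel\<close>): expanded in the eigenfunctions of the Laplacian, an eigenfunction of \<open>A\<^sub>1\<close> yields a
  characteristic root for some mode, the only such roots on the axis belong to the \<open>e\<^sub>j\<close>, and \<open>\<pi>\<close> removes
  these. The same uniqueness shows that \<open>h\<^sub>a\<^sub>c\<^sub>b\<close> is the conjugate of \<open>h\<^sub>a\<^sub>b\<^sub>c\<close>, which, with the reality of
  \<open>L\<^sub>1\<close>, \<open>Q\<close>, \<open>C\<close>, makes the third component of the normal form the conjugate of the second.

  Three ingredients have to be extracted from the hypotheses. That the Laplacian is diagonal,
  \<open>\<langle>\<Delta>u, \<beta>\<^sub>k\<rangle> = -\<mu>\<^sub>k\<langle>u, \<beta>\<^sub>k\<rangle>\<close>, cannot be had from Green's formula, since the inner product of \<open>X\<close> is not tied to the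
  integral over the domain; it follows from the semigroup in (H1), which is diagonal in the basis
  and whose derivative at 0 is \<open>D\<^sub>0\<Delta>\<close> (\<open>semigroup_on_eigenvector\<close>, \<open>lap_rel_coeff\<close>). The reality of \<open>L\<^sub>1\<close>, \<open>Q\<close>
  and \<open>C\<close> is inherited from \<open>L\<close> and \<open>G\<close> by taking limits in their Taylor expansions, followed by
  polarization. Finally, the pairing must be linear, compatible with conjugation, and equal to
  \<open>\<psi>(0)u\<close> on a jump \<open>X\<^sub>0u\<close>, which are elementary facts about Riemann--Stieltjes integrals.\<close>

section \<open>Complex inner products\<close>

lemma scaleC_zero_right [simp]: "c *\<^sub>C (0::'a::complex_hilbert) = 0"
  by (metis add_cancel_right_right scaleC_add_right)

lemma scaleC_zero_left [simp]: "0 *\<^sub>C (x::'a::complex_hilbert) = 0"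
  by (metis add_cancel_right_right scaleC_add_left)

lemma scaleC_one [simp]: "1 *\<^sub>C (x::'a::complex_hilbert) = x"
  using scaleC_of_real[of 1 x] by simp

lemma scaleC_minus_right: "c *\<^sub>C (- x) = - (c *\<^sub>C (x::'a::complex_hilbert))"
  by (metis add.right_inverse add_eq_0_iff scaleC_add_right scaleC_zero_right)

lemma scaleC_minus_left: "(- c) *\<^sub>C x = - (c *\<^sub>C (x::'a::complex_hilbert))"
  by (metis add.right_inverse add_eq_0_iff scaleC_add_left scaleC_zero_left)

lemma scaleC_diff_right: "c *\<^sub>C (x - y) = c *\<^sub>C x - c *\<^sub>C (y::'a::complex_hilbert)"
  using scaleC_add_right[of c x "- y"] by (simp add: scaleC_minus_right)

lemma scaleC_diff_left: "(c - d) *\<^sub>C x = c *\<^sub>C x - d *\<^sub>C (x::'a::complex_hilbert)"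
  using scaleC_add_left[of c "- d" x] by (simp add: scaleC_minus_left)

lemma scaleR_conv_scaleC: "t *\<^sub>R x = complex_of_real t *\<^sub>C (x::'a::complex_hilbert)"
  by (simp add: scaleC_of_real)

lemma scaleC_sum_right: "c *\<^sub>C (\<Sum>i\<in>I. f i) = (\<Sum>i\<in>I. c *\<^sub>C (f i :: 'a::complex_hilbert))"
  by (induction I rule: infinite_finite_induct) (simp_all add: scaleC_add_right)

lemma scaleC_scaleR_commute: "c *\<^sub>C (t *\<^sub>R x) = t *\<^sub>R (c *\<^sub>C (x::'a::complex_hilbert))"
  by (simp add: scaleR_conv_scaleC scaleC_scaleC mult.commute)

lemma scaleR_scaleC: "(t *\<^sub>R c) *\<^sub>C x = t *\<^sub>R (c *\<^sub>C (x::'a::complex_hilbert))"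
  by (simp add: scaleR_conv_scaleC scaleC_scaleC scaleR_conv_of_real)

lemma cinner_add_right: "cinner x (y + z) = cinner x y + cinner x (z::'a::complex_hilbert)"
  by (metis cinner_add_left cinner_commute complex_cnj_add)

lemma cinner_scaleC_right: "cinner x (c *\<^sub>C y) = cnj c * cinner x (y::'a::complex_hilbert)"
  by (metis cinner_scaleC_left cinner_commute complex_cnj_mult)

lemma cinner_zero_left [simp]: "cinner 0 (y::'a::complex_hilbert) = 0"
  by (metis add_cancel_right_right cinner_add_left)

lemma cinner_scaleR_left: "cinner (t *\<^sub>R x) y = of_real t * cinner x (y::'a::complex_hilbert)"
  by (simp add: scaleR_conv_scaleC cinner_scaleC_left)

lemma cinner_scaleR_right: "cinner x (t *\<^sub>R y) = of_real t * cinner x (y::'a::complex_hilbert)"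
  by (simp add: scaleR_conv_scaleC cinner_scaleC_right)

lemma cinner_minus_left: "cinner (- x) y = - cinner x (y::'a::complex_hilbert)"
  using cinner_scaleR_left[of "-1" x y] by simp

lemma cinner_diff_left: "cinner (x - z) y = cinner x y - cinner z (y::'a::complex_hilbert)"
  using cinner_add_left[of x "- z" y] by (simp add: cinner_minus_left)

lemma cinner_sum_left: "cinner (\<Sum>i\<in>I. f i) y = (\<Sum>i\<in>I. cinner (f i) (y::'a::complex_hilbert))"
  by (induction I rule: infinite_finite_induct) (simp_all add: cinner_add_left)

lemma cinner_self: "cinner x x = of_real ((norm (x::'a::complex_hilbert))\<^sup>2)"
proof -
  have "Im (cinner x x) = 0"
    using cinner_commute[of x x] by (metis Im_complex_of_real Reals_cnj_iff of_real_Re)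
  then show ?thesis
    by (simp add: complex_eq_iff Re_cinner power2_norm_eq_inner)
qed

lemma norm_scaleC [simp]: "norm (c *\<^sub>C (x::'a::complex_hilbert)) = cmod c * norm x"
proof -
  have "of_real ((norm (c *\<^sub>C x))\<^sup>2) = c * cnj c * cinner x x"
    by (simp only: cinner_self [symmetric] cinner_scaleC_left cinner_scaleC_right mult_ac)
  also have "\<dots> = of_real ((cmod c * norm x)\<^sup>2)"
    by (simp only: cinner_self complex_norm_square[symmetric] power_mult_distrib of_real_mult)
  finally have "(norm (c *\<^sub>C x))\<^sup>2 = (cmod c * norm x)\<^sup>2"
    by (simp only: of_real_eq_iff)
  then show ?thesis by (simp add: power2_eq_iff_nonneg)
qed

lemma cmod_cinner_le: "cmod (cinner x y) \<le> norm x * norm (y::'a::complex_hilbert)"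
proof (cases "cinner x y = 0")
  case False
  \<comment> \<open>Rotate \<open>x\<close> so that the inner product becomes real.\<close>
  define c where "c = cnj (cinner x y) / cmod (cinner x y)"
  have "cmod c = 1" using False by (simp add: c_def norm_divide)
  have "c * cinner x y = of_real (cmod (cinner x y))"
  proof -
    have "cnj (cinner x y) * cinner x y = of_real (cmod (cinner x y)) * of_real (cmod (cinner x y))"
      by (metis complex_norm_square mult.commute of_real_power power2_eq_square)
    then show ?thesis using False by (simp add: c_def)
  qed
  then have "cmod (cinner x y) = Re (cinner (c *\<^sub>C x) y)"
    by (simp add: cinner_scaleC_left)
  also have "\<dots> \<le> norm (c *\<^sub>C x) * norm y"
    unfolding Re_cinner by (rule norm_cauchy_schwarz)
  finally show ?thesis using \<open>cmod c = 1\<close> by simp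
qed simp

lemma bounded_bilinear_scaleC:
  "bounded_bilinear (scaleC :: complex \<Rightarrow> 'a::complex_hilbert \<Rightarrow> 'a)"
  by (rule bounded_bilinear.intro)
    (auto simp: scaleC_add_left scaleC_add_right scaleR_scaleC scaleC_scaleR_commute intro: exI[of _ 1])

lemma bounded_bilinear_cinner:
  "bounded_bilinear (cinner :: 'a::complex_hilbert \<Rightarrow> 'a \<Rightarrow> complex)"
  by (rule bounded_bilinear.intro)
    (auto simp: cinner_add_left cinner_add_right cinner_scaleR_left cinner_scaleR_right
      scaleR_conv_of_real cmod_cinner_le intro!: exI[of _ 1])

lemmas continuous_on_scaleC [continuous_intros] =
  bounded_bilinear.continuous_on[OF bounded_bilinear_scaleC]
lemmas tendsto_scaleC [tendsto_intros] = bounded_bilinear.tendsto[OF bounded_bilinear_scaleC]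
lemmas bounded_linear_scaleC_right = bounded_bilinear.bounded_linear_right[OF bounded_bilinear_scaleC]
lemmas bounded_linear_scaleC_left = bounded_bilinear.bounded_linear_left[OF bounded_bilinear_scaleC]
lemmas tendsto_cinner [tendsto_intros] = bounded_bilinear.tendsto[OF bounded_bilinear_cinner]

lemma scaleC_vec_nth [simp]: "(c *\<^sub>C v) $ i = c *\<^sub>C (v $ i)"
  by (simp add: scaleC_vec_def)

lemma tens_nth [simp]: "(v \<otimes> b) $ i = (v $ i) *\<^sub>C b"
  by (simp add: tens_def)

lemma comp_ip_nth [simp]: "comp_ip v b $ i = cinner (v $ i) b"
  by (simp add: comp_ip_def)

lemma cvec_nth [simp]: "cvec v $ i = cnj (v $ i)"
  by (simp add: cvec_def)

lemma cvec_cvec [simp]: "cvec (cvec v) = v"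
  by (simp add: vec_eq_iff)

lemma diag_mul_nth [simp]: "diag_mul d u $ i = d $ i *\<^sub>R u $ i"
  by (simp add: diag_mul_def)

lemma tens_add_left: "(u + v) \<otimes> b = u \<otimes> b + v \<otimes> (b::'x::complex_hilbert)"
  by (simp add: vec_eq_iff scaleC_add_left)

lemma tens_smult: "(c *s v) \<otimes> b = c *\<^sub>C (v \<otimes> (b::'x::complex_hilbert))"
  by (simp add: vec_eq_iff scaleC_scaleC)

lemma comp_ip_add: "comp_ip (u + v) b = comp_ip u b + comp_ip v b"
  by (simp add: vec_eq_iff cinner_add_left)

lemma comp_ip_scaleC: "comp_ip (c *\<^sub>C u) b = c *s comp_ip u b"
  by (simp add: vec_eq_iff cinner_scaleC_left)

lemma comp_ip_zero [simp]: "comp_ip 0 b = 0"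
  by (simp add: vec_eq_iff)

lemma comp_ip_sum: "comp_ip (\<Sum>i\<in>I. f i) b = (\<Sum>i\<in>I. comp_ip (f i) b)"
  by (induction I rule: infinite_finite_induct) (simp_all add: comp_ip_add)

lemma comp_ip_tens: "comp_ip (c \<otimes> b) b' = cinner b b' *s c"
  by (simp add: vec_eq_iff cinner_scaleC_left)

lemma tendsto_comp_ip [tendsto_intros]:
  assumes "(f \<longlongrightarrow> u) F" shows "((\<lambda>x. comp_ip (f x) b) \<longlongrightarrow> comp_ip u b) F"
  unfolding comp_ip_def by (intro tendsto_intros assms)

lemma continuous_on_comp_ip [continuous_intros]:
  assumes "continuous_on A f" shows "continuous_on A (\<lambda>x. comp_ip (f x) b)"
  using assms by (auto simp: continuous_on_def intro: tendsto_intros)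

section \<open>Expansion in an orthonormal basis\<close>

locale orthonormal_basis =
  fixes N :: "nat set" and b :: "nat \<Rightarrow> 'x::complex_hilbert"
  assumes orthonormal: "\<And>j k. j \<in> N \<Longrightarrow> k \<in> N \<Longrightarrow> cinner (b j) (b k) = (if j = k then 1 else 0)"
    and total: "\<And>u. (\<And>k. k \<in> N \<Longrightarrow> cinner u (b k) = 0) \<Longrightarrow> u = 0"
begin

lemma coeff_of_sum:
  assumes "finite A" "A \<subseteq> N" "k \<in> N"
  shows "cinner (\<Sum>j\<in>A. c j *\<^sub>C b j) (b k) = (if k \<in> A then c k else 0)"
proof -
  have "cinner (\<Sum>j\<in>A. c j *\<^sub>C b j) (b k) = (\<Sum>j\<in>A. if j = k then c j else 0)"
    unfolding cinner_sum_left cinner_scaleC_left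
    by (rule sum.cong) (use assms orthonormal in auto)
  then show ?thesis using assms by simp
qed

lemma norm_sum_sq:
  assumes "finite A" "A \<subseteq> N"
  shows "(norm (\<Sum>j\<in>A. c j *\<^sub>C b j))\<^sup>2 = (\<Sum>j\<in>A. (cmod (c j))\<^sup>2)"
proof -
  let ?s = "\<Sum>j\<in>A. c j *\<^sub>C b j"
  have "of_real ((norm ?s)\<^sup>2) = (\<Sum>j\<in>A. c j * cinner (b j) ?s)"
    by (simp only: cinner_self[symmetric] cinner_sum_left[of _ A ?s] cinner_scaleC_left)
  also have "\<dots> = (\<Sum>j\<in>A. c j * cnj (c j))"
  proof (rule sum.cong[OF refl])
    fix j assume "j \<in> A"
    then show "c j * cinner (b j) ?s = c j * cnj (c j)"
      using assms cinner_commute[of "b j" ?s] by (simp add: coeff_of_sum subset_iff)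
  qed
  also have "\<dots> = of_real (\<Sum>j\<in>A. (cmod (c j))\<^sup>2)"
    by (simp only: of_real_sum complex_norm_square)
  finally show ?thesis by (simp only: of_real_eq_iff)
qed

lemma bessel:
  assumes "finite A" "A \<subseteq> N"
  shows "(\<Sum>j\<in>A. (cmod (cinner u (b j)))\<^sup>2) \<le> (norm u)\<^sup>2"
proof -
  let ?s = "\<Sum>j\<in>A. cinner u (b j) *\<^sub>C b j"
  have "cinner ?s (u - ?s) = (\<Sum>j\<in>A. cinner u (b j) * cnj (cinner (u - ?s) (b j)))"
    unfolding cinner_sum_left[of _ A "u - ?s"] cinner_scaleC_left
    by (rule sum.cong[OF refl], subst cinner_commute) (rule refl)
  also have "\<dots> = 0"
    using assms by (intro sum.neutral) (auto simp: cinner_diff_left coeff_of_sum subset_iff)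
  finally have "inner ?s (u - ?s) = 0" by (simp flip: Re_cinner)
  then have "(norm (?s + (u - ?s)))\<^sup>2 = (norm ?s)\<^sup>2 + (norm (u - ?s))\<^sup>2"
    by (intro norm_add_Pythagorean) (simp add: orthogonal_def)
  then show ?thesis using norm_sum_sq[OF assms, of "\<lambda>j. cinner u (b j)"] by simp
qed

text \<open>The partial sums converge because the squared coefficients are summable by Bessel's inequality; their
  limit has the same coefficients as \<open>u\<close>.\<close>

lemma expansion:
  "(\<lambda>n. \<Sum>k\<in>N \<inter> {..<n}. cinner u (b k) *\<^sub>C b k) \<longlonglongrightarrow> u"
proof -
  let ?c = "\<lambda>k. if k \<in> N then (cmod (cinner u (b k)))\<^sup>2 else 0"
  let ?s = "\<lambda>n. \<Sum>k\<in>N \<inter> {..<n}. cinner u (b k) *\<^sub>C b k"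
  have "summable ?c"
  proof (rule summableI_nonneg_bounded)
    fix n
    show "(\<Sum>k<n. ?c k) \<le> (norm u)\<^sup>2"
      using bessel[of "{..<n} \<inter> N" u] by (simp add: sum.inter_restrict)
  qed simp
  have "Cauchy ?s"
  proof (rule CauchyI)
    fix e :: real assume "e > 0"
    then have "e\<^sup>2 > 0" by simp
    with \<open>summable ?c\<close> obtain M where M: "\<And>m n. m \<ge> M \<Longrightarrow> norm (sum ?c {m..<n}) < e\<^sup>2"
      unfolding summable_Cauchy by blast
    have less: "norm (?s n - ?s m) < e" if "m \<ge> M" "m \<le> n" for m n
    proof -
      have "?s n = ?s m + (\<Sum>k\<in>N \<inter> {m..<n}. cinner u (b k) *\<^sub>C b k)"
        using that by (subst sum.union_disjoint [symmetric]) (auto intro!: sum.cong)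
      then have "(norm (?s n - ?s m))\<^sup>2 = (\<Sum>k\<in>N \<inter> {m..<n}. (cmod (cinner u (b k)))\<^sup>2)"
        using norm_sum_sq[of "N \<inter> {m..<n}"] by simp
      also have "\<dots> = sum ?c {m..<n}"
        by (subst Int_commute) (simp add: sum.inter_restrict)
      also have "\<dots> < e\<^sup>2"
        using M[OF that(1), of n] by simp
      finally show ?thesis using \<open>e > 0\<close> by (simp add: power_less_imp_less_base)
    qed
    show "\<exists>M. \<forall>m\<ge>M. \<forall>n\<ge>M. norm (?s m - ?s n) < e"
    proof (intro exI allI impI)
      fix m n assume "m \<ge> M" "n \<ge> M"
      then show "norm (?s m - ?s n) < e"
        using less[of m n] less[of n m] by (cases "m \<le> n") (simp_all add: norm_minus_commute)
    qed
  qed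
  then obtain v where v: "?s \<longlonglongrightarrow> v"
    using Cauchy_convergent_iff convergent_def by blast
  have "cinner (u - v) (b k) = 0" if "k \<in> N" for k
  proof -
    have "(\<lambda>n. cinner (?s n) (b k)) \<longlonglongrightarrow> cinner v (b k)"
      by (intro tendsto_intros v)
    moreover have "(\<lambda>n. cinner (?s n) (b k)) \<longlonglongrightarrow> cinner u (b k)"
      using that
      by (intro tendsto_eventually eventually_sequentiallyI[of "Suc k"]) (simp add: coeff_of_sum)
    ultimately show ?thesis
      using LIMSEQ_unique by (fastforce simp: cinner_diff_left)
  qed
  then have "u = v" using total[of "u - v"] by simp
  then show ?thesis using v by simp
qed

lemma eqI_vec:
  fixes u v :: "'x ^ 'm"
  assumes "\<And>k. k \<in> N \<Longrightarrow> comp_ip u (b k) = comp_ip v (b k)"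
  shows "u = v"
proof -
  have "u $ i - v $ i = 0" for i
    using assms by (intro total) (auto simp: cinner_diff_left vec_eq_iff)
  then show ?thesis by (simp add: vec_eq_iff)
qed

lemma expansion_vec:
  fixes u :: "'x ^ 'm"
  shows "(\<lambda>n. \<Sum>k\<in>N \<inter> {..<n}. comp_ip u (b k) \<otimes> b k) \<longlonglongrightarrow> u"
  by (rule vec_tendstoI) (simp add: expansion)

text \<open>An operator that respects the modes acts on the coefficients mode by mode; by continuity it
  suffices to know it on the elements of a single mode.\<close>

lemma coeff_of_diagonal_operator:
  fixes A :: "'x ^ 'm::finite \<Rightarrow> 'x ^ 'm"
  assumes "bounded_linear A"
    and A: "\<And>j c. j \<in> N \<Longrightarrow> A (c \<otimes> b j) = M j c \<otimes> b j" and "k \<in> N"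
  shows "comp_ip (A u) (b k) = M k (comp_ip u (b k))"
proof -
  interpret bounded_linear A by fact
  let ?c = "\<lambda>k. comp_ip u (b k)"
  let ?s = "\<lambda>n. \<Sum>k\<in>N \<inter> {..<n}. ?c k \<otimes> b k"
  have "(\<lambda>n. comp_ip (A (?s n)) (b k)) \<longlonglongrightarrow> comp_ip (A u) (b k)"
    by (intro tendsto_comp_ip tendsto expansion_vec)
  moreover have "comp_ip (A (?s n)) (b k) = M k (?c k)" if "n > k" for n
  proof -
    have "comp_ip (A (?s n)) (b k) = (\<Sum>j\<in>N \<inter> {..<n}. comp_ip (M j (?c j) \<otimes> b j) (b k))"
      by (simp add: sum comp_ip_sum A)
    also have "\<dots> = (\<Sum>j\<in>N \<inter> {..<n}. if j = k then M j (?c j) else 0)"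
      by (rule sum.cong) (use \<open>k \<in> N\<close> orthonormal in \<open>auto simp: comp_ip_tens\<close>)
    also have "\<dots> = M k (?c k)" using \<open>k \<in> N\<close> that by simp
    finally show ?thesis .
  qed
  then have "(\<lambda>n. comp_ip (A (?s n)) (b k)) \<longlonglongrightarrow> M k (?c k)"
    by (intro tendsto_eventually eventually_sequentiallyI[of "Suc k"]) simp
  ultimately show ?thesis using LIMSEQ_unique by blast
qed

end

section \<open>Semigroups on eigenvectors of the generator\<close>

text \<open>The derivative of the orbit is given at time 0 only. Hence \<open>[0, t]\<close> is cut into \<open>n\<close> steps of length
  \<open>s = t/n\<close>. One step incurs an error
  \<open>E(s) = T(s)u - e\<^sup>a\<^sup>su\<close> of size \<open>o(s)\<close>, and by telescoping the total error is at most a constant times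
  \<open>n\<parallel>E(s)\<parallel>\<close>, which tends to 0.\<close>

lemma semigroup_on_eigenvector:
  fixes T :: "real \<Rightarrow> 'a::real_normed_vector \<Rightarrow> 'a"
  assumes T0: "T 0 u = u" and T_add: "\<And>s t. s \<ge> 0 \<Longrightarrow> t \<ge> 0 \<Longrightarrow> T (s + t) u = T s (T t u)"
    and lin: "\<And>t. t \<ge> 0 \<Longrightarrow> bounded_linear (T t)"
    and bound: "\<And>t v. t \<ge> 0 \<Longrightarrow> norm (T t v) \<le> M * exp (\<omega> * t) * norm v"
    and gen: "((\<lambda>t. (T t u - u) /\<^sub>R t) \<longlongrightarrow> a *\<^sub>R u) (at_right 0)"
    and "t \<ge> 0"
  shows "T t u = exp (a * t) *\<^sub>R u"
proof (cases "t = 0")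
  case True
  then show ?thesis by (simp add: T0)
next
  case False
  with \<open>t \<ge> 0\<close> have "t > 0" by simp
  define E where "E s = T s u - exp (a * s) *\<^sub>R u" for s
  define K where "K = \<bar>M\<bar> * exp (\<bar>\<omega>\<bar> * t)"
  have "K \<ge> 0" by (simp add: K_def)
  have K: "norm (T s v) \<le> K * norm v" if "0 \<le> s" "s \<le> t" for s v
  proof -
    have "\<omega> * s \<le> \<bar>\<omega>\<bar> * s" using that by (intro mult_right_mono) auto
    also have "\<dots> \<le> \<bar>\<omega>\<bar> * t" using that by (intro mult_left_mono) auto
    finally have "M * exp (\<omega> * s) \<le> K"
      unfolding K_def by (intro mult_mono) auto
    then have "M * exp (\<omega> * s) * norm v \<le> K * norm v" by (rule mult_right_mono) simp
    then show ?thesis using bound[OF that(1), of v] by linarith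
  qed
  have E_small: "((\<lambda>s. E s /\<^sub>R s) \<longlongrightarrow> 0) (at_right 0)"
  proof -
    have "((\<lambda>s. exp (a * s)) has_real_derivative a) (at 0)"
      by (auto intro!: derivative_eq_intros)
    then have "((\<lambda>s. (exp (a * s) - 1) / s) \<longlongrightarrow> a) (at_right 0)"
      by (auto simp: has_field_derivative_iff intro: filterlim_mono[OF _ order_refl at_le])
    then have "((\<lambda>s. (T s u - u) /\<^sub>R s - ((exp (a * s) - 1) / s) *\<^sub>R u) \<longlongrightarrow> a *\<^sub>R u - a *\<^sub>R u) (at_right 0)"
      by (intro tendsto_intros gen)
    then show ?thesis
      by (simp add: E_def algebra_simps divide_inverse)
  qed
  \<comment> \<open>The errors of \<open>n\<close> steps of length \<open>s\<close> accumulate at most linearly.\<close>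
  have step: "norm (T (real n * s) u - exp (a * (real n * s)) *\<^sub>R u) \<le> n * K * exp (\<bar>a\<bar> * (real n * s)) * norm (E s)"
    if "s \<ge> 0" "real n * s \<le> t" for n :: nat and s :: real
    using that(2)
  proof (induction n)
    case 0
    then show ?case by (simp add: T0)
  next
    case (Suc n)
    have ns: "0 \<le> real n * s" "real n * s \<le> t" "real n * s + s = real (Suc n) * s" 
      using Suc.prems \<open>s \<ge> 0\<close> by (auto simp: algebra_simps)
    interpret Tn: bounded_linear "T (real n * s)" by (rule lin) (rule ns)
    have "T (real (Suc n) * s) u - exp (a * (real (Suc n) * s)) *\<^sub>R u
        = T (real n * s) (E s) + exp (a * s) *\<^sub>R (T (real n * s) u - exp (a * (real n * s)) *\<^sub>R u)"
    proof -
      have "T (real n * s) (E s) = T (real (Suc n) * s) u - exp (a * s) *\<^sub>R T (real n * s) u"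
        using T_add[OF ns(1) \<open>s \<ge> 0\<close>] by (simp only: ns(3) E_def Tn.diff Tn.scaleR)
      moreover have "exp (a * (real (Suc n) * s)) = exp (a * s) * exp (a * (real n * s))"
        by (simp add: algebra_simps flip: exp_add)
      ultimately show ?thesis by (simp add: scaleR_diff_right)
    qed
    then have "norm (T (real (Suc n) * s) u - exp (a * (real (Suc n) * s)) *\<^sub>R u)
        \<le> norm (T (real n * s) (E s)) + exp (a * s) * norm (T (real n * s) u - exp (a * (real n * s)) *\<^sub>R u)"
      by (metis (no_types) norm_triangle_ineq norm_scaleR abs_exp_cancel)
    also have "norm (T (real n * s) (E s)) \<le> K * norm (E s) * 1"
      using K[OF ns(1,2)] by simp
    also have "\<dots> \<le> K * norm (E s) * exp (\<bar>a\<bar> * (real (Suc n) * s))"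
      using \<open>K \<ge> 0\<close> \<open>s \<ge> 0\<close> by (intro mult_left_mono) auto
    also have "exp (a * s) * norm (T (real n * s) u - exp (a * (real n * s)) *\<^sub>R u)
        \<le> exp (\<bar>a\<bar> * s) * (n * K * exp (\<bar>a\<bar> * (real n * s)) * norm (E s))"
      using \<open>s \<ge> 0\<close> \<open>K \<ge> 0\<close> by (intro mult_mono Suc.IH ns) (auto intro!: mult_right_mono)
    also have "\<dots> = n * (K * norm (E s) * exp (\<bar>a\<bar> * (real (Suc n) * s)))"
      by (simp add: algebra_simps flip: exp_add)
    finally show ?case by (simp add: algebra_simps)
  qed
  have "norm (T t u - exp (a * t) *\<^sub>R u) \<le> 0"
  proof (rule tendsto_lowerbound)
    have "filterlim (\<lambda>n. t / real (Suc n)) (at_right 0) sequentially"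
      unfolding filterlim_at using \<open>t > 0\<close> LIMSEQ_Suc[OF lim_const_over_n[of t]]
      by (auto intro!: always_eventually simp del: of_nat_Suc)
    then have "(\<lambda>n. norm (E (t / real (Suc n)) /\<^sub>R (t / real (Suc n)))) \<longlonglongrightarrow> 0"
      by (intro tendsto_norm_zero filterlim_compose[OF E_small])
    then have "(\<lambda>n. t * K * exp (\<bar>a\<bar> * t) * norm (E (t / real (Suc n)) /\<^sub>R (t / real (Suc n))))
        \<longlonglongrightarrow> t * K * exp (\<bar>a\<bar> * t) * 0"
      by (intro tendsto_intros)
    then show "(\<lambda>n. t * K * exp (\<bar>a\<bar> * t) * norm (E (t / real (Suc n)) /\<^sub>R (t / real (Suc n)))) \<longlonglongrightarrow> 0"
      by simp
    show "\<forall>\<^sub>F n in sequentially. norm (T t u - exp (a * t) *\<^sub>R u)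
        \<le> t * K * exp (\<bar>a\<bar> * t) * norm (E (t / real (Suc n)) /\<^sub>R (t / real (Suc n)))"
    proof (rule always_eventually, rule allI)
      fix n
      have "real (Suc n) * (t / real (Suc n)) = t" by simp
      then show "norm (T t u - exp (a * t) *\<^sub>R u)
          \<le> t * K * exp (\<bar>a\<bar> * t) * norm (E (t / real (Suc n)) /\<^sub>R (t / real (Suc n)))"
        using step[of "t / real (Suc n)" "Suc n"] \<open>t > 0\<close>
        by (simp add: divide_simps mult_ac del: of_nat_Suc)
    qed
  qed simp
  then show ?thesis by simp
qed

section \<open>The bifurcation setting\<close>

locale bifurcation =
  fixes S :: "('n::finite, 'x::complex_hilbert, 'm::finite) pfde"
  assumes setting: "setting S" and hopf: "hopf_steady_state S" and bases: "center_bases S"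
begin

abbreviation "r \<equiv> delay S"
abbreviation "\<Omega> \<equiv> lebesgue_on (Omega S)"
abbreviation "N \<equiv> modes (bcond S)"
abbreviation "\<beta> \<equiv> eigf S"

lemma r_pos: "r > 0" and params: "open (params S)" "0 \<in> params S"
  using setting by (auto simp: setting_def)

section \<open>Complex conjugation\<close>

lemma
  shows fn_linear: "AE x in \<Omega>. fn S (c *\<^sub>C u + v) x = c * fn S u x + fn S v x"
    and fn_zero_iff: "(AE x in \<Omega>. fn S u x = 0) \<longleftrightarrow> u = 0"
    and ex_conj: "\<exists>v. is_conj S u v \<and> norm v = norm u"
  using setting by (auto simp: setting_def function_hilbert_space_def)

text \<open>Elements of \<open>X\<close> are represented by functions up to null sets, and the representation is injective;
  so identities in \<open>X\<close> may be checked almost everywhere.\<close>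

lemma fn_eqI:
  assumes "AE x in \<Omega>. fn S u x = fn S v x" shows "u = v"
proof -
  have "AE x in \<Omega>. fn S ((- 1) *\<^sub>C v + u) x = 0"
    using assms fn_linear[of "-1" v u] by eventually_elim simp
  then have "(- 1) *\<^sub>C v + u = 0" by (simp only: fn_zero_iff)
  then show ?thesis by (simp add: scaleC_minus_left)
qed

lemma fn_scaleC: "AE x in \<Omega>. fn S (c *\<^sub>C u) x = c * fn S u x"
proof -
  have "AE x in \<Omega>. fn S 0 x = 0" by (simp add: fn_zero_iff)
  moreover have "AE x in \<Omega>. fn S (c *\<^sub>C u + 0) x = c * fn S u x + fn S 0 x" by (rule fn_linear)
  ultimately show ?thesis by eventually_elim simp
qed

definition cj :: "'x \<Rightarrow> 'x" where "cj u = (THE v. is_conj S u v)"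

lemma is_conj_unique: "is_conj S u v \<Longrightarrow> is_conj S u w \<Longrightarrow> v = w"
  unfolding is_conj_def by (rule fn_eqI) (erule (1) eventually_elim2, simp)

lemma is_conj_cj: "is_conj S u (cj u)"
  unfolding cj_def by (rule theI') (use ex_conj is_conj_unique in blast)

lemma cjI: "is_conj S u v \<Longrightarrow> cj u = v"
  using is_conj_cj is_conj_unique by blast

lemma norm_cj [simp]: "norm (cj u) = norm u"
  using ex_conj[of u] cjI by metis

lemma fn_cj: "AE x in \<Omega>. fn S (cj u) x = cnj (fn S u x)"
  using is_conj_cj by (simp add: is_conj_def)

lemma cj_linear: "cj (c *\<^sub>C u + v) = cnj c *\<^sub>C cj u + cj v"
proof (rule cjI)
  show "is_conj S (c *\<^sub>C u + v) (cnj c *\<^sub>C cj u + cj v)"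
    unfolding is_conj_def
    using fn_linear[of c u v] fn_linear[of "cnj c" "cj u" "cj v"] fn_cj[of u] fn_cj[of v]
    by eventually_elim simp
qed

lemma cj_zero [simp]: "cj 0 = 0"
  using norm_cj[of 0] by (simp only: norm_zero norm_eq_zero)

lemma cj_scaleC: "cj (c *\<^sub>C u) = cnj c *\<^sub>C cj u"
  using cj_linear[of c u 0] by simp

lemma cj_add: "cj (u + v) = cj u + cj v"
  using cj_linear[of 1 u v] by simp

lemma cj_cj [simp]: "cj (cj u) = u"
proof (rule cjI)
  show "is_conj S (cj u) u"
    unfolding is_conj_def using fn_cj[of u] by eventually_elim simp
qed

lemma cj_eigf [simp]: "k \<in> N \<Longrightarrow> cj (\<beta> k) = \<beta> k"
  using setting by (intro cjI) (auto simp: setting_def eigenbasis_def)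

lemma inner_cj: "inner (cj u) (cj v) = inner u v"
  unfolding dot_norm by (simp flip: cj_add)

lemma cinner_cj_cj: "cinner (cj u) (cj v) = cnj (cinner u v)"
proof (rule complex_eqI)
  show "Re (cinner (cj u) (cj v)) = Re (cnj (cinner u v))"
    by (simp add: Re_cinner inner_cj)
  have "Re (cinner (cj (\<i> *\<^sub>C u)) (cj v)) = Re (cinner (\<i> *\<^sub>C u) v)"
    by (simp add: Re_cinner inner_cj)
  then show "Im (cinner (cj u) (cj v)) = Im (cnj (cinner u v))"
    by (simp add: cj_scaleC cinner_scaleC_left)
qed

lemma cinner_cj_eigf: "k \<in> N \<Longrightarrow> cinner (cj u) (\<beta> k) = cnj (cinner u (\<beta> k))"
  using cinner_cj_cj[of u "\<beta> k"] by simp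

lemma conjv_nth [simp]: "conjv S u $ i = cj (u $ i)"
  by (simp add: conjv_def cj_def)

lemma conjv_conjv [simp]: "conjv S (conjv S u) = u"
  by (simp add: vec_eq_iff)

lemma conjv_zero [simp]: "conjv S 0 = 0"
  by (simp add: vec_eq_iff)

lemma conjv_add: "conjv S (u + v) = conjv S u + conjv S v"
  by (simp add: vec_eq_iff cj_add)

lemma conjv_scaleC: "conjv S (c *\<^sub>C u) = cnj c *\<^sub>C conjv S u"
  by (simp add: vec_eq_iff cj_scaleC)

lemma conjv_scaleR: "conjv S (t *\<^sub>R u) = t *\<^sub>R conjv S u"
  by (simp add: scaleR_conv_scaleC conjv_scaleC)

lemma conjv_minus: "conjv S (- u) = - conjv S u"
  using conjv_scaleR[of "-1" u] by simp

lemma conjv_diff: "conjv S (u - v) = conjv S u - conjv S v"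
  using conjv_add[of u "- v"] by (simp add: conjv_minus)

lemma norm_conjv [simp]: "norm (conjv S u) = norm u"
  by (simp add: norm_vec_def)

lemma bounded_linear_conjv: "bounded_linear (conjv S)"
  by (intro bounded_linear_intro[of _ 1]) (simp_all add: conjv_add conjv_scaleR)

lemmas tendsto_conjv = bounded_linear.tendsto[OF bounded_linear_conjv]
lemmas continuous_on_conjv = bounded_linear.continuous_on[OF bounded_linear_conjv]

lemma conjv_tens: "k \<in> N \<Longrightarrow> conjv S (c \<otimes> \<beta> k) = cvec c \<otimes> \<beta> k"
  by (simp add: vec_eq_iff cj_scaleC)

lemma comp_ip_conjv: "k \<in> N \<Longrightarrow> comp_ip (conjv S u) (\<beta> k) = cvec (comp_ip u (\<beta> k))"
  by (simp add: vec_eq_iff cinner_cj_eigf)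

lemma real_vec_iff: "real_vec S u \<longleftrightarrow> conjv S u = u"
  by (auto simp: real_vec_def vec_eq_iff intro: cjI is_conj_cj) (metis is_conj_cj)

section \<open>The Laplacian in the basis of eigenfunctions\<close>

sublocale orthonormal_basis N \<beta>
  by unfold_locales (use setting in \<open>auto simp: setting_def eigenbasis_def\<close>)

lemma lap_rel_eigf: "k \<in> N \<Longrightarrow> lap_rel S (\<beta> k) (- mu S k *\<^sub>R \<beta> k)"
  using setting by (auto simp: setting_def eigenbasis_def)

lemma diffc_pos: "diffc S 0 $ i > 0"
  using setting by (auto simp: setting_def coefficient_maps_def Let_def)

lemma diag_diffc_inj:
  "diag_mul (diffc S 0) u = diag_mul (diffc S 0) v \<longleftrightarrow> u = (v :: 'x ^ 'm)"
  using diffc_pos by (force simp: vec_eq_iff less_le)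

text \<open>The relation between \<open>u\<close> and \<open>\<Delta>u\<close> is given through weak derivatives of the representing functions,
  whereas the inner product of \<open>X\<close> is abstract. The semigroup of (H1) connects the two: its generator
  is \<open>D\<^sub>0\<Delta>\<close>, with \<open>D\<^sub>0\<close> invertible, so the graph of the Laplacian is the set of derivatives of orbits at
  0. This makes it linear and single-valued. On the eigenfunctions the semigroup acts by exponentials,
  hence by continuity it acts diagonally on all coefficients; differentiating at 0 gives the
  coefficients of \<open>\<Delta>u\<close>. As the multipliers are real, the semigroup commutes with conjugation.\<close>

lemma
  shows lap_rel_unique: "lap_rel S u v \<Longrightarrow> lap_rel S u v' \<Longrightarrow> v = v'"
    and lap_rel_linear: "lap_rel S u v \<Longrightarrow> lap_rel S u' v' \<Longrightarrow> lap_rel S (c *\<^sub>C u + u') (c *\<^sub>C v + v')"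
    and lap_rel_zero: "lap_rel S 0 0"
    and lap_rel_cj: "lap_rel S u v \<Longrightarrow> lap_rel S (cj u) (cj v)"
    and lap_rel_coeff: "lap_rel S u v \<Longrightarrow> k \<in> N \<Longrightarrow> cinner v (\<beta> k) = - of_real (mu S k) * cinner u (\<beta> k)"
proof -
  let ?D = "diag_mul (diffc S 0) :: 'x ^ 'm \<Rightarrow> 'x ^ 'm"
  obtain T :: "real \<Rightarrow> 'x ^ 'm \<Rightarrow> 'x ^ 'm" and M \<omega> where
      T0': "\<forall>u. T 0 u = u"
    and T_add': "\<forall>s\<ge>0. \<forall>t\<ge>0. \<forall>u. T (s + t) u = T s (T t u)"
    and lin': "\<forall>t\<ge>0. bounded_linear (T t) \<and> (\<forall>c u. T t (c *\<^sub>C u) = c *\<^sub>C T t u)"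
    and bound': "\<forall>t\<ge>0. \<forall>u. norm (T t u) \<le> M * exp (\<omega> * t) * norm u"
    and gen': "\<forall>u w. ((\<lambda>t. (T t u - u) /\<^sub>R t) \<longlongrightarrow> w) (at_right 0) \<longleftrightarrow>
        (\<exists>l. (\<forall>i. lap_rel S (u $ i) (l $ i)) \<and> w = ?D l)"
    using hopf unfolding hopf_steady_state_def hyp_H1_def
    by (elim exE conjE) (rule that, assumption+)
  note T0 = T0'[rule_format] and T_add = T_add'[rule_format]
    and lin = lin'[rule_format, THEN conjunct1] and T_scaleC = lin'[rule_format, THEN conjunct2, rule_format]
    and bound = bound'[rule_format] and gen = gen'[rule_format]
  define G where "G u w \<longleftrightarrow> ((\<lambda>t. (T t u - u) /\<^sub>R t) \<longlongrightarrow> w) (at_right 0)" for u w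
  \<comment> \<open>A scalar function is placed in every component, which turns the scalar relation into one of vectors.\<close>
  define V :: "'x \<Rightarrow> 'x ^ 'm" where "V u = (\<chi> i. u)" for u
  have G_unique: "w = w'" if "G u w" "G u w'" for u w w'
    using that tendsto_unique trivial_limit_at_right_real unfolding G_def by blast
  have G_rel: "G u (?D l)" if "\<And>i. lap_rel S (u $ i) (l $ i)" for u l
    using that gen by (auto simp: G_def)
  have rel_G: "lap_rel S (u $ i) (l $ i)" if "G u (?D l)" for u l i
    using that gen[of u "?D l"] by (auto simp: G_def diag_diffc_inj)
  have rel_iff: "lap_rel S u v \<longleftrightarrow> G (V u) (?D (V v))" for u v
    using G_rel[of "V u" "V v"] rel_G[of "V u" "V v"] by (auto simp: V_def)
  show unique: "v = v'" if "lap_rel S u v" "lap_rel S u v'" for u v v'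
    using that G_unique diag_diffc_inj unfolding rel_iff by (metis V_def vec_lambda_beta)
  have eventually_nonneg: "\<forall>\<^sub>F t in at_right (0::real). t \<ge> 0"
    by (simp add: eventually_at_right_less eventually_mono[OF eventually_at_right_less[of 0]] less_imp_le)
  have G_linear: "G (c *\<^sub>C u + u') (c *\<^sub>C w + w')" if "G u w" "G u' w'" for c u u' w w'
  proof -
    have "((\<lambda>t. c *\<^sub>C ((T t u - u) /\<^sub>R t) + (T t u' - u') /\<^sub>R t) \<longlongrightarrow> c *\<^sub>C w + w') (at_right 0)"
      using that unfolding G_def by (intro tendsto_intros)
    moreover have "\<forall>\<^sub>F t in at_right 0. c *\<^sub>C ((T t u - u) /\<^sub>R t) + (T t u' - u') /\<^sub>R t
        = (T t (c *\<^sub>C u + u') - (c *\<^sub>C u + u')) /\<^sub>R t"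
      using eventually_nonneg
    proof eventually_elim
      case (elim t)
      then interpret bounded_linear "T t" by (rule lin)
      show ?case
        using elim by (simp add: add T_scaleC scaleC_scaleR_commute scaleC_diff_right algebra_simps)
    qed
    ultimately show ?thesis unfolding G_def by (rule Lim_transform_eventually)
  qed
  show "lap_rel S (c *\<^sub>C u + u') (c *\<^sub>C v + v')" if "lap_rel S u v" "lap_rel S u' v'" for c u u' v v'
  proof -
    have "V (c *\<^sub>C u + u') = c *\<^sub>C V u + V u'" "?D (V (c *\<^sub>C v + v')) = c *\<^sub>C ?D (V v) + ?D (V v')"
      by (simp_all add: V_def vec_eq_iff scaleC_scaleR_commute algebra_simps)
    then show ?thesis using that G_linear unfolding rel_iff by simp
  qed
  have "((\<lambda>t. (T t 0 - 0) /\<^sub>R t) \<longlongrightarrow> 0) (at_right 0)"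
    by (rule tendsto_eventually)
      (use eventually_nonneg in \<open>eventually_elim, simp add: linear_simps(3)[OF lin]\<close>)
  then have "G 0 0" by (simp add: G_def)
  then show zero: "lap_rel S 0 0"
    using rel_G[of 0 0] by (simp add: diag_mul_def zero_vec_def)
  \<comment> \<open>The semigroup is diagonal in the basis, with the eigenvalues that its generator dictates.\<close>
  have T_axis: "T t (axis i 1 \<otimes> \<beta> k) = of_real (exp (- diffc S 0 $ i * mu S k * t)) *\<^sub>C (axis i 1 \<otimes> \<beta> k)"
    if "k \<in> N" "t \<ge> 0" for t i k
  proof -
    let ?u = "axis i 1 \<otimes> \<beta> k"
    have "lap_rel S (?u $ j) ((- mu S k *\<^sub>R ?u) $ j)" for j
      using lap_rel_eigf[OF \<open>k \<in> N\<close>] zero by (cases "j = i") (simp_all add: axis_def)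
    then have "G ?u (?D (- mu S k *\<^sub>R ?u))" by (rule G_rel)
    also have "?D (- mu S k *\<^sub>R ?u) = (- diffc S 0 $ i * mu S k) *\<^sub>R ?u"
      by (simp add: vec_eq_iff axis_def)
    finally show ?thesis
      using semigroup_on_eigenvector[of T ?u M \<omega> "- diffc S 0 $ i * mu S k" t]
        T0 T_add lin bound \<open>t \<ge> 0\<close>
      unfolding G_def by (simp add: scaleC_of_real)
  qed
  define m where "m t k c = (\<chi> i. of_real (exp (- diffc S 0 $ i * mu S k * t)) * c $ i)"
    for t k and c :: "complex ^ 'm"
  have T_coeff: "comp_ip (T t u) (\<beta> k) = m t k (comp_ip u (\<beta> k))" if "k \<in> N" "t \<ge> 0" for t u k
  proof (rule coeff_of_diagonal_operator[OF lin[OF \<open>t \<ge> 0\<close>] _ \<open>k \<in> N\<close>])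
    fix j c assume "j \<in> N"
    interpret bounded_linear "T t" using \<open>t \<ge> 0\<close> by (rule lin)
    have "c \<otimes> \<beta> j = (\<Sum>i\<in>UNIV. c $ i *\<^sub>C (axis i 1 \<otimes> \<beta> j))" for c :: "complex ^ 'm"
    proof -
      have "c $ l *\<^sub>C \<beta> j = (\<Sum>i\<in>UNIV. if l = i then c $ i *\<^sub>C \<beta> j else 0)" for l
        by simp
      also have "\<dots> l = (\<Sum>i\<in>UNIV. (c $ i *\<^sub>C (axis i 1 \<otimes> \<beta> j)) $ l)" for l
        by (rule sum.cong) (auto simp: axis_def)
      finally show ?thesis by (simp add: vec_eq_iff)
    qed
    note expand = this
    have "T t (c \<otimes> \<beta> j) = (\<Sum>i\<in>UNIV. m t j c $ i *\<^sub>C (axis i 1 \<otimes> \<beta> j))"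
      unfolding expand[of c] using \<open>t \<ge> 0\<close> \<open>j \<in> N\<close>
      by (simp add: sum T_scaleC T_axis m_def scaleC_scaleC mult.commute)
    then show "T t (c \<otimes> \<beta> j) = m t j c \<otimes> \<beta> j"
      using expand[of "m t j c"] by simp
  qed
  show "cinner v (\<beta> k) = - of_real (mu S k) * cinner u (\<beta> k)"
    if "lap_rel S u v" "k \<in> N" for u v k
  proof -
    fix i :: 'm
    let ?a = "- diffc S 0 $ i * mu S k" and ?c = "cinner u (\<beta> k)"
    have "((\<lambda>t. (T t (V u) - V u) /\<^sub>R t) \<longlongrightarrow> ?D (V v)) (at_right 0)"
      using that(1) by (simp add: rel_iff G_def)
    then have "((\<lambda>t. cinner (((T t (V u) - V u) /\<^sub>R t) $ i) (\<beta> k)) \<longlongrightarrow> cinner (?D (V v) $ i) (\<beta> k)) (at_right 0)"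
      by (intro tendsto_intros)
    moreover have "\<forall>\<^sub>F t in at_right 0. cinner (((T t (V u) - V u) /\<^sub>R t) $ i) (\<beta> k)
        = of_real ((exp (?a * t) - 1) / t) * ?c"
      using eventually_nonneg
    proof eventually_elim
      case (elim t)
      have "cinner (T t (V u) $ i) (\<beta> k) = of_real (exp (?a * t)) * ?c"
        using T_coeff[OF \<open>k \<in> N\<close> elim, of "V u"] by (auto simp: vec_eq_iff m_def V_def dest: spec[of _ i])
      then show ?case
        by (simp add: cinner_scaleR_left cinner_diff_left V_def divide_inverse algebra_simps)
    qed
    ultimately have "((\<lambda>t. of_real ((exp (?a * t) - 1) / t) * ?c) \<longlongrightarrow> cinner (?D (V v) $ i) (\<beta> k)) (at_right 0)"
      by (rule Lim_transform_eventually)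
    moreover have "((\<lambda>t. exp (?a * t)) has_real_derivative ?a) (at 0)"
      by (auto intro!: derivative_eq_intros)
    then have "((\<lambda>t. (exp (?a * t) - 1) / t) \<longlongrightarrow> ?a) (at_right 0)"
      by (auto simp: has_field_derivative_iff intro: filterlim_mono[OF _ order_refl at_le])
    then have "((\<lambda>t. of_real ((exp (?a * t) - 1) / t) * ?c) \<longlongrightarrow> of_real ?a * ?c) (at_right 0)"
      by (intro tendsto_intros)
    ultimately have "cinner (?D (V v) $ i) (\<beta> k) = of_real ?a * ?c"
      using tendsto_unique trivial_limit_at_right_real by blast
    then have "of_real (diffc S 0 $ i) * cinner v (\<beta> k)
        = of_real (diffc S 0 $ i) * (- of_real (mu S k) * cinner u (\<beta> k))"
      by (simp add: V_def cinner_scaleR_left)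
    then show ?thesis
      using diffc_pos[of i] by (metis mult_cancel_left of_real_eq_0_iff less_irrefl)
  qed
  show "lap_rel S (cj u) (cj v)" if "lap_rel S u v" for u v
  proof -
    have comm: "T t (conjv S u) = conjv S (T t u)" if "t \<ge> 0" for t u
      by (rule eqI_vec) (use that in \<open>auto simp: T_coeff comp_ip_conjv m_def vec_eq_iff\<close>)
    have "((\<lambda>t. conjv S ((T t (V u) - V u) /\<^sub>R t)) \<longlongrightarrow> conjv S (?D (V v))) (at_right 0)"
      using that by (intro tendsto_conjv) (simp add: rel_iff G_def)
    moreover have "\<forall>\<^sub>F t in at_right 0. conjv S ((T t (V u) - V u) /\<^sub>R t)
        = (T t (conjv S (V u)) - conjv S (V u)) /\<^sub>R t"
      using eventually_nonneg by eventually_elim (simp add: comm conjv_scaleR conjv_diff)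
    ultimately have "G (conjv S (V u)) (conjv S (?D (V v)))"
      unfolding G_def by (rule Lim_transform_eventually)
    moreover have "conjv S (V u) = V (cj u)" "conjv S (?D (V v)) = ?D (V (cj v))"
      by (simp_all add: vec_eq_iff V_def scaleR_conv_scaleC cj_scaleC)
    ultimately show ?thesis by (simp add: rel_iff)
  qed
qed

lemma lap_eqI: "(\<And>i. lap_rel S (u $ i) (v $ i)) \<Longrightarrow> lap S u = v"
  unfolding lap_def by (auto simp: vec_eq_iff intro: the_equality lap_rel_unique)

lemma lap_rel_lap: "u \<in> dom_lap S \<Longrightarrow> lap_rel S (u $ i) (lap S u $ i)"
  unfolding dom_lap_def lap_def by (auto intro: theI2 lap_rel_unique)

lemma dom_lapI: "(\<And>i. lap_rel S (u $ i) (v $ i)) \<Longrightarrow> u \<in> dom_lap S"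
  by (auto simp: dom_lap_def)

lemma
  assumes "u \<in> dom_lap S" "v \<in> dom_lap S"
  shows dom_lap_linear: "c *\<^sub>C u + v \<in> dom_lap S"
    and lap_linear: "lap S (c *\<^sub>C u + v) = c *\<^sub>C lap S u + lap S v"
proof -
  have "lap_rel S ((c *\<^sub>C u + v) $ i) ((c *\<^sub>C lap S u + lap S v) $ i)" for i
    using assms by (simp add: lap_rel_linear lap_rel_lap)
  then show "c *\<^sub>C u + v \<in> dom_lap S" "lap S (c *\<^sub>C u + v) = c *\<^sub>C lap S u + lap S v"
    by (rule dom_lapI, rule lap_eqI)
qed

lemma
  shows dom_lap_zero: "0 \<in> dom_lap S" and lap_zero: "lap S 0 = 0"
  by (auto intro!: dom_lapI[of _ 0] lap_eqI lap_rel_zero simp del: zero_index simp: zero_vec_def)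

lemma
  assumes "u \<in> dom_lap S"
  shows dom_lap_scaleC: "c *\<^sub>C u \<in> dom_lap S" and lap_scaleC: "lap S (c *\<^sub>C u) = c *\<^sub>C lap S u"
  using dom_lap_linear[OF assms dom_lap_zero, of c] lap_linear[OF assms dom_lap_zero, of c]
  by (simp_all add: lap_zero)

lemma
  assumes "u \<in> dom_lap S" "v \<in> dom_lap S"
  shows dom_lap_add: "u + v \<in> dom_lap S" and lap_add: "lap S (u + v) = lap S u + lap S v"
  using dom_lap_linear[OF assms, of 1] lap_linear[OF assms, of 1] by simp_all

lemma
  assumes "u \<in> dom_lap S"
  shows dom_lap_conjv: "conjv S u \<in> dom_lap S" and lap_conjv: "lap S (conjv S u) = conjv S (lap S u)"
proof -
  have "lap_rel S (conjv S u $ i) (conjv S (lap S u) $ i)" for i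
    using assms by (simp add: lap_rel_cj lap_rel_lap)
  then show "conjv S u \<in> dom_lap S" "lap S (conjv S u) = conjv S (lap S u)"
    by (rule dom_lapI, rule lap_eqI)
qed

lemma comp_ip_lap:
  "u \<in> dom_lap S \<Longrightarrow> k \<in> N \<Longrightarrow> comp_ip (lap S u) (\<beta> k) = (- of_real (mu S k)) *s comp_ip u (\<beta> k)"
  by (simp add: vec_eq_iff lap_rel_coeff[OF lap_rel_lap])

lemma
  assumes "k \<in> N"
  shows dom_lap_tens: "c \<otimes> \<beta> k \<in> dom_lap S"
    and lap_tens: "lap S (c \<otimes> \<beta> k) = (- of_real (mu S k)) *\<^sub>C (c \<otimes> \<beta> k)"
proof -
  have "lap_rel S (a *\<^sub>C \<beta> k) ((- of_real (mu S k)) *\<^sub>C a *\<^sub>C \<beta> k)" for a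
    using lap_rel_linear[OF lap_rel_eigf[OF assms] lap_rel_zero, of a]
    by (simp add: scaleR_conv_scaleC scaleC_scaleC scaleC_minus_left scaleC_minus_right mult.commute)
  then show "c \<otimes> \<beta> k \<in> dom_lap S"
      "lap S (c \<otimes> \<beta> k) = (- of_real (mu S k)) *\<^sub>C (c \<otimes> \<beta> k)"
    by (auto intro!: dom_lapI[of _ "(- of_real (mu S k)) *\<^sub>C (c \<otimes> \<beta> k)"] lap_eqI)
qed

end

section \<open>Operators on histories\<close>

lemma Cspace_add: "v \<in> Cspace r \<Longrightarrow> w \<in> Cspace r \<Longrightarrow> (\<lambda>\<theta>. v \<theta> + w \<theta> :: 'a::real_normed_vector) \<in> Cspace r"
  by (auto simp: Cspace_def intro: continuous_intros)

lemma Cspace_diff: "v \<in> Cspace r \<Longrightarrow> w \<in> Cspace r \<Longrightarrow> (\<lambda>\<theta>. v \<theta> - w \<theta> :: 'a::real_normed_vector) \<in> Cspace r"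
  by (auto simp: Cspace_def intro: continuous_intros)

lemma Cspace_scaleC: "v \<in> Cspace r \<Longrightarrow> (\<lambda>\<theta>. c *\<^sub>C (v \<theta> :: 'a::complex_hilbert)) \<in> Cspace r"
  by (auto simp: Cspace_def intro: continuous_intros)

lemma Cspace_scaleR: "v \<in> Cspace r \<Longrightarrow> (\<lambda>\<theta>. t *\<^sub>R (v \<theta> :: 'a::real_normed_vector)) \<in> Cspace r"
  by (auto simp: Cspace_def intro: continuous_intros)

lemma Cspace_zero: "(\<lambda>\<theta>. 0) \<in> Cspace r"
  by (auto simp: Cspace_def intro: continuous_intros)

lemma Cspace_sum:
  "(\<And>i. i \<in> I \<Longrightarrow> f i \<in> Cspace r) \<Longrightarrow> (\<lambda>\<theta>. \<Sum>i\<in>I. f i \<theta> :: 'a::real_normed_vector) \<in> Cspace r"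
  by (auto simp: Cspace_def intro: continuous_intros)

lemma Cspace_smult: "\<phi> \<in> Cspace r \<Longrightarrow> (\<lambda>\<theta>. c *s (\<phi> \<theta> :: complex ^ 'm)) \<in> Cspace r"
  unfolding Cspace_def vector_scalar_mult_def
  by (auto intro!: continuous_intros)

lemma Cspace_comp_ip: "v \<in> Cspace r \<Longrightarrow> (\<lambda>\<theta>. comp_ip (v \<theta>) b) \<in> Cspace r"
  by (auto simp: Cspace_def intro: continuous_intros)

lemma Cspace_htens: "\<phi> \<in> Cspace r \<Longrightarrow> htens \<phi> b \<in> Cspace r"
  unfolding Cspace_def htens_def tens_def by (auto intro!: continuous_intros)

lemma Cspace_exp: "(\<lambda>\<theta>. exp (l * complex_of_real \<theta>) *\<^sub>C u) \<in> Cspace r"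
  unfolding Cspace_def by (auto intro!: continuous_intros)

lemma Cspace_exp_smult: "(\<lambda>\<theta>. exp (l * complex_of_real \<theta>) *s (c :: complex ^ 'm)) \<in> Cspace r"
  unfolding Cspace_def vector_scalar_mult_def by (auto intro!: continuous_intros)

lemmas Cspace_intros = Cspace_add Cspace_diff Cspace_scaleC Cspace_scaleR Cspace_zero Cspace_sum
  Cspace_smult Cspace_comp_ip Cspace_htens Cspace_exp Cspace_exp_smult

lemma
  fixes v :: "real \<Rightarrow> 'a::real_normed_vector"
  assumes "v \<in> Cspace r" "r > 0"
  shows norm_le_supnorm: "\<theta> \<in> {-r..0} \<Longrightarrow> norm (v \<theta>) \<le> supnorm r v"
    and supnorm_nonneg: "supnorm r v \<ge> 0"
proof -
  have "compact ((\<lambda>\<theta>. norm (v \<theta>)) ` {-r..0})"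
    using assms by (intro compact_continuous_image continuous_intros) (auto simp: Cspace_def)
  then have "bdd_above ((\<lambda>\<theta>. norm (v \<theta>)) ` {-r..0})"
    by (rule bounded_imp_bdd_above[OF compact_imp_bounded])
  then show *: "norm (v \<theta>) \<le> supnorm r v" if "\<theta> \<in> {-r..0}" for \<theta>
    unfolding supnorm_def using that by (intro cSUP_upper)
  show "supnorm r v \<ge> 0"
    using order.trans[OF norm_ge_zero *[of 0]] assms(2) by simp
qed

lemma supnorm_le:
  assumes "r > 0" "\<And>\<theta>. \<theta> \<in> {-r..0} \<Longrightarrow> norm (v \<theta>) \<le> B"
  shows "supnorm r v \<le> B"
  unfolding supnorm_def using assms by (intro cSUP_least) auto

lemma supnorm_scaleR_le:
  assumes "v \<in> Cspace r" "r > 0" "t \<ge> 0"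
  shows "supnorm r (\<lambda>\<theta>. t *\<^sub>R v \<theta>) \<le> t * supnorm r v"
proof (rule supnorm_le[OF assms(2)])
  fix \<theta> assume "\<theta> \<in> {-r..0}"
  then show "norm (t *\<^sub>R v \<theta>) \<le> t * supnorm r v"
    using norm_le_supnorm[OF assms(1,2)] assms(3) by (simp add: mult_left_mono)
qed

locale history_operator =
  fixes r :: real and T :: "(real \<Rightarrow> 'a::complex_hilbert) \<Rightarrow> 'b::complex_hilbert"
  assumes r_pos: "r > 0" and bdd_linear: "bdd_linear_on r (Cspace r) T"
begin

lemma add: "v \<in> Cspace r \<Longrightarrow> w \<in> Cspace r \<Longrightarrow> T (\<lambda>\<theta>. v \<theta> + w \<theta>) = T v + T w"
  and scaleC: "v \<in> Cspace r \<Longrightarrow> T (\<lambda>\<theta>. c *\<^sub>C v \<theta>) = c *\<^sub>C T v"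
  using bdd_linear by (auto simp: bdd_linear_on_def)

lemma scaleR: "v \<in> Cspace r \<Longrightarrow> T (\<lambda>\<theta>. t *\<^sub>R v \<theta>) = t *\<^sub>R T v"
  by (simp add: scaleR_conv_scaleC scaleC)

lemma diff: "v \<in> Cspace r \<Longrightarrow> w \<in> Cspace r \<Longrightarrow> T (\<lambda>\<theta>. v \<theta> - w \<theta>) = T v - T w"
  using add[of v "\<lambda>\<theta>. (-1) *\<^sub>R w \<theta>"] scaleR[of w "-1"] Cspace_scaleR[of w r "-1"] by simp

lemma zero: "T (\<lambda>\<theta>. 0) = 0"
  using scaleR[of "\<lambda>\<theta>. 0" 0] by (simp add: Cspace_zero)

lemma sum:
  "finite I \<Longrightarrow> (\<And>i. i \<in> I \<Longrightarrow> f i \<in> Cspace r) \<Longrightarrow>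
    T (\<lambda>\<theta>. \<Sum>i\<in>I. c i *\<^sub>C f i \<theta>) = (\<Sum>i\<in>I. c i *\<^sub>C T (f i))"
  by (induction I rule: finite_induct) (simp_all add: zero add scaleC Cspace_intros)

text \<open>Boundedness by the norm on \<open>[-r, 0]\<close> makes the operator blind to the values elsewhere.\<close>

lemma cong:
  assumes "v \<in> Cspace r" "w \<in> Cspace r" "\<And>\<theta>. \<theta> \<in> {-r..0} \<Longrightarrow> v \<theta> = w \<theta>"
  shows "T v = T w"
proof -
  obtain K where "norm (T (\<lambda>\<theta>. v \<theta> - w \<theta>)) \<le> K * supnorm r (\<lambda>\<theta>. v \<theta> - w \<theta>)"
    using bdd_linear Cspace_diff[OF assms(1,2)] unfolding bdd_linear_on_def by auto
  also have "supnorm r (\<lambda>\<theta>. v \<theta> - w \<theta>) = supnorm r (\<lambda>\<theta>. 0 :: 'a)"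
    unfolding supnorm_def using assms(3) by (intro SUP_cong) auto
  also have "\<dots> = 0"
    using supnorm_le[OF r_pos, of "\<lambda>\<theta>. 0 :: 'a" 0] supnorm_nonneg[OF Cspace_zero r_pos, where 'a = 'a]
    by simp
  finally show ?thesis using assms by (simp add: diff)
qed

text \<open>For fixed \<open>l\<close>, restricting an operator to the histories \<open>e\<^sup>l\<^sup>\<theta>u\<close> gives an operator on the space of
  values, to which expansion in eigenfunctions applies.\<close>

lemma bounded_linear_on_exponentials:
  "bounded_linear (\<lambda>u. T (\<lambda>\<theta>. exp (l * complex_of_real \<theta>) *\<^sub>C u))"
proof -
  let ?e = "\<lambda>u \<theta>. exp (l * complex_of_real \<theta>) *\<^sub>C (u :: 'a)"
  obtain K where K: "\<And>v. v \<in> Cspace r \<Longrightarrow> norm (T v) \<le> K * supnorm r v"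
    using bdd_linear unfolding bdd_linear_on_def by blast
  show ?thesis
  proof (rule bounded_linear_intro)
    show "T (?e (u + v)) = T (?e u) + T (?e v)" for u v
      by (simp add: scaleC_add_right add Cspace_exp)
    show "T (?e (t *\<^sub>R u)) = t *\<^sub>R T (?e u)" for t u
      by (simp add: scaleC_scaleR_commute scaleR Cspace_exp)
    show "norm (T (?e u)) \<le> norm u * (\<bar>K\<bar> * exp (cmod l * r))" for u
    proof -
      have T_le: "norm (T (?e u)) \<le> \<bar>K\<bar> * supnorm r (?e u)"
        using K[OF Cspace_exp, of l u] mult_right_mono[OF abs_ge_self supnorm_nonneg[OF Cspace_exp r_pos], of K l u]
        by linarith
      have "supnorm r (?e u) \<le> exp (cmod l * r) * norm u"
      proof (rule supnorm_le[OF r_pos])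
        fix \<theta> assume "\<theta> \<in> {-r..0}"
        then have "norm (exp (l * complex_of_real \<theta>)) \<le> exp (cmod l * r)"
          using mult_left_mono[of "- \<theta>" r "cmod l"]
          by (intro order.trans[OF norm_exp]) (auto simp: norm_mult abs_if)
        then show "norm (?e u \<theta>) \<le> exp (cmod l * r) * norm u"
          by (simp add: mult_right_mono)
      qed
      then have "\<bar>K\<bar> * supnorm r (?e u) \<le> \<bar>K\<bar> * (exp (cmod l * r) * norm u)"
        by (rule mult_left_mono) simp
      with T_le show ?thesis by (simp add: mult_ac)
    qed
  qed
qed

end

context bifurcation
begin

abbreviation "E \<equiv> (Cspace r :: (real \<Rightarrow> 'x ^ 'm) set)"

lemma modes_12: "k1 S \<in> N" "k2 S \<in> N" and om_pos: "om0 S > 0"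
  using hopf by (auto simp: hopf_steady_state_def hyp_H4_def)

lemma coefficient_operators:
  shows "\<alpha> \<in> params S \<Longrightarrow> history_operator r (Lop S \<alpha>)"
    and "history_operator r (L1op S \<alpha>)"
    and "sym_bilinear r (Qop S)" and "sym_trilinear r (Cop S)"
    and "v \<in> E \<Longrightarrow> linear (\<lambda>\<alpha>. L1op S \<alpha> v)"
  using setting by (auto simp: setting_def coefficient_maps_def Let_def history_operator_def)

lemma L_htens:
  shows "\<phi> \<in> Cspace r \<Longrightarrow> Lop S 0 (htens \<phi> b) = Lvec S 0 \<phi> \<otimes> b"
    and "\<phi> \<in> Cspace r \<Longrightarrow> L1op S \<alpha> (htens \<phi> b) = L1vec S \<alpha> \<phi> \<otimes> b"
  using setting params(2) by (auto simp: setting_def act_pointwise_def Let_def)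

sublocale L0: history_operator r "Lop S 0"
  by (rule coefficient_operators) (rule params)

sublocale L1: history_operator r "L1op S \<alpha>" for \<alpha>
  by (rule coefficient_operators)

lemma Q_commute: "v \<in> E \<Longrightarrow> w \<in> E \<Longrightarrow> Qop S v w = Qop S w v"
  using coefficient_operators(3) by (auto simp: sym_bilinear_def)

lemma Q_left: "w \<in> E \<Longrightarrow> history_operator r (\<lambda>v. Qop S v w)"
  using coefficient_operators(3) r_pos by (auto simp: sym_bilinear_def history_operator_def)

lemma Q_right:
  assumes "v \<in> E" shows "history_operator r (Qop S v)"
proof -
  interpret history_operator r "\<lambda>w. Qop S w v" using assms by (rule Q_left)
  obtain K where "\<And>w. w \<in> E \<Longrightarrow> norm (Qop S w v) \<le> K * supnorm r w"
    using bdd_linear unfolding bdd_linear_on_def by blast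
  then show ?thesis
    unfolding history_operator_def bdd_linear_on_def
    using r_pos assms add scaleC by (auto simp: Q_commute[OF assms] Cspace_intros)
qed

lemma C_commute:
  assumes "u \<in> E" "v \<in> E" "w \<in> E"
  shows "Cop S u v w = Cop S v u w" and "Cop S u v w = Cop S u w v"
  using coefficient_operators(4) assms unfolding sym_trilinear_def by blast+

lemma C_left: "v \<in> E \<Longrightarrow> w \<in> E \<Longrightarrow> history_operator r (\<lambda>u. Cop S u v w)"
  using coefficient_operators(4) r_pos by (auto simp: sym_trilinear_def history_operator_def)

lemma C_middle:
  assumes "u \<in> E" "w \<in> E" shows "history_operator r (\<lambda>v. Cop S u v w)"
proof -
  interpret history_operator r "\<lambda>v. Cop S v u w" using assms by (rule C_left)
  obtain K where "\<And>v. v \<in> E \<Longrightarrow> norm (Cop S v u w) \<le> K * supnorm r v"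
    using bdd_linear unfolding bdd_linear_on_def by blast
  then show ?thesis
    unfolding history_operator_def bdd_linear_on_def
    using r_pos assms add scaleC by (auto simp: C_commute(1)[OF assms(1) _ assms(2)] Cspace_intros)
qed

lemma C_right:
  assumes "u \<in> E" "v \<in> E" shows "history_operator r (Cop S u v)"
proof -
  interpret history_operator r "\<lambda>w. Cop S u w v" using assms by (rule C_middle)
  obtain K where "\<And>w. w \<in> E \<Longrightarrow> norm (Cop S u w v) \<le> K * supnorm r w"
    using bdd_linear unfolding bdd_linear_on_def by blast
  then show ?thesis
    unfolding history_operator_def bdd_linear_on_def
    using r_pos assms add scaleC by (auto simp: C_commute(2)[OF assms] Cspace_intros)
qed

section \<open>Reality of the coefficient operators\<close>

abbreviation (input) "hconj v \<equiv> (\<lambda>\<theta>. conjv S (v \<theta>))"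

lemma Cspace_hconj: "v \<in> E \<Longrightarrow> hconj v \<in> E"
  by (auto simp: Cspace_def continuous_on_conjv)

lemma hconj_htens: "k \<in> N \<Longrightarrow> hconj (htens \<phi> (\<beta> k)) = htens (\<lambda>\<theta>. cvec (\<phi> \<theta>)) (\<beta> k)"
  by (simp add: htens_def conjv_tens)

lemma real_histI: "hconj v = v \<Longrightarrow> real_hist S v"
  by (auto simp: real_hist_def real_vec_iff fun_eq_iff)

lemma conjv_limit:
  assumes "(f \<longlongrightarrow> l) F" "\<forall>\<^sub>F t in F. conjv S (f t) = f t" "F \<noteq> bot"
  shows "conjv S l = l"
proof (rule tendsto_unique[OF assms(3) _ assms(1)])
  show "(f \<longlongrightarrow> conjv S l) F"
    by (rule Lim_transform_eventually[OF tendsto_conjv[OF assms(1)] assms(2)])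
qed

text \<open>Every history is \<open>a + \<i>b\<close> with real histories \<open>a\<close>, \<open>b\<close>, and both sides are complex linear in it.\<close>

lemma real_determines:
  assumes T: "history_operator r T" and T': "history_operator r T'"
    and real: "\<And>v. v \<in> E \<Longrightarrow> hconj v = v \<Longrightarrow> conjv S (T v) = T' v" and "v \<in> E"
  shows "conjv S (T (hconj v)) = T' v"
proof -
  interpret T: history_operator r T by fact
  interpret T': history_operator r T' by fact
  define a where "a \<theta> = (1/2) *\<^sub>R (v \<theta> + conjv S (v \<theta>))" for \<theta>
  define b where "b \<theta> = (- \<i>/2) *\<^sub>C (v \<theta> - conjv S (v \<theta>))" for \<theta>
  have ab: "a \<in> E" "b \<in> E" unfolding a_def b_def
    by (intro Cspace_intros Cspace_hconj \<open>v \<in> E\<close>)+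
  have "hconj a = a" "hconj b = b"
    by (simp_all add: a_def b_def fun_eq_iff conjv_scaleC conjv_scaleR conjv_add conjv_diff scaleC_diff_right
        scaleC_minus_left add.commute)
  have "v \<theta> = a \<theta> + \<i> *\<^sub>C b \<theta>" "conjv S (v \<theta>) = a \<theta> + (- \<i>) *\<^sub>C b \<theta>" for \<theta>
  proof -
    have "\<i> *\<^sub>C b \<theta> = (1/2) *\<^sub>R (v \<theta> - conjv S (v \<theta>))"
      "(- \<i>) *\<^sub>C b \<theta> = - ((1/2) *\<^sub>R (v \<theta> - conjv S (v \<theta>)))"
      by (simp_all add: b_def scaleC_scaleC scaleR_conv_scaleC scaleC_minus_left scaleC_minus_right)
    then show "v \<theta> = a \<theta> + \<i> *\<^sub>C b \<theta>" "conjv S (v \<theta>) = a \<theta> + (- \<i>) *\<^sub>C b \<theta>"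
      by (simp_all add: a_def flip: scaleR_add_right scaleR_diff_right)
  qed
  then have v: "v = (\<lambda>\<theta>. a \<theta> + \<i> *\<^sub>C b \<theta>)" "hconj v = (\<lambda>\<theta>. a \<theta> + (- \<i>) *\<^sub>C b \<theta>)" by auto
  have "conjv S (T (hconj v)) = conjv S (T a) + \<i> *\<^sub>C conjv S (T b)"
    unfolding v(2) using ab by (simp add: T.add T.scaleC Cspace_intros conjv_add conjv_scaleC)
  also have "\<dots> = T' a + \<i> *\<^sub>C T' b"
    using real ab \<open>hconj a = a\<close> \<open>hconj b = b\<close> by simp
  also have "\<dots> = T' v"
    using ab arg_cong[OF v(1), of T'] by (simp add: T'.add T'.scaleC Cspace_intros)
  finally show ?thesis .
qed

lemma L0_conj:
  assumes "v \<in> E" shows "Lop S 0 (hconj v) = conjv S (Lop S 0 v)"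
proof -
  have "conjv S (Lop S 0 (hconj v)) = Lop S 0 v"
  proof (rule real_determines[OF _ _ _ assms])
    fix v assume "v \<in> E" "hconj v = v"
    then have "real_vec S (Lop S 0 v)"
      using setting params(2) real_histI[of v]
      by (auto simp: setting_def coefficient_maps_def Let_def)
    then show "conjv S (Lop S 0 v) = Lop S 0 v" by (simp add: real_vec_iff)
  qed unfold_locales
  then show ?thesis by (metis conjv_conjv)
qed

text \<open>\<open>L\<^sub>1(\<alpha>)v\<close> is the limit of the real quotients \<open>(2/t)(L(t\<alpha>)v - L\<^sub>0v)\<close> as \<open>t \<rightarrow> 0+\<close>.\<close>

lemma L1_real:
  assumes "v \<in> E" "hconj v = v" shows "conjv S (L1op S \<alpha> v) = L1op S \<alpha> v"
proof (cases "\<alpha> = 0")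
  case True
  then show ?thesis using linear_0[OF coefficient_operators(5)[OF assms(1)]] by simp
next
  case False
  let ?f = "\<lambda>t. (2 / t) *\<^sub>R (Lop S (t *\<^sub>R \<alpha>) v - Lop S 0 v)"
  have ev: "\<forall>\<^sub>F t in at_right 0. t > 0 \<and> t *\<^sub>R \<alpha> \<in> params S"
  proof -
    have "((\<lambda>t. t *\<^sub>R \<alpha>) \<longlongrightarrow> 0 *\<^sub>R \<alpha>) (at_right 0)" by (intro tendsto_intros)
    then have "\<forall>\<^sub>F t in at_right 0. t *\<^sub>R \<alpha> \<in> params S"
      using params by (auto dest: topological_tendstoD)
    then show ?thesis using eventually_at_right_less[of 0] by eventually_elim simp
  qed
  have expand: "\<forall>\<epsilon>>0. \<exists>\<delta>>0. \<forall>\<alpha>\<in>params S. norm \<alpha> < \<delta> \<longrightarrow> (\<forall>v\<in>E.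
      norm (Lop S \<alpha> v - Lop S 0 v - (1/2) *\<^sub>R L1op S \<alpha> v) \<le> \<epsilon> * norm \<alpha> * supnorm r v)"
    using setting by (auto simp: setting_def coefficient_maps_def Let_def)
  have "(?f \<longlongrightarrow> L1op S \<alpha> v) (at_right 0)"
  proof (rule tendstoI)
    fix e :: real assume "e > 0"
    define s where "s = supnorm r v"
    have "s \<ge> 0" using supnorm_nonneg[OF assms(1) r_pos] by (simp add: s_def)
    \<comment> \<open>Chosen so that \<open>(2/t) \<epsilon> \<parallel>t\<alpha>\<parallel> s < e\<close> for every \<open>t\<close>; \<open>s + 1\<close> avoids a separate case \<open>s = 0\<close>.\<close>
    define \<epsilon> where "\<epsilon> = e / (4 * norm \<alpha> * (s + 1))"
    have "\<epsilon> > 0" using \<open>e > 0\<close> \<open>s \<ge> 0\<close> False by (simp add: \<epsilon>_def)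
    with expand obtain \<delta> where "\<delta> > 0" and \<delta>: "\<And>\<kappa>. \<kappa> \<in> params S \<Longrightarrow> norm \<kappa> < \<delta> \<Longrightarrow>
        norm (Lop S \<kappa> v - Lop S 0 v - (1/2) *\<^sub>R L1op S \<kappa> v) \<le> \<epsilon> * norm \<kappa> * s"
      using assms(1) unfolding s_def by blast
    have "((\<lambda>t. norm (t *\<^sub>R \<alpha>)) \<longlongrightarrow> norm (0 *\<^sub>R \<alpha>)) (at_right 0)" by (intro tendsto_intros)
    then have "\<forall>\<^sub>F t in at_right 0. norm (t *\<^sub>R \<alpha>) < \<delta>"
      using \<open>\<delta> > 0\<close> by (auto dest: order_tendstoD)
    with ev show "\<forall>\<^sub>F t in at_right 0. dist (?f t) (L1op S \<alpha> v) < e"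
    proof eventually_elim
      case (elim t)
      then have "t > 0" by simp
      have "L1op S (t *\<^sub>R \<alpha>) v = t *\<^sub>R L1op S \<alpha> v"
        using linear_scale[OF coefficient_operators(5)[OF assms(1)]] by simp
      then have "?f t - L1op S \<alpha> v = (2 / t) *\<^sub>R (Lop S (t *\<^sub>R \<alpha>) v - Lop S 0 v - (1/2) *\<^sub>R L1op S (t *\<^sub>R \<alpha>) v)"
        using \<open>t > 0\<close> by (simp add: scaleR_diff_right)
      then have "norm (?f t - L1op S \<alpha> v) \<le> (2 / t) * (\<epsilon> * (t * norm \<alpha>) * s)"
        using \<delta>[of "t *\<^sub>R \<alpha>"] elim \<open>t > 0\<close>
        by (simp only: norm_scaleR) (intro mult_mono, auto)
      also have "\<dots> = e / 2 * (s / (s + 1))"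
      proof -
        have "(2 / t) * (e / (4 * n * q) * (t * n) * s) = e / 2 * (s / q)" if "n > 0" "q > 0" for n q
          using that \<open>t > 0\<close> by (simp add: field_simps)
        then show ?thesis using False \<open>s \<ge> 0\<close> by (simp add: \<epsilon>_def del: times_divide_eq_left times_divide_eq_right)
      qed
      also have "\<dots> \<le> e / 2 * 1"
        using \<open>e > 0\<close> \<open>s \<ge> 0\<close> by (intro mult_left_mono) auto
      also have "\<dots> < e" using \<open>e > 0\<close> by simp
      finally show ?case by (simp add: dist_norm)
    qed
  qed
  moreover have "\<forall>\<^sub>F t in at_right 0. conjv S (?f t) = ?f t"
    using ev
  proof eventually_elim
    case (elim t)
    have "real_vec S (Lop S \<kappa> v)" if "\<kappa> \<in> params S" for \<kappa>
      using setting that assms real_histI[of v]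
      by (auto simp: setting_def coefficient_maps_def Let_def)
    then show ?case
      using elim params(2) by (simp add: real_vec_iff conjv_scaleR conjv_diff)
  qed
  ultimately show ?thesis by (rule conjv_limit) simp
qed

lemma L1_conj:
  assumes "v \<in> E" shows "L1op S \<alpha> (hconj v) = conjv S (L1op S \<alpha> v)"
proof -
  have "conjv S (L1op S \<alpha> (hconj v)) = L1op S \<alpha> v"
    by (rule real_determines[OF _ _ _ assms]) (unfold_locales, rule L1_real)
  then show ?thesis by (metis conjv_conjv)
qed

text \<open>Along a real ray, \<open>G(tv, 0) = t\<^sup>2/2 Q(v,v) + t\<^sup>3/6 C(v,v,v) + o(t\<^sup>3)\<close> has real values, so \<open>Q(v,v)\<close> is the
  limit of the real quotients \<open>2 G(tv, 0)/t\<^sup>2\<close>; once it is known to be real, the same argument applies to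
  the next order.\<close>

lemma QC_diagonal_real:
  assumes "v \<in> E" "hconj v = v"
  shows "conjv S (Qop S v v) = Qop S v v" "conjv S (Cop S v v v) = Cop S v v v"
proof -
  define s where "s = supnorm r v"
  have "s \<ge> 0" using supnorm_nonneg[OF assms(1) r_pos] by (simp add: s_def)
  let ?g = "\<lambda>t. Gop S (\<lambda>\<theta>. t *\<^sub>R v \<theta>) 0"
  define rem where "rem t = ?g t - (t\<^sup>2 / 2) *\<^sub>R Qop S v v - (t^3 / 6) *\<^sub>R Cop S v v v" for t
  have hom: "Qop S (\<lambda>\<theta>. t *\<^sub>R v \<theta>) (\<lambda>\<theta>. t *\<^sub>R v \<theta>) = t\<^sup>2 *\<^sub>R Qop S v v"
    "Cop S (\<lambda>\<theta>. t *\<^sub>R v \<theta>) (\<lambda>\<theta>. t *\<^sub>R v \<theta>) (\<lambda>\<theta>. t *\<^sub>R v \<theta>) = t^3 *\<^sub>R Cop S v v v" for t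
    using assms(1) history_operator.scaleR[OF Q_left, of "\<lambda>\<theta>. t *\<^sub>R v \<theta>" v t]
      history_operator.scaleR[OF Q_right, of v v t]
      history_operator.scaleR[OF C_left, of "\<lambda>\<theta>. t *\<^sub>R v \<theta>" "\<lambda>\<theta>. t *\<^sub>R v \<theta>" v t]
      history_operator.scaleR[OF C_middle, of v "\<lambda>\<theta>. t *\<^sub>R v \<theta>" v t]
      history_operator.scaleR[OF C_right, of v v v t]
    by (simp_all add: Cspace_intros power2_eq_square power3_eq_cube mult.assoc)
  have expand: "\<forall>\<epsilon>>0. \<exists>\<delta>>0. \<forall>v\<in>E. real_hist S v \<and> supnorm r v < \<delta> \<longrightarrow>
      norm (Gop S v 0 - (1/2) *\<^sub>R Qop S v v - (1/6) *\<^sub>R Cop S v v v) \<le> \<epsilon> * supnorm r v ^ 3"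
    using setting by (auto simp: setting_def coefficient_maps_def Let_def)
  have ev_pos: "\<forall>\<^sub>F t in at_right 0. t > (0::real)"
    by (rule eventually_at_right_less)
  have rem: "((\<lambda>t. rem t /\<^sub>R t^3) \<longlongrightarrow> 0) (at_right 0)"
  proof (rule tendstoI)
    fix e :: real assume "e > 0"
    define \<epsilon> where "\<epsilon> = e / (2 * (s^3 + 1))"
    have "s^3 \<ge> 0" using \<open>s \<ge> 0\<close> by simp
    then have "2 * (s^3 + 1) > 0" by (intro mult_pos_pos add_nonneg_pos) auto
    then have "\<epsilon> > 0" using \<open>e > 0\<close> unfolding \<epsilon>_def by simp
    with expand obtain \<delta> where "\<delta> > 0" and \<delta>: "\<And>v. v \<in> E \<Longrightarrow> real_hist S v \<Longrightarrow> supnorm r v < \<delta> \<Longrightarrow>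
        norm (Gop S v 0 - (1/2) *\<^sub>R Qop S v v - (1/6) *\<^sub>R Cop S v v v) \<le> \<epsilon> * supnorm r v ^ 3"
      by blast
    have "((\<lambda>t. t * s) \<longlongrightarrow> 0 * s) (at_right 0)" by (intro tendsto_intros)
    then have "\<forall>\<^sub>F t in at_right 0. t * s < \<delta>"
      using \<open>\<delta> > 0\<close> by (auto dest: order_tendstoD)
    with ev_pos show "\<forall>\<^sub>F t in at_right 0. dist (rem t /\<^sub>R t^3) 0 < e"
    proof eventually_elim
      case (elim t)
      have le: "supnorm r (\<lambda>\<theta>. t *\<^sub>R v \<theta>) \<le> t * s" "0 \<le> supnorm r (\<lambda>\<theta>. t *\<^sub>R v \<theta>)"
        using assms(1) elim r_pos
        by (simp_all add: s_def supnorm_scaleR_le supnorm_nonneg Cspace_intros)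
      have "norm (rem t) \<le> \<epsilon> * supnorm r (\<lambda>\<theta>. t *\<^sub>R v \<theta>) ^ 3"
        using \<delta>[of "\<lambda>\<theta>. t *\<^sub>R v \<theta>"] le elim assms fun_cong[OF assms(2)]
        by (simp add: rem_def hom Cspace_intros real_histI conjv_scaleR)
      also have "\<dots> \<le> \<epsilon> * (t * s) ^ 3"
        using \<open>\<epsilon> > 0\<close> le by (intro mult_left_mono power_mono) auto
      finally have "norm (rem t) / t^3 \<le> \<epsilon> * s^3"
        using elim by (simp add: field_simps power_mult_distrib)
      also have "\<dots> = e / 2 * (s^3 / (s^3 + 1))"
        using \<open>s^3 \<ge> 0\<close> by (simp add: \<epsilon>_def field_simps)
      also have "\<dots> \<le> e / 2 * 1"
      proof -
        have "x / (x + 1) \<le> 1" if "x \<ge> 0" for x :: real using that by simp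
        from this[OF \<open>s^3 \<ge> 0\<close>] show ?thesis using \<open>e > 0\<close> by (intro mult_left_mono) auto
      qed
      also have "\<dots> < e" using \<open>e > 0\<close> by simp
      finally show ?case using elim by (simp add: divide_inverse mult.commute)
    qed
  qed
  have G_real: "conjv S (?g t) = ?g t" for t
  proof -
    have "real_vec S (?g t)"
      using setting params(2) assms fun_cong[OF assms(2)] real_histI[of "\<lambda>\<theta>. t *\<^sub>R v \<theta>"]
      by (auto simp: setting_def coefficient_maps_def Let_def Cspace_intros conjv_scaleR)
    then show ?thesis by (simp add: real_vec_iff)
  qed
  have "((\<lambda>t. (2 * t) *\<^sub>R (rem t /\<^sub>R t^3) + Qop S v v + (t / 3) *\<^sub>R Cop S v v v)
      \<longlongrightarrow> (2 * 0) *\<^sub>R 0 + Qop S v v + (0 / 3) *\<^sub>R Cop S v v v) (at_right 0)"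
    by (intro tendsto_intros rem) simp
  moreover have "\<forall>\<^sub>F t in at_right 0.
      (2 * t) *\<^sub>R (rem t /\<^sub>R t^3) + Qop S v v + (t / 3) *\<^sub>R Cop S v v v = (2 / t\<^sup>2) *\<^sub>R ?g t"
    using ev_pos
    by eventually_elim (simp add: rem_def scaleR_diff_right power2_eq_square power3_eq_cube field_simps)
  ultimately have "((\<lambda>t. (2 / t\<^sup>2) *\<^sub>R ?g t) \<longlongrightarrow> Qop S v v) (at_right 0)"
    by (auto dest: Lim_transform_eventually)
  then show Q: "conjv S (Qop S v v) = Qop S v v"
    by (rule conjv_limit) (simp_all add: conjv_scaleR G_real)
  have "((\<lambda>t. 6 *\<^sub>R (rem t /\<^sub>R t^3) + Cop S v v v) \<longlongrightarrow> 6 *\<^sub>R 0 + Cop S v v v) (at_right 0)"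
    by (intro tendsto_intros rem)
  moreover have "\<forall>\<^sub>F t in at_right 0.
      6 *\<^sub>R (rem t /\<^sub>R t^3) + Cop S v v v = (6 / t^3) *\<^sub>R ?g t - (3 / t) *\<^sub>R Qop S v v"
    using ev_pos
    by eventually_elim (simp add: rem_def scaleR_diff_right power2_eq_square power3_eq_cube field_simps)
  ultimately have "((\<lambda>t. (6 / t^3) *\<^sub>R ?g t - (3 / t) *\<^sub>R Qop S v v) \<longlongrightarrow> Cop S v v v) (at_right 0)"
    by (auto dest: Lim_transform_eventually)
  then show "conjv S (Cop S v v v) = Cop S v v v"
    by (rule conjv_limit) (simp_all add: conjv_scaleR conjv_diff G_real Q)
qed

text \<open>By polarization of the diagonal values.\<close>

lemma Q_real:
  assumes "v \<in> E" "hconj v = v" "w \<in> E" "hconj w = w"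
  shows "conjv S (Qop S v w) = Qop S v w"
proof -
  have vw: "(\<lambda>\<theta>. v \<theta> + w \<theta>) \<in> E" "hconj (\<lambda>\<theta>. v \<theta> + w \<theta>) = (\<lambda>\<theta>. v \<theta> + w \<theta>)"
    using assms fun_cong[OF assms(2)] fun_cong[OF assms(4)] by (simp_all add: Cspace_intros conjv_add)
  have "Qop S (\<lambda>\<theta>. v \<theta> + w \<theta>) (\<lambda>\<theta>. v \<theta> + w \<theta>) = Qop S v v + Qop S w w + 2 *\<^sub>R Qop S v w"
    using assms vw by (simp add: history_operator.add[OF Q_left] history_operator.add[OF Q_right]
        Q_commute[of w v] scaleR_2)
  then have "Qop S v w = (1/2) *\<^sub>R (Qop S (\<lambda>\<theta>. v \<theta> + w \<theta>) (\<lambda>\<theta>. v \<theta> + w \<theta>) - Qop S v v - Qop S w w)"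
    by simp
  then show ?thesis
    using QC_diagonal_real(1)[OF assms(1,2)] QC_diagonal_real(1)[OF assms(3,4)] QC_diagonal_real(1)[OF vw]
    by (simp add: conjv_scaleR conjv_diff)
qed

text \<open>The even part in \<open>v\<close> of \<open>C(w+v, w+v, w+v)\<close> is \<open>C(w,w,w) + 3 C(v,v,w)\<close>, which expresses \<open>C(v,v,w)\<close>
  by diagonal values. A second polarization, in the repeated argument, gives all values.\<close>

lemma C_real2:
  assumes "v \<in> E" "hconj v = v" "w \<in> E" "hconj w = w"
  shows "conjv S (Cop S v v w) = Cop S v v w"
proof -
  let ?C = "\<lambda>v. Cop S v v v"
  let ?p = "\<lambda>\<theta>. w \<theta> + v \<theta>" and ?m = "\<lambda>\<theta>. w \<theta> - v \<theta>"
  have p: "?p \<in> E" "hconj ?p = ?p" and m: "?m \<in> E" "hconj ?m = ?m"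
    using assms fun_cong[OF assms(2)] fun_cong[OF assms(4)]
    by (simp_all add: Cspace_intros conjv_add conjv_diff)
  have "Cop S v w w = Cop S w v w" "Cop S w w v = Cop S w v w" "Cop S w v v = Cop S v v w"
      "Cop S v w v = Cop S v v w"
    using assms C_commute by metis+
  moreover have "6 *\<^sub>R x = x + (x + (x + (x + 2 *\<^sub>R x)))" for x :: "'x ^ 'm"
    by (simp flip: scaleR_left_distrib[of 1, simplified])
  ultimately have "?C ?p + ?C ?m - 2 *\<^sub>R ?C w = 6 *\<^sub>R Cop S v v w"
    using assms p m
    by (simp add: history_operator.add[OF C_left] history_operator.add[OF C_middle] history_operator.add[OF C_right]
        history_operator.diff[OF C_left] history_operator.diff[OF C_middle] history_operator.diff[OF C_right]
        algebra_simps scaleR_2)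
  then have "Cop S v v w = (1/6) *\<^sub>R (?C ?p + ?C ?m - 2 *\<^sub>R ?C w)" by simp
  then show ?thesis
    using QC_diagonal_real(2)[OF p] QC_diagonal_real(2)[OF m] QC_diagonal_real(2)[OF assms(3,4)]
    by (simp add: conjv_scaleR conjv_diff conjv_add)
qed

lemma C_real:
  assumes "u \<in> E" "hconj u = u" "v \<in> E" "hconj v = v" "w \<in> E" "hconj w = w"
  shows "conjv S (Cop S u v w) = Cop S u v w"
proof -
  let ?p = "\<lambda>\<theta>. u \<theta> + v \<theta>"
  have p: "?p \<in> E" "hconj ?p = ?p"
    using assms fun_cong[OF assms(2)] fun_cong[OF assms(4)] by (simp_all add: Cspace_intros conjv_add)
  have "Cop S ?p ?p w = Cop S u u w + Cop S v v w + 2 *\<^sub>R Cop S u v w"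
    using assms p by (simp add: history_operator.add[OF C_left] history_operator.add[OF C_middle]
        C_commute(1)[of v u] scaleR_2)
  then have "Cop S u v w = (1/2) *\<^sub>R (Cop S ?p ?p w - Cop S u u w - Cop S v v w)" by simp
  then show ?thesis
    using C_real2[OF p assms(5,6)] C_real2[OF assms(1,2,5,6)] C_real2[OF assms(3-6)]
    by (simp add: conjv_scaleR conjv_diff)
qed

lemma Q_conj:
  assumes "v \<in> E" "w \<in> E"
  shows "Qop S (hconj v) (hconj w) = conjv S (Qop S v w)"
proof -
  have 1: "Qop S (hconj v) w = conjv S (Qop S v w)" if "v \<in> E" "w \<in> E" "hconj w = w" for v w
  proof -
    have "conjv S (Qop S (hconj v) w) = Qop S v w"
      by (rule real_determines[OF Q_left Q_left]) (use that Q_real in auto)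
    then show ?thesis by (metis conjv_conjv)
  qed
  have "conjv S (Qop S (hconj v) (hconj w)) = Qop S v w"
    by (rule real_determines[OF Q_right Q_right])
      (use assms 1 Cspace_hconj in auto)
  then show ?thesis by (metis conjv_conjv)
qed

lemma C_conj:
  assumes "u \<in> E" "v \<in> E" "w \<in> E"
  shows "Cop S (hconj u) (hconj v) (hconj w) = conjv S (Cop S u v w)"
proof -
  have 1: "Cop S (hconj u) v w = conjv S (Cop S u v w)"
    if "u \<in> E" "v \<in> E" "hconj v = v" "w \<in> E" "hconj w = w" for u v w
  proof -
    have "conjv S (Cop S (hconj u) v w) = Cop S u v w"
      by (rule real_determines[OF C_left C_left]) (use that C_real in auto)
    then show ?thesis by (metis conjv_conjv)
  qed
  have 2: "Cop S (hconj u) (hconj v) w = conjv S (Cop S u v w)"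
    if "u \<in> E" "v \<in> E" "w \<in> E" "hconj w = w" for u v w
  proof -
    have "conjv S (Cop S (hconj u) (hconj v) w) = Cop S u v w"
      by (rule real_determines[OF C_middle C_middle]) (use that 1 Cspace_hconj in auto)
    then show ?thesis by (metis conjv_conjv)
  qed
  have "conjv S (Cop S (hconj u) (hconj v) (hconj w)) = Cop S u v w"
    by (rule real_determines[OF C_right C_right]) (use assms 2 Cspace_hconj in auto)
  then show ?thesis by (metis conjv_conjv)
qed

section \<open>The linear part in the basis of eigenfunctions\<close>

lemma Lvec_eq: "\<phi> \<in> Cspace r \<Longrightarrow> k \<in> N \<Longrightarrow> Lvec S 0 \<phi> = comp_ip (Lop S 0 (htens \<phi> (\<beta> k))) (\<beta> k)"
  using orthonormal by (simp add: L_htens comp_ip_tens)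

text \<open>\<open>L\<^sub>0\<close> acts pointwise in space, hence leaves each mode invariant.\<close>

lemma comp_ip_L0_exp:
  assumes "k \<in> N"
  shows "comp_ip (Lop S 0 (\<lambda>\<theta>. exp (l * of_real \<theta>) *\<^sub>C u)) (\<beta> k)
    = Lvec S 0 (\<lambda>\<theta>. exp (l * of_real \<theta>) *s comp_ip u (\<beta> k))"
proof (rule coeff_of_diagonal_operator[OF L0.bounded_linear_on_exponentials _ assms])
  fix j and c :: "complex ^ 'm" assume "j \<in> N"
  have "(\<lambda>\<theta>. exp (l * of_real \<theta>) *\<^sub>C (c \<otimes> \<beta> j)) = htens (\<lambda>\<theta>. exp (l * of_real \<theta>) *s c) (\<beta> j)"
    by (simp add: htens_def tens_smult)
  then show "Lop S 0 (\<lambda>\<theta>. exp (l * of_real \<theta>) *\<^sub>C (c \<otimes> \<beta> j))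
      = Lvec S 0 (\<lambda>\<theta>. exp (l * of_real \<theta>) *s c) \<otimes> \<beta> j"
    by (simp add: L_htens Cspace_exp_smult)
qed

lemma diffc1_linear: "linear (diffc1 S)"
proof -
  have "bounded_linear (\<lambda>\<alpha>. (1/2) *\<^sub>R diffc1 S \<alpha>)"
    using setting by (auto simp: setting_def coefficient_maps_def Let_def dest: has_derivative_bounded_linear)
  then have "linear (\<lambda>\<alpha>. 2 *\<^sub>R (1/2) *\<^sub>R diffc1 S \<alpha>)"
    by (rule linear_compose_scale_right[OF bounded_linear.linear])
  then show ?thesis by simp
qed

end

section \<open>Riemann--Stieltjes integrals and the bilinear pairing\<close>

lemma rs_partition_mem:
  assumes "rs_partition a b n t" "i \<le> n" shows "a \<le> t i" "t i \<le> b"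
proof -
  have mono: "t i \<le> t j" if "i \<le> j" "j \<le> n" for i j
    using that by (induction j rule: dec_induct)
      (use assms(1) in \<open>auto simp: rs_partition_def intro: order.trans\<close>)
  show "a \<le> t i" "t i \<le> b"
    using mono[of 0 i] mono[of i n] assms by (auto simp: rs_partition_def)
qed

lemma has_rs_integralE:
  assumes "has_rs_integral f g a b I" "e > 0"
  obtains d where "d > 0" and "\<And>n t \<xi>. rs_partition a b n t \<and>
      (\<forall>i<n. t (Suc i) - t i < d \<and> \<xi> i \<in> {t i..t (Suc i)}) \<Longrightarrow>
      norm ((\<Sum>i<n. f (\<xi> i) * complex_of_real (g (t (Suc i)) - g (t i))) - I) < e"
proof -
  from assms(1)[unfolded has_rs_integral_def, rule_format, OF assms(2)]
  show thesis by (elim exE conjE) (rule that, assumption, blast)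
qed

text \<open>Equidistant partitions are eventually finer than any two given meshes, and one of them, with its left
  endpoints as tags, separates two distinct candidates.\<close>

lemma has_rs_integral_unique:
  assumes "a \<le> b" "has_rs_integral f g a b I" "has_rs_integral f g a b J"
  shows "I = J"
proof (rule ccontr)
  assume "I \<noteq> J"
  define e where "e = norm (I - J) / 2"
  have "e > 0" using \<open>I \<noteq> J\<close> by (simp add: e_def)
  let ?s = "\<lambda>n t \<xi>. \<Sum>i<n. f (\<xi> i) * complex_of_real (g (t (Suc i)) - g (t i))"
  obtain d1 where "d1 > 0" and d1: "\<And>n t \<xi>. rs_partition a b n t \<and>
      (\<forall>i<n. t (Suc i) - t i < d1 \<and> \<xi> i \<in> {t i..t (Suc i)}) \<Longrightarrow> norm (?s n t \<xi> - I) < e"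
    by (rule has_rs_integralE[OF assms(2) \<open>e > 0\<close>]) (rule that)
  obtain d2 where "d2 > 0" and d2: "\<And>n t \<xi>. rs_partition a b n t \<and>
      (\<forall>i<n. t (Suc i) - t i < d2 \<and> \<xi> i \<in> {t i..t (Suc i)}) \<Longrightarrow> norm (?s n t \<xi> - J) < e"
    by (rule has_rs_integralE[OF assms(3) \<open>e > 0\<close>]) (rule that)
  define d where "d = min d1 d2"
  have "d > 0" using \<open>d1 > 0\<close> \<open>d2 > 0\<close> by (simp add: d_def)
  obtain n :: nat where n: "(b - a) / d < n" using reals_Archimedean2 by blast
  have "n > 0" using n assms(1) \<open>d > 0\<close> by (cases n) (auto simp: divide_less_0_iff)
  define t where "t i = a + real i * ((b - a) / n)" for i
  have step: "t (Suc i) - t i = (b - a) / n" for i by (simp only: t_def of_nat_Suc distrib_right)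
  have "(b - a) / n < d" using n \<open>d > 0\<close> \<open>n > 0\<close> by (simp add: field_simps)
  moreover have "0 \<le> (b - a) / n" using assms(1) by simp
  ultimately have small: "t (Suc i) - t i < d1" "t (Suc i) - t i < d2" "t i \<le> t (Suc i)" for i
    using step[of i] by (auto simp: d_def)
  have "rs_partition a b n t"
    using \<open>n > 0\<close> small by (auto simp: rs_partition_def t_def)
  then have "norm (?s n t t - I) < e" "norm (?s n t t - J) < e"
    using small by (intro d1 d2; simp)+
  then have "norm (I - J) < e + e"
    using norm_triangle_ineq4[of "?s n t t - J" "?s n t t - I"] by simp
  then show False by (simp add: e_def)
qed

lemma rs_integral_eqI: "a \<le> b \<Longrightarrow> has_rs_integral f g a b I \<Longrightarrow> rs_integral f g a b = I"
  unfolding rs_integral_def by (rule the_equality) (auto intro: has_rs_integral_unique)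

lemma has_rs_integral_rs_integral:
  "a \<le> b \<Longrightarrow> has_rs_integral f g a b I \<Longrightarrow> has_rs_integral f g a b (rs_integral f g a b)"
  by (simp add: rs_integral_eqI)

lemma has_rs_integral_transform:
  assumes "\<And>x. x \<in> {a..b} \<Longrightarrow> f x = f' x" and "has_rs_integral f g a b I"
  shows "has_rs_integral f' g a b I"
proof -
  have *: "(\<Sum>i<n. f (\<xi> i) * complex_of_real (g (t (Suc i)) - g (t i)))
      = (\<Sum>i<n. f' (\<xi> i) * complex_of_real (g (t (Suc i)) - g (t i)))"
    if "rs_partition a b n t \<and> (\<forall>i<n. t (Suc i) - t i < \<delta> \<and> \<xi> i \<in> {t i..t (Suc i)})" for n t \<xi> \<delta>
  proof (rule sum.cong[OF refl])
    fix i assume "i \<in> {..<n}"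
    then have "\<xi> i \<in> {a..b}"
      using that rs_partition_mem[of a b n t i] rs_partition_mem[of a b n t "Suc i"] by fastforce
    then show "f (\<xi> i) * complex_of_real (g (t (Suc i)) - g (t i))
        = f' (\<xi> i) * complex_of_real (g (t (Suc i)) - g (t i))" by (simp add: assms(1))
  qed
  show ?thesis
    unfolding has_rs_integral_def
  proof (intro allI impI)
    fix e :: real assume "e > 0"
    then obtain \<delta> where "\<delta> > 0" and \<delta>: "\<And>n t \<xi>. rs_partition a b n t \<and>
        (\<forall>i<n. t (Suc i) - t i < \<delta> \<and> \<xi> i \<in> {t i..t (Suc i)}) \<Longrightarrow>
        norm ((\<Sum>i<n. f (\<xi> i) * of_real (g (t (Suc i)) - g (t i))) - I) < e"
      by (rule has_rs_integralE[OF assms(2)]) (rule that)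
    have "norm ((\<Sum>i<n. f' (\<xi> i) * of_real (g (t (Suc i)) - g (t i))) - I) < e"
      if "rs_partition a b n t \<and> (\<forall>i<n. t (Suc i) - t i < \<delta> \<and> \<xi> i \<in> {t i..t (Suc i)})" for n t \<xi>
      using \<delta>[OF that] unfolding *[OF that] .
    then show "\<exists>\<delta>>0. \<forall>n t \<xi>. rs_partition a b n t \<and>
        (\<forall>i<n. t (Suc i) - t i < \<delta> \<and> \<xi> i \<in> {t i..t (Suc i)}) \<longrightarrow>
        norm ((\<Sum>i<n. f' (\<xi> i) * of_real (g (t (Suc i)) - g (t i))) - I) < e"
      using \<open>\<delta> > 0\<close> by blast
  qed
qed

lemma has_rs_integral_cong:
  assumes "\<And>x. x \<in> {a..b} \<Longrightarrow> f x = f' x"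
  shows "has_rs_integral f g a b I \<longleftrightarrow> has_rs_integral f' g a b I"
  using has_rs_integral_transform[of a b f f' g I] has_rs_integral_transform[of a b f' f g I] assms
  by metis

lemma rs_integral_cong:
  "(\<And>x. x \<in> {a..b} \<Longrightarrow> f x = f' x) \<Longrightarrow> rs_integral f g a b = rs_integral f' g a b"
  unfolding rs_integral_def by (rule arg_cong[of _ _ The]) (rule ext, rule has_rs_integral_cong)

lemma has_rs_integral_linear:
  assumes f: "has_rs_integral f g a b I" and f': "has_rs_integral f' g a b J"
  shows "has_rs_integral (\<lambda>x. c * f x + f' x) g a b (c * I + J)"
  unfolding has_rs_integral_def
proof (intro allI impI)
  fix e :: real assume "e > 0"
  let ?s = "\<lambda>f n t \<xi>. \<Sum>i<n. f (\<xi> i) * complex_of_real (g (t (Suc i)) - g (t i))"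
  define e1 where "e1 = e / (2 * (norm c + 1))"
  have pos: "norm c + 1 > 0" using norm_ge_zero[of c] by linarith
  then have "e1 > 0" using \<open>e > 0\<close> by (simp add: e1_def)
  then obtain d1 where "d1 > 0" and d1: "\<And>n t \<xi>. rs_partition a b n t \<and>
      (\<forall>i<n. t (Suc i) - t i < d1 \<and> \<xi> i \<in> {t i..t (Suc i)}) \<Longrightarrow> norm (?s f n t \<xi> - I) < e1"
    by (rule has_rs_integralE[OF f]) (rule that)
  obtain d2 where "d2 > 0" and d2: "\<And>n t \<xi>. rs_partition a b n t \<and>
      (\<forall>i<n. t (Suc i) - t i < d2 \<and> \<xi> i \<in> {t i..t (Suc i)}) \<Longrightarrow> norm (?s f' n t \<xi> - J) < e / 2"
    by (rule has_rs_integralE[OF f' half_gt_zero[OF \<open>e > 0\<close>]]) (rule that)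
  have "norm (?s (\<lambda>x. c * f x + f' x) n t \<xi> - (c * I + J)) < e"
    if "rs_partition a b n t \<and> (\<forall>i<n. t (Suc i) - t i < min d1 d2 \<and> \<xi> i \<in> {t i..t (Suc i)})" for n t \<xi>
  proof -
    have eq: "?s (\<lambda>x. c * f x + f' x) n t \<xi> - (c * I + J) = c * (?s f n t \<xi> - I) + (?s f' n t \<xi> - J)"
      by (simp add: algebra_simps sum.distrib sum_distrib_left sum_subtractf)
    have "norm (c * (?s f n t \<xi> - I)) \<le> norm c * e1"
      unfolding norm_mult using that by (intro mult_left_mono[OF less_imp_le[OF d1]]) auto
    moreover have "norm c * e1 \<le> (norm c + 1) * e1" using \<open>e1 > 0\<close> by (intro mult_right_mono) auto
    moreover have "(norm c + 1) * e1 = e / 2"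
    proof -
      have "q * (e / (2 * q)) = e / 2" if "q > 0" for q using that by simp
      from this[OF pos] show ?thesis by (simp only: e1_def)
    qed
    moreover have "norm (?s f' n t \<xi> - J) < e / 2" using that by (intro d2) auto
    ultimately show ?thesis
      unfolding eq using norm_triangle_ineq[of "c * (?s f n t \<xi> - I)" "?s f' n t \<xi> - J"] by linarith
  qed
  then show "\<exists>d>0. \<forall>n t \<xi>. rs_partition a b n t \<and> (\<forall>i<n. t (Suc i) - t i < d \<and> \<xi> i \<in> {t i..t (Suc i)})
      \<longrightarrow> norm (?s (\<lambda>x. c * f x + f' x) n t \<xi> - (c * I + J)) < e"
    using \<open>d1 > 0\<close> \<open>d2 > 0\<close> by (intro exI[of _ "min d1 d2"]) simp
qed

lemma has_rs_integral_cnj: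
  assumes "has_rs_integral f g a b I"
  shows "has_rs_integral (\<lambda>x. cnj (f x)) g a b (cnj I)"
proof -
  have "norm ((\<Sum>i<n. cnj (f (\<xi> i)) * complex_of_real (g (t (Suc i)) - g (t i))) - cnj I)
      = norm ((\<Sum>i<n. f (\<xi> i) * complex_of_real (g (t (Suc i)) - g (t i))) - I)" for n t \<xi>
    by (subst complex_mod_cnj[symmetric]) (simp del: complex_mod_cnj)
  then show ?thesis using assms unfolding has_rs_integral_def by simp
qed

lemma has_rs_integral_zero: "has_rs_integral (\<lambda>x. 0) g a b 0"
  by (auto simp: has_rs_integral_def intro: exI[of _ 1])

context bifurcation
begin

text \<open>Existence for continuous integrands comes with the representing measure \<open>\<eta>\<^sub>k\<close>: these integrals give
  \<open>-\<mu>\<^sub>kD\<^sub>0\<psi>(0) + L\<^sub>0\<psi>\<close> for every history \<open>\<psi>\<close>.\<close>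

lemma rs_integral_exists:
  assumes "k \<in> N" "continuous_on {-r..0} f"
  obtains J where "has_rs_integral f (\<lambda>\<theta>. eta S k \<theta> $ a $ b) (- r) 0 J"
proof -
  have "(\<lambda>\<theta>. \<chi> b. f \<theta>) \<in> Cspace r"
    using assms(2) by (auto simp: Cspace_def intro: continuous_intros)
  then show thesis
    using bases assms(1) that unfolding center_bases_def eta_represents_def by fastforce
qed

text \<open>The adjoint eigenvectors are of this form. For them the inner integral of the pairing factors as
  \<open>\<psi>(\<xi> - \<theta>) = e\<^sup>-\<^sup>\<kappa>\<^sup>\<theta>\<psi>(\<xi>)\<close>, which makes its continuity in \<open>\<theta>\<close> immediate.\<close>

definition exponential :: "(real \<Rightarrow> complex ^ 'm) \<Rightarrow> bool"
  where "exponential \<psi> \<longleftrightarrow> (\<exists>\<kappa> q. \<psi> = (\<lambda>s. exp (\<kappa> * of_real s) *s q))"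

lemma exponential_psi: "exponential (psi1 S)" "exponential (psi2 S)" "exponential (psi2c S)"
proof -
  show "exponential (psi1 S)"
    unfolding exponential_def psi1_def by (intro exI[of _ 0] exI[of _ "q1 S"]) simp
  show "exponential (psi2 S)"
    unfolding exponential_def psi2_def by (intro exI[of _ "- \<i> * om0 S"] exI[of _ "q2 S"]) (simp add: mult.assoc)
  show "exponential (psi2c S)"
    unfolding exponential_def psi2c_def psi2_def
    by (intro exI[of _ "\<i> * om0 S"] exI[of _ "cvec (q2 S)"])
      (simp add: fun_eq_iff vec_eq_iff exp_cnj mult.assoc)
qed

abbreviation "pairing_int \<psi> \<phi> a b \<theta> \<equiv> - integral {\<theta>..0} (\<lambda>\<xi>. \<psi> (\<xi> - \<theta>) $ a * \<phi> \<xi> $ b)"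

lemma continuous_pairing_int:
  assumes "exponential \<psi>" "\<phi> \<in> Cspace r"
  shows "continuous_on {-r..0} (pairing_int \<psi> \<phi> a b)"
proof -
  obtain \<kappa> q where \<psi>: "\<psi> = (\<lambda>s. exp (\<kappa> * of_real s) *s q)" using assms(1) by (auto simp: exponential_def)
  let ?f = "\<lambda>\<xi>. exp (\<kappa> * complex_of_real \<xi>) * \<phi> \<xi> $ b"
  have f: "?f integrable_on {-r..0}"
    using assms(2) by (intro integrable_continuous_real continuous_intros) (auto simp: Cspace_def)
  have "pairing_int \<psi> \<phi> a b \<theta> = - (exp (- (\<kappa> * of_real \<theta>)) * q $ a * integral {\<theta>..0} ?f)" for \<theta>
  proof -
    have "(\<lambda>\<xi>. \<psi> (\<xi> - \<theta>) $ a * \<phi> \<xi> $ b) = (\<lambda>\<xi>. (exp (- (\<kappa> * of_real \<theta>)) * q $ a) * ?f \<xi>)"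
      by (simp add: \<psi> fun_eq_iff right_diff_distrib exp_diff exp_minus divide_inverse mult_ac)
    then show ?thesis by (simp only: integral_mult_right)
  qed
  moreover have "continuous_on {-r..0} (\<lambda>\<theta>. integral {\<theta>..0} ?f)"
    by (rule indefinite_integral_continuous_1'[OF f])
  ultimately show ?thesis by (auto intro!: continuous_intros)
qed

lemma integrable_pairing:
  assumes "exponential \<psi>" "\<phi> \<in> Cspace r" "\<theta> \<in> {-r..0}"
  shows "(\<lambda>\<xi>. \<psi> (\<xi> - \<theta>) $ a * \<phi> \<xi> $ b) integrable_on {\<theta>..0}"
proof -
  obtain \<kappa> q where \<psi>: "\<psi> = (\<lambda>s. exp (\<kappa> * of_real s) *s q)" using assms(1) by (auto simp: exponential_def)
  have "continuous_on {\<theta>..0} \<phi>"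
    using assms(2,3) by (auto simp: Cspace_def elim: continuous_on_subset)
  then show ?thesis unfolding \<psi>
    by (intro integrable_continuous_real) (auto intro!: continuous_intros)
qed

lemma pairing_has_rs:
  assumes "exponential \<psi>" "\<phi> \<in> Cspace r" "k \<in> N"
  shows "has_rs_integral (pairing_int \<psi> \<phi> a b) (\<lambda>\<theta>. eta S k \<theta> $ a $ b) (- r) 0
    (rs_integral (pairing_int \<psi> \<phi> a b) (\<lambda>\<theta>. eta S k \<theta> $ a $ b) (- r) 0)"
  by (rule rs_integral_exists[OF assms(3) continuous_pairing_int[OF assms(1,2)], of a b])
    (rule has_rs_integral_rs_integral, use r_pos in auto)

lemma pairing_linear:
  assumes "exponential \<psi>" "\<phi> \<in> Cspace r" "\<phi>' \<in> Cspace r" "k \<in> N"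
  shows "pairing S k \<psi> (\<lambda>\<theta>. c *s \<phi> \<theta> + \<phi>' \<theta>) = c * pairing S k \<psi> \<phi> + pairing S k \<psi> \<phi>'"
proof -
  let ?\<phi> = "\<lambda>\<theta>. c *s \<phi> \<theta> + \<phi>' \<theta>"
  let ?R = "\<lambda>\<phi> a b. rs_integral (pairing_int \<psi> \<phi> a b) (\<lambda>\<theta>. eta S k \<theta> $ a $ b) (- r) 0"
  have "?R ?\<phi> a b = c * ?R \<phi> a b + ?R \<phi>' a b" for a b
  proof (rule rs_integral_eqI)
    have "pairing_int \<psi> ?\<phi> a b \<theta> = c * pairing_int \<psi> \<phi> a b \<theta> + pairing_int \<psi> \<phi>' a b \<theta>"
      if "\<theta> \<in> {-r..0}" for \<theta>
    proof -
      have "integral {\<theta>..0} (\<lambda>\<xi>. \<psi> (\<xi> - \<theta>) $ a * ?\<phi> \<xi> $ b) =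
          integral {\<theta>..0} (\<lambda>\<xi>. c * (\<psi> (\<xi> - \<theta>) $ a * \<phi> \<xi> $ b) + \<psi> (\<xi> - \<theta>) $ a * \<phi>' \<xi> $ b)"
        by (rule arg_cong[of _ _ "integral _"]) (simp add: fun_eq_iff distrib_left mult.left_commute)
      then show ?thesis
        using integrable_pairing[OF assms(1,2) that, of a b] integrable_pairing[OF assms(1,3) that, of a b]
        by (simp add: integral_add integrable_on_mult_right)
    qed
    then show "has_rs_integral (pairing_int \<psi> ?\<phi> a b) (\<lambda>\<theta>. eta S k \<theta> $ a $ b) (- r) 0 (c * ?R \<phi> a b + ?R \<phi>' a b)"
      by (intro has_rs_integral_transform[OF _
            has_rs_integral_linear[OF pairing_has_rs[OF assms(1,2,4)] pairing_has_rs[OF assms(1,3,4)]]]) simp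
  qed (use r_pos in simp)
  then show ?thesis
    by (simp add: pairing_def rowmul_def algebra_simps sum.distrib sum_distrib_left)
qed

lemma pairing_zero: "pairing S k \<psi> (\<lambda>\<theta>. 0) = 0"
proof -
  have "rs_integral (\<lambda>\<theta>. 0) g (- r) 0 = 0" for g
    using r_pos by (intro rs_integral_eqI has_rs_integral_zero) simp
  then show ?thesis by (simp add: pairing_def rowmul_def)
qed

lemma pairing_smult:
  "exponential \<psi> \<Longrightarrow> \<phi> \<in> Cspace r \<Longrightarrow> k \<in> N \<Longrightarrow>
    pairing S k \<psi> (\<lambda>\<theta>. c *s \<phi> \<theta>) = c * pairing S k \<psi> \<phi>"
  using pairing_linear[of \<psi> \<phi> "\<lambda>\<theta>. 0" k c] by (simp add: Cspace_zero pairing_zero)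

lemma pairing_cong:
  assumes "\<And>\<theta>. \<theta> \<in> {-r..0} \<Longrightarrow> \<phi> \<theta> = \<phi>' \<theta>"
  shows "pairing S k \<psi> \<phi> = pairing S k \<psi> \<phi>'"
proof -
  have "pairing_int \<psi> \<phi> a b \<theta> = pairing_int \<psi> \<phi>' a b \<theta>" if "\<theta> \<in> {-r..0}" for a b \<theta>
    using that assms by (auto intro!: arg_cong[of _ _ uminus] integral_cong)
  then show ?thesis
    unfolding pairing_def using assms[of 0] r_pos
    by (intro arg_cong2[of _ _ _ _ "(-)"] sum.cong rs_integral_cong) auto
qed

lemma pairing_cnj:
  assumes "exponential \<psi>" "\<phi> \<in> Cspace r" "k \<in> N"
  shows "pairing S k (\<lambda>s. cvec (\<psi> s)) (\<lambda>\<theta>. cvec (\<phi> \<theta>)) = cnj (pairing S k \<psi> \<phi>)"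
proof -
  let ?R = "\<lambda>\<psi> \<phi> a b. rs_integral (pairing_int \<psi> \<phi> a b) (\<lambda>\<theta>. eta S k \<theta> $ a $ b) (- r) 0"
  have "?R (\<lambda>s. cvec (\<psi> s)) (\<lambda>\<theta>. cvec (\<phi> \<theta>)) a b = cnj (?R \<psi> \<phi> a b)" for a b
  proof (rule rs_integral_eqI)
    have "pairing_int (\<lambda>s. cvec (\<psi> s)) (\<lambda>\<theta>. cvec (\<phi> \<theta>)) a b \<theta> = cnj (pairing_int \<psi> \<phi> a b \<theta>)" for \<theta>
      by (simp add: integral_cnj)
    then show "has_rs_integral (pairing_int (\<lambda>s. cvec (\<psi> s)) (\<lambda>\<theta>. cvec (\<phi> \<theta>)) a b)
        (\<lambda>\<theta>. eta S k \<theta> $ a $ b) (- r) 0 (cnj (?R \<psi> \<phi> a b))"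
      using has_rs_integral_cnj[OF pairing_has_rs[OF assms, of a b]] by simp
  qed (use r_pos in simp)
  then show ?thesis by (simp add: pairing_def rowmul_def)
qed

text \<open>\<open>X\<^sub>0c\<close> vanishes almost everywhere, so only the boundary term \<open>\<psi>(0)c\<close> is left; this is why the
  reduced equation involves \<open>\<psi>(0)\<close> alone.\<close>

lemma pairing_jump: "pairing S k \<psi> (X0 c) = \<psi> 0 \<cdot> c"
proof -
  have "integral {\<theta>..0} (\<lambda>\<xi>. \<psi> (\<xi> - \<theta>) $ a * X0 c \<xi> $ b) = integral {\<theta>..0} (\<lambda>\<xi>. 0 :: complex)" for \<theta> a b
    by (rule integral_spike[of "{0}"]) (auto simp: X0_def)
  moreover have "rs_integral (\<lambda>\<theta>. 0) g (- r) 0 = 0" for g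
    using r_pos by (intro rs_integral_eqI has_rs_integral_zero) simp
  ultimately show ?thesis
    unfolding pairing_def by (simp only: integral_0 minus_zero sum.neutral_const diff_zero) (simp add: X0_def)
qed

section \<open>The center space\<close>

text \<open>The three basis functions \<open>\<phi>\<^sub>1\<beta>\<^sub>1\<close>, \<open>\<phi>\<^sub>2\<beta>\<^sub>2\<close>, \<open>\<phi>\<^sub>2\<^sup>*\<beta>\<^sub>2\<close> and everything attached to them are
  indexed by the type \<open>3\<close>; \<open>swap\<close> is the effect of complex conjugation on the index.\<close>

definition swap :: "3 \<Rightarrow> 3" where "swap j = (if j = 2 then 3 else if j = 3 then 2 else j)"

definition cmode :: "3 \<Rightarrow> nat" where "cmode j = (if j = 1 then k1 S else k2 S)"

definition cphi :: "3 \<Rightarrow> real \<Rightarrow> complex ^ 'm"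
  where "cphi j = (if j = 1 then phi1 S else if j = 2 then phi2 S else phi2c S)"

definition cpsi :: "3 \<Rightarrow> real \<Rightarrow> complex ^ 'm"
  where "cpsi j = (if j = 1 then psi1 S else if j = 2 then psi2 S else psi2c S)"

definition cexp :: "3 \<Rightarrow> complex"
  where "cexp j = (if j = 1 then 0 else if j = 2 then \<i> * om0 S else - \<i> * om0 S)"

definition cfun :: "3 \<Rightarrow> real \<Rightarrow> 'x ^ 'm" where "cfun j = htens (cphi j) (\<beta> (cmode j))"

definition ell :: "3 \<Rightarrow> 'x ^ 'm \<Rightarrow> complex"
  where "ell j u = cpsi j 0 \<cdot> comp_ip u (\<beta> (cmode j))"

definition proj_coeff :: "3 \<Rightarrow> (real \<Rightarrow> 'x ^ 'm) \<Rightarrow> complex"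
  where "proj_coeff j v = pairing S (cmode j) (cpsi j) (\<lambda>s. comp_ip (v s) (\<beta> (cmode j)))"

lemma three_cases: "j = 1 \<or> j = 2 \<or> j = (3 :: 3)"
  using exhaust_3 by blast

lemma cmode_mem: "cmode j \<in> N"
  by (simp add: cmode_def modes_12)

lemma exponential_cpsi: "exponential (cpsi j)"
  by (simp add: cpsi_def exponential_psi)

lemma swap_simps [simp]: "swap 1 = 1" "swap 2 = 3" "swap 3 = 2"
  by (simp_all add: swap_def)

lemma cexp_simps: "cexp 1 = 0" "cexp 2 = \<i> * om0 S" "cexp 3 = - \<i> * om0 S"
  by (simp_all add: cexp_def)

lemma cexp_swap: "cexp (swap j) = cnj (cexp j)"
  using three_cases[of j] by (auto simp: cexp_def)

lemma cmode_swap: "cmode (swap j) = cmode j"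
  using three_cases[of j] by (auto simp: cmode_def)

lemma cphi_eq: "cphi j \<theta> = exp (cexp j * of_real \<theta>) *s cphi j 0"
  by (simp add: cphi_def cexp_def phi1_def phi2_def phi2c_def vec_eq_iff exp_cnj mult.assoc)

lemma cphi_swap: "cphi (swap j) = (\<lambda>\<theta>. cvec (cphi j \<theta>))"
  using three_cases[of j] bases by (auto simp: cphi_def phi1_def phi2c_def center_bases_def)

lemma cpsi_swap: "cpsi (swap j) = (\<lambda>\<theta>. cvec (cpsi j \<theta>))"
  using three_cases[of j] bases by (auto simp: cpsi_def psi1_def psi2c_def center_bases_def)

lemma Cspace_cphi: "cphi j \<in> Cspace r"
  using Cspace_exp_smult[of "cexp j" "cphi j 0" r] by (simp flip: cphi_eq)

lemma Cspace_cfun: "cfun j \<in> E"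
  by (simp add: cfun_def Cspace_htens Cspace_cphi)

lemma cfun_eq: "cfun j \<theta> = exp (cexp j * of_real \<theta>) *\<^sub>C cfun j 0"
  unfolding cfun_def htens_def by (subst cphi_eq) (rule tens_smult)

lemma hconj_cfun: "hconj (cfun j) = cfun (swap j)"
  by (simp add: cfun_def hconj_htens cmode_mem cphi_swap cmode_swap)

lemma pairing_self: "pairing S (cmode j) (cpsi j) (cphi j) = 1"
  using bases by (auto simp: cmode_def cpsi_def cphi_def center_bases_def)

lemma cphi_0_nonzero: "cphi j 0 \<noteq> 0"
proof
  assume "cphi j 0 = 0"
  then have "cphi j \<theta> = 0" for \<theta> by (subst cphi_eq) simp
  then have "cphi j = (\<lambda>\<theta>. 0)" by (rule ext)
  then show False using pairing_self[of j] by (simp add: pairing_zero)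
qed

lemma cfun_0_nonzero: "cfun j 0 \<noteq> 0"
proof
  assume "cfun j 0 = 0"
  then have "comp_ip (cfun j 0) (\<beta> (cmode j)) = 0" by simp
  then show False
    using cphi_0_nonzero cmode_mem orthonormal by (simp add: cfun_def htens_def comp_ip_tens)
qed

lemma ell_add: "ell j (u + v) = ell j u + ell j v"
  by (simp add: ell_def comp_ip_add rowmul_def algebra_simps sum.distrib)

lemma ell_scaleC: "ell j (c *\<^sub>C u) = c * ell j u"
  by (simp add: ell_def comp_ip_scaleC rowmul_def algebra_simps sum_distrib_left)

lemma ell_zero [simp]: "ell j 0 = 0"
  using ell_scaleC[of j 0 0] by simp

lemma ell_scaleR: "ell j (t *\<^sub>R u) = t *\<^sub>R ell j u"
  by (simp add: scaleR_conv_scaleC ell_scaleC scaleR_conv_of_real)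

lemma ell_sum: "ell j (\<Sum>i\<in>I. f i) = (\<Sum>i\<in>I. ell j (f i))"
  by (induction I rule: infinite_finite_induct) (simp_all add: ell_add)

lemma ell_conjv: "ell (swap j) (conjv S u) = cnj (ell j u)"
  by (simp add: ell_def cmode_swap cpsi_swap comp_ip_conjv cmode_mem rowmul_def)

lemma center_comps_eq: "center_comps S u = (\<chi> j. ell j u)"
  unfolding center_comps_def vec_eq_iff forall_3
  by (simp add: ell_def cmode_def cpsi_def beta1_def beta2_def)

lemma w_center_eq: "w_center S z = (\<lambda>\<theta>. \<Sum>j\<in>UNIV. z $ j *\<^sub>C cfun j \<theta>)"
  unfolding w_center_def sum_3 cfun_def htens_def
  by (simp add: cphi_def cmode_def beta1_def beta2_def tens_add_left tens_smult add.assoc)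

lemma proj_center_eq: "proj_center S v \<theta> = (\<Sum>j\<in>UNIV. proj_coeff j v *\<^sub>C cfun j \<theta>)"
  unfolding proj_center_def sum_3 cfun_def htens_def proj_coeff_def Let_def
  by (simp add: cphi_def cmode_def cpsi_def beta1_def beta2_def tens_add_left tens_smult add.assoc)

text \<open>Thus the same functionals govern the reduced equation and the projection \<open>(I - \<pi>)X\<^sub>0\<close> in the equation
  for \<open>y\<close>.\<close>

lemma proj_coeff_jump: "proj_coeff j (X0 u) = ell j u"
proof -
  have "(\<lambda>s. comp_ip (X0 u s) b) = X0 (comp_ip u b)" for b
    by (auto simp: X0_def)
  then show ?thesis by (simp add: proj_coeff_def pairing_jump ell_def)
qed

lemma proj_coeff_linear:
  assumes "v \<in> E" "w \<in> E"
  shows "proj_coeff j (\<lambda>\<theta>. c *\<^sub>C v \<theta> + w \<theta>) = c * proj_coeff j v + proj_coeff j w"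
  using assms unfolding proj_coeff_def
  by (simp add: comp_ip_add comp_ip_scaleC pairing_linear exponential_cpsi Cspace_intros cmode_mem)

lemma proj_coeff_hconj:
  assumes "v \<in> E" shows "proj_coeff (swap j) (hconj v) = cnj (proj_coeff j v)"
  unfolding proj_coeff_def cmode_swap cpsi_swap comp_ip_conjv[OF cmode_mem]
  by (rule pairing_cnj) (simp_all add: exponential_cpsi Cspace_intros assms cmode_mem)

lemma vector_derivative_of_zero:
  fixes g :: "real \<Rightarrow> 'b::real_normed_vector"
  assumes "\<And>\<theta>. \<theta> \<in> {-r..0} \<Longrightarrow> g \<theta> = 0" "(g has_vector_derivative D) (at \<theta> within {-r..0})" "\<theta> \<in> {-r..0}"
  shows "D = 0"
proof -
  have "(g has_vector_derivative 0) (at \<theta> within {-r..0})"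
    by (rule has_vector_derivative_transform[OF assms(3) _ has_vector_derivative_const[of 0]]) (use assms(1) in auto)
  then show ?thesis
    using assms(2,3) r_pos vector_derivative_unique_within_closed_interval[of "-r" 0 \<theta> g D 0] by auto
qed

lemma has_vector_derivative_exp [derivative_intros]:
  "((\<lambda>\<theta>. exp (l * complex_of_real \<theta>)) has_vector_derivative l * exp (l * of_real \<theta>)) (at \<theta> within A)"
proof -
  have "((\<lambda>z. exp (l * z)) has_field_derivative l * exp (l * of_real \<theta>)) (at (of_real \<theta>))"
    by (auto intro!: derivative_eq_intros)
  from has_vector_derivative_real_field[OF this] show ?thesis by simp
qed

lemma has_vector_derivative_scaleC [derivative_intros]:
  "(f has_vector_derivative f') (at \<theta> within A) \<Longrightarrow>
    ((\<lambda>\<theta>. f \<theta> *\<^sub>C u) has_vector_derivative f' *\<^sub>C (u :: 'b::complex_hilbert)) (at \<theta> within A)"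
  by (rule bounded_linear.has_vector_derivative[OF bounded_linear_scaleC_left])

lemma has_vector_derivative_scaleC_right:
  "(f has_vector_derivative f') (at \<theta> within A) \<Longrightarrow>
    ((\<lambda>\<theta>. c *\<^sub>C f \<theta>) has_vector_derivative c *\<^sub>C (f' :: 'b::complex_hilbert)) (at \<theta> within A)"
  by (rule bounded_linear.has_vector_derivative[OF bounded_linear_scaleC_right])

text \<open>Differentiating twice at \<open>\<theta> = 0\<close> gives a Vandermonde system for the exponents \<open>0, \<i>\<omega>\<^sub>0, -\<i>\<omega>\<^sub>0\<close>.\<close>

lemma exponentials_independent:
  fixes x :: "3 \<Rightarrow> 'x ^ 'm"
  assumes "\<And>\<theta>. \<theta> \<in> {-r..0} \<Longrightarrow> (\<Sum>j\<in>UNIV. exp (cexp j * of_real \<theta>) *\<^sub>C x j) = 0"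
  shows "x j = 0"
proof -
  have deriv: "(\<Sum>j\<in>UNIV. exp (cexp j * of_real \<theta>) *\<^sub>C (cexp j *\<^sub>C y j)) = 0"
    if y: "\<And>\<theta>. \<theta> \<in> {-r..0} \<Longrightarrow> (\<Sum>j\<in>UNIV. exp (cexp j * of_real \<theta>) *\<^sub>C y j) = 0"
      and "\<theta> \<in> {-r..0}" for y :: "3 \<Rightarrow> 'x ^ 'm" and \<theta>
  proof (rule vector_derivative_of_zero[OF y _ \<open>\<theta> \<in> {-r..0}\<close>])
    show "((\<lambda>\<theta>. \<Sum>j\<in>UNIV. exp (cexp j * of_real \<theta>) *\<^sub>C y j) has_vector_derivative
        (\<Sum>j\<in>UNIV. exp (cexp j * of_real \<theta>) *\<^sub>C (cexp j *\<^sub>C y j))) (at \<theta> within {-r..0})"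
    proof (rule has_vector_derivative_sum)
      fix j :: 3
      show "((\<lambda>\<theta>. exp (cexp j * of_real \<theta>) *\<^sub>C y j) has_vector_derivative
          exp (cexp j * of_real \<theta>) *\<^sub>C (cexp j *\<^sub>C y j)) (at \<theta> within {-r..0})"
        using has_vector_derivative_scaleC[OF has_vector_derivative_exp[of "cexp j" \<theta>], where u = "y j"]
        by (simp add: scaleC_scaleC mult.commute)
    qed
  qed
  have 0: "0 \<in> {-r..0}" using r_pos by simp
  have "x 1 + x 2 + x 3 = 0"
    using assms[OF 0] by (simp add: sum_3)
  moreover have "cexp 2 *\<^sub>C x 2 + cexp 3 *\<^sub>C x 3 = 0"
    using deriv[OF assms 0] by (simp add: sum_3 cexp_simps(1))
  moreover have "cexp 2 *\<^sub>C cexp 2 *\<^sub>C x 2 + cexp 3 *\<^sub>C cexp 3 *\<^sub>C x 3 = 0"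
    using deriv[OF deriv[OF assms] 0] by (simp add: sum_3 cexp_simps(1))
  ultimately have e: "x 1 + (x 2 + x 3) = 0" "(\<i> * om0 S) *\<^sub>C (x 2 - x 3) = 0"
      "(\<i> * om0 S * (\<i> * om0 S)) *\<^sub>C (x 2 + x 3) = 0"
    by (simp_all only: cexp_simps scaleC_scaleC scaleC_diff_right scaleC_add_right add.assoc
        mult_minus_left mult_minus_right minus_minus)
      (simp add: scaleC_minus_left)
  from e(2) have "norm ((\<i> * om0 S) *\<^sub>C (x 2 - x 3)) = 0" by (simp only: norm_zero)
  then have "x 2 - x 3 = 0" unfolding norm_scaleC using om_pos by (simp add: norm_mult)
  from e(3) have "norm ((\<i> * om0 S * (\<i> * om0 S)) *\<^sub>C (x 2 + x 3)) = 0" by (simp only: norm_zero)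
  then have "x 2 + x 3 = 0" unfolding norm_scaleC using om_pos by (simp add: norm_mult)
  have "2 *\<^sub>R x 2 = (x 2 + x 3) + (x 2 - x 3)" by (simp add: scaleR_2)
  then have "x 2 = 0" by (simp add: \<open>x 2 - x 3 = 0\<close> \<open>x 2 + x 3 = 0\<close>)
  then show ?thesis using \<open>x 2 + x 3 = 0\<close> e(1) three_cases[of j] by auto
qed

lemma cfun_independent:
  assumes "\<And>\<theta>. \<theta> \<in> {-r..0} \<Longrightarrow> (\<Sum>j\<in>UNIV. c j *\<^sub>C cfun j \<theta>) = 0"
  shows "c j = 0"
proof -
  have "c j *\<^sub>C cfun j 0 = 0"
  proof (rule exponentials_independent[of "\<lambda>j. c j *\<^sub>C cfun j 0"])
    fix \<theta> assume "\<theta> \<in> {-r..0}"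
    have "(\<Sum>j\<in>UNIV. exp (cexp j * of_real \<theta>) *\<^sub>C c j *\<^sub>C cfun j 0) = (\<Sum>j\<in>UNIV. c j *\<^sub>C cfun j \<theta>)"
      by (rule sum.cong[OF refl], subst (2) cfun_eq) (simp add: scaleC_scaleC mult.commute)
    then show "(\<Sum>j\<in>UNIV. exp (cexp j * of_real \<theta>) *\<^sub>C c j *\<^sub>C cfun j 0) = 0"
      using assms[OF \<open>\<theta> \<in> {-r..0}\<close>] by simp
  qed
  then have "norm (c j *\<^sub>C cfun j 0) = 0" by simp
  then show ?thesis using cfun_0_nonzero[of j] by simp
qed

lemma hderiv_eqI:
  assumes "(v has_vector_derivative D) (at \<theta> within {-r..0})" "\<theta> \<in> {-r..0}"
  shows "hderiv r v \<theta> = D"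
  unfolding hderiv_def using vector_derivative_within_cbox[of "-r" 0 \<theta> v D] assms r_pos by auto

text \<open>\<open>\<pi>v = 0\<close> is a condition on the function \<open>\<pi>v\<close>; by independence of the center functions it amounts
  to the vanishing of three numbers.\<close>

lemma Q1_space_iff:
  "v \<in> Q1_space S \<longleftrightarrow> v \<in> E \<and> v 0 \<in> dom_lap S \<and> (\<forall>j. proj_coeff j v = 0) \<and>
    (\<exists>v'\<in>E. \<forall>\<theta>\<in>{-r..0}. (v has_vector_derivative v' \<theta>) (at \<theta> within {-r..0}))"
proof -
  have "(\<forall>\<theta>\<in>{-r..0}. proj_center S v \<theta> = 0) \<longleftrightarrow> (\<forall>j. proj_coeff j v = 0)"
    using cfun_independent[of "\<lambda>j. proj_coeff j v"] by (auto simp: proj_center_eq)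
  moreover have "(\<forall>\<theta>\<in>{-r..0}. v differentiable (at \<theta> within {-r..0})) \<and> hderiv r v \<in> E \<longleftrightarrow>
      (\<exists>v'\<in>E. \<forall>\<theta>\<in>{-r..0}. (v has_vector_derivative v' \<theta>) (at \<theta> within {-r..0}))" (is "?L \<longleftrightarrow> ?R")
  proof
    assume ?L
    then show ?R
      by (intro bexI[of _ "hderiv r v"]) (auto simp: hderiv_def vector_derivative_works)
  next
    assume ?R
    then obtain v' where v': "v' \<in> E"
      "\<And>\<theta>. \<theta> \<in> {-r..0} \<Longrightarrow> (v has_vector_derivative v' \<theta>) (at \<theta> within {-r..0})" by blast
    then have "hderiv r v \<theta> = v' \<theta>" if "\<theta> \<in> {-r..0}" for \<theta>
      using that by (auto intro: hderiv_eqI)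
    then have "hderiv r v \<in> E"
      using v'(1) continuous_on_cong[of "{-r..0}" "{-r..0}" "hderiv r v" v'] unfolding Cspace_def by auto
    then show ?L by (auto intro: differentiableI_vector[OF v'(2)])
  qed
  ultimately show ?thesis unfolding Q1_space_def by auto
qed

lemma Q1_spaceD:
  assumes "v \<in> Q1_space S"
  shows "v \<in> E" "v 0 \<in> dom_lap S" "proj_coeff j v = 0" "hderiv r v \<in> E"
    and "\<theta> \<in> {-r..0} \<Longrightarrow> (v has_vector_derivative hderiv r v \<theta>) (at \<theta> within {-r..0})"
proof -
  show "v \<in> E" "v 0 \<in> dom_lap S" "proj_coeff j v = 0" using assms by (auto simp: Q1_space_iff)
  show "hderiv r v \<in> E" using assms by (auto simp: Q1_space_def)
  show "\<theta> \<in> {-r..0} \<Longrightarrow> (v has_vector_derivative hderiv r v \<theta>) (at \<theta> within {-r..0})"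
    using assms by (auto simp: Q1_space_def hderiv_def vector_derivative_works)
qed

lemma Q1_linear:
  assumes v: "v \<in> Q1_space S" and w: "w \<in> Q1_space S"
  shows "(\<lambda>\<theta>. c *\<^sub>C v \<theta> + w \<theta>) \<in> Q1_space S"
  unfolding Q1_space_iff
  by (auto intro!: Cspace_intros dom_lap_linear Q1_spaceD[OF v] Q1_spaceD[OF w]
      bexI[of _ "\<lambda>\<theta>. c *\<^sub>C hderiv r v \<theta> + hderiv r w \<theta>"]
      has_vector_derivative_add has_vector_derivative_scaleC_right
      simp: proj_coeff_linear Q1_spaceD[OF v] Q1_spaceD[OF w])

lemma Q1_zero: "(\<lambda>\<theta>. 0) \<in> Q1_space S"
  unfolding Q1_space_iff
  by (auto intro!: Cspace_zero dom_lap_zero bexI[of _ "\<lambda>\<theta>. 0"] simp: proj_coeff_def pairing_zero)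

lemma Q1_diff:
  assumes "v \<in> Q1_space S" "w \<in> Q1_space S" shows "(\<lambda>\<theta>. v \<theta> - w \<theta>) \<in> Q1_space S"
  using Q1_linear[OF assms(2,1), of "-1"] by (simp add: scaleC_minus_left)

lemma Q1_hconj:
  assumes v: "v \<in> Q1_space S" shows "hconj v \<in> Q1_space S"
proof -
  have "proj_coeff j (hconj v) = 0" for j
    using proj_coeff_hconj[OF Q1_spaceD(1)[OF v], of "swap j"] Q1_spaceD(3)[OF v] three_cases[of j] by auto
  then show ?thesis
    unfolding Q1_space_iff
    by (auto intro!: Cspace_hconj dom_lap_conjv Q1_spaceD[OF v] bexI[of _ "hconj (hderiv r v)"]
        bounded_linear.has_vector_derivative[OF bounded_linear_conjv])
qed

end

instance complex_hilbert \<subseteq> banach ..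

lemmas has_derivative_vec_nth [derivative_intros] =
  bounded_linear_imp_has_derivative[OF bounded_linear_vec_nth]

context bifurcation
begin

section \<open>Eigenfunctions on the imaginary axis\<close>

lemma Lvec_exp:
  "Lvec S 0 (\<lambda>\<theta>. exp (l * of_real \<theta>) *s c) = (\<Sum>j\<in>UNIV. c $ j *s Lvec S 0 (\<lambda>\<theta>. exp (l * of_real \<theta>) *s axis j 1))"
proof -
  let ?h = "\<lambda>c. htens (\<lambda>\<theta>. exp (l * of_real \<theta>) *s c) (\<beta> (k1 S))"
  have "?h c = (\<lambda>\<theta>. \<Sum>j\<in>UNIV. c $ j *\<^sub>C ?h (axis j 1) \<theta>)"
  proof (rule ext, unfold vec_eq_iff, rule allI)
    fix \<theta> i
    have "(\<Sum>j\<in>UNIV. (c $ j *\<^sub>C ?h (axis j 1) \<theta>) $ i) = (\<Sum>j\<in>UNIV. if i = j then ?h c \<theta> $ i else 0)"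
      by (rule sum.cong) (auto simp: htens_def axis_def scaleC_scaleC mult.commute)
    then show "?h c \<theta> $ i = (\<Sum>j\<in>UNIV. c $ j *\<^sub>C ?h (axis j 1) \<theta>) $ i" by simp
  qed
  then have "Lop S 0 (?h c) = (\<Sum>j\<in>UNIV. c $ j *\<^sub>C Lop S 0 (?h (axis j 1)))"
    by (simp add: L0.sum Cspace_htens Cspace_exp_smult)
  then show ?thesis
    by (simp add: Lvec_eq[OF Cspace_exp_smult modes_12(1)] comp_ip_sum comp_ip_scaleC)
qed

text \<open>\<open>c\<close> lies in the kernel of the characteristic matrix, which is invertible off the characteristic roots.\<close>

lemma charfun_kernel:
  assumes "\<And>a. z * c $ a = - of_real (mu S k * diffc S 0 $ a) * c $ a + Lvec S 0 (\<lambda>\<theta>. exp (z * of_real \<theta>) *s c) $ a"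
    and "charfun S k 0 z \<noteq> 0"
  shows "c = 0"
proof -
  let ?A = "\<chi> i j. (if i = j then z + of_real (mu S k * diffc S 0 $ i) else 0)
      - Lvec S 0 (\<lambda>\<theta>. exp (z * of_real \<theta>) *s axis j 1) $ i"
  have "(?A *v c) $ i = 0" for i
  proof -
    have "(?A *v c) $ i = (\<Sum>j\<in>UNIV. (if i = j then (z + of_real (mu S k * diffc S 0 $ i)) * c $ j else 0)
        - c $ j * Lvec S 0 (\<lambda>\<theta>. exp (z * of_real \<theta>) *s axis j 1) $ i)"
      unfolding matrix_vector_mult_def vec_lambda_beta
      by (rule sum.cong) (auto simp: algebra_simps)
    also have "\<dots> = (z + of_real (mu S k * diffc S 0 $ i)) * c $ i - Lvec S 0 (\<lambda>\<theta>. exp (z * of_real \<theta>) *s c) $ i"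
      by (subst Lvec_exp) (simp add: sum_subtractf)
    also have "\<dots> = 0" using assms(1)[of i] by (simp add: algebra_simps)
    finally show ?thesis .
  qed
  then have "?A *v c = 0" by (simp add: vec_eq_iff)
  have "invertible ?A"
    using assms(2) unfolding charfun_def invertible_det_nz .
  then obtain B where "B ** ?A = mat 1" unfolding invertible_def by blast
  then have "c = B *v (?A *v c)"
    by (simp only: matrix_vector_mul_assoc matrix_vector_mul_lid)
  also have "\<dots> = 0"
    by (simp only: \<open>?A *v c = 0\<close> matrix_vector_mult_0_right)
  finally show ?thesis .
qed

lemma Lvec_cvec:
  assumes "\<phi> \<in> Cspace r" shows "Lvec S 0 (\<lambda>\<theta>. cvec (\<phi> \<theta>)) = cvec (Lvec S 0 \<phi>)"
proof -
  have "(\<lambda>\<theta>. cvec (\<phi> \<theta>)) \<in> Cspace r"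
    using assms unfolding Cspace_def cvec_def by (auto intro!: continuous_intros)
  then show ?thesis
    using assms modes_12(1)
    by (simp add: Lvec_eq[of _ "k1 S"] hconj_htens[symmetric] comp_ip_conjv L0_conj Cspace_htens)
qed

text \<open>At \<open>\<alpha> = 0\<close> the exceptional roots of (H4) are \<open>0\<close> in mode \<open>k\<^sub>1\<close> and \<open>\<plusminus>\<i>\<omega>\<^sub>0\<close> in mode \<open>k\<^sub>2\<close>.\<close>

lemma char_roots_imaginary:
  assumes "k \<in> N" "charfun S k 0 z = 0" "Re z = 0"
  shows "\<exists>j. k = cmode j \<and> z = cexp j"
proof -
  obtain \<gamma> \<nu> \<omega> :: "real ^ 2 \<Rightarrow> real" where 0: "\<gamma> 0 = 0" "\<nu> 0 = 0" "\<omega> 0 = om0 S" and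
    "\<forall>\<alpha>\<in>params S. \<forall>k\<in>N. \<forall>z. charfun S k \<alpha> z = 0 \<and>
          (k, z) \<notin> {(k1 S, of_real (\<gamma> \<alpha>)), (k2 S, Complex (\<nu> \<alpha>) (\<omega> \<alpha>)), (k2 S, Complex (\<nu> \<alpha>) (- \<omega> \<alpha>))}
          \<longrightarrow> Re z \<noteq> 0"
    using hopf unfolding hopf_steady_state_def hyp_H4_def by blast
  then have "(k, z) \<in> {(k1 S, of_real (\<gamma> 0)), (k2 S, Complex (\<nu> 0) (\<omega> 0)), (k2 S, Complex (\<nu> 0) (- \<omega> 0))}"
    using params(2) assms by blast
  then have "(k, z) \<in> {(k1 S, 0), (k2 S, \<i> * om0 S), (k2 S, - \<i> * om0 S)}"
    by (auto simp: 0 complex_eq_iff)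
  then consider "k = cmode 1 \<and> z = cexp 1" | "k = cmode 2 \<and> z = cexp 2" | "k = cmode 3 \<and> z = cexp 3"
    by (auto simp: cmode_def cexp_def)
  then show ?thesis by metis
qed

lemma eigenfunction_exp:
  assumes "\<And>a. z * c $ a = - of_real (mu S k * diffc S 0 $ a) * c $ a + Lvec S 0 (\<lambda>\<theta>. exp (z * of_real \<theta>) *s c) $ a"
  shows "eigenfunction S k z (\<lambda>\<theta>. exp (z * of_real \<theta>) *s c)"
  unfolding eigenfunction_def
proof (intro conjI ballI allI)
  fix \<theta>
  have "bounded_linear (\<lambda>x. x *s c)"
    by (rule linear_conv_bounded_linear[THEN iffD1], rule linearI) (simp_all add: vec_eq_iff algebra_simps)
  from bounded_linear.has_vector_derivative[OF this has_vector_derivative_exp]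
  show "((\<lambda>\<theta>. exp (z * of_real \<theta>) *s c) has_vector_derivative z *s (exp (z * of_real \<theta>) *s c)) (at \<theta> within {-r..0})"
    by simp
qed (use assms in simp)

text \<open>The eigenspaces are assumed to be one-dimensional for \<open>0\<close> and \<open>\<i>\<omega>\<^sub>0\<close>; for \<open>-\<i>\<omega>\<^sub>0\<close> this follows by
  conjugation, as \<open>L\<^sub>0\<close> is real.\<close>

lemma eigenfunction_cexp:
  assumes "eigenfunction S (cmode j) (cexp j) (\<lambda>\<theta>. exp (cexp j * of_real \<theta>) *s c)"
  shows "\<exists>a. \<forall>\<theta>\<in>{-r..0}. exp (cexp j * of_real \<theta>) *s c = a *s cphi j \<theta>"
proof -
  have span: "\<exists>a. \<forall>\<theta>\<in>{-r..0}. f \<theta> = a *s cphi j \<theta>"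
    if "eigenfunction S (cmode j) (cexp j) f" "j \<noteq> 3" for f j
  proof -
    have "spans_eigenspace S (cmode 1) (cexp 1) (cphi 1)" "spans_eigenspace S (cmode 2) (cexp 2) (cphi 2)"
      using bases by (simp_all add: center_bases_def cmode_def cexp_def cphi_def)
    then have "spans_eigenspace S (cmode j) (cexp j) (cphi j)"
      using that(2) three_cases[of j] by blast
    then show ?thesis using that(1) unfolding spans_eigenspace_def by blast
  qed
  show ?thesis
  proof (cases "j = 3")
    case True
    have "eigenfunction S (cmode 2) (cexp 2) (\<lambda>\<theta>. exp (cexp 2 * of_real \<theta>) *s cvec c)"
    proof (rule eigenfunction_exp)
      fix a
      let ?f = "\<lambda>\<theta>. exp (cexp 3 * of_real \<theta>) *s c"
      have "cexp 3 * c $ a = - of_real (mu S (cmode 3) * diffc S 0 $ a) * c $ a + Lvec S 0 ?f $ a"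
        using assms unfolding True eigenfunction_def by (elim conjE) (drule spec[of _ a], simp)
      then have "cnj (cexp 3 * c $ a) = cnj (- of_real (mu S (cmode 3) * diffc S 0 $ a) * c $ a + Lvec S 0 ?f $ a)"
        by (rule arg_cong)
      moreover have "(\<lambda>\<theta>. cvec (?f \<theta>)) = (\<lambda>\<theta>. exp (cexp 2 * of_real \<theta>) *s cvec c)"
        by (simp add: fun_eq_iff vec_eq_iff exp_cnj cexp_def)
      then have "cnj (Lvec S 0 ?f $ a) = Lvec S 0 (\<lambda>\<theta>. exp (cexp 2 * of_real \<theta>) *s cvec c) $ a"
        using Lvec_cvec[OF Cspace_exp_smult, of "cexp 3" c] by simp
      ultimately show "cexp 2 * cvec c $ a = - of_real (mu S (cmode 2) * diffc S 0 $ a) * cvec c $ a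
          + Lvec S 0 (\<lambda>\<theta>. exp (cexp 2 * of_real \<theta>) *s cvec c) $ a"
        using cexp_swap[of 3] by (simp add: cmode_def)
    qed
    then have "\<exists>a. \<forall>\<theta>\<in>{-r..0}. exp (cexp 2 * of_real \<theta>) *s cvec c = a *s cphi 2 \<theta>"
      by (rule span) simp
    then obtain a where
      a: "\<And>\<theta>. \<theta> \<in> {-r..0} \<Longrightarrow> exp (cexp 2 * of_real \<theta>) *s cvec c = a *s cphi 2 \<theta>" by blast
    have "exp (cexp 3 * of_real \<theta>) *s c = cnj a *s cphi 3 \<theta>" if "\<theta> \<in> {-r..0}" for \<theta>
    proof -
      have "cvec (exp (cexp 2 * of_real \<theta>) *s cvec c) = cvec (a *s cphi 2 \<theta>)"
        using a[OF that] by simp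
      then show ?thesis
        using fun_cong[OF cphi_swap[of 2], of \<theta>] by (simp add: vec_eq_iff exp_cnj cexp_def)
    qed
    then show ?thesis unfolding True by (intro exI[of _ "cnj a"] ballI)
  next
    case False
    with assms show ?thesis by (rule span)
  qed
qed

text \<open>The operator \<open>A\<^sub>1\<close> has no eigenvalue on the imaginary axis: the coefficient of an eigenfunction
  along \<open>\<beta>\<^sub>k\<close> is an eigenfunction of mode \<open>k\<close>, hence a multiple of a basis function of the center
  space, and \<open>\<pi>v = 0\<close> makes the multiple vanish.\<close>

lemma A1_kernel:
  assumes v: "v \<in> Q1_space S" and exp: "\<And>\<theta>. \<theta> \<in> {-r..0} \<Longrightarrow> v \<theta> = exp (l * of_real \<theta>) *\<^sub>C v 0"
    and eq: "Lop S 0 v + diag_mul (diffc S 0) (lap S (v 0)) = l *\<^sub>C v 0" and "Re l = 0"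
  shows "v 0 = 0"
proof (rule eqI_vec)
  fix k assume "k \<in> N"
  define c where "c = comp_ip (v 0) (\<beta> k)"
  have c_eq: "l * c $ a = - of_real (mu S k * diffc S 0 $ a) * c $ a + Lvec S 0 (\<lambda>\<theta>. exp (l * of_real \<theta>) *s c) $ a" for a
  proof -
    have "Lop S 0 v = Lop S 0 (\<lambda>\<theta>. exp (l * of_real \<theta>) *\<^sub>C v 0)"
      by (rule L0.cong[OF Q1_spaceD(1)[OF v] Cspace_exp exp])
    then have Lv: "comp_ip (Lop S 0 v) (\<beta> k) = Lvec S 0 (\<lambda>\<theta>. exp (l * of_real \<theta>) *s c)"
      using \<open>k \<in> N\<close> by (simp only: comp_ip_L0_exp c_def)
    have coeff: "Lvec S 0 (\<lambda>\<theta>. exp (l * of_real \<theta>) *s c) + comp_ip (diag_mul (diffc S 0) (lap S (v 0))) (\<beta> k)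
        = l *s c"
      using arg_cong[OF eq, of "\<lambda>u. comp_ip u (\<beta> k)"]
      unfolding comp_ip_add comp_ip_scaleC Lv c_def[symmetric] .
    have lap: "comp_ip (diag_mul (diffc S 0) (lap S (v 0))) (\<beta> k) $ a = - of_real (mu S k * diffc S 0 $ a) * c $ a"
      using arg_cong[OF comp_ip_lap[OF Q1_spaceD(2)[OF v] \<open>k \<in> N\<close>], of "\<lambda>v. v $ a"]
      by (simp add: cinner_scaleR_left c_def)
    show ?thesis
      using arg_cong[OF coeff, of "\<lambda>v. v $ a"]
      unfolding vector_add_component lap vector_smult_component by (simp only: add.commute)
  qed
  have "c = 0"
  proof (cases "charfun S k 0 l = 0")
    case False
    with c_eq show ?thesis by (rule charfun_kernel)
  next
    case True
    then obtain j where j: "k = cmode j" "l = cexp j"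
      using char_roots_imaginary[OF \<open>k \<in> N\<close> _ \<open>Re l = 0\<close>] by blast
    have "eigenfunction S k l (\<lambda>\<theta>. exp (l * of_real \<theta>) *s c)"
      by (rule eigenfunction_exp) (rule c_eq)
    then have "\<exists>a. \<forall>\<theta>\<in>{-r..0}. exp (l * of_real \<theta>) *s c = a *s cphi j \<theta>"
      unfolding j by (rule eigenfunction_cexp)
    then obtain a where a: "\<And>\<theta>. \<theta> \<in> {-r..0} \<Longrightarrow> exp (l * of_real \<theta>) *s c = a *s cphi j \<theta>"
      by blast
    have "pairing S k (cpsi j) (\<lambda>\<theta>. comp_ip (v \<theta>) (\<beta> k)) = pairing S k (cpsi j) (\<lambda>\<theta>. a *s cphi j \<theta>)"
    proof (rule pairing_cong)
      fix \<theta> assume "\<theta> \<in> {-r..0}"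
      then show "comp_ip (v \<theta>) (\<beta> k) = a *s cphi j \<theta>"
        using a[of \<theta>] exp[of \<theta>] by (simp only: comp_ip_scaleC c_def)
    qed
    also have "\<dots> = a"
      unfolding j(1) pairing_smult[OF exponential_cpsi Cspace_cphi cmode_mem] pairing_self by simp
    finally have "a = 0"
      using Q1_spaceD(3)[OF v, of j] by (simp only: proj_coeff_def j(1))
    moreover have "c = a *s cphi j 0" using a[of 0] r_pos by simp
    ultimately show ?thesis by simp
  qed
  then show "comp_ip (v 0) (\<beta> k) = comp_ip 0 (\<beta> k)" by (simp only: c_def comp_ip_zero)
qed

section \<open>Resolvent equations of \<open>A\<^sub>1\<close>\<close>

text \<open>\<open>duhamel l \<kappa>\<close> solves \<open>g' = l g + e\<^sup>\<kappa>\<^sup>\<theta>\<close>, \<open>g(0) = 0\<close>.\<close>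

definition duhamel :: "complex \<Rightarrow> complex \<Rightarrow> real \<Rightarrow> complex"
  where "duhamel l \<kappa> \<theta> = (if l = \<kappa> then of_real \<theta> * exp (l * of_real \<theta>)
    else (exp (l * of_real \<theta>) - exp (\<kappa> * of_real \<theta>)) / (l - \<kappa>))"

lemma duhamel_0 [simp]: "duhamel l \<kappa> 0 = 0"
  by (simp add: duhamel_def)

lemma duhamel_deriv:
  "(duhamel l \<kappa> has_vector_derivative l * duhamel l \<kappa> \<theta> + exp (\<kappa> * of_real \<theta>)) (at \<theta> within A)"
proof (cases "l = \<kappa>")
  case True
  have "((\<lambda>\<theta>. of_real \<theta> * exp (l * of_real \<theta>)) has_vector_derivative
      of_real \<theta> * (l * exp (l * of_real \<theta>)) + of_real 1 * exp (l * of_real \<theta>)) (at \<theta> within A)"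
    by (intro has_vector_derivative_mult has_vector_derivative_exp has_vector_derivative_of_real DERIV_ident)
  moreover have "duhamel l \<kappa> = (\<lambda>\<theta>. of_real \<theta> * exp (l * of_real \<theta>))"
    using True by (simp add: duhamel_def fun_eq_iff)
  ultimately show ?thesis using True by (simp add: algebra_simps)
next
  case False
  have "((\<lambda>\<theta>. (exp (l * of_real \<theta>) - exp (\<kappa> * of_real \<theta>)) / (l - \<kappa>)) has_vector_derivative
      (l * exp (l * of_real \<theta>) - \<kappa> * exp (\<kappa> * of_real \<theta>)) / (l - \<kappa>)) (at \<theta> within A)"
    by (intro has_vector_derivative_divide has_vector_derivative_diff has_vector_derivative_exp)
  moreover have "duhamel l \<kappa> = (\<lambda>\<theta>. (exp (l * of_real \<theta>) - exp (\<kappa> * of_real \<theta>)) / (l - \<kappa>))"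
    using False by (simp add: duhamel_def fun_eq_iff)
  moreover have "(l * exp (l * of_real \<theta>) - \<kappa> * exp (\<kappa> * of_real \<theta>)) / (l - \<kappa>)
      = l * duhamel l \<kappa> \<theta> + exp (\<kappa> * of_real \<theta>)"
    using False by (simp add: duhamel_def field_simps)
  ultimately show ?thesis by simp
qed

lemma duhamel_cnj: "cnj (duhamel l \<kappa> \<theta>) = duhamel (cnj l) (cnj \<kappa>) \<theta>"
  by (auto simp: duhamel_def exp_cnj)

text \<open>\<open>resolvent_rel l y v\<close> is the explicit form of \<open>l v - A\<^sub>1 v = (I - \<pi>) X\<^sub>0 y\<close>.\<close>

definition resolvent_rel :: "complex \<Rightarrow> 'x ^ 'm \<Rightarrow> (real \<Rightarrow> 'x ^ 'm) \<Rightarrow> bool"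
  where "resolvent_rel l y v \<longleftrightarrow>
    (\<forall>\<theta>\<in>{-r..0}. v \<theta> = exp (l * of_real \<theta>) *\<^sub>C v 0
      + (\<Sum>j\<in>UNIV. (ell j y * duhamel l (cexp j) \<theta>) *\<^sub>C cfun j 0)) \<and>
    - l *\<^sub>C v 0 + (Lop S 0 v + diag_mul (diffc S 0) (lap S (v 0))) = - y + (\<Sum>j\<in>UNIV. ell j y *\<^sub>C cfun j 0)"

text \<open>For \<open>\<theta> < 0\<close> the equation reads \<open>v' = l v + \<Sum>\<^sub>j (ell j y) e\<^sub>j\<close>, whose solutions with given \<open>v(0)\<close> are unique: if \<open>p\<close> is the
  particular solution with \<open>p(0) = 0\<close>, then \<open>e\<^sup>-\<^sup>l\<^sup>\<theta>(v - p)\<close> is constant. The value \<open>\<theta> = 0\<close> gives the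
  boundary equation, as there the jump replaces \<open>v'(0)\<close> by \<open>L\<^sub>0v + D\<^sub>0\<Delta>v(0)\<close>.\<close>

lemma resolvent_relI:
  assumes v: "v \<in> Q1_space S"
    and eq: "\<And>\<theta>. \<theta> \<in> {-r..0} \<Longrightarrow> l *\<^sub>C v \<theta> - A1 S v \<theta> = X0 y \<theta> - (\<Sum>j\<in>UNIV. ell j y *\<^sub>C cfun j \<theta>)"
  shows "resolvent_rel l y v"
  unfolding resolvent_rel_def
proof (intro conjI ballI)
  define p where "p \<theta> = (\<Sum>j\<in>UNIV. (ell j y * duhamel l (cexp j) \<theta>) *\<^sub>C cfun j 0)" for \<theta>
  define d where "d \<theta> = exp (- l * of_real \<theta>) *\<^sub>C (v \<theta> - p \<theta>)" for \<theta>
  have p_deriv: "(p has_vector_derivative (l *\<^sub>C p \<theta> + (\<Sum>j\<in>UNIV. ell j y *\<^sub>C cfun j \<theta>))) (at \<theta> within A)" for \<theta> A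
  proof -
    have "(p has_vector_derivative (\<Sum>j\<in>UNIV. (ell j y * (l * duhamel l (cexp j) \<theta> + exp (cexp j * of_real \<theta>))) *\<^sub>C cfun j 0))
        (at \<theta> within A)"
      unfolding p_def
      by (intro has_vector_derivative_sum has_vector_derivative_scaleC has_vector_derivative_mult_right duhamel_deriv)
    also have "(\<Sum>j\<in>UNIV. (ell j y * (l * duhamel l (cexp j) \<theta> + exp (cexp j * of_real \<theta>))) *\<^sub>C cfun j 0)
        = l *\<^sub>C p \<theta> + (\<Sum>j\<in>UNIV. ell j y *\<^sub>C cfun j \<theta>)"
      unfolding p_def scaleC_sum_right sum.distrib[symmetric]
      by (rule sum.cong[OF refl], subst (2) cfun_eq) (simp add: scaleC_scaleC scaleC_add_left[symmetric] algebra_simps)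
    finally show ?thesis .
  qed
  \<comment> \<open>The single point \<open>\<theta> = 0\<close>, where \<open>A\<^sub>1\<close> does not differentiate, is covered by the continuity of \<open>d\<close>.\<close>
  have d_deriv: "(d has_vector_derivative 0) (at \<theta> within {-r..0})" if "\<theta> \<in> {-r..0} - {0}" for \<theta>
  proof -
    have "hderiv r v \<theta> = l *\<^sub>C v \<theta> + (\<Sum>j\<in>UNIV. ell j y *\<^sub>C cfun j \<theta>)"
      using eq[of \<theta>] that by (auto simp: A1_def X0_def algebra_simps)
    then have "((\<lambda>\<theta>. v \<theta> - p \<theta>) has_vector_derivative l *\<^sub>C (v \<theta> - p \<theta>)) (at \<theta> within {-r..0})"
      using has_vector_derivative_diff[OF Q1_spaceD(5)[OF v] p_deriv, of \<theta>] that
      by (simp add: scaleC_diff_right)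
    then have "(d has_vector_derivative
        (exp (- l * of_real \<theta>) *\<^sub>C (l *\<^sub>C (v \<theta> - p \<theta>)) + (- l * exp (- l * of_real \<theta>)) *\<^sub>C (v \<theta> - p \<theta>)))
        (at \<theta> within {-r..0})"
      unfolding d_def
      by (intro bounded_bilinear.has_vector_derivative[OF bounded_bilinear_scaleC] has_vector_derivative_exp)
    then show ?thesis by (simp add: scaleC_scaleC scaleC_minus_left mult.commute)
  qed
  have "continuous_on {-r..0} p"
    by (rule continuous_on_vector_derivative) (rule p_deriv)
  then have "continuous_on {-r..0} d"
    using Q1_spaceD(1)[OF v] unfolding d_def Cspace_def by (auto intro!: continuous_intros)
  then have d_const: "d \<theta> = d (- r)" if "\<theta> \<in> {-r..0}" for \<theta>
    using has_derivative_zero_unique_strong_interval[of "{0}" "-r" 0 d "d (- r)" \<theta>] d_deriv that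
    by (auto simp: has_vector_derivative_def)
  fix \<theta> assume \<theta>: "\<theta> \<in> {-r..0}"
  have "d \<theta> = d 0" using d_const[OF \<theta>] d_const[of 0] r_pos by simp
  also have "d 0 = v 0" by (simp add: d_def p_def)
  finally have "exp (l * of_real \<theta>) *\<^sub>C d \<theta> = exp (l * of_real \<theta>) *\<^sub>C v 0" by simp
  then have "v \<theta> - p \<theta> = exp (l * of_real \<theta>) *\<^sub>C v 0"
    by (simp add: d_def scaleC_scaleC flip: exp_add)
  then show "v \<theta> = exp (l * of_real \<theta>) *\<^sub>C v 0 + (\<Sum>j\<in>UNIV. (ell j y * duhamel l (cexp j) \<theta>) *\<^sub>C cfun j 0)"
    by (simp add: p_def algebra_simps)
next
  show "- l *\<^sub>C v 0 + (Lop S 0 v + diag_mul (diffc S 0) (lap S (v 0))) = - y + (\<Sum>j\<in>UNIV. ell j y *\<^sub>C cfun j 0)"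
    using eq[of 0] r_pos by (simp add: A1_def X0_def scaleC_minus_left algebra_simps)
qed

text \<open>The difference of two solutions is an eigenfunction of \<open>A\<^sub>1\<close> for the eigenvalue \<open>l\<close>.\<close>

lemma resolvent_unique:
  assumes v: "v \<in> Q1_space S" "resolvent_rel l y v" and w: "w \<in> Q1_space S" "resolvent_rel l y w"
    and "Re l = 0" "\<theta> \<in> {-r..0}"
  shows "v \<theta> = w \<theta>"
proof -
  let ?d = "\<lambda>\<theta>. v \<theta> - w \<theta>"
  have d: "?d \<theta> = exp (l * of_real \<theta>) *\<^sub>C ?d 0" if "\<theta> \<in> {-r..0}" for \<theta>
  proof -
    have "v \<theta> = exp (l * of_real \<theta>) *\<^sub>C v 0 + (\<Sum>j\<in>UNIV. (ell j y * duhamel l (cexp j) \<theta>) *\<^sub>C cfun j 0)"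
      "w \<theta> = exp (l * of_real \<theta>) *\<^sub>C w 0 + (\<Sum>j\<in>UNIV. (ell j y * duhamel l (cexp j) \<theta>) *\<^sub>C cfun j 0)"
      using v(2) w(2) that unfolding resolvent_rel_def by blast+
    then show ?thesis by (simp only: scaleC_diff_right add_diff_cancel_right)
  qed
  have lap: "lap S (?d 0) = lap S (v 0) - lap S (w 0)"
    using lap_linear[OF Q1_spaceD(2)[OF w(1)] Q1_spaceD(2)[OF v(1)], of "-1"] by (simp add: scaleC_minus_left)
  have "Lop S 0 ?d + diag_mul (diffc S 0) (lap S (?d 0)) = l *\<^sub>C ?d 0"
  proof -
    have "Lop S 0 ?d + diag_mul (diffc S 0) (lap S (?d 0)) - l *\<^sub>C ?d 0 =
      (- l *\<^sub>C v 0 + (Lop S 0 v + diag_mul (diffc S 0) (lap S (v 0)))) -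
      (- l *\<^sub>C w 0 + (Lop S 0 w + diag_mul (diffc S 0) (lap S (w 0))))"
      unfolding lap L0.diff[OF Q1_spaceD(1)[OF v(1)] Q1_spaceD(1)[OF w(1)]]
      by (simp add: vec_eq_iff algebra_simps scaleC_minus_left scaleC_diff_right)
    also have "\<dots> = 0" using v(2) w(2) unfolding resolvent_rel_def by simp
    finally show ?thesis by simp
  qed
  then have "?d 0 = 0"
    using A1_kernel[OF Q1_diff[OF v(1) w(1)] d] \<open>Re l = 0\<close> by blast
  then show ?thesis using d[OF \<open>\<theta> \<in> {-r..0}\<close>] by simp
qed

text \<open>Conjugation exchanges \<open>e\<^sub>2\<close> and \<open>e\<^sub>3\<close> together with their exponents and functionals, and commutes with
  \<open>L\<^sub>0\<close> and the Laplacian.\<close>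

lemma resolvent_hconj:
  assumes v: "v \<in> Q1_space S" "resolvent_rel l y v"
  shows "resolvent_rel (cnj l) (conjv S y) (hconj v)"
proof -
  have ell: "ell j (conjv S y) = cnj (ell (swap j) y)" for j
    using ell_conjv[of "swap j" y] three_cases[of j] by auto
  have swap_sum: "conjv S (\<Sum>j\<in>UNIV. (ell j y * f j) *\<^sub>C cfun j 0) = (\<Sum>j\<in>UNIV. (ell j (conjv S y) * cnj (f (swap j))) *\<^sub>C cfun j 0)" for f
    using fun_cong[OF hconj_cfun[of 1], of 0] fun_cong[OF hconj_cfun[of 2], of 0] fun_cong[OF hconj_cfun[of 3], of 0]
    by (simp add: sum_3 conjv_add conjv_scaleC ell add_ac)
  have "conjv S (diag_mul (diffc S 0) u) = diag_mul (diffc S 0) (conjv S u)" for u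
    by (simp add: vec_eq_iff scaleR_conv_scaleC cj_scaleC)
  then have 0: "- cnj l *\<^sub>C conjv S (v 0) + (Lop S 0 (hconj v) + diag_mul (diffc S 0) (lap S (conjv S (v 0))))
      = - conjv S y + (\<Sum>j\<in>UNIV. ell j (conjv S y) *\<^sub>C cfun j 0)"
    using arg_cong[of _ _ "conjv S", OF conjunct2[OF v(2)[unfolded resolvent_rel_def]]] swap_sum[of "\<lambda>_. 1"]
    by (simp add: conjv_add conjv_diff conjv_scaleC conjv_minus L0_conj lap_conjv Q1_spaceD[OF v(1)])
  have "conjv S (v \<theta>) = exp (cnj l * of_real \<theta>) *\<^sub>C conjv S (v 0)
      + (\<Sum>j\<in>UNIV. (ell j (conjv S y) * duhamel (cnj l) (cexp j) \<theta>) *\<^sub>C cfun j 0)" if "\<theta> \<in> {-r..0}" for \<theta>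
  proof -
    have "conjv S (v \<theta>) = conjv S (exp (l * of_real \<theta>) *\<^sub>C v 0
      + (\<Sum>j\<in>UNIV. (ell j y * duhamel l (cexp j) \<theta>) *\<^sub>C cfun j 0))"
      using v(2) that unfolding resolvent_rel_def by (metis (no_types, lifting))
    also have "\<dots> = exp (cnj l * of_real \<theta>) *\<^sub>C conjv S (v 0)
      + (\<Sum>j\<in>UNIV. (ell j (conjv S y) * cnj (duhamel l (cexp (swap j)) \<theta>)) *\<^sub>C cfun j 0)"
      by (simp add: conjv_add conjv_scaleC swap_sum exp_cnj)
    finally show ?thesis by (simp add: duhamel_cnj cexp_swap)
  qed
  with 0 show ?thesis unfolding resolvent_rel_def by blast
qed

section \<open>The coefficients of h\<close>

definition Qc :: "3 \<Rightarrow> 3 \<Rightarrow> 'x ^ 'm" where "Qc i j = Qop S (cfun i) (cfun j)"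

lemma Qc_commute: "Qc i j = Qc j i"
  unfolding Qc_def by (rule Q_commute) (rule Cspace_cfun)+

lemma conjv_Qc: "conjv S (Qc i j) = Qc (swap i) (swap j)"
  unfolding Qc_def by (simp add: Q_conj[symmetric] Cspace_cfun hconj_cfun)

lemma Q_cfun_sum:
  "v \<in> E \<Longrightarrow> Qop S (\<lambda>\<theta>. \<Sum>j\<in>UNIV. c j *\<^sub>C cfun j \<theta>) v = (\<Sum>j\<in>UNIV. c j *\<^sub>C Qop S (cfun j) v)"
  by (rule history_operator.sum[OF Q_left]) (simp_all add: Cspace_cfun)

lemma Q_cfun_sum_right:
  "v \<in> E \<Longrightarrow> Qop S v (\<lambda>\<theta>. \<Sum>j\<in>UNIV. c j *\<^sub>C cfun j \<theta>) = (\<Sum>j\<in>UNIV. c j *\<^sub>C Qop S v (cfun j))"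
  by (rule history_operator.sum[OF Q_right]) (simp_all add: Cspace_cfun)

lemma Cspace_w_center: "w_center S z \<in> E"
  unfolding w_center_eq by (intro Cspace_intros Cspace_cfun)

lemma Q_w_w: "Qop S (w_center S z) (w_center S z') = (\<Sum>i\<in>UNIV. \<Sum>j\<in>UNIV. (z $ i * z' $ j) *\<^sub>C Qc i j)"
proof -
  have "Qop S (w_center S z) (w_center S z') = (\<Sum>i\<in>UNIV. z $ i *\<^sub>C Qop S (cfun i) (w_center S z'))"
    using Q_cfun_sum[OF Cspace_w_center, of "\<lambda>i. z $ i" z'] by (simp flip: w_center_eq)
  moreover have "Qop S (cfun i) (w_center S z') = (\<Sum>j\<in>UNIV. z' $ j *\<^sub>C Qc i j)" for i
    using Q_cfun_sum_right[OF Cspace_cfun, of i "\<lambda>j. z' $ j"] by (simp add: Qc_def flip: w_center_eq)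
  ultimately show ?thesis by (simp add: scaleC_sum_right scaleC_scaleC)
qed

lemma L1_zero: "v \<in> E \<Longrightarrow> L1op S 0 v = 0"
  using linear_0[OF coefficient_operators(5)] by simp

lemma diffc1_zero: "diffc1 S 0 = 0"
  by (rule linear_0[OF diffc1_linear])

lemma F2_zero: "v \<in> E \<Longrightarrow> F2 S v 0 = Qop S v v"
  by (simp add: F2_def L1_zero diffc1_zero vec_eq_iff)

lemma sum_h_index:
  "(\<Sum>(a, b, c)\<in>h_index. f a b c) = f 2 0 0 + f 0 2 0 + f 0 0 2 + f 1 1 0 + f 1 0 1 + f 0 1 1"
  for f :: "nat \<Rightarrow> nat \<Rightarrow> nat \<Rightarrow> 'b::comm_monoid_add"
  by (simp add: h_index_def add_ac)

lemma sum_h_index_diff: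
  "(\<Sum>(a, b, c)\<in>h_index. w a b c *\<^sub>C (f a b c - g a b c))
    = (\<Sum>(a, b, c)\<in>h_index. w a b c *\<^sub>C f a b c) - (\<Sum>(a, b, c)\<in>h_index. w a b c *\<^sub>C g a b c)"
  for f :: "nat \<Rightarrow> nat \<Rightarrow> nat \<Rightarrow> 'b::complex_hilbert"
  by (simp add: sum_h_index scaleC_diff_right)

text \<open>The coefficient of \<open>z\<^sub>1\<^sup>a z\<^sub>2\<^sup>b z\<^sub>3\<^sup>c\<close> in \<open>Q(w(z), w(z))/2\<close>. Mixed terms occur twice in \<open>Q(w, w)\<close>, which
  cancels the factor \<open>1/2\<close>.\<close>

definition h_rhs :: "nat \<Rightarrow> nat \<Rightarrow> nat \<Rightarrow> 'x ^ 'm"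
  where "h_rhs a b c =
    (if (a, b, c) = (2, 0, 0) then (1/2) *\<^sub>C Qc 1 1
     else if (a, b, c) = (0, 2, 0) then (1/2) *\<^sub>C Qc 2 2
     else if (a, b, c) = (0, 0, 2) then (1/2) *\<^sub>C Qc 3 3
     else if (a, b, c) = (1, 1, 0) then Qc 1 2
     else if (a, b, c) = (1, 0, 1) then Qc 1 3 else Qc 2 3)"

lemma half_F2_w: "(1/2) *\<^sub>R F2 S (w_center S z) 0 = (\<Sum>(a, b, c)\<in>h_index. (z $ 1 ^ a * z $ 2 ^ b * z $ 3 ^ c) *\<^sub>C h_rhs a b c)"
proof -
  have "F2 S (w_center S z) 0 = (z $ 1 ^ 2) *\<^sub>C Qc 1 1 + (z $ 2 ^ 2) *\<^sub>C Qc 2 2 + (z $ 3 ^ 2) *\<^sub>C Qc 3 3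
     + ((z $ 1 * z $ 2) *\<^sub>C Qc 1 2 + (z $ 1 * z $ 2) *\<^sub>C Qc 1 2)
     + ((z $ 1 * z $ 3) *\<^sub>C Qc 1 3 + (z $ 1 * z $ 3) *\<^sub>C Qc 1 3)
     + ((z $ 2 * z $ 3) *\<^sub>C Qc 2 3 + (z $ 2 * z $ 3) *\<^sub>C Qc 2 3)"
    by (simp add: F2_zero Cspace_w_center Q_w_w sum_3 Qc_commute[of 2 1] Qc_commute[of 3 1] Qc_commute[of 3 2]
        power2_eq_square mult.commute add_ac)
  then show ?thesis
    by (simp only: scaleR_add_right sum_h_index h_rhs_def)
      (simp add: scaleR_conv_scaleC scaleC_scaleC mult.commute flip: scaleC_add_left)
qed

lemma f22_eq: "(1/2) *\<^sub>R f22 S z \<theta> = (\<Sum>(a, b, c)\<in>h_index. (z $ 1 ^ a * z $ 2 ^ b * z $ 3 ^ c) *\<^sub>C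
    (X0 (h_rhs a b c) \<theta> - (\<Sum>j\<in>UNIV. ell j (h_rhs a b c) *\<^sub>C cfun j \<theta>)))"
proof -
  define P where "P u = X0 u \<theta> - (\<Sum>j\<in>UNIV. ell j u *\<^sub>C cfun j \<theta>)" for u
  have P_add: "P (u + v) = P u + P v" for u v
    by (simp add: P_def X0_def ell_add scaleC_add_left sum.distrib)
  have P_scaleC: "P (c *\<^sub>C u) = c *\<^sub>C P u" for c u
    by (simp add: P_def X0_def ell_scaleC scaleC_diff_right scaleC_sum_right scaleC_scaleC)
  have "(1/2) *\<^sub>R f22 S z \<theta> = P ((1/2) *\<^sub>R F2 S (w_center S z) 0)"
    by (simp add: f22_def Let_def proj_center_eq proj_coeff_jump scaleR_conv_scaleC P_scaleC)
      (simp add: P_def)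
  also have "\<dots> = (\<Sum>(a, b, c)\<in>h_index. (z $ 1 ^ a * z $ 2 ^ b * z $ 3 ^ c) *\<^sub>C P (h_rhs a b c))"
    unfolding half_F2_w sum_h_index by (simp add: P_add P_scaleC)
  finally show ?thesis by (simp add: P_def)
qed

lemma A1_linear:
  assumes v: "v \<in> Q1_space S" and w: "w \<in> Q1_space S" and "\<theta> \<in> {-r..0}"
  shows "A1 S (\<lambda>\<theta>. c *\<^sub>C v \<theta> + w \<theta>) \<theta> = c *\<^sub>C A1 S v \<theta> + A1 S w \<theta>"
proof -
  let ?u = "\<lambda>\<theta>. c *\<^sub>C v \<theta> + w \<theta>"
  have hd: "hderiv r ?u t = c *\<^sub>C hderiv r v t + hderiv r w t" if "t \<in> {-r..0}" for t
    by (rule hderiv_eqI[OF _ that])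
      (intro has_vector_derivative_add has_vector_derivative_scaleC_right Q1_spaceD(5)[OF v that] Q1_spaceD(5)[OF w that])
  have "Lop S 0 ?u = c *\<^sub>C Lop S 0 v + Lop S 0 w"
    by (simp add: L0.add L0.scaleC Cspace_intros Q1_spaceD(1)[OF v] Q1_spaceD(1)[OF w])
  moreover have "diag_mul (diffc S 0) (lap S (?u 0)) = c *\<^sub>C diag_mul (diffc S 0) (lap S (v 0)) + diag_mul (diffc S 0) (lap S (w 0))"
    by (simp add: lap_linear Q1_spaceD(2)[OF v] Q1_spaceD(2)[OF w] vec_eq_iff scaleC_scaleR_commute scaleR_add_right)
  ultimately show ?thesis
    using hd[OF assms(3)] hd[of 0] r_pos
    by (simp add: A1_def X0_def scaleC_add_right scaleC_diff_right algebra_simps)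
qed

lemma h_poly_explicit:
  "h_poly h z = (\<lambda>\<theta>. (z $ 1 ^ 2) *\<^sub>C h 2 0 0 \<theta> + ((z $ 2 ^ 2) *\<^sub>C h 0 2 0 \<theta> + ((z $ 3 ^ 2) *\<^sub>C h 0 0 2 \<theta>
     + ((z $ 1 * z $ 2) *\<^sub>C h 1 1 0 \<theta> + ((z $ 1 * z $ 3) *\<^sub>C h 1 0 1 \<theta> + ((z $ 2 * z $ 3) *\<^sub>C h 0 1 1 \<theta> + 0))))))"
  unfolding h_poly_def sum_h_index by (simp add: add.assoc)

lemma h_in_Q1D:
  assumes "h_in_Q1 S h"
  shows "h 2 0 0 \<in> Q1_space S" "h 0 2 0 \<in> Q1_space S" "h 0 0 2 \<in> Q1_space S" "h 1 1 0 \<in> Q1_space S"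
    "h 1 0 1 \<in> Q1_space S" "h 0 1 1 \<in> Q1_space S"
  using assms by (auto simp: h_in_Q1_def h_index_def)

lemma A1_h_poly:
  assumes "h_in_Q1 S h" "\<theta> \<in> {-r..0}"
  shows "A1 S (h_poly h z) \<theta> = (\<Sum>(a, b, c)\<in>h_index. (z $ 1 ^ a * z $ 2 ^ b * z $ 3 ^ c) *\<^sub>C A1 S (h a b c) \<theta>)"
proof -
  have "A1 S (\<lambda>\<theta>. 0) \<theta> = 0"
    using A1_linear[OF Q1_zero Q1_zero assms(2), of 1] by simp
  then show ?thesis
    unfolding h_poly_explicit sum_h_index
    by (simp only: A1_linear Q1_linear Q1_zero h_in_Q1D[OF assms(1)] assms(2)) (simp add: add.assoc)
qed

lemma has_derivative_scaleC_left [derivative_intros]: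
  "(f has_derivative f') F \<Longrightarrow> ((\<lambda>x. f x *\<^sub>C (u :: 'b::complex_hilbert)) has_derivative (\<lambda>x. f' x *\<^sub>C u)) F"
  by (rule bounded_linear.has_derivative[OF bounded_linear_scaleC_left])

text \<open>Since \<open>B\<close> is diagonal with entries \<open>0, \<i>\<omega>\<^sub>0, -\<i>\<omega>\<^sub>0\<close>, the derivative along \<open>Bz\<close> multiplies
  \<open>z\<^sub>1\<^sup>a z\<^sub>2\<^sup>b z\<^sub>3\<^sup>c\<close> by \<open>\<i>\<omega>\<^sub>0(b - c)\<close>.\<close>

lemma deriv_h_poly:
  "frechet_derivative (\<lambda>z. h_poly h z \<theta>) (at z) (Bmat S z) =
    (\<Sum>(a, b, c)\<in>h_index. (z $ 1 ^ a * z $ 2 ^ b * z $ 3 ^ c) *\<^sub>C ((\<i> * om0 S * (of_nat b - of_nat c)) *\<^sub>C h a b c \<theta>))"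
proof -
  have "((\<lambda>z. h_poly h z \<theta>) has_derivative (\<lambda>v. (2 * z $ 1 * v $ 1) *\<^sub>C h 2 0 0 \<theta> + (2 * z $ 2 * v $ 2) *\<^sub>C h 0 2 0 \<theta>
      + (2 * z $ 3 * v $ 3) *\<^sub>C h 0 0 2 \<theta> + (z $ 1 * v $ 2 + v $ 1 * z $ 2) *\<^sub>C h 1 1 0 \<theta>
      + (z $ 1 * v $ 3 + v $ 1 * z $ 3) *\<^sub>C h 1 0 1 \<theta> + (z $ 2 * v $ 3 + v $ 2 * z $ 3) *\<^sub>C h 0 1 1 \<theta>)) (at z)"
    unfolding h_poly_explicit
    by (auto intro!: derivative_eq_intros simp: fun_eq_iff add_ac mult_ac)
  then show ?thesis
    unfolding sum_h_index
    by (subst frechet_derivative_at[symmetric], assumption)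
      (simp add: Bmat_def scaleC_scaleC algebra_simps power2_eq_square)
qed

lemma h_index_coeffs_unique:
  fixes f g :: "nat \<Rightarrow> nat \<Rightarrow> nat \<Rightarrow> 'b::complex_hilbert"
  assumes "\<And>z :: complex ^ 3. (\<Sum>(a, b, c)\<in>h_index. (z $ 1 ^ a * z $ 2 ^ b * z $ 3 ^ c) *\<^sub>C f a b c)
      = (\<Sum>(a, b, c)\<in>h_index. (z $ 1 ^ a * z $ 2 ^ b * z $ 3 ^ c) *\<^sub>C g a b c)"
    and "(a, b, c) \<in> h_index"
  shows "f a b c = g a b c"
proof -
  note eq = assms(1)[unfolded sum_h_index]
  have 1: "f 2 0 0 = g 2 0 0" using eq[of "vector [1, 0, 0]"] by simp
  have 2: "f 0 2 0 = g 0 2 0" using eq[of "vector [0, 1, 0]"] by simp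
  have 3: "f 0 0 2 = g 0 0 2" using eq[of "vector [0, 0, 1]"] by simp
  have 4: "f 1 1 0 = g 1 1 0" using eq[of "vector [1, 1, 0]"] 1 2 by simp
  have 5: "f 1 0 1 = g 1 0 1" using eq[of "vector [1, 0, 1]"] 1 3 by simp
  have 6: "f 0 1 1 = g 0 1 1" using eq[of "vector [0, 1, 1]"] 2 3 by simp
  show ?thesis using assms(2) 1 2 3 4 5 6 by (auto simp: h_index_def)
qed

lemma h_solution_resolvent:
  assumes "h_solution S h" "(a, b, c) \<in> h_index"
  shows "resolvent_rel (\<i> * om0 S * (of_nat b - of_nat c)) (h_rhs a b c) (h a b c)"
proof (rule resolvent_relI)
  have Q1: "h_in_Q1 S h" using assms(1) by (simp add: h_solution_def)
  then show "h a b c \<in> Q1_space S" using assms(2) by (auto simp: h_in_Q1_def)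
  fix \<theta> assume \<theta>: "\<theta> \<in> {-r..0}"
  show "(\<i> * om0 S * (of_nat b - of_nat c)) *\<^sub>C h a b c \<theta> - A1 S (h a b c) \<theta>
      = X0 (h_rhs a b c) \<theta> - (\<Sum>j\<in>UNIV. ell j (h_rhs a b c) *\<^sub>C cfun j \<theta>)"
  proof (rule h_index_coeffs_unique[OF _ assms(2),
        of "\<lambda>a b c. (\<i> * om0 S * (of_nat b - of_nat c)) *\<^sub>C h a b c \<theta> - A1 S (h a b c) \<theta>"
          "\<lambda>a b c. X0 (h_rhs a b c) \<theta> - (\<Sum>j\<in>UNIV. ell j (h_rhs a b c) *\<^sub>C cfun j \<theta>)"])
    fix z :: "complex ^ 3"
    have "frechet_derivative (\<lambda>z. h_poly h z \<theta>) (at z) (Bmat S z) - A1 S (h_poly h z) \<theta> = (1/2) *\<^sub>R f22 S z \<theta>"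
      using assms(1) \<theta> by (auto simp: h_solution_def)
    then show "(\<Sum>(a, b, c)\<in>h_index. (z $ 1 ^ a * z $ 2 ^ b * z $ 3 ^ c) *\<^sub>C
          ((\<i> * om0 S * (of_nat b - of_nat c)) *\<^sub>C h a b c \<theta> - A1 S (h a b c) \<theta>))
        = (\<Sum>(a, b, c)\<in>h_index. (z $ 1 ^ a * z $ 2 ^ b * z $ 3 ^ c) *\<^sub>C
          (X0 (h_rhs a b c) \<theta> - (\<Sum>j\<in>UNIV. ell j (h_rhs a b c) *\<^sub>C cfun j \<theta>)))"
      unfolding sum_h_index_diff[where w = "\<lambda>a b c. z $ 1 ^ a * z $ 2 ^ b * z $ 3 ^ c"
          and f = "\<lambda>a b c. (\<i> * om0 S * (of_nat b - of_nat c)) *\<^sub>C h a b c \<theta>"]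
        deriv_h_poly A1_h_poly[OF Q1 \<theta>] f22_eq .
  qed
qed

lemma Re_freq [simp]: "Re (\<i> * complex_of_real x * (of_nat b - of_nat c)) = 0"
  by simp

lemma conjv_h_rhs:
  "(a, b, c) \<in> h_index \<Longrightarrow> conjv S (h_rhs a b c) = h_rhs a c b"
  by (auto simp: h_index_def h_rhs_def conjv_scaleC conjv_Qc Qc_commute[of 3 2])

text \<open>The conjugate of \<open>h\<^sub>a\<^sub>b\<^sub>c\<close> solves the resolvent equation of \<open>h\<^sub>a\<^sub>c\<^sub>b\<close>, which has only one solution in \<open>Q\<^sup>1\<close>.\<close>

lemma h_conj:
  assumes "h_solution S h" "(a, b, c) \<in> h_index" "\<theta> \<in> {-r..0}"
  shows "h a c b \<theta> = conjv S (h a b c \<theta>)"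
proof -
  have mem: "(a, c, b) \<in> h_index" using assms(2) by (auto simp: h_index_def)
  have Q1: "h a b c \<in> Q1_space S" "h a c b \<in> Q1_space S"
    using assms(1,2) mem by (auto simp: h_solution_def h_in_Q1_def)
  have "resolvent_rel (\<i> * om0 S * (of_nat c - of_nat b)) (h_rhs a c b) (hconj (h a b c))"
    using resolvent_hconj[OF Q1(1) h_solution_resolvent[OF assms(1,2)]] conjv_h_rhs[OF assms(2)]
    by (simp add: algebra_simps)
  then show ?thesis
    using resolvent_unique[OF Q1(2) h_solution_resolvent[OF assms(1) mem] Q1_hconj[OF Q1(1)] _ Re_freq assms(3)]
    by blast
qed

end

section \<open>Rank-one matrices\<close>

lemma outer_mult: "outer v q *v u = (q \<cdot> u) *s v"
  by (simp add: vec_eq_iff matrix_vector_mult_def outer_def rowmul_def sum_distrib_left mult_ac)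

lemma scaled_outer: "(\<chi> i j. c * outer v q $ i $ j) = outer (c *s v) q"
  by (simp add: vec_eq_iff outer_def mult.assoc)

lemma outer_sum_mult: "(outer v q + outer w p) *v u = (q \<cdot> u) *s v + (p \<cdot> u) *s w"
  by (simp add: matrix_vector_mult_add_rdistrib outer_mult)

lemma outer_diff_mult: "(outer v q - outer w p) *v u = (q \<cdot> u) *s v + (- (p \<cdot> u)) *s w"
  by (simp add: matrix_vector_mult_diff_rdistrib outer_mult)

lemma rowmul_simps:
  "q \<cdot> (u + v) = q \<cdot> u + q \<cdot> v" "q \<cdot> (u - v) = q \<cdot> u - q \<cdot> v" "q \<cdot> (- u) = - (q \<cdot> u)"
  "q \<cdot> (c *s u) = c * (q \<cdot> u)"
  by (simp_all add: rowmul_def algebra_simps sum.distrib sum_subtractf sum_negf sum_distrib_left)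

text \<open>The matrix combinations that occur in the cubic coefficients.\<close>

lemma outer_combination:
  "(- outer v q + outer w p) *v u = - ((q \<cdot> u) *s v) + (p \<cdot> u) *s w"
  "(a *\<^sub>R outer v q + b *\<^sub>R outer w p) *v u = (of_real a * (q \<cdot> u)) *s v + (of_real b * (p \<cdot> u)) *s w"
proof -
  have "t *\<^sub>R outer v q = outer (of_real t *s v) q" for t :: real and v q :: "complex ^ 'a"
    by (simp add: vec_eq_iff outer_def) (simp add: scaleR_conv_of_real)
  note scale = this
  show "(a *\<^sub>R outer v q + b *\<^sub>R outer w p) *v u = (of_real a * (q \<cdot> u)) *s v + (of_real b * (p \<cdot> u)) *s w"
    unfolding scale outer_sum_mult by (simp add: vector_smult_assoc mult.commute)
  have eq: "- outer v q = outer (- v) q" by (simp add: vec_eq_iff outer_def)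
  show "(- outer v q + outer w p) *v u = - ((q \<cdot> u) *s v) + (p \<cdot> u) *s w"
    unfolding eq outer_sum_mult by (simp add: vec_eq_iff)
qed

context bifurcation
begin

section \<open>Pointwise products\<close>

text \<open>The product of elements of \<open>X\<close> is defined only if the pointwise product represents an element of \<open>X\<close>.
  If some \<open>c\<^sub>i \<noteq> 0\<close>, then \<open>y\<^sub>i/c\<^sub>i\<close> is such an element; if \<open>c = 0\<close>, both sides vanish, whatever value the
  product has.\<close>

lemma tens_prodX:
  assumes fn: "\<And>i. AE x in \<Omega>. fn S (y $ i) x = c $ i * prod_list (map (\<lambda>u. fn S u x) us)"
  shows "y = c \<otimes> prodX S us"
proof -
  have "y $ i = c $ i *\<^sub>C prodX S us" for i
  proof (cases "c $ i = 0")
    case True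
    then have "AE x in \<Omega>. fn S (y $ i) x = 0" using fn[of i] by simp
    then show ?thesis using True by (simp add: fn_zero_iff)
  next
    case False
    define w where "w = (1 / c $ i) *\<^sub>C (y $ i)"
    have w: "AE x in \<Omega>. fn S w x = prod_list (map (\<lambda>u. fn S u x) us)"
      using fn[of i] fn_scaleC[of "1 / c $ i" "y $ i"] unfolding w_def
      by eventually_elim (simp add: False)
    have "prodX S us = w"
      unfolding prodX_def
    proof (rule the_equality)
      show "AE x in \<Omega>. fn S w x = prod_list (map (\<lambda>u. fn S u x) us)" by (rule w)
    next
      fix w' assume "AE x in \<Omega>. fn S w' x = prod_list (map (\<lambda>u. fn S u x) us)"
      with w show "w' = w" by (intro fn_eqI) (erule (1) eventually_elim2, simp)
    qed
    then show ?thesis using False by (simp add: w_def scaleC_scaleC)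
  qed
  then show ?thesis by (simp add: vec_eq_iff)
qed

lemma Q_htens:
  assumes "\<phi> \<in> Cspace r" "\<phi>' \<in> Cspace r"
  shows "Qop S (htens \<phi> b) (htens \<phi>' b') = Qvec S \<phi> \<phi>' \<otimes> prodX S [b, b']"
proof (rule tens_prodX)
  fix i
  have "act_pointwise S" using setting by (simp add: setting_def)
  then have "AE x in \<Omega>. fn S (Qop S (htens \<phi> b) (htens \<phi>' b') $ i) x = Qvec S \<phi> \<phi>' $ i * (fn S b x * fn S b' x)"
    using assms unfolding act_pointwise_def Let_def by simp
  then show "AE x in \<Omega>. fn S (Qop S (htens \<phi> b) (htens \<phi>' b') $ i) x
      = Qvec S \<phi> \<phi>' $ i * prod_list (map (\<lambda>u. fn S u x) [b, b'])"
    by simp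
qed

lemma C_htens:
  assumes "\<phi> \<in> Cspace r" "\<phi>' \<in> Cspace r" "\<zeta> \<in> Cspace r"
  shows "Cop S (htens \<phi> b) (htens \<phi>' b') (htens \<zeta> b'') = Cvec S \<phi> \<phi>' \<zeta> \<otimes> prodX S [b, b', b'']"
proof (rule tens_prodX)
  fix i
  have "act_pointwise S" using setting by (simp add: setting_def)
  then have "AE x in \<Omega>. fn S (Cop S (htens \<phi> b) (htens \<phi>' b') (htens \<zeta> b'') $ i) x
      = Cvec S \<phi> \<phi>' \<zeta> $ i * (fn S b x * fn S b' x * fn S b'' x)"
    using assms unfolding act_pointwise_def Let_def by simp
  then show "AE x in \<Omega>. fn S (Cop S (htens \<phi> b) (htens \<phi>' b') (htens \<zeta> b'') $ i) x
      = Cvec S \<phi> \<phi>' \<zeta> $ i * prod_list (map (\<lambda>u. fn S u x) [b, b', b''])"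
    by (simp add: mult.assoc)
qed

lemma Qc_tens: "Qc a b = Qvec S (cphi a) (cphi b) \<otimes> prodX S [\<beta> (cmode a), \<beta> (cmode b)]"
  unfolding Qc_def cfun_def by (rule Q_htens) (rule Cspace_cphi)+

lemma ell_tens: "ell j (c \<otimes> u) = cinner u (\<beta> (cmode j)) * (cpsi j 0 \<cdot> c)"
  by (simp add: ell_def comp_ip_tens rowmul_simps)

lemma ell_Qc: "ell j (Qc a b) = cinner (prodX S [\<beta> (cmode a), \<beta> (cmode b)]) (\<beta> (cmode j)) * (cpsi j 0 \<cdot> Qvec S (cphi a) (cphi b))"
  by (simp add: Qc_tens ell_tens)

section \<open>The relations for the coefficients of h\<close>

lemma basis_names:
  "phi1 S = cphi 1" "phi2 S = cphi 2" "phi2c S = cphi 3" "beta1 S = \<beta> (cmode 1)"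
  "q1 S = cpsi 1 0" "q2 S = cpsi 2 0" "cvec (q2 S) = cpsi 3 0"
  "p1 S = cphi 1 0" "p2 S = cphi 2 0" "cvec (p2 S) = cphi 3 0"
  by (simp_all add: cphi_def cpsi_def cmode_def beta1_def phi1_def phi2_def phi2c_def psi1_def psi2_def psi2c_def)

lemma cmode_2: "beta2 S = \<beta> (cmode 2)" "cmode 3 = cmode 2"
  by (simp_all add: cmode_def beta2_def)

lemma cvec_basis_names: "cvec (cphi 2 0) = cphi 3 0" "cvec (cpsi 2 0) = cpsi 3 0"
  using basis_names by simp_all

lemma scaleC_cong: "a = b \<Longrightarrow> a *\<^sub>C x = b *\<^sub>C (x :: 'b::complex_hilbert)"
  by simp

text \<open>The matrix expressions of the relations for \<open>h\<close>, contracted: a rank-one matrix \<open>\<phi>\<^sub>j(0)\<psi>\<^sub>j(0)\<close> applied to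
  \<open>Q\<close> and paired with \<open>\<langle>\<beta>\<beta>', \<beta>\<^sub>j\<rangle>\<close> is the number \<open>ell j Q\<close> times \<open>e\<^sub>j(0)\<close>. The forms without the factors
  \<open>c1\<close>, \<open>c2\<close> are stated separately below because they do not match syntactically.\<close>

lemma center_part:
  "(c1 * cinner (prodX S [\<beta> (cmode a), \<beta> (cmode b)]) (\<beta> (cmode 1))) *s
      (outer (cphi 1 0) (cpsi 1 0) *v Qvec S (cphi a) (cphi b)) \<otimes> \<beta> (cmode 1)
    = (ell 1 (Qc a b) * c1) *\<^sub>C cfun 1 0"
  "(c2 * cinner (prodX S [\<beta> (cmode a), \<beta> (cmode b)]) (\<beta> (cmode 2))) *s
      ((outer (x *s cphi 2 0) (cpsi 2 0) + outer (y *s cphi 3 0) (cpsi 3 0)) *v Qvec S (cphi a) (cphi b)) \<otimes> \<beta> (cmode 2)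
    = (ell 2 (Qc a b) * (c2 * x)) *\<^sub>C cfun 2 0 + (ell 3 (Qc a b) * (c2 * y)) *\<^sub>C cfun 3 0"
  "(c2 * cinner (prodX S [\<beta> (cmode a), \<beta> (cmode b)]) (\<beta> (cmode 2))) *s
      ((outer (x *s cphi 2 0) (cpsi 2 0) - outer (y *s cphi 3 0) (cpsi 3 0)) *v Qvec S (cphi a) (cphi b)) \<otimes> \<beta> (cmode 2)
    = (ell 2 (Qc a b) * (c2 * x)) *\<^sub>C cfun 2 0 + (ell 3 (Qc a b) * (- c2 * y)) *\<^sub>C cfun 3 0"
  by (simp_all add: ell_Qc cfun_def htens_def cmode_2 outer_mult outer_sum_mult outer_diff_mult
      vec_eq_iff scaleC_scaleC mult_ac flip: scaleC_add_left scaleC_minus_left scaleC_diff_left)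

lemma center_part_1:
  "cinner (prodX S [\<beta> (cmode a), \<beta> (cmode b)]) (\<beta> (cmode 1)) *s
      (outer (cphi 1 0) (cpsi 1 0) *v Qvec S (cphi a) (cphi b)) \<otimes> \<beta> (cmode 1)
    = ell 1 (Qc a b) *\<^sub>C cfun 1 0"
  "cinner (prodX S [\<beta> (cmode a), \<beta> (cmode b)]) (\<beta> (cmode 2)) *s
      ((outer (x *s cphi 2 0) (cpsi 2 0) + outer (y *s cphi 3 0) (cpsi 3 0)) *v Qvec S (cphi a) (cphi b)) \<otimes> \<beta> (cmode 2)
    = (ell 2 (Qc a b) * x) *\<^sub>C cfun 2 0 + (ell 3 (Qc a b) * y) *\<^sub>C cfun 3 0"
  "cinner (prodX S [\<beta> (cmode a), \<beta> (cmode b)]) (\<beta> (cmode 2)) *s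
      ((outer (cphi 2 0) (cpsi 2 0) + outer (cphi 3 0) (cpsi 3 0)) *v Qvec S (cphi a) (cphi b)) \<otimes> \<beta> (cmode 2)
    = ell 2 (Qc a b) *\<^sub>C cfun 2 0 + ell 3 (Qc a b) *\<^sub>C cfun 3 0"
  using center_part(1)[of 1 a b] center_part(2)[of 1 a b x y] center_part(2)[of 1 a b 1 1] by simp_all

abbreviation (input) "duhamel_form l y v \<theta> \<equiv> v \<theta> = exp (l * of_real \<theta>) *\<^sub>C v 0
      + (\<Sum>j\<in>UNIV. (ell j y * duhamel l (cexp j) \<theta>) *\<^sub>C cfun j 0)"

abbreviation (input) "boundary_form l y v \<equiv>
    - l *\<^sub>C v 0 + (Lop S 0 v + diag_mul (diffc S 0) (lap S (v 0))) = - y + (\<Sum>j\<in>UNIV. ell j y *\<^sub>C cfun j 0)"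

abbreviation "iw \<equiv> \<i> * complex_of_real (om0 S)"

lemma iw_nonzero: "iw \<noteq> 0" using om_pos by simp

text \<open>Written with the coefficients \<open>1\<close>, \<open>-1\<close> spelled out, as they stand in the relations for \<open>h\<close>.\<close>

lemma duhamel_values:
  "duhamel 0 (cexp 1) \<theta> = of_real \<theta>"
  "duhamel 0 (cexp 2) \<theta> = 1 / iw * (exp (1 * iw * of_real \<theta>) - 1)"
  "duhamel 0 (cexp 3) \<theta> = - (1 / iw) * (exp (- 1 * iw * of_real \<theta>) - 1)"
  "duhamel (2 * iw) (cexp 1) \<theta> = 1 / (2 * iw) * (exp (2 * iw * of_real \<theta>) - 1)"
  "duhamel (2 * iw) (cexp 2) \<theta> = 1 / (2 * iw) * (2 * (exp (2 * iw * of_real \<theta>) - exp (1 * iw * of_real \<theta>)))"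
  "duhamel (2 * iw) (cexp 3) \<theta> = 1 / (2 * iw) * (2 * (1/3 * (exp (2 * iw * of_real \<theta>) - exp (- 1 * iw * of_real \<theta>))))"
  "duhamel iw (cexp 1) \<theta> = 1 / iw * (exp (1 * iw * of_real \<theta>) - 1)"
  "duhamel iw (cexp 2) \<theta> = of_real \<theta> * exp (1 * iw * of_real \<theta>)"
  "duhamel iw (cexp 3) \<theta> = 1 / (2 * iw) * (exp (1 * iw * of_real \<theta>) - exp (- 1 * iw * of_real \<theta>))"
  using om_pos by (simp_all add: duhamel_def cexp_simps field_simps)

lemma relation_200:
  "(h200 \<theta> = h200 0 + (1/2) *\<^sub>C
      ((ell 1 (Qc 1 1) * of_real \<theta>) *\<^sub>C cfun 1 0
       + ((ell 2 (Qc 1 1) * (1 / iw * (exp (1 * iw * of_real \<theta>) - 1))) *\<^sub>C cfun 2 0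
       + (ell 3 (Qc 1 1) * (- (1 / iw) * (exp (- 1 * iw * of_real \<theta>) - 1))) *\<^sub>C cfun 3 0)))
    \<longleftrightarrow> duhamel_form 0 ((1/2) *\<^sub>C Qc 1 1) h200 \<theta>"
  unfolding duhamel_values sum_3 ell_scaleC scaleC_add_right scaleC_scaleC mult.assoc add.assoc
  by simp

lemma relation_011:
  "(h011 \<theta> = h011 0
      + (ell 1 (Qc 2 3) * of_real \<theta>) *\<^sub>C cfun 1 0
       + ((ell 2 (Qc 2 3) * (1 / iw * (exp (1 * iw * of_real \<theta>) - 1))) *\<^sub>C cfun 2 0
       + (ell 3 (Qc 2 3) * (- (1 / iw) * (exp (- 1 * iw * of_real \<theta>) - 1))) *\<^sub>C cfun 3 0))
    \<longleftrightarrow> duhamel_form 0 (Qc 2 3) h011 \<theta>"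
  unfolding duhamel_values sum_3 add.assoc by simp

lemma relation_020:
  "(h020 \<theta> = exp (2 * iw * of_real \<theta>) *\<^sub>C h020 0 + (1 / (2 * iw)) *\<^sub>C
      ((ell 1 (Qc 2 2) * (1/2 * (exp (2 * iw * of_real \<theta>) - 1))) *\<^sub>C cfun 1 0
       + ((ell 2 (Qc 2 2) * (exp (2 * iw * of_real \<theta>) - exp (1 * iw * of_real \<theta>))) *\<^sub>C cfun 2 0
       + (ell 3 (Qc 2 2) * (1/3 * (exp (2 * iw * of_real \<theta>) - exp (- 1 * iw * of_real \<theta>)))) *\<^sub>C cfun 3 0)))
    \<longleftrightarrow> duhamel_form (2 * iw) ((1/2) *\<^sub>C Qc 2 2) h020 \<theta>"
proof -
  have "(1 / (2 * iw)) *\<^sub>C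
      ((ell 1 (Qc 2 2) * (1/2 * (exp (2 * iw * of_real \<theta>) - 1))) *\<^sub>C cfun 1 0
       + ((ell 2 (Qc 2 2) * (exp (2 * iw * of_real \<theta>) - exp (1 * iw * of_real \<theta>))) *\<^sub>C cfun 2 0
       + (ell 3 (Qc 2 2) * (1/3 * (exp (2 * iw * of_real \<theta>) - exp (- 1 * iw * of_real \<theta>)))) *\<^sub>C cfun 3 0))
    = (\<Sum>j\<in>UNIV. (ell j ((1/2) *\<^sub>C Qc 2 2) * duhamel (2 * iw) (cexp j) \<theta>) *\<^sub>C cfun j 0)"
    unfolding sum_3 ell_scaleC duhamel_values scaleC_add_right scaleC_scaleC add.assoc
    using om_pos by (intro arg_cong2[of _ _ _ _ "(+)"] scaleC_cong) (simp_all add: field_simps)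
  then show ?thesis by (simp only:)
qed

lemma relation_110:
  "(h110 \<theta> = exp (1 * iw * of_real \<theta>) *\<^sub>C h110 0
      + (ell 1 (Qc 1 2) * (1 / iw * (exp (1 * iw * of_real \<theta>) - 1))) *\<^sub>C cfun 1 0
      + ((ell 2 (Qc 1 2) * (of_real \<theta> * exp (1 * iw * of_real \<theta>))) *\<^sub>C cfun 2 0
      + (ell 3 (Qc 1 2) * (1 / (2 * iw) * (exp (1 * iw * of_real \<theta>) - exp (- 1 * iw * of_real \<theta>)))) *\<^sub>C cfun 3 0))
    \<longleftrightarrow> duhamel_form iw (Qc 1 2) h110 \<theta>"
  unfolding sum_3 duhamel_values add.assoc by simp

lemma boundary_relation:
  "(- l *\<^sub>C v 0 + (Lop S 0 v + diag_mul (diffc S 0) (lap S (v 0))) = (1/2) *\<^sub>C (- Qc a b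
      + ell 1 (Qc a b) *\<^sub>C cfun 1 0 + (ell 2 (Qc a b) *\<^sub>C cfun 2 0 + ell 3 (Qc a b) *\<^sub>C cfun 3 0)))
    \<longleftrightarrow> boundary_form l ((1/2) *\<^sub>C Qc a b) v"
  "(- l *\<^sub>C v 0 + (Lop S 0 v + diag_mul (diffc S 0) (lap S (v 0))) = - Qc a b
      + ell 1 (Qc a b) *\<^sub>C cfun 1 0 + (ell 2 (Qc a b) *\<^sub>C cfun 2 0 + ell 3 (Qc a b) *\<^sub>C cfun 3 0))
    \<longleftrightarrow> boundary_form l (Qc a b) v"
  unfolding sum_3 ell_scaleC scaleC_add_right scaleC_scaleC scaleC_minus_right add.assoc by (rule refl)+

text \<open>Each listed relation is variation of constants (for \<open>\<theta> \<le> 0\<close>) or the boundary equation for one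
  coefficient, after contraction of the matrix products.\<close>

lemma h_relations_iff:
  "h_relations S h \<longleftrightarrow> (\<forall>\<theta>\<in>{-r..0}. duhamel_form 0 ((1/2) *\<^sub>C Qc 1 1) (h 2 0 0) \<theta> \<and>
      duhamel_form 0 (Qc 2 3) (h 0 1 1) \<theta> \<and>
      duhamel_form (2 * iw) ((1/2) *\<^sub>C Qc 2 2) (h 0 2 0) \<theta> \<and>
      duhamel_form iw (Qc 1 2) (h 1 1 0) \<theta> \<and>
      h 0 0 2 \<theta> = conjv S (h 0 2 0 \<theta>) \<and> h 1 0 1 \<theta> = conjv S (h 1 1 0 \<theta>)) \<and>
    boundary_form 0 ((1/2) *\<^sub>C Qc 1 1) (h 2 0 0) \<and> boundary_form 0 (Qc 2 3) (h 0 1 1) \<and>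
    boundary_form (2 * iw) ((1/2) *\<^sub>C Qc 2 2) (h 0 2 0) \<and> boundary_form iw (Qc 1 2) (h 1 1 0)"
  unfolding h_relations_def Let_def basis_names cmode_2(1) scaled_outer
    minus_zero scaleC_zero_left add_0
  by (simp only: cvec_basis_names center_part center_part_1 Qc_tens[symmetric]
      center_part[where a = 2 and b = 3, unfolded cmode_2(2)]
      center_part_1[where a = 2 and b = 3, unfolded cmode_2(2)]
      Qc_tens[of 2 3, unfolded cmode_2(2), symmetric]
      relation_200 relation_011 relation_020 relation_110 boundary_relation
      boundary_relation[where l = 0, unfolded minus_zero scaleC_zero_left add_0])

lemma h_relations_resolvent:
  "h_relations S h \<longleftrightarrow> resolvent_rel 0 (h_rhs 2 0 0) (h 2 0 0) \<and> resolvent_rel 0 (h_rhs 0 1 1) (h 0 1 1) \<and>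
    resolvent_rel (2 * iw) (h_rhs 0 2 0) (h 0 2 0) \<and> resolvent_rel iw (h_rhs 1 1 0) (h 1 1 0) \<and>
    (\<forall>\<theta>\<in>{-r..0}. h 0 0 2 \<theta> = conjv S (h 0 2 0 \<theta>) \<and> h 1 0 1 \<theta> = conjv S (h 1 1 0 \<theta>))"
proof -
  have rhs: "h_rhs 2 0 0 = (1/2) *\<^sub>C Qc 1 1" "h_rhs 0 1 1 = Qc 2 3" "h_rhs 0 2 0 = (1/2) *\<^sub>C Qc 2 2" "h_rhs 1 1 0 = Qc 1 2"
    by (simp_all add: h_rhs_def)
  show ?thesis
    unfolding h_relations_iff resolvent_rel_def rhs by blast
qed

lemma h_solution_relations:
  assumes "h_solution S h" shows "h_relations S h"
proof -
  note res = h_solution_resolvent[OF assms]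
  have "h 0 0 2 \<theta> = conjv S (h 0 2 0 \<theta>) \<and> h 1 0 1 \<theta> = conjv S (h 1 1 0 \<theta>)" if "\<theta> \<in> {-r..0}" for \<theta>
    using h_conj[OF assms _ that, of 0 2 0] h_conj[OF assms _ that, of 1 1 0] by (simp add: h_index_def)
  moreover have "resolvent_rel 0 (h_rhs 2 0 0) (h 2 0 0)" "resolvent_rel 0 (h_rhs 0 1 1) (h 0 1 1)"
    "resolvent_rel (2 * iw) (h_rhs 0 2 0) (h 0 2 0)" "resolvent_rel iw (h_rhs 1 1 0) (h 1 1 0)"
    using res[of 2 0 0] res[of 0 1 1] res[of 0 2 0] res[of 1 1 0] by (simp_all add: h_index_def mult.commute)
  ultimately show ?thesis unfolding h_relations_resolvent by blast
qed

lemma h_relations_unique: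
  assumes h: "h_in_Q1 S h" "h_relations S h" and h': "h_in_Q1 S h'" "h_relations S h'"
    and "(a, b, c) \<in> h_index" "\<theta> \<in> {-r..0}"
  shows "h' a b c \<theta> = h a b c \<theta>"
proof -
  note rel = h(2)[unfolded h_relations_resolvent] and rel' = h'(2)[unfolded h_relations_resolvent]
  note Q1 = h_in_Q1D[OF h(1)] and Q1' = h_in_Q1D[OF h'(1)]
  have 1: "h' 2 0 0 \<theta> = h 2 0 0 \<theta>"
    by (rule resolvent_unique[OF Q1'(1) _ Q1(1) _ _ assms(6), of 0 "h_rhs 2 0 0"]) (use rel rel' in auto)
  have 2: "h' 0 1 1 \<theta> = h 0 1 1 \<theta>"
    by (rule resolvent_unique[OF Q1'(6) _ Q1(6) _ _ assms(6), of 0 "h_rhs 0 1 1"]) (use rel rel' in auto)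
  have 3: "h' 0 2 0 \<theta> = h 0 2 0 \<theta>"
    by (rule resolvent_unique[OF Q1'(2) _ Q1(2) _ _ assms(6), of "2 * iw" "h_rhs 0 2 0"]) (use rel rel' in auto)
  have 4: "h' 1 1 0 \<theta> = h 1 1 0 \<theta>"
    by (rule resolvent_unique[OF Q1'(4) _ Q1(4) _ _ assms(6), of iw "h_rhs 1 1 0"]) (use rel rel' in auto)
  have 5: "h' 0 0 2 \<theta> = h 0 0 2 \<theta>" "h' 1 0 1 \<theta> = h 1 0 1 \<theta>"
    using rel rel' 3 4 assms(6) by auto
  show ?thesis using assms(5) 1 2 3 4 5 by (auto simp: h_index_def)
qed

end

section \<open>Vector monomials\<close>

text \<open>A vector monomial is given by its exponents in \<open>z\<^sub>1, z\<^sub>2, z\<^sub>3, \<alpha>\<^sub>1, \<alpha>\<^sub>2\<close> and its component.\<close>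

definition low_degree :: "mono_index set"
  where "low_degree = {(a, b, c, d, e, i). a + b + c + d + e \<le> 3}"

definition kronecker_code :: "mono_index \<Rightarrow> nat"
  where "kronecker_code = (\<lambda>(a, b, c, d, e, i). a + 4 * b + 16 * c + 64 * d + 256 * e)"

definition comp_of :: "mono_index \<Rightarrow> 3"
  where "comp_of = (\<lambda>(a, b, c, d, e, i). i)"

lemma finite_low_degree: "finite low_degree"
proof (rule finite_subset)
  show "low_degree \<subseteq> {..3} \<times> {..3} \<times> {..3} \<times> {..3} \<times> {..3} \<times> UNIV"
    by (auto simp: low_degree_def)
qed simp

lemma kronecker_code_inj:
  assumes "s \<in> low_degree" "s' \<in> low_degree" "comp_of s = comp_of s'" "kronecker_code s = kronecker_code s'"
  shows "s = s'"
proof -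
  obtain a b c d e i where s: "s = (a, b, c, d, e, i)" by (metis prod_cases6)
  obtain a' b' c' d' e' i' where s': "s' = (a', b', c', d', e', i')" by (metis prod_cases6)
  have digits: "a + b + c + d + e \<le> 3" "a' + b' + c' + d' + e' \<le> 3"
    and code: "a + 4 * b + 16 * c + 64 * d + 256 * e = a' + 4 * b' + 16 * c' + 64 * d' + 256 * e'"
    using assms by (auto simp: s s' low_degree_def kronecker_code_def)
  have "e = e'" using digits code by linarith
  moreover have "d = d'" using digits code \<open>e = e'\<close> by linarith
  moreover have "c = c'" using digits code \<open>e = e'\<close> \<open>d = d'\<close> by linarith
  moreover have "b = b'" using digits code \<open>e = e'\<close> \<open>d = d'\<close> \<open>c = c'\<close> by linarith
  ultimately show ?thesis using assms(3) code by (simp add: s s' comp_of_def)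
qed

text \<open>Substitute powers \<open>t, t\<^sup>4, t\<^sup>1\<^sup>6, ...\<close> of a single real variable \<open>t\<close>: in one
  component, distinct monomials of degree at most 3 become distinct powers of \<open>t\<close>, since their exponents
  are the digits of a number in base 4. A polynomial that vanishes on the real line has no
  coefficients.\<close>

lemma vmonoms_independent:
  assumes "finite I" "I \<subseteq> low_degree"
    and zero: "\<And>z \<alpha>. (\<Sum>s\<in>I. c s *s vmonom s z \<alpha>) = 0" and "s \<in> I"
  shows "c s = 0"
proof -
  define J where "J = {s' \<in> I. comp_of s' = comp_of s}"
  have J: "finite J" "J \<subseteq> low_degree" "s \<in> J" using assms by (auto simp: J_def)
  have inj: "inj_on kronecker_code J"
  proof (rule inj_onI)
    fix s1 s2 assume "s1 \<in> J" "s2 \<in> J" "kronecker_code s1 = kronecker_code s2"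
    then show "s1 = s2"
      using subsetD[OF J(2)] by (intro kronecker_code_inj) (simp_all add: J_def)
  qed
  define C where "C k = (if k \<in> kronecker_code ` J then c (the_inv_into J kronecker_code k) else 0)" for k
  define n where "n = Max (kronecker_code ` J)"
  have n: "kronecker_code ` J \<subseteq> {..n}" using J by (auto simp: n_def)
  have poly: "(\<Sum>k\<le>n. C k * of_real t ^ k) = 0" for t :: real
  proof -
    define z :: "complex ^ 3" where "z = vector [of_real t, of_real t ^ 4, of_real t ^ 16]"
    define \<alpha> :: "real ^ 2" where "\<alpha> = vector [t ^ 64, t ^ 256]"
    have mono: "vmonom s' z \<alpha> $ j = (if j = comp_of s' then of_real t ^ kronecker_code s' else 0)" for s' j
    proof -
      obtain a b c d e i where s': "s' = (a, b, c, d, e, i)" by (metis prod_cases6)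
      have "z $ 1 ^ a * z $ 2 ^ b * z $ 3 ^ c * of_real (\<alpha> $ 1 ^ d * \<alpha> $ 2 ^ e) = of_real t ^ kronecker_code s'"
        by (simp add: s' z_def \<alpha>_def kronecker_code_def power_add flip: power_mult)
      then show ?thesis by (simp add: s' vmonom_def axis_def comp_of_def)
    qed
    have "(\<Sum>k\<le>n. C k * of_real t ^ k) = (\<Sum>k\<in>kronecker_code ` J. C k * of_real t ^ k)"
      by (rule sum.mono_neutral_right) (use n in \<open>auto simp: C_def\<close>)
    also have "\<dots> = (\<Sum>s'\<in>J. c s' * of_real t ^ kronecker_code s')"
      unfolding sum.reindex[OF inj] comp_def
      by (rule sum.cong) (auto simp: C_def the_inv_into_f_f[OF inj])
    also have "\<dots> = (\<Sum>s'\<in>I. c s' * vmonom s' z \<alpha> $ comp_of s)"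
      unfolding J_def by (rule sum.mono_neutral_cong_left) (use assms(1) mono in auto)
    also have "\<dots> = (\<Sum>s'\<in>I. c s' *s vmonom s' z \<alpha>) $ comp_of s" by simp
    also have "\<dots> = 0" by (simp only: zero zero_index)
    finally show ?thesis .
  qed
  have "C (kronecker_code s) = 0"
  proof (rule ccontr)
    assume "C (kronecker_code s) \<noteq> 0"
    moreover have "kronecker_code s \<le> n" using n J(3) by auto
    ultimately have "finite {z. (\<Sum>k\<le>n. C k * z ^ k) = 0}"
      using polyfun_finite_roots[of C n] by blast
    then have "finite (range complex_of_real)"
      by (rule finite_subset[rotated]) (use poly in auto)
    then show False
      using finite_imageD[of complex_of_real UNIV] infinite_UNIV_char_0 by (auto simp: inj_on_def)
  qed
  then show ?thesis using J(3) by (simp add: C_def the_inv_into_f_f[OF inj])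
qed

definition mono_list :: "(mono_index \<times> complex) list \<Rightarrow> complex ^ 3 \<Rightarrow> real ^ 2 \<Rightarrow> complex ^ 3"
  where "mono_list xs z \<alpha> = (\<Sum>(s, c)\<leftarrow>xs. c *s vmonom s z \<alpha>)"

lemma mono_list_simps [simp]:
  "mono_list [] z \<alpha> = 0" "mono_list ((s, c) # xs) z \<alpha> = c *s vmonom s z \<alpha> + mono_list xs z \<alpha>"
  by (simp_all add: mono_list_def)

lemma mono_list_in_span:
  assumes "finite I" "fst ` set xs \<subseteq> I" shows "mono_list xs \<in> monom_span I"
  using assms(2)
proof (induction xs)
  case Nil
  then show ?case by (auto simp: monom_span_def fun_eq_iff intro!: exI[of _ "\<lambda>_. 0"])
next
  case (Cons x xs)
  obtain s c where x: "x = (s, c)" by fastforce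
  obtain k where k: "mono_list xs = (\<lambda>z \<alpha>. \<Sum>s\<in>I. k s *s vmonom s z \<alpha>)"
    using Cons by (auto simp: monom_span_def)
  have "s \<in> I" using Cons.prems x by simp
  have "mono_list (x # xs) z \<alpha> = (\<Sum>s'\<in>I. (k s' + (if s' = s then c else 0)) *s vmonom s' z \<alpha>)" for z \<alpha>
  proof -
    have "(\<Sum>s'\<in>I. (k s' + (if s' = s then c else 0)) *s vmonom s' z \<alpha>)
      = (\<Sum>s'\<in>I. k s' *s vmonom s' z \<alpha>) + (\<Sum>s'\<in>I. if s' = s then c *s vmonom s' z \<alpha> else 0)"
      unfolding sum.distrib[symmetric] by (rule sum.cong) (auto simp: vector_sadd_rdistrib)
    then show ?thesis using \<open>s \<in> I\<close> assms(1) by (simp add: x k add.commute)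
  qed
  then show ?case
    unfolding monom_span_def
    by (intro CollectI exI[of _ "\<lambda>s'. k s' + (if s' = s then c else 0)"] ext)
qed

text \<open>For a polynomial given by a list of monomials, projecting along the monomials outside \<open>R\<close> means
  keeping the entries in \<open>R\<close>. Another splitting would differ in the coefficient of some monomial, which
  independence excludes.\<close>

lemma proj_res_mono_list:
  assumes I: "finite I" "I \<subseteq> low_degree" "R \<subseteq> I"
    and p: "\<And>z \<alpha>. p z \<alpha> = mono_list xs z \<alpha>" and xs: "fst ` set xs \<subseteq> I"
  shows "proj_res I R p = mono_list (filter (\<lambda>x. fst x \<in> R) xs)"
  unfolding proj_res_def
proof (rule the_equality)
  let ?f = "\<lambda>Q. mono_list (filter (\<lambda>x. Q (fst x)) xs)"
  have split: "p z \<alpha> - ?f (\<lambda>s. s \<in> R) z \<alpha> = ?f (\<lambda>s. s \<notin> R) z \<alpha>" for z \<alpha>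
    unfolding p by (induction xs) auto
  show goal: "?f (\<lambda>s. s \<in> R) \<in> monom_span R \<and> (\<lambda>z \<alpha>. p z \<alpha> - ?f (\<lambda>s. s \<in> R) z \<alpha>) \<in> monom_span (I - R)"
  proof -
    have "fst x \<in> I" if "x \<in> set xs" for x using xs that by auto
    then show ?thesis
      unfolding split using I finite_subset[OF I(3,1)]
      by (intro conjI mono_list_in_span image_subsetI) simp_all
  qed
  fix g assume g: "g \<in> monom_span R \<and> (\<lambda>z \<alpha>. p z \<alpha> - g z \<alpha>) \<in> monom_span (I - R)"
  obtain c1 c2 d1 d2 where
    1: "g = (\<lambda>z \<alpha>. \<Sum>s\<in>R. c1 s *s vmonom s z \<alpha>)" "(\<lambda>z \<alpha>. p z \<alpha> - g z \<alpha>) = (\<lambda>z \<alpha>. \<Sum>s\<in>I - R. d1 s *s vmonom s z \<alpha>)" and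
    2: "?f (\<lambda>s. s \<in> R) = (\<lambda>z \<alpha>. \<Sum>s\<in>R. c2 s *s vmonom s z \<alpha>)"
    "(\<lambda>z \<alpha>. p z \<alpha> - ?f (\<lambda>s. s \<in> R) z \<alpha>) = (\<lambda>z \<alpha>. \<Sum>s\<in>I - R. d2 s *s vmonom s z \<alpha>)"
    using g goal unfolding monom_span_def by blast
  define c where "c s = (if s \<in> R then c1 s - c2 s else d1 s - d2 s)" for s
  have "c s = 0" if "s \<in> I" for s
  proof (rule vmonoms_independent[OF I(1,2) _ that])
    fix z \<alpha>
    have "(\<Sum>s\<in>I. c s *s vmonom s z \<alpha>) = (\<Sum>s\<in>I - R. c s *s vmonom s z \<alpha>) + (\<Sum>s\<in>R. c s *s vmonom s z \<alpha>)"
      using I by (intro sum.subset_diff)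
    also have "(\<Sum>s\<in>I - R. c s *s vmonom s z \<alpha>) = (p z \<alpha> - g z \<alpha>) - (p z \<alpha> - ?f (\<lambda>s. s \<in> R) z \<alpha>)"
      unfolding fun_cong[OF fun_cong[OF 1(2)]] fun_cong[OF fun_cong[OF 2(2)]] sum_subtractf[symmetric]
      by (rule sum.cong) (auto simp: c_def vector_sub_rdistrib)
    also have "(\<Sum>s\<in>R. c s *s vmonom s z \<alpha>) = g z \<alpha> - ?f (\<lambda>s. s \<in> R) z \<alpha>"
      unfolding fun_cong[OF fun_cong[OF 1(1)]] fun_cong[OF fun_cong[OF 2(1)]] sum_subtractf[symmetric]
      by (rule sum.cong) (auto simp: c_def vector_sub_rdistrib)
    finally show "(\<Sum>s\<in>I. c s *s vmonom s z \<alpha>) = 0" by simp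
  qed
  from this[OF subsetD[OF I(3)]] have "c1 s = c2 s" if "s \<in> R" for s
    using that by (simp add: c_def)
  then show "g = ?f (\<lambda>s. s \<in> R)" unfolding 1(1) 2(1) by simp
qed

lemma monoms_low:
  "finite monoms2" "monoms2 \<subseteq> low_degree" "res2 \<subseteq> monoms2"
  "finite monoms2_z" "monoms2_z \<subseteq> low_degree"
  "finite monoms3_z" "monoms3_z \<subseteq> low_degree" "res3 \<subseteq> monoms3_z"
proof -
  show sub: "monoms2 \<subseteq> low_degree" "monoms2_z \<subseteq> low_degree" "monoms3_z \<subseteq> low_degree"
    by (auto simp: monoms2_def monoms2_z_def monoms3_z_def low_degree_def)
  show "finite monoms2" "finite monoms2_z" "finite monoms3_z"
    using sub finite_low_degree finite_subset by blast+
  show "res2 \<subseteq> monoms2" "res3 \<subseteq> monoms3_z"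
    by (auto simp: monoms2_def monoms3_z_def res2_def res3_def)
qed

section \<open>Quadratic and cubic vector fields\<close>

text \<open>Coefficients are indexed by the exponents of \<open>(z\<^sub>1, z\<^sub>2, z\<^sub>3)\<close> and by the component.\<close>

type_synonym coeffs = "nat \<Rightarrow> nat \<Rightarrow> nat \<Rightarrow> 3 \<Rightarrow> complex"

definition quad :: "coeffs \<Rightarrow> complex ^ 3 \<Rightarrow> complex ^ 3"
  where "quad K z = (\<chi> i. K 2 0 0 i * (z $ 1)\<^sup>2 + K 0 2 0 i * (z $ 2)\<^sup>2 + K 0 0 2 i * (z $ 3)\<^sup>2
    + K 1 1 0 i * (z $ 1 * z $ 2) + K 1 0 1 i * (z $ 1 * z $ 3) + K 0 1 1 i * (z $ 2 * z $ 3))"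

lemma quad_nth: "quad K z $ i = K 2 0 0 i * (z $ 1)\<^sup>2 + K 0 2 0 i * (z $ 2)\<^sup>2 + K 0 0 2 i * (z $ 3)\<^sup>2
    + K 1 1 0 i * (z $ 1 * z $ 2) + K 1 0 1 i * (z $ 1 * z $ 3) + K 0 1 1 i * (z $ 2 * z $ 3)"
  by (simp add: quad_def)

definition cubic :: "coeffs \<Rightarrow> complex ^ 3 \<Rightarrow> complex ^ 3"
  where "cubic K z = (\<chi> i. K 3 0 0 i * z $ 1 ^ 3 + K 0 3 0 i * z $ 2 ^ 3 + K 0 0 3 i * z $ 3 ^ 3
    + K 2 1 0 i * ((z $ 1)\<^sup>2 * z $ 2) + K 2 0 1 i * ((z $ 1)\<^sup>2 * z $ 3)
    + K 1 2 0 i * (z $ 1 * (z $ 2)\<^sup>2) + K 0 2 1 i * ((z $ 2)\<^sup>2 * z $ 3)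
    + K 1 0 2 i * (z $ 1 * (z $ 3)\<^sup>2) + K 0 1 2 i * (z $ 2 * (z $ 3)\<^sup>2) + K 1 1 1 i * (z $ 1 * z $ 2 * z $ 3))"

definition param_part :: "(3 \<Rightarrow> 3 \<Rightarrow> 2 \<Rightarrow> complex) \<Rightarrow> complex ^ 3 \<Rightarrow> real ^ 2 \<Rightarrow> complex ^ 3"
  where "param_part A z \<alpha> = (\<chi> i. \<Sum>j\<in>UNIV. z $ j * (A i j 1 * of_real (\<alpha> $ 1) + A i j 2 * of_real (\<alpha> $ 2)))"

lemma proj_quad:
  "proj_res monoms2 res2 (\<lambda>z \<alpha>. quad K z + param_part A z \<alpha>) z \<alpha> = vector
    [K 2 0 0 1 * (z $ 1)\<^sup>2 + K 0 1 1 1 * (z $ 2 * z $ 3) + z $ 1 * (A 1 1 1 * of_real (\<alpha> $ 1) + A 1 1 2 * of_real (\<alpha> $ 2)),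
     K 1 1 0 2 * (z $ 1 * z $ 2) + z $ 2 * (A 2 2 1 * of_real (\<alpha> $ 1) + A 2 2 2 * of_real (\<alpha> $ 2)),
     K 1 0 1 3 * (z $ 1 * z $ 3) + z $ 3 * (A 3 3 1 * of_real (\<alpha> $ 1) + A 3 3 2 * of_real (\<alpha> $ 2))]"
proof -
  define xs :: "3 \<Rightarrow> (mono_index \<times> complex) list" where "xs i =
    [((2,0,0,0,0,i), K 2 0 0 i), ((0,2,0,0,0,i), K 0 2 0 i), ((0,0,2,0,0,i), K 0 0 2 i),
     ((1,1,0,0,0,i), K 1 1 0 i), ((1,0,1,0,0,i), K 1 0 1 i), ((0,1,1,0,0,i), K 0 1 1 i),
     ((1,0,0,1,0,i), A i 1 1), ((1,0,0,0,1,i), A i 1 2), ((0,1,0,1,0,i), A i 2 1), ((0,1,0,0,1,i), A i 2 2),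
     ((0,0,1,1,0,i), A i 3 1), ((0,0,1,0,1,i), A i 3 2)]" for i :: 3
  have "proj_res monoms2 res2 (\<lambda>z \<alpha>. quad K z + param_part A z \<alpha>)
      = mono_list (filter (\<lambda>x. fst x \<in> res2) (xs 1 @ xs 2 @ xs 3))"
  proof (rule proj_res_mono_list[OF monoms_low(1-3)])
    show "quad K z + param_part A z \<alpha> = mono_list (xs 1 @ xs 2 @ xs 3) z \<alpha>" for z \<alpha>
      unfolding vec_eq_iff forall_3
      by (simp add: xs_def quad_def param_part_def vmonom_def axis_def sum_3 algebra_simps)
    show "fst ` set (xs 1 @ xs 2 @ xs 3) \<subseteq> monoms2"
      by (simp add: xs_def monoms2_def)
  qed
  then show ?thesis
    unfolding vec_eq_iff forall_3
    by (simp add: xs_def res2_def vmonom_def axis_def algebra_simps)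
qed

lemma proj_cubic:
  "proj_res monoms3_z res3 (\<lambda>z \<alpha>. cubic K z) z \<alpha> = vector
    [K 3 0 0 1 * z $ 1 ^ 3 + K 1 1 1 1 * (z $ 1 * z $ 2 * z $ 3),
     K 2 1 0 2 * ((z $ 1)\<^sup>2 * z $ 2) + K 0 2 1 2 * ((z $ 2)\<^sup>2 * z $ 3),
     K 2 0 1 3 * ((z $ 1)\<^sup>2 * z $ 3) + K 0 1 2 3 * (z $ 2 * (z $ 3)\<^sup>2)]"
proof -
  define xs :: "3 \<Rightarrow> (mono_index \<times> complex) list" where "xs i =
    [((3,0,0,0,0,i), K 3 0 0 i), ((0,3,0,0,0,i), K 0 3 0 i), ((0,0,3,0,0,i), K 0 0 3 i),
     ((2,1,0,0,0,i), K 2 1 0 i), ((2,0,1,0,0,i), K 2 0 1 i), ((1,2,0,0,0,i), K 1 2 0 i),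
     ((0,2,1,0,0,i), K 0 2 1 i), ((1,0,2,0,0,i), K 1 0 2 i), ((0,1,2,0,0,i), K 0 1 2 i),
     ((1,1,1,0,0,i), K 1 1 1 i)]" for i :: 3
  have "proj_res monoms3_z res3 (\<lambda>z \<alpha>. cubic K z)
      = mono_list (filter (\<lambda>x. fst x \<in> res3) (xs 1 @ xs 2 @ xs 3))"
  proof (rule proj_res_mono_list[OF monoms_low(6-8)])
    show "cubic K z = mono_list (xs 1 @ xs 2 @ xs 3) z \<alpha>" for z \<alpha>
      unfolding vec_eq_iff forall_3
      by (simp add: xs_def cubic_def vmonom_def axis_def algebra_simps)
    show "fst ` set (xs 1 @ xs 2 @ xs 3) \<subseteq> monoms3_z"
      by (simp add: xs_def monoms3_z_def)
  qed
  then show ?thesis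
    unfolding vec_eq_iff forall_3
    by (simp add: xs_def res3_def vmonom_def axis_def algebra_simps)
qed

lemma has_derivative_componentwise_vec:
  fixes f :: "'a::real_normed_vector \<Rightarrow> complex ^ 3"
  assumes "\<And>i. ((\<lambda>x. f x $ i) has_derivative (\<lambda>v. D v $ i)) F"
  shows "(f has_derivative D) F"
proof -
  have "bounded_linear (\<lambda>c. axis i c :: complex ^ 3)" for i
    by (rule linear_conv_bounded_linear[THEN iffD1], rule linearI) (simp_all add: vec_eq_iff axis_def)
  then have "((\<lambda>x. \<Sum>i\<in>UNIV. axis i (f x $ i)) has_derivative (\<lambda>v. \<Sum>i\<in>UNIV. axis i (D v $ i))) F"
    by (intro has_derivative_sum bounded_linear.has_derivative[OF _ assms])
  moreover have "(\<Sum>i\<in>UNIV. axis i (u $ i)) = u" for u :: "complex ^ 3"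
    unfolding vec_eq_iff forall_3 by (simp add: sum_3 axis_def)
  ultimately show ?thesis by simp
qed

lemma quad_deriv:
  "(quad K has_derivative (\<lambda>v. \<chi> i. K 2 0 0 i * (2 * z $ 1 * v $ 1) + K 0 2 0 i * (2 * z $ 2 * v $ 2)
     + K 0 0 2 i * (2 * z $ 3 * v $ 3) + K 1 1 0 i * (z $ 1 * v $ 2 + v $ 1 * z $ 2)
     + K 1 0 1 i * (z $ 1 * v $ 3 + v $ 1 * z $ 3) + K 0 1 1 i * (z $ 2 * v $ 3 + v $ 2 * z $ 3))) (at z)"
proof (rule has_derivative_componentwise_vec)
  fix i
  have sq: "((\<lambda>z. (z $ j)\<^sup>2) has_derivative (\<lambda>v. 2 * z $ j * v $ j)) (at z)" for j
    unfolding power2_eq_square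
    by (rule has_derivative_eq_rhs[OF has_derivative_mult[OF has_derivative_vec_nth has_derivative_vec_nth]])
      (simp add: fun_eq_iff)
  have pr: "((\<lambda>z. z $ j * z $ k) has_derivative (\<lambda>v. z $ j * v $ k + v $ j * z $ k)) (at z)" for j k
    by (rule has_derivative_mult) (rule has_derivative_vec_nth)+
  have "((\<lambda>z. K 2 0 0 i * (z $ 1)\<^sup>2 + K 0 2 0 i * (z $ 2)\<^sup>2 + K 0 0 2 i * (z $ 3)\<^sup>2
    + K 1 1 0 i * (z $ 1 * z $ 2) + K 1 0 1 i * (z $ 1 * z $ 3) + K 0 1 1 i * (z $ 2 * z $ 3)) has_derivative
    (\<lambda>v. K 2 0 0 i * (2 * z $ 1 * v $ 1) + K 0 2 0 i * (2 * z $ 2 * v $ 2)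
     + K 0 0 2 i * (2 * z $ 3 * v $ 3) + K 1 1 0 i * (z $ 1 * v $ 2 + v $ 1 * z $ 2)
     + K 1 0 1 i * (z $ 1 * v $ 3 + v $ 1 * z $ 3) + K 0 1 1 i * (z $ 2 * v $ 3 + v $ 2 * z $ 3))) (at z)"
    by (intro has_derivative_add has_derivative_mult_right sq pr)
  then show "((\<lambda>z. quad K z $ i) has_derivative (\<lambda>v. (\<chi> i. K 2 0 0 i * (2 * z $ 1 * v $ 1) + K 0 2 0 i * (2 * z $ 2 * v $ 2)
     + K 0 0 2 i * (2 * z $ 3 * v $ 3) + K 1 1 0 i * (z $ 1 * v $ 2 + v $ 1 * z $ 2)
     + K 1 0 1 i * (z $ 1 * v $ 3 + v $ 1 * z $ 3) + K 0 1 1 i * (z $ 2 * v $ 3 + v $ 2 * z $ 3)) $ i)) (at z)"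
    by (simp only: quad_def vec_lambda_beta)
qed

section \<open>The homological operator\<close>

context bifurcation
begin

text \<open>\<open>B\<close> is \<open>\<i>\<omega>\<^sub>0\<close> times the diagonal matrix of these numbers; accordingly the weight of a monomial
  is its eigenvalue under the homological operator, divided by \<open>\<i>\<omega>\<^sub>0\<close>.\<close>

definition comp_weight :: "3 \<Rightarrow> complex" where "comp_weight i = (if i = 1 then 0 else if i = 2 then 1 else - 1)"

definition weight :: "mono_index \<Rightarrow> complex"
  where "weight = (\<lambda>(a, b, c, d, e, i). of_nat b - of_nat c - comp_weight i)"

lemma Bmat_nth: "Bmat S z $ i = iw * comp_weight i * z $ i"
proof -
  have "\<forall>i. Bmat S z $ i = iw * comp_weight i * z $ i"
    unfolding forall_3 by (simp add: Bmat_def comp_weight_def)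
  then show ?thesis ..
qed

lemma Bmat_sum: "Bmat S (\<Sum>s\<in>I. c s *s v s) = (\<Sum>s\<in>I. c s *s Bmat S (v s))"
  by (simp add: vec_eq_iff Bmat_nth sum_distrib_left mult_ac)

lemma vmonom_deriv:
  obtains D where "((\<lambda>z. vmonom s z \<alpha>) has_derivative D) (at z)"
    "D (Bmat S z) - Bmat S (vmonom s z \<alpha>) = (iw * weight s) *s vmonom s z \<alpha>"
proof -
  obtain a b c d e i where s: "s = (a, b, c, d, e, i)" by (metis prod_cases6)
  let ?k = "complex_of_real (\<alpha> $ 1 ^ d * \<alpha> $ 2 ^ e)"
  define D where "D v = (\<chi> j. if j = i then
      (of_nat a * v $ 1 * z $ 1 ^ (a - 1) * z $ 2 ^ b * z $ 3 ^ c
       + of_nat b * v $ 2 * z $ 2 ^ (b - 1) * z $ 1 ^ a * z $ 3 ^ c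
       + of_nat c * v $ 3 * z $ 3 ^ (c - 1) * z $ 1 ^ a * z $ 2 ^ b) * ?k else 0)" for v :: "complex ^ 3"
  have "((\<lambda>z. vmonom s z \<alpha>) has_derivative D) (at z)"
  proof (rule has_derivative_componentwise_vec)
    fix j
    have "((\<lambda>z. z $ 1 ^ a * z $ 2 ^ b * z $ 3 ^ c * ?k) has_derivative (\<lambda>v. D v $ i)) (at z)"
    proof -
      note pow = has_derivative_power[OF has_derivative_vec_nth]
      have "((\<lambda>z. z $ 1 ^ a * z $ 2 ^ b * z $ 3 ^ c * ?k) has_derivative
        (\<lambda>v. (z $ 1 ^ a * z $ 2 ^ b * (of_nat c * v $ 3 * z $ 3 ^ (c - 1)) +
          (z $ 1 ^ a * (of_nat b * v $ 2 * z $ 2 ^ (b - 1)) + of_nat a * v $ 1 * z $ 1 ^ (a - 1) * z $ 2 ^ b) * z $ 3 ^ c) * ?k)) (at z)"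
        by (intro has_derivative_mult_left has_derivative_mult pow)
      then show ?thesis by (simp add: D_def algebra_simps)
    qed
    then show "((\<lambda>z. vmonom s z \<alpha> $ j) has_derivative (\<lambda>v. D v $ j)) (at z)"
      by (cases "j = i") (simp_all add: s vmonom_def axis_def D_def)
  qed
  moreover have "D (Bmat S z) - Bmat S (vmonom s z \<alpha>) = (iw * weight s) *s vmonom s z \<alpha>"
  proof -
    have pow: "of_nat n * (x * y) * y ^ (n - 1) = x * (of_nat n * y ^ n)" for n and x y :: complex
      by (cases n) simp_all
    have "D (Bmat S z) $ i = (iw * (of_nat b - of_nat c)) * (z $ 1 ^ a * z $ 2 ^ b * z $ 3 ^ c * ?k)"
      unfolding D_def vec_lambda_beta if_P[OF refl] Bmat_nth pow
      by (simp add: comp_weight_def algebra_simps)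
    then have "D (Bmat S z) $ j = (if j = i then (iw * (of_nat b - of_nat c)) * (z $ 1 ^ a * z $ 2 ^ b * z $ 3 ^ c * ?k) else 0)" for j
      by (simp add: D_def)
    then show ?thesis
      unfolding vec_eq_iff vector_minus_component Bmat_nth
      by (simp add: s vmonom_def axis_def weight_def algebra_simps)
  qed
  ultimately show thesis by (rule that)
qed

lemma M1_sum:
  assumes "finite I"
  shows "M1 S (\<lambda>z \<alpha>. \<Sum>s\<in>I. c s *s vmonom s z \<alpha>) z \<alpha> = (\<Sum>s\<in>I. (iw * weight s * c s) *s vmonom s z \<alpha>)"
proof -
  have "\<forall>s. \<exists>D. ((\<lambda>z. vmonom s z \<alpha>) has_derivative D) (at z) \<and>
      D (Bmat S z) - Bmat S (vmonom s z \<alpha>) = (iw * weight s) *s vmonom s z \<alpha>"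
    using vmonom_deriv by metis
  then obtain D where D: "\<And>s. ((\<lambda>z. vmonom s z \<alpha>) has_derivative D s) (at z)"
    "\<And>s. D s (Bmat S z) - Bmat S (vmonom s z \<alpha>) = (iw * weight s) *s vmonom s z \<alpha>"
    by metis
  have "((\<lambda>z. \<Sum>s\<in>I. c s *s vmonom s z \<alpha>) has_derivative (\<lambda>v. \<Sum>s\<in>I. c s *s D s v)) (at z)"
  proof (rule has_derivative_sum)
    fix s
    have "bounded_linear (\<lambda>v. c s *s (v :: complex ^ 3))"
      by (rule linear_conv_bounded_linear[THEN iffD1], rule linearI) (simp_all add: vec_eq_iff algebra_simps)
    then show "((\<lambda>z. c s *s vmonom s z \<alpha>) has_derivative (\<lambda>v. c s *s D s v)) (at z)"
      using D(1) by (rule bounded_linear.has_derivative)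
  qed
  then have "M1 S (\<lambda>z \<alpha>. \<Sum>s\<in>I. c s *s vmonom s z \<alpha>) z \<alpha>
      = (\<Sum>s\<in>I. c s *s D s (Bmat S z)) - Bmat S (\<Sum>s\<in>I. c s *s vmonom s z \<alpha>)"
    unfolding M1_def by (simp only: frechet_derivative_at[symmetric])
  also have "\<dots> = (\<Sum>s\<in>I. c s *s (D s (Bmat S z) - Bmat S (vmonom s z \<alpha>)))"
    unfolding Bmat_sum sum_subtractf[symmetric] vector_ssub_ldistrib ..
  also have "\<dots> = (\<Sum>s\<in>I. (iw * weight s * c s) *s vmonom s z \<alpha>)"
    unfolding D(2) by (simp add: vector_smult_assoc mult_ac)
  finally show ?thesis .
qed

text \<open>A check of the 18 quadratic vector monomials in \<open>z\<close>: those of weight 0 are the resonant ones.\<close>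

lemma weight_nonzero:
  assumes "s \<in> monoms2_z - res2" shows "weight s \<noteq> 0"
proof -
  obtain a b c d e i where s: "s = (a, b, c, d, e, i)" by (metis prod_cases6)
  have abc: "a + b + c = 2" "d = 0" "e = 0" using assms by (simp_all add: s monoms2_z_def)
  have key: "weight (a, b, c, 0, 0, i) \<noteq> 0 \<or> (a, b, c, 0, 0, i) \<in> res2"
    if "(a, b, c) \<in> {(2,0,0), (0,2,0), (0,0,2), (1,1,0), (1,0,1), (0,1,1)}" for a b c i
  proof -
    have "\<forall>i. weight (a, b, c, 0, 0, i) \<noteq> 0 \<or> (a, b, c, 0, 0, i) \<in> res2"
      using that unfolding forall_3 weight_def comp_weight_def res2_def
      by (elim insertE emptyE) (simp_all del: One_nat_def)
    then show ?thesis ..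
  qed
  have "(a, b, c) \<in> {(2,0,0), (0,2,0), (0,0,2), (1,1,0), (1,0,1), (0,1,1)}"
  proof -
    have "c = 2 - a - b" "a + b \<le> 2" using abc(1) by linarith+
    moreover from this(2) have "(a, b) \<in> {(0, 0), (0, 1), (0, 2), (1, 0), (1, 1), (2, 0)}"
      by (cases "a = 0"; cases "a = 1"; cases "b = 0"; cases "b = 1") auto
    ultimately show ?thesis by auto
  qed
  from key[OF this] show ?thesis using assms unfolding s abc(2,3) by blast
qed

text \<open>The homological operator multiplies each coefficient by a nonzero eigenvalue, and the monomials are
  independent.\<close>

lemma M1_inj:
  assumes "U \<in> monom_span (monoms2_z - res2)" "U' \<in> monom_span (monoms2_z - res2)"
    and eq: "\<And>z. M1 S U z 0 = M1 S U' z 0"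
  shows "U = U'"
proof -
  let ?J = "monoms2_z - res2"
  have J: "finite ?J" "?J \<subseteq> low_degree" using monoms_low by auto
  obtain c c' where U: "U = (\<lambda>z \<alpha>. \<Sum>s\<in>?J. c s *s vmonom s z \<alpha>)" and U': "U' = (\<lambda>z \<alpha>. \<Sum>s\<in>?J. c' s *s vmonom s z \<alpha>)"
    using assms(1,2) unfolding monom_span_def by blast
  have "iw * weight s * (c s - c' s) = 0" if "s \<in> ?J" for s
  proof (rule vmonoms_independent[OF J _ that, of "\<lambda>s. iw * weight s * (c s - c' s)"])
    fix z :: "complex ^ 3" and \<alpha> :: "real ^ 2"
    have "vmonom s z \<alpha> = vmonom s z 0" if "s \<in> ?J" for s
      using that by (auto simp: monoms2_z_def vmonom_def)
    then have "(\<Sum>s\<in>?J. (iw * weight s * (c s - c' s)) *s vmonom s z \<alpha>)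
        = (\<Sum>s\<in>?J. (iw * weight s * c s) *s vmonom s z 0 - (iw * weight s * c' s) *s vmonom s z 0)"
      by (intro sum.cong refl) (simp add: vec_eq_iff algebra_simps)
    also have "\<dots> = 0"
      using eq[of z] unfolding U U' M1_sum[OF J(1)] by (simp add: sum_subtractf)
    finally show "(\<Sum>s\<in>?J. (iw * weight s * (c s - c' s)) *s vmonom s z \<alpha>) = 0" .
  qed
  note coeff = this
  have "c s = c' s" if "s \<in> ?J" for s
    using weight_nonzero[OF that] coeff[OF that] iw_nonzero unfolding mult_eq_0_iff by simp
  then show ?thesis unfolding U U' by simp
qed

text \<open>The solution of the homological equation for a quadratic field with coefficients \<open>K\<close>: the
  coefficient of each nonresonant monomial is divided by its eigenvalue.\<close>

definition solve :: "coeffs \<Rightarrow> coeffs"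
  where "solve K a b c i = (let w = of_nat b - of_nat c - comp_weight i in if w = 0 then 0 else K a b c i / (iw * w))"

lemma solve_values:
  "solve K 2 0 0 1 = 0" "solve K 2 0 0 2 = - K 2 0 0 2 / iw" "solve K 2 0 0 3 = K 2 0 0 3 / iw"
  "solve K 0 2 0 1 = K 0 2 0 1 / (2 * iw)" "solve K 0 2 0 2 = K 0 2 0 2 / iw" "solve K 0 2 0 3 = K 0 2 0 3 / (3 * iw)"
  "solve K 0 0 2 1 = - K 0 0 2 1 / (2 * iw)" "solve K 0 0 2 2 = - K 0 0 2 2 / (3 * iw)" "solve K 0 0 2 3 = - K 0 0 2 3 / iw"
  "solve K 1 1 0 1 = K 1 1 0 1 / iw" "solve K 1 1 0 2 = 0" "solve K 1 1 0 3 = K 1 1 0 3 / (2 * iw)"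
  "solve K 1 0 1 1 = - K 1 0 1 1 / iw" "solve K 1 0 1 2 = - K 1 0 1 2 / (2 * iw)" "solve K 1 0 1 3 = 0"
  "solve K 0 1 1 1 = 0" "solve K 0 1 1 2 = - K 0 1 1 2 / iw" "solve K 0 1 1 3 = K 0 1 1 3 / iw"
  unfolding solve_def comp_weight_def Let_def by (simp_all del: One_nat_def)

lemma solve_in_span: "(\<lambda>z \<alpha>. quad (solve K) z) \<in> monom_span (monoms2_z - res2)"
proof -
  let ?xs = "[((0,2,0,0,0,1), solve K 0 2 0 1), ((0,0,2,0,0,1), solve K 0 0 2 1), ((1,1,0,0,0,1), solve K 1 1 0 1),
    ((1,0,1,0,0,1), solve K 1 0 1 1), ((2,0,0,0,0,2), solve K 2 0 0 2), ((0,2,0,0,0,2), solve K 0 2 0 2),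
    ((0,0,2,0,0,2), solve K 0 0 2 2), ((1,0,1,0,0,2), solve K 1 0 1 2), ((0,1,1,0,0,2), solve K 0 1 1 2),
    ((2,0,0,0,0,3), solve K 2 0 0 3), ((0,2,0,0,0,3), solve K 0 2 0 3), ((0,0,2,0,0,3), solve K 0 0 2 3),
    ((1,1,0,0,0,3), solve K 1 1 0 3), ((0,1,1,0,0,3), solve K 0 1 1 3)]"
  have "quad (solve K) z = mono_list ?xs z \<alpha>" for z \<alpha>
    unfolding vec_eq_iff forall_3
    by (simp add: quad_def vmonom_def axis_def algebra_simps solve_values(1,11,15,16) del: One_nat_def)
  then have eq: "(\<lambda>z \<alpha>. quad (solve K) z) = mono_list ?xs" by (intro ext)
  have "fst ` set ?xs \<subseteq> monoms2_z - res2"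
    by (simp add: monoms2_z_def res2_def)
  then show ?thesis
    unfolding eq by (rule mono_list_in_span[OF finite_Diff[OF monoms_low(4)]])
qed

lemma M1_solve:
  "M1 S (\<lambda>z \<alpha>. quad (solve K) z) z \<alpha> = quad K z - vector
    [K 2 0 0 1 * (z $ 1)\<^sup>2 + K 0 1 1 1 * (z $ 2 * z $ 3), K 1 1 0 2 * (z $ 1 * z $ 2), K 1 0 1 3 * (z $ 1 * z $ 3)]"
proof -
  have "frechet_derivative (quad (solve K)) (at z) = (\<lambda>v. \<chi> i. solve K 2 0 0 i * (2 * z $ 1 * v $ 1) + solve K 0 2 0 i * (2 * z $ 2 * v $ 2)
     + solve K 0 0 2 i * (2 * z $ 3 * v $ 3) + solve K 1 1 0 i * (z $ 1 * v $ 2 + v $ 1 * z $ 2)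
     + solve K 1 0 1 i * (z $ 1 * v $ 3 + v $ 1 * z $ 3) + solve K 0 1 1 i * (z $ 2 * v $ 3 + v $ 2 * z $ 3))"
    by (rule frechet_derivative_at[OF quad_deriv, symmetric])
  then have M1: "M1 S (\<lambda>z \<alpha>. quad (solve K) z) z \<alpha> = (\<chi> i. solve K 2 0 0 i * (2 * z $ 1 * Bmat S z $ 1) + solve K 0 2 0 i * (2 * z $ 2 * Bmat S z $ 2)
     + solve K 0 0 2 i * (2 * z $ 3 * Bmat S z $ 3) + solve K 1 1 0 i * (z $ 1 * Bmat S z $ 2 + Bmat S z $ 1 * z $ 2)
     + solve K 1 0 1 i * (z $ 1 * Bmat S z $ 3 + Bmat S z $ 1 * z $ 3) + solve K 0 1 1 i * (z $ 2 * Bmat S z $ 3 + Bmat S z $ 2 * z $ 3))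
     - Bmat S (quad (solve K) z)"
    by (simp only: M1_def)
  have "M1 S (\<lambda>z \<alpha>. quad (solve K) z) z \<alpha> $ i =
     solve K 2 0 0 i * (- (iw * comp_weight i) * (z $ 1)\<^sup>2) + solve K 0 2 0 i * ((2 * iw - iw * comp_weight i) * (z $ 2)\<^sup>2)
     + solve K 0 0 2 i * ((- 2 * iw - iw * comp_weight i) * (z $ 3)\<^sup>2) + solve K 1 1 0 i * ((iw - iw * comp_weight i) * (z $ 1 * z $ 2))
     + solve K 1 0 1 i * ((- iw - iw * comp_weight i) * (z $ 1 * z $ 3)) + solve K 0 1 1 i * (- (iw * comp_weight i) * (z $ 2 * z $ 3))" for i
    unfolding M1 vector_minus_component vec_lambda_beta Bmat_nth quad_nth
    using three_cases[of i]
    by (elim disjE) (simp_all add: comp_weight_def power2_eq_square algebra_simps del: One_nat_def)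
  then show ?thesis
    unfolding vec_eq_iff forall_3 using om_pos
    by (simp add: solve_values comp_weight_def quad_def del: One_nat_def)
qed

end

text \<open>The coefficients of the cubic field \<open>\<Sum>\<^sub>j z\<^sub>j V\<^sub>j(z)\<close> for quadratic fields \<open>V\<^sub>j\<close>. The three corrections \<open>Q(w, w(U))\<close>,
  \<open>Q(w, h)\<close> and \<open>DU g\<close> of the cubic terms all have this shape.\<close>

definition lin_quad :: "(3 \<Rightarrow> coeffs) \<Rightarrow> coeffs"
  where "lin_quad V a b c i = (if a > 0 then V 1 (a - 1) b c i else 0)
    + (if b > 0 then V 2 a (b - 1) c i else 0) + (if c > 0 then V 3 a b (c - 1) i else 0)"

lemma lin_quad_values:
  "lin_quad V 3 0 0 i = V 1 2 0 0 i" "lin_quad V 0 3 0 i = V 2 0 2 0 i" "lin_quad V 0 0 3 i = V 3 0 0 2 i"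
  "lin_quad V 2 1 0 i = V 1 1 1 0 i + V 2 2 0 0 i" "lin_quad V 2 0 1 i = V 1 1 0 1 i + V 3 2 0 0 i"
  "lin_quad V 1 2 0 i = V 1 0 2 0 i + V 2 1 1 0 i" "lin_quad V 0 2 1 i = V 2 0 1 1 i + V 3 0 2 0 i"
  "lin_quad V 1 0 2 i = V 1 0 0 2 i + V 3 1 0 1 i" "lin_quad V 0 1 2 i = V 2 0 0 2 i + V 3 0 1 1 i"
  "lin_quad V 1 1 1 i = V 1 0 1 1 i + V 2 1 0 1 i + V 3 1 1 0 i"
  by (simp_all add: lin_quad_def)

lemma cubic_nth: "cubic K z $ i = K 3 0 0 i * z $ 1 ^ 3 + K 0 3 0 i * z $ 2 ^ 3 + K 0 0 3 i * z $ 3 ^ 3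
    + K 2 1 0 i * ((z $ 1)\<^sup>2 * z $ 2) + K 2 0 1 i * ((z $ 1)\<^sup>2 * z $ 3)
    + K 1 2 0 i * (z $ 1 * (z $ 2)\<^sup>2) + K 0 2 1 i * ((z $ 2)\<^sup>2 * z $ 3)
    + K 1 0 2 i * (z $ 1 * (z $ 3)\<^sup>2) + K 0 1 2 i * (z $ 2 * (z $ 3)\<^sup>2) + K 1 1 1 i * (z $ 1 * z $ 2 * z $ 3)"
  by (simp add: cubic_def)

lemma cubic_lin_quad: "cubic (lin_quad V) z $ i = (\<Sum>j\<in>UNIV. z $ j * quad (V j) z $ i)"
  unfolding cubic_nth quad_nth lin_quad_values sum_3
  by (simp add: power2_eq_square power3_eq_cube algebra_simps del: One_nat_def)

lemma cubic_linear:
  "cubic (\<lambda>a b c i. K a b c i + (s * K1 a b c i + (t * K2 a b c i - u * K3 a b c i))) z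
    = cubic K z + (s *s cubic K1 z + (t *s cubic K2 z - u *s cubic K3 z))"
  by (simp add: vec_eq_iff cubic_nth algebra_simps del: One_nat_def)

lemma quad_sum:
  "quad (\<lambda>a b c i. \<Sum>l\<in>UNIV. m i l * K a b c l) z $ i = (\<Sum>l\<in>UNIV. m i l * quad K z $ l)" for m :: "3 \<Rightarrow> 3 \<Rightarrow> complex"
  by (simp add: quad_nth sum_3 algebra_simps del: One_nat_def)

text \<open>The coefficients of the Jacobian: \<open>\<partial>(quad K)\<^sub>i/\<partial>z\<^sub>j = \<Sum>\<^sub>k jac K i k j z\<^sub>k\<close>. The three tests separate the
  six unordered pairs of indices.\<close>

definition jac :: "coeffs \<Rightarrow> 3 \<Rightarrow> 3 \<Rightarrow> 3 \<Rightarrow> complex"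
  where "jac K i j k = (if j = k then 2 * (if j = 1 then K 2 0 0 i else if j = 2 then K 0 2 0 i else K 0 0 2 i)
    else if j \<noteq> 3 \<and> k \<noteq> 3 then K 1 1 0 i else if j \<noteq> 2 \<and> k \<noteq> 2 then K 1 0 1 i else K 0 1 1 i)"

lemma jac_values:
  "jac K i 1 1 = 2 * K 2 0 0 i" "jac K i 2 2 = 2 * K 0 2 0 i" "jac K i 3 3 = 2 * K 0 0 2 i"
  "jac K i 1 2 = K 1 1 0 i" "jac K i 2 1 = K 1 1 0 i" "jac K i 1 3 = K 1 0 1 i" "jac K i 3 1 = K 1 0 1 i"
  "jac K i 2 3 = K 0 1 1 i" "jac K i 3 2 = K 0 1 1 i"
  by (simp_all add: jac_def del: One_nat_def)

lemma frechet_quad: "frechet_derivative (quad K) (at z) v $ i = (\<Sum>k\<in>UNIV. z $ k * (\<Sum>j\<in>UNIV. jac K i k j * v $ j))"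
  unfolding frechet_derivative_at[OF quad_deriv, symmetric] vec_lambda_beta sum_3 jac_values
  by (simp add: algebra_simps del: One_nat_def)

context bifurcation
begin

section \<open>The normal form\<close>

definition qc :: "3 \<Rightarrow> 3 \<Rightarrow> 3 \<Rightarrow> complex" where "qc i j k = ell i (Qc j k)"

definition Cc :: "3 \<Rightarrow> 3 \<Rightarrow> 3 \<Rightarrow> 'x ^ 'm" where "Cc i j k = Cop S (cfun i) (cfun j) (cfun k)"

definition cc :: "3 \<Rightarrow> 3 \<Rightarrow> 3 \<Rightarrow> 3 \<Rightarrow> complex" where "cc i j k l = ell i (Cc j k l)"

definition lin_param :: "real ^ 2 \<Rightarrow> 3 \<Rightarrow> 'x ^ 'm"
  where "lin_param \<alpha> j = L1op S \<alpha> (cfun j) + diag_mul (diffc1 S \<alpha>) (lap S (cfun j 0))"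

definition lamc :: "3 \<Rightarrow> 3 \<Rightarrow> real ^ 2 \<Rightarrow> complex" where "lamc i j \<alpha> = ell i (lin_param \<alpha> j)"

definition hq :: "(nat \<Rightarrow> nat \<Rightarrow> nat \<Rightarrow> real \<Rightarrow> 'x ^ 'm) \<Rightarrow> 3 \<Rightarrow> 3 \<Rightarrow> nat \<Rightarrow> nat \<Rightarrow> nat \<Rightarrow> complex"
  where "hq h i j a b c = ell i (Qop S (cfun j) (h a b c))"

text \<open>Twice, since \<open>f\<^sub>2\<^sup>1\<close> comes from \<open>Q(w, w)\<close> rather than from its half.\<close>

definition fcoef :: coeffs where "fcoef a b c i = 2 * ell i (h_rhs a b c)"

lemma qc_commute: "qc i j k = qc i k j"
  by (simp add: qc_def Qc_commute[of j k])

lemma fcoef_values: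
  "fcoef 2 0 0 i = qc i 1 1" "fcoef 0 2 0 i = qc i 2 2" "fcoef 0 0 2 i = qc i 3 3"
  "fcoef 1 1 0 i = 2 * qc i 1 2" "fcoef 1 0 1 i = 2 * qc i 1 3" "fcoef 0 1 1 i = 2 * qc i 2 3"
  by (simp_all add: fcoef_def h_rhs_def ell_scaleC qc_def)

lemma lap_cfun: "cfun j 0 \<in> dom_lap S" "lap S (cfun j 0) = (- of_real (mu S (cmode j))) *\<^sub>C cfun j 0"
  by (simp_all add: cfun_def htens_def dom_lap_tens lap_tens cmode_mem)

lemma F2_w:
  "F2 S (w_center S z) \<alpha> = F2 S (w_center S z) 0 + (\<Sum>j\<in>UNIV. z $ j *\<^sub>C lin_param \<alpha> j)"
proof -
  have "L1op S \<alpha> (w_center S z) = (\<Sum>j\<in>UNIV. z $ j *\<^sub>C L1op S \<alpha> (cfun j))"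
    unfolding w_center_eq by (rule L1.sum) (simp_all add: Cspace_cfun)
  moreover have "diag_mul (diffc1 S \<alpha>) (lap S (w_center S z 0)) = (\<Sum>j\<in>UNIV. z $ j *\<^sub>C diag_mul (diffc1 S \<alpha>) (lap S (cfun j 0)))"
  proof -
    have "lap S (w_center S z 0) = (\<Sum>j\<in>UNIV. z $ j *\<^sub>C lap S (cfun j 0))"
      unfolding w_center_eq sum_3 by (simp add: lap_add lap_scaleC dom_lap_add dom_lap_scaleC lap_cfun(1))
    then show ?thesis
      by (simp add: sum_3 vec_eq_iff scaleR_add_right scaleC_scaleR_commute)
  qed
  ultimately show ?thesis
    unfolding F2_zero[OF Cspace_w_center] lin_param_def scaleC_add_right sum.distrib
    by (simp only: F2_def add_ac)
qed

text \<open>Linearity in \<open>\<alpha>\<close> splits the parameter terms into the monomials \<open>z\<^sub>j\<alpha>\<^sub>l\<close>.\<close>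

lemma lamc_linear: "lamc i j \<alpha> = lamc i j (axis 1 1) * of_real (\<alpha> $ 1) + lamc i j (axis 2 1) * of_real (\<alpha> $ 2)"
proof -
  have lin: "linear (\<lambda>\<alpha>. lin_param \<alpha> j)"
  proof (rule linearI)
    fix \<alpha> \<alpha>' :: "real ^ 2" and t :: real
    show "lin_param (\<alpha> + \<alpha>') j = lin_param \<alpha> j + lin_param \<alpha>' j"
      using linear_add[OF coefficient_operators(5)[OF Cspace_cfun]] linear_add[OF diffc1_linear]
      by (simp add: lin_param_def vec_eq_iff algebra_simps)
    show "lin_param (t *\<^sub>R \<alpha>) j = t *\<^sub>R lin_param \<alpha> j"
      using linear_scale[OF coefficient_operators(5)[OF Cspace_cfun]] linear_scale[OF diffc1_linear]
      by (simp add: lin_param_def vec_eq_iff algebra_simps)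
  qed
  have "\<alpha> = \<alpha> $ 1 *\<^sub>R axis 1 1 + \<alpha> $ 2 *\<^sub>R axis 2 1"
    by (simp add: vec_eq_iff forall_2 axis_def)
  then have "lin_param \<alpha> j = lin_param (\<alpha> $ 1 *\<^sub>R axis 1 1 + \<alpha> $ 2 *\<^sub>R axis 2 1) j"
    by (rule arg_cong)
  also have "\<dots> = \<alpha> $ 1 *\<^sub>R lin_param (axis 1 1) j + \<alpha> $ 2 *\<^sub>R lin_param (axis 2 1) j"
    unfolding linear_add[OF lin] linear_scale[OF lin] ..
  finally have "lin_param \<alpha> j = \<alpha> $ 1 *\<^sub>R lin_param (axis 1 1) j + \<alpha> $ 2 *\<^sub>R lin_param (axis 2 1) j" .
  then show ?thesis
    unfolding lamc_def by (simp add: ell_add ell_scaleR scaleR_conv_of_real)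
qed

lemma f21_eq: "f21 S z (\<lambda>\<theta>. 0) \<alpha> = quad fcoef z + param_part (\<lambda>i j l. lamc i j (axis l 1)) z \<alpha>"
proof -
  have "F2 S (w_center S z) 0 = 2 *\<^sub>R (1/2) *\<^sub>R F2 S (w_center S z) 0" by simp
  also have "\<dots> = (\<Sum>(a, b, c)\<in>h_index. (z $ 1 ^ a * z $ 2 ^ b * z $ 3 ^ c) *\<^sub>C 2 *\<^sub>R h_rhs a b c)"
    unfolding half_F2_w sum_h_index by (simp add: scaleR_add_right scaleC_scaleR_commute)
  finally have "ell i (F2 S (w_center S z) 0) = quad fcoef z $ i" for i
    unfolding sum_h_index quad_nth fcoef_def
    by (simp add: ell_add ell_scaleC ell_scaleR scaleR_conv_of_real del: One_nat_def)
  moreover have "ell i (\<Sum>j\<in>UNIV. z $ j *\<^sub>C lin_param \<alpha> j) = param_part (\<lambda>i j l. lamc i j (axis l 1)) z \<alpha> $ i" for i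
    unfolding param_part_def vec_lambda_beta lamc_linear[of _ _ \<alpha>, symmetric]
    by (simp add: ell_sum ell_scaleC lamc_def)
  ultimately show ?thesis
    unfolding f21_def center_comps_eq vec_eq_iff by (simp add: F2_w[of z \<alpha>] ell_add)
qed

lemma g21_eq:
  "g21 S z \<alpha> = vector
    [fcoef 2 0 0 1 * (z $ 1)\<^sup>2 + fcoef 0 1 1 1 * (z $ 2 * z $ 3) + z $ 1 * lamc 1 1 \<alpha>,
     fcoef 1 1 0 2 * (z $ 1 * z $ 2) + z $ 2 * lamc 2 2 \<alpha>,
     fcoef 1 0 1 3 * (z $ 1 * z $ 3) + z $ 3 * lamc 3 3 \<alpha>]"
  unfolding g21_def f21_eq proj_quad lamc_linear[of _ _ \<alpha>, symmetric] ..

lemma lamc_zero: "lamc i j 0 = 0"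
  using lamc_linear[of i j 0] by simp

lemma U21_eq: "U21 S = quad (solve fcoef)"
proof -
  have "(THE U. U \<in> monom_span (monoms2_z - res2) \<and> (\<forall>z. M1 S U z 0 = f21 S z (\<lambda>\<theta>. 0) 0 - g21 S z 0))
      = (\<lambda>z \<alpha>. quad (solve fcoef) z)"
  proof (rule the_equality)
    have "f21 S z (\<lambda>\<theta>. 0) 0 = quad fcoef z" for z
      by (simp add: f21_eq param_part_def vec_eq_iff)
    then show 1: "(\<lambda>z \<alpha>. quad (solve fcoef) z) \<in> monom_span (monoms2_z - res2) \<and>
        (\<forall>z. M1 S (\<lambda>z \<alpha>. quad (solve fcoef) z) z 0 = f21 S z (\<lambda>\<theta>. 0) 0 - g21 S z 0)"
      by (simp only: solve_in_span M1_solve g21_eq lamc_zero mult_zero_right add_0_right simp_thms)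
    fix U assume "U \<in> monom_span (monoms2_z - res2) \<and> (\<forall>z. M1 S U z 0 = f21 S z (\<lambda>\<theta>. 0) 0 - g21 S z 0)"
    then show "U = (\<lambda>z \<alpha>. quad (solve fcoef) z)"
      using 1 by (intro M1_inj) simp_all
  qed
  then show ?thesis unfolding U21_def by (intro ext) simp
qed

lemma C_commutes: "Cc j i k = Cc i j k" "Cc i k j = Cc i j k"
  unfolding Cc_def using C_commute[OF Cspace_cfun Cspace_cfun Cspace_cfun] by metis+

lemma cc_commutes: "cc l j i k = cc l i j k" "cc l i k j = cc l i j k"
  unfolding cc_def by (rule arg_cong[OF C_commutes(1)], rule arg_cong[OF C_commutes(2)])

text \<open>The coefficients of \<open>C(w, w, w)\<close>; the factors are the multinomial coefficients of the cubic monomials.\<close>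

definition ccoef :: coeffs
  where "ccoef a b c i =
    (if (a, b, c) = (3, 0, 0) then cc i 1 1 1 else if (a, b, c) = (0, 3, 0) then cc i 2 2 2
     else if (a, b, c) = (0, 0, 3) then cc i 3 3 3 else if (a, b, c) = (2, 1, 0) then 3 * cc i 1 1 2
     else if (a, b, c) = (2, 0, 1) then 3 * cc i 1 1 3 else if (a, b, c) = (1, 2, 0) then 3 * cc i 1 2 2
     else if (a, b, c) = (0, 2, 1) then 3 * cc i 2 2 3 else if (a, b, c) = (1, 0, 2) then 3 * cc i 1 3 3
     else if (a, b, c) = (0, 1, 2) then 3 * cc i 2 3 3 else 6 * cc i 1 2 3)"

lemma C_w: "Cop S (w_center S z) (w_center S z) (w_center S z)
    = (\<Sum>i\<in>UNIV. \<Sum>j\<in>UNIV. \<Sum>k\<in>UNIV. (z $ i * z $ j * z $ k) *\<^sub>C Cc i j k)"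
proof -
  let ?w = "w_center S z"
  have 1: "Cop S ?w v u = (\<Sum>i\<in>UNIV. z $ i *\<^sub>C Cop S (cfun i) v u)" if "v \<in> E" "u \<in> E" for v u
    unfolding w_center_eq using that by (intro history_operator.sum[OF C_left]) (simp_all add: Cspace_cfun)
  have 2: "Cop S v ?w u = (\<Sum>i\<in>UNIV. z $ i *\<^sub>C Cop S v (cfun i) u)" if "v \<in> E" "u \<in> E" for v u
    unfolding w_center_eq using that by (intro history_operator.sum[OF C_middle]) (simp_all add: Cspace_cfun)
  have 3: "Cop S v u ?w = (\<Sum>i\<in>UNIV. z $ i *\<^sub>C Cop S v u (cfun i))" if "v \<in> E" "u \<in> E" for v u
    unfolding w_center_eq using that by (intro history_operator.sum[OF C_right]) (simp_all add: Cspace_cfun)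
  show ?thesis
    unfolding 1[OF Cspace_w_center Cspace_w_center] 2[OF Cspace_cfun Cspace_w_center] 3[OF Cspace_cfun Cspace_cfun]
    by (simp add: Cc_def scaleC_sum_right scaleC_scaleC mult.assoc)
qed

lemma f31_eq: "f31 S z = cubic ccoef z"
proof -
  have "ell l (F3 S (w_center S z)) = (\<Sum>i\<in>UNIV. \<Sum>j\<in>UNIV. \<Sum>k\<in>UNIV. z $ i * z $ j * z $ k * cc l i j k)" for l
    by (simp add: F3_def C_w ell_sum ell_scaleC cc_def)
  also have "\<dots> l = cubic ccoef z $ l" for l
    unfolding sum_3 cubic_nth ccoef_def
      cc_commutes(1)[of l 2 1] cc_commutes(1)[of l 3 1] cc_commutes(1)[of l 3 2]
      cc_commutes(2)[of l _ 2 1] cc_commutes(2)[of l _ 3 1] cc_commutes(2)[of l _ 3 2]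
    by (simp add: power2_eq_square power3_eq_cube algebra_simps cc_commutes(1)[of l 2 1] cc_commutes(1)[of l 3 1] cc_commutes(1)[of l 3 2]
      cc_commutes(2)[of l _ 2 1] cc_commutes(2)[of l _ 3 1] cc_commutes(2)[of l _ 3 2])
  finally show ?thesis
    unfolding f31_def center_comps_eq vec_eq_iff by simp
qed

lemma w_center_linear: "w_center S (z + t *\<^sub>R u) \<theta> = w_center S z \<theta> + t *\<^sub>R w_center S u \<theta>"
  by (simp add: w_center_eq sum_3 scaleC_add_left scaleR_scaleC scaleR_add_right add_ac)

text \<open>Along the line \<open>w + tk\<close> the quadratic field is \<open>Q(w,w) + 2t Q(w,k) + t\<^sup>2Q(k,k)\<close>.\<close>

lemma f21_line_derivative:
  assumes k: "y \<in> E"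
  shows "vector_derivative (\<lambda>t. f21 S (z + t *\<^sub>R u) (\<lambda>\<theta>. t *\<^sub>R (2 *\<^sub>R y \<theta>)) 0) (at 0)
    = 2 *\<^sub>R center_comps S (Qop S (w_center S z) (\<lambda>\<theta>. w_center S u \<theta> + 2 *\<^sub>R y \<theta>))"
proof -
  let ?w = "w_center S z" and ?k = "\<lambda>\<theta>. w_center S u \<theta> + 2 *\<^sub>R y \<theta>"
  have E: "?w \<in> E" "?k \<in> E" using k by (simp_all add: Cspace_w_center Cspace_intros)
  have lin: "center_comps S (u + v) = center_comps S u + center_comps S v"
    "center_comps S (t *\<^sub>R u) = t *\<^sub>R center_comps S u" for u v t
    by (simp_all add: center_comps_eq vec_eq_iff ell_add ell_scaleR)
  have "f21 S (z + t *\<^sub>R u) (\<lambda>\<theta>. t *\<^sub>R (2 *\<^sub>R y \<theta>)) 0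
      = center_comps S (Qop S ?w ?w) + (t *\<^sub>R (2 *\<^sub>R center_comps S (Qop S ?w ?k)) + t\<^sup>2 *\<^sub>R center_comps S (Qop S ?k ?k))" for t
  proof -
    have v: "(\<lambda>\<theta>. w_center S (z + t *\<^sub>R u) \<theta> + t *\<^sub>R (2 *\<^sub>R y \<theta>)) = (\<lambda>\<theta>. ?w \<theta> + t *\<^sub>R ?k \<theta>)"
      by (simp add: w_center_linear scaleR_add_right add.assoc)
    have tk: "(\<lambda>\<theta>. t *\<^sub>R ?k \<theta>) \<in> E" "(\<lambda>\<theta>. ?w \<theta> + t *\<^sub>R ?k \<theta>) \<in> E"
    proof -
      show 1: "(\<lambda>\<theta>. t *\<^sub>R ?k \<theta>) \<in> E" by (rule Cspace_scaleR[OF E(2)])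
      show "(\<lambda>\<theta>. ?w \<theta> + t *\<^sub>R ?k \<theta>) \<in> E" by (rule Cspace_add[OF E(1) 1])
    qed
    have "Qop S (\<lambda>\<theta>. ?w \<theta> + t *\<^sub>R ?k \<theta>) (\<lambda>\<theta>. ?w \<theta> + t *\<^sub>R ?k \<theta>)
        = (Qop S ?w ?w + t *\<^sub>R Qop S ?k ?w) + t *\<^sub>R (Qop S ?w ?k + t *\<^sub>R Qop S ?k ?k)"
      unfolding history_operator.add[OF Q_right[OF tk(2)] E(1) tk(1)] history_operator.scaleR[OF Q_right[OF tk(2)] E(2)]
        history_operator.add[OF Q_left[OF E(1)] E(1) tk(1)] history_operator.add[OF Q_left[OF E(2)] E(1) tk(1)]
        history_operator.scaleR[OF Q_left[OF E(1)] E(2)] history_operator.scaleR[OF Q_left[OF E(2)] E(2)] ..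
    also have "\<dots> = Qop S ?w ?w + (t *\<^sub>R (2 *\<^sub>R Qop S ?w ?k) + t\<^sup>2 *\<^sub>R Qop S ?k ?k)"
      unfolding Q_commute[OF E(2,1)] by (simp add: scaleR_2 power2_eq_square scaleR_add_right)
    finally show ?thesis
      unfolding f21_def v F2_zero[OF tk(2)] by (simp only: lin)
  qed
  moreover have "((\<lambda>t. a + (t *\<^sub>R b + t\<^sup>2 *\<^sub>R c)) has_vector_derivative b) (at 0)" for a b c :: "complex ^ 3"
    by (auto intro!: derivative_eq_intros simp: has_vector_derivative_def)
  ultimately show ?thesis by (simp only: vector_derivative_at)
qed

text \<open>The resonant part of \<open>f\<^sub>2\<^sup>1\<close> at \<open>\<alpha> = 0\<close>.\<close>

definition gcoef :: coeffs
  where "gcoef a b c i = (if (a, b, c, i) \<in> {(2, 0, 0, 1), (0, 1, 1, 1), (1, 1, 0, 2), (1, 0, 1, 3)} then fcoef a b c i else 0)"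

lemma gcoef_values:
  "gcoef 2 0 0 1 = fcoef 2 0 0 1" "gcoef 2 0 0 2 = 0" "gcoef 2 0 0 3 = 0"
  "gcoef 0 2 0 i = 0" "gcoef 0 0 2 i = 0"
  "gcoef 1 1 0 1 = 0" "gcoef 1 1 0 2 = fcoef 1 1 0 2" "gcoef 1 1 0 3 = 0"
  "gcoef 1 0 1 1 = 0" "gcoef 1 0 1 2 = 0" "gcoef 1 0 1 3 = fcoef 1 0 1 3"
  "gcoef 0 1 1 1 = fcoef 0 1 1 1" "gcoef 0 1 1 2 = 0" "gcoef 0 1 1 3 = 0"
  by (simp_all add: gcoef_def)

lemma g21_zero: "g21 S z 0 = quad gcoef z"
  unfolding vec_eq_iff forall_3 g21_eq
  by (simp add: quad_nth gcoef_values lamc_zero del: One_nat_def)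

text \<open>All cubic coefficients before projection: from \<open>C(w,w,w)\<close>, from \<open>3/2 \<cdot> 2 Q(w, w(U\<^sub>2\<^sup>1))\<close>, from
  \<open>3/2 \<cdot> 2 Q(w, 2h)\<close> and from \<open>-3/2 D\<^sub>zU\<^sub>2\<^sup>1 g\<^sub>2\<^sup>1\<close>.\<close>

definition cubic_coef :: "(nat \<Rightarrow> nat \<Rightarrow> nat \<Rightarrow> real \<Rightarrow> 'x ^ 'm) \<Rightarrow> coeffs"
  where "cubic_coef h a b c i = ccoef a b c i
    + (3 * lin_quad (\<lambda>j a b c i. \<Sum>l\<in>UNIV. qc i j l * solve fcoef a b c l) a b c i
    + (6 * lin_quad (\<lambda>j a b c i. hq h i j a b c) a b c i
    - 3 / 2 * lin_quad (\<lambda>k a b c i. \<Sum>j\<in>UNIV. jac (solve fcoef) i k j * gcoef a b c j) a b c i))"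

lemma Cspace_h:
  assumes "h_in_Q1 S h" shows "(a, b, c) \<in> h_index \<Longrightarrow> h a b c \<in> E" and "h_poly h z \<in> E"
proof -
  show h: "(a, b, c) \<in> h_index \<Longrightarrow> h a b c \<in> E" for a b c
    using assms by (auto simp: h_in_Q1_def dest: Q1_spaceD(1))
  show "h_poly h z \<in> E"
    unfolding h_poly_explicit by (intro Cspace_intros h) (simp_all add: h_index_def)
qed

lemma Q_cfun_h_poly:
  assumes "h_in_Q1 S h"
  shows "ell i (Qop S (cfun j) (h_poly h z)) = quad (\<lambda>a b c i. hq h i j a b c) z $ i"
proof -
  interpret Qj: history_operator r "Qop S (cfun j)" by (rule Q_right) (rule Cspace_cfun)
  have h: "h 2 0 0 \<in> E" "h 0 2 0 \<in> E" "h 0 0 2 \<in> E" "h 1 1 0 \<in> E" "h 1 0 1 \<in> E" "h 0 1 1 \<in> E"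
    by (rule Cspace_h(1)[OF assms], simp add: h_index_def)+
  show ?thesis
    unfolding h_poly_explicit quad_nth hq_def
    by (simp add: Qj.add Qj.scaleC Cspace_intros h ell_add ell_scaleC mult_ac del: One_nat_def)
qed

lemma g31_eq:
  assumes "h_in_Q1 S h"
  shows "g31 S h z = vector
    [cubic_coef h 3 0 0 1 * z $ 1 ^ 3 + cubic_coef h 1 1 1 1 * (z $ 1 * z $ 2 * z $ 3),
     cubic_coef h 2 1 0 2 * ((z $ 1)\<^sup>2 * z $ 2) + cubic_coef h 0 2 1 2 * ((z $ 2)\<^sup>2 * z $ 3),
     cubic_coef h 2 0 1 3 * ((z $ 1)\<^sup>2 * z $ 3) + cubic_coef h 0 1 2 3 * (z $ 2 * (z $ 3)\<^sup>2)]"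
proof -
  define V1 where "V1 j a b c i = (\<Sum>l\<in>UNIV. qc i j l * solve fcoef a b c l)" for j a b c i
  define V2 where "V2 j a b c i = hq h i j a b c" for j a b c i
  define V3 where "V3 k a b c i = (\<Sum>j\<in>UNIV. jac (solve fcoef) i k j * gcoef a b c j)" for k a b c i
  have "f31 S z + (3/2) *\<^sub>R
      (vector_derivative (\<lambda>t. f21 S (z + t *\<^sub>R U21 S z) (\<lambda>\<theta>. t *\<^sub>R (2 *\<^sub>R h_poly h z \<theta>)) 0) (at 0)
       - frechet_derivative (U21 S) (at z) (g21 S z 0)) = cubic (cubic_coef h) z" for z
  proof -
    let ?u = "U21 S z"
    have Q1: "ell i (Qop S (w_center S z) (w_center S ?u)) = cubic (lin_quad V1) z $ i" for i
    proof -
      have "ell i (Qop S (w_center S z) (w_center S ?u)) = (\<Sum>j\<in>UNIV. z $ j * (\<Sum>l\<in>UNIV. qc i j l * ?u $ l))"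
        by (simp add: Q_w_w ell_sum ell_scaleC qc_def sum_distrib_left mult_ac)
      also have "\<dots> = cubic (lin_quad V1) z $ i"
        unfolding cubic_lin_quad V1_def quad_sum U21_eq ..
      finally show ?thesis .
    qed
    have Q2: "ell i (Qop S (w_center S z) (h_poly h z)) = cubic (lin_quad V2) z $ i" for i
    proof -
      have "Qop S (w_center S z) (h_poly h z) = (\<Sum>j\<in>UNIV. z $ j *\<^sub>C Qop S (cfun j) (h_poly h z))"
        unfolding w_center_eq by (rule Q_cfun_sum[OF Cspace_h(2)[OF assms]])
      then show ?thesis
        unfolding cubic_lin_quad V2_def by (simp add: ell_sum ell_scaleC Q_cfun_h_poly[OF assms])
    qed
    have Q3: "Qop S (w_center S z) (\<lambda>\<theta>. w_center S ?u \<theta> + 2 *\<^sub>R h_poly h z \<theta>)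
        = Qop S (w_center S z) (w_center S ?u) + 2 *\<^sub>R Qop S (w_center S z) (h_poly h z)"
      using history_operator.add[OF Q_right[OF Cspace_w_center] Cspace_w_center Cspace_scaleR[OF Cspace_h(2)[OF assms]], of z ?u 2 z]
        history_operator.scaleR[OF Q_right[OF Cspace_w_center] Cspace_h(2)[OF assms], of z 2 z]
      by simp
    have Q: "center_comps S (Qop S (w_center S z) (\<lambda>\<theta>. w_center S ?u \<theta> + 2 *\<^sub>R h_poly h z \<theta>))
        = cubic (lin_quad V1) z + 2 *\<^sub>R cubic (lin_quad V2) z"
      unfolding center_comps_eq Q3 ell_add ell_scaleR Q1 Q2 by (simp add: vec_eq_iff)
    have D: "frechet_derivative (U21 S) (at z) (g21 S z 0) = cubic (lin_quad V3) z"
      unfolding vec_eq_iff U21_eq g21_zero frechet_quad cubic_lin_quad V3_def quad_sum by simp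
    have K: "cubic (cubic_coef h) z = cubic ccoef z
        + (3 *s cubic (lin_quad V1) z + (6 *s cubic (lin_quad V2) z - (3/2) *s cubic (lin_quad V3) z))"
      unfolding cubic_linear[symmetric] cubic_coef_def[abs_def] V1_def[abs_def] V2_def[abs_def] V3_def[abs_def] ..
    show ?thesis
      unfolding f21_line_derivative[OF Cspace_h(2)[OF assms]] Q D K f31_eq
        vec_eq_iff vector_add_component vector_minus_component vector_scaleR_component vector_smult_component
      by (simp add: scaleR_conv_of_real algebra_simps)
  qed
  then show ?thesis
    unfolding g31_def by (simp only: proj_cubic)
qed

text \<open>These are \<open>a\<^sub>1\<^sub>1\<^sub>1\<close>, \<open>a\<^sub>1\<^sub>2\<^sub>3\<close>, \<open>b\<^sub>1\<^sub>1\<^sub>2\<close>, \<open>b\<^sub>2\<^sub>2\<^sub>3\<close>, with the products \<open>\<psi>\<^sub>i(0) Q \<langle>\<beta>\<beta>', \<beta>''\<rangle>\<close> contracted to single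
  numbers. In this form complex conjugation only permutes indices.\<close>

definition "nf111 h = 1/6 * cc 1 1 1 1 + hq h 1 1 2 0 0 + 1 / (2 * iw) * (- qc 1 1 2 * qc 2 1 1 + qc 1 1 3 * qc 3 1 1)"

definition "nf123 h = cc 1 1 2 3 + 1 / iw * (- qc 1 1 2 * qc 2 2 3 + qc 1 1 3 * qc 3 2 3
    + 1/2 * (- qc 1 2 2 * qc 2 1 3 + qc 1 3 3 * qc 3 1 2))
  + (hq h 1 1 0 1 1 + hq h 1 2 1 0 1 + hq h 1 3 1 1 0)"

definition "nf112 h = 1/2 * cc 2 1 1 2 + 1 / (2 * iw) * (2 * qc 2 1 1 * qc 1 1 2 + qc 2 1 3 * qc 3 1 2
    - qc 2 2 2 * qc 2 1 1 + qc 2 2 3 * qc 3 1 1) + (hq h 2 1 1 1 0 + hq h 2 2 2 0 0)"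

definition "nf223 h = 1/2 * cc 2 2 2 3 + 1 / (4 * iw) * (qc 2 1 3 * qc 1 2 2 + 2/3 * qc 2 3 3 * qc 3 2 2
    - 2 * qc 2 2 2 * qc 2 2 3 + 4 * qc 2 2 3 * qc 3 2 3) + (hq h 2 2 0 1 1 + hq h 2 3 0 2 0)"

lemma qc_order: "qc i 2 1 = qc i 1 2" "qc i 3 1 = qc i 1 3" "qc i 3 2 = qc i 2 3"
  by (rule qc_commute)+

text \<open>At the resonant monomials the contributions of \<open>D\<^sub>zU\<^sub>2\<^sup>1 g\<^sub>2\<^sup>1\<close> vanish, as every product of entries there
  has a resonant coefficient of \<open>U\<^sub>2\<^sup>1\<close> or a nonresonant one of \<open>g\<^sub>2\<^sup>1\<close> as a factor.\<close>

lemma cubic_coef_values: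
  "1/6 * cubic_coef h 3 0 0 1 = nf111 h" "1/6 * cubic_coef h 1 1 1 1 = nf123 h"
  "1/6 * cubic_coef h 2 1 0 2 = nf112 h" "1/6 * cubic_coef h 0 2 1 2 = nf223 h"
  using iw_nonzero unfolding cubic_coef_def lin_quad_values sum_3 jac_values gcoef_values solve_values fcoef_values qc_order
    nf111_def nf123_def nf112_def nf223_def ccoef_def
  by (simp_all add: field_simps del: One_nat_def)

lemma cnj_qc: "cnj (qc i j k) = qc (swap i) (swap j) (swap k)"
  by (simp add: qc_def ell_conjv[symmetric] conjv_Qc)

lemma cnj_cc: "cnj (cc i j k l) = cc (swap i) (swap j) (swap k) (swap l)"
  by (simp add: cc_def Cc_def ell_conjv[symmetric] C_conj[symmetric] Cspace_cfun hconj_cfun)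

lemma cnj_hq:
  assumes "h_solution S h" "(a, b, c) \<in> h_index"
  shows "cnj (hq h i j a b c) = hq h (swap i) (swap j) a c b"
proof -
  have mem: "(a, c, b) \<in> h_index" using assms(2) by (auto simp: h_index_def)
  have Q1: "h_in_Q1 S h" using assms(1) by (simp add: h_solution_def)
  have "conjv S (Qop S (cfun j) (h a b c)) = Qop S (cfun (swap j)) (hconj (h a b c))"
    using Q_conj[OF Cspace_cfun Cspace_h(1)[OF Q1 assms(2)], of j] by (simp add: hconj_cfun)
  also have "\<dots> = Qop S (cfun (swap j)) (h a c b)"
    by (rule history_operator.cong[OF Q_right[OF Cspace_cfun] Cspace_hconj[OF Cspace_h(1)[OF Q1 assms(2)]] Cspace_h(1)[OF Q1 mem]])
      (simp add: h_conj[OF assms])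
  finally show ?thesis by (simp add: hq_def ell_conjv[symmetric])
qed

lemma cnj_lamc: "cnj (lamc i j \<alpha>) = lamc (swap i) (swap j) \<alpha>"
proof -
  have "conjv S (lin_param \<alpha> j) = lin_param \<alpha> (swap j)"
  proof -
    have "conjv S (diag_mul d u) = diag_mul d (conjv S u)" for d :: "real ^ 'm" and u
      by (simp add: vec_eq_iff scaleR_conv_scaleC cj_scaleC)
    then show ?thesis
      using fun_cong[OF hconj_cfun[of j], of 0]
      by (simp add: lin_param_def conjv_add L1_conj[symmetric] Cspace_cfun hconj_cfun lap_conjv[symmetric] lap_cfun(1))
  qed
  then show ?thesis by (simp add: lamc_def ell_conjv[symmetric])
qed

text \<open>Exchanging \<open>e\<^sub>2\<close> and \<open>e\<^sub>3\<close> conjugates \<open>q\<close>, \<open>c\<close>, the numbers from \<open>h\<close>, and \<open>\<i>\<omega>\<^sub>0\<close>, hence turns the coefficients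
  of the second component into those of the third.\<close>

lemma cubic_coef_cnj:
  assumes "h_solution S h"
  shows "1/6 * cubic_coef h 2 0 1 3 = cnj (nf112 h)" "1/6 * cubic_coef h 0 1 2 3 = cnj (nf223 h)"
proof -
  have mem: "(1, 1, 0) \<in> h_index" "(2, 0, 0) \<in> h_index" "(0, 1, 1) \<in> h_index" "(0, 2, 0) \<in> h_index"
    by (simp_all add: h_index_def)
  have cc: "cc 3 3 3 2 = cc 3 2 3 3"
    using cc_commutes by metis
  show "1/6 * cubic_coef h 2 0 1 3 = cnj (nf112 h)" "1/6 * cubic_coef h 0 1 2 3 = cnj (nf223 h)"
    unfolding cubic_coef_def lin_quad_values sum_3 jac_values gcoef_values solve_values fcoef_values qc_order
      nf112_def nf223_def ccoef_def
    using iw_nonzero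
    by (simp_all add: cnj_qc cnj_cc cnj_hq[OF assms mem(1)] cnj_hq[OF assms mem(2)] cnj_hq[OF assms mem(3)]
        cnj_hq[OF assms mem(4)] qc_order cc field_simps del: One_nat_def)
qed

lemma normal_form_components:
  assumes "h_solution S h"
  defines "NF \<equiv> \<lambda>z \<alpha>. Bmat S z + (1/2) *\<^sub>R g21 S z \<alpha> + (1/6) *\<^sub>R g31 S h z"
  shows "NF z \<alpha> $ 1 = 1/2 * lamc 1 1 \<alpha> * z $ 1 + 1/2 * qc 1 1 1 * (z $ 1)\<^sup>2 + qc 1 2 3 * z $ 2 * z $ 3
      + nf111 h * z $ 1 ^ 3 + nf123 h * z $ 1 * z $ 2 * z $ 3"
    and "NF z \<alpha> $ 2 = iw * z $ 2 + 1/2 * lamc 2 2 \<alpha> * z $ 2 + qc 2 1 2 * z $ 1 * z $ 2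
      + nf112 h * (z $ 1)\<^sup>2 * z $ 2 + nf223 h * (z $ 2)\<^sup>2 * z $ 3"
    and "NF z \<alpha> $ 3 = - iw * z $ 3 + cnj (1/2 * lamc 2 2 \<alpha>) * z $ 3 + cnj (qc 2 1 2) * z $ 1 * z $ 3
      + cnj (nf112 h) * (z $ 1)\<^sup>2 * z $ 3 + cnj (nf223 h) * z $ 2 * (z $ 3)\<^sup>2"
proof -
  have Q1: "h_in_Q1 S h" using assms(1) by (simp add: h_solution_def)
  show "NF z \<alpha> $ 1 = 1/2 * lamc 1 1 \<alpha> * z $ 1 + 1/2 * qc 1 1 1 * (z $ 1)\<^sup>2 + qc 1 2 3 * z $ 2 * z $ 3
      + nf111 h * z $ 1 ^ 3 + nf123 h * z $ 1 * z $ 2 * z $ 3"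
    and "NF z \<alpha> $ 2 = iw * z $ 2 + 1/2 * lamc 2 2 \<alpha> * z $ 2 + qc 2 1 2 * z $ 1 * z $ 2
      + nf112 h * (z $ 1)\<^sup>2 * z $ 2 + nf223 h * (z $ 2)\<^sup>2 * z $ 3"
    and "NF z \<alpha> $ 3 = - iw * z $ 3 + cnj (1/2 * lamc 2 2 \<alpha>) * z $ 3 + cnj (qc 2 1 2) * z $ 1 * z $ 3
      + cnj (nf112 h) * (z $ 1)\<^sup>2 * z $ 3 + cnj (nf223 h) * z $ 2 * (z $ 3)\<^sup>2"
    unfolding NF_def g21_eq g31_eq[OF Q1] cubic_coef_cnj[OF assms(1), symmetric]
    unfolding cubic_coef_values[symmetric] vector_add_component vector_scaleR_component
    by (simp_all add: Bmat_def fcoef_values scaleR_conv_of_real cnj_lamc cnj_qc algebra_simps del: One_nat_def)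
qed

lemma lamc_eq: "lamc j j \<alpha> = cpsi j 0 \<cdot> (L1vec S \<alpha> (cphi j) - of_real (mu S (cmode j)) *s diag_mul (diffc1 S \<alpha>) (cphi j 0))"
proof -
  have "L1op S \<alpha> (cfun j) = L1vec S \<alpha> (cphi j) \<otimes> \<beta> (cmode j)"
    unfolding cfun_def by (rule L_htens(2)[OF Cspace_cphi])
  moreover have "cfun j 0 = cphi j 0 \<otimes> \<beta> (cmode j)" by (simp add: cfun_def htens_def)
  ultimately have "lin_param \<alpha> j = (L1vec S \<alpha> (cphi j) - of_real (mu S (cmode j)) *s diag_mul (diffc1 S \<alpha>) (cphi j 0)) \<otimes> \<beta> (cmode j)"
    unfolding lin_param_def lap_cfun(2)
    by (simp add: vec_eq_iff scaleC_diff_left scaleC_minus_left scaleC_scaleC scaleC_scaleR_commute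
        scaleR_scaleC mult_scaleR_right)
  then show ?thesis
    unfolding lamc_def using orthonormal[OF cmode_mem cmode_mem, of j j] by (simp add: ell_tens)
qed

end

theorem theorem3p1:
  fixes S :: "('n::finite, 'x::complex_hilbert, 'm::finite) pfde"
    and h :: "nat \<Rightarrow> nat \<Rightarrow> nat \<Rightarrow> real \<Rightarrow> 'x ^ 'm"
    and \<phi>1 \<phi>2 \<phi>2c :: "real \<Rightarrow> complex ^ 'm"
    and \<psi>1 \<psi>2 \<psi>2c :: "complex ^ 'm"
    and \<beta>1 \<beta>2 :: 'x
    and \<mu>1 \<mu>2 :: real
    and Q :: "(real \<Rightarrow> complex ^ 'm) \<Rightarrow> (real \<Rightarrow> complex ^ 'm) \<Rightarrow> complex ^ 'm"
    and C :: "(real \<Rightarrow> complex ^ 'm) \<Rightarrow> (real \<Rightarrow> complex ^ 'm) \<Rightarrow> (real \<Rightarrow> complex ^ 'm) \<Rightarrow> complex ^ 'm"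
    and Qh :: "(real \<Rightarrow> complex ^ 'm) \<Rightarrow> (real \<Rightarrow> 'x ^ 'm) \<Rightarrow> 'x \<Rightarrow> 'x \<Rightarrow> complex ^ 'm"
    and ip :: "'x list \<Rightarrow> 'x \<Rightarrow> complex"
    and iw :: complex
    and a1 b2 :: "real ^ 2 \<Rightarrow> complex"
    and a11 a23 a111 a123 b12 b112 b223 :: complex
  assumes "setting S" and "hopf_steady_state S" and "center_bases S" and "h_solution S h"
    and "\<phi>1 = phi1 S" and "\<phi>2 = phi2 S" and "\<phi>2c = phi2c S"
    and "\<psi>1 = psi1 S 0" and "\<psi>2 = psi2 S 0" and "\<psi>2c = psi2c S 0"
    and "\<beta>1 = beta1 S" and "\<beta>2 = beta2 S"
    and "\<mu>1 = mu S (k1 S)" and "\<mu>2 = mu S (k2 S)"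
    and "Q = Qvec S" and "C = Cvec S"
    and "Qh = (\<lambda>\<phi> v \<beta> \<beta>'. comp_ip (Qop S (htens \<phi> \<beta>) v) \<beta>')"
    and "ip = (\<lambda>us \<beta>. cinner (prodX S us) \<beta>)"
    and "iw = \<i> * of_real (om0 S)"
    and "a1 = (\<lambda>\<alpha>. 1/2 * (\<psi>1 \<cdot> (L1vec S \<alpha> \<phi>1 - of_real \<mu>1 *s diag_mul (diffc1 S \<alpha>) (\<phi>1 0))))"
    and "b2 = (\<lambda>\<alpha>. 1/2 * (\<psi>2 \<cdot> (L1vec S \<alpha> \<phi>2 - of_real \<mu>2 *s diag_mul (diffc1 S \<alpha>) (\<phi>2 0))))"
    and "a11 = 1/2 * (\<psi>1 \<cdot> Q \<phi>1 \<phi>1) * ip [\<beta>1, \<beta>1] \<beta>1"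
    and "a23 = (\<psi>1 \<cdot> Q \<phi>2 \<phi>2c) * ip [\<beta>2, \<beta>2] \<beta>1"
    and "b12 = (\<psi>2 \<cdot> Q \<phi>1 \<phi>2) * ip [\<beta>1, \<beta>2] \<beta>2"
    and "a111 =
      1/6 * (\<psi>1 \<cdot> C \<phi>1 \<phi>1 \<phi>1) * ip [\<beta>1, \<beta>1, \<beta>1] \<beta>1
      + (\<psi>1 \<cdot> Qh \<phi>1 (h 2 0 0) \<beta>1 \<beta>1)
      + 1 / (2 * iw) * (\<psi>1 \<cdot> (- outer (Q \<phi>1 \<phi>2) \<psi>2 + outer (Q \<phi>1 \<phi>2c) \<psi>2c) *v Q \<phi>1 \<phi>1)
          * ip [\<beta>1, \<beta>2] \<beta>1 * ip [\<beta>1, \<beta>1] \<beta>2"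
    and "a123 =
      (\<psi>1 \<cdot> C \<phi>1 \<phi>2 \<phi>2c) * ip [\<beta>1, \<beta>2, \<beta>2] \<beta>1
      + 1 / iw * (\<psi>1 \<cdot> (
          (ip [\<beta>1, \<beta>2] \<beta>1 * ip [\<beta>2, \<beta>2] \<beta>2) *s
            ((- outer (Q \<phi>1 \<phi>2) \<psi>2 + outer (Q \<phi>1 \<phi>2c) \<psi>2c) *v Q \<phi>2 \<phi>2c)
          + (1/2 * ip [\<beta>1, \<beta>2] \<beta>2 * ip [\<beta>2, \<beta>2] \<beta>1) *s
            (- (outer (Q \<phi>2 \<phi>2) \<psi>2 *v Q \<phi>1 \<phi>2c) + outer (Q \<phi>2c \<phi>2c) \<psi>2c *v Q \<phi>1 \<phi>2)))
      + ((\<psi>1 \<cdot> Qh \<phi>1 (h 0 1 1) \<beta>1 \<beta>1) + (\<psi>1 \<cdot> Qh \<phi>2 (h 1 0 1) \<beta>2 \<beta>1)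
          + (\<psi>1 \<cdot> Qh \<phi>2c (h 1 1 0) \<beta>2 \<beta>1))"
    and "b112 =
      1/2 * (\<psi>2 \<cdot> C \<phi>1 \<phi>1 \<phi>2) * ip [\<beta>1, \<beta>1, \<beta>2] \<beta>2
      + 1 / (2 * iw) * (\<psi>2 \<cdot> (
          (2 * ip [\<beta>1, \<beta>2] \<beta>1 * ip [\<beta>1, \<beta>1] \<beta>2) *s (outer (Q \<phi>1 \<phi>1) \<psi>1 *v Q \<phi>1 \<phi>2)
          + (ip [\<beta>1, \<beta>2] \<beta>2)\<^sup>2 *s (outer (Q \<phi>1 \<phi>2c) \<psi>2c *v Q \<phi>1 \<phi>2)
          + (ip [\<beta>1, \<beta>1] \<beta>2 * ip [\<beta>2, \<beta>2] \<beta>2) *s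
            ((- outer (Q \<phi>2 \<phi>2) \<psi>2 + outer (Q \<phi>2 \<phi>2c) \<psi>2c) *v Q \<phi>1 \<phi>1)))
      + ((\<psi>2 \<cdot> Qh \<phi>1 (h 1 1 0) \<beta>1 \<beta>2) + (\<psi>2 \<cdot> Qh \<phi>2 (h 2 0 0) \<beta>2 \<beta>2))"
    and "b223 =
      1/2 * (\<psi>2 \<cdot> C \<phi>2 \<phi>2 \<phi>2c) * ip [\<beta>2, \<beta>2, \<beta>2] \<beta>2
      + 1 / (4 * iw) * (\<psi>2 \<cdot> (
          (ip [\<beta>1, \<beta>2] \<beta>2 * ip [\<beta>2, \<beta>2] \<beta>1) *s (outer (Q \<phi>1 \<phi>2c) \<psi>1 *v Q \<phi>2 \<phi>2)
          + (2/3 * (ip [\<beta>2, \<beta>2] \<beta>2)\<^sup>2) *s (outer (Q \<phi>2c \<phi>2c) \<psi>2c *v Q \<phi>2 \<phi>2)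
          + (ip [\<beta>2, \<beta>2] \<beta>2)\<^sup>2 *s
            ((- 2 *\<^sub>R outer (Q \<phi>2 \<phi>2) \<psi>2 + 4 *\<^sub>R outer (Q \<phi>2 \<phi>2c) \<psi>2c) *v Q \<phi>2 \<phi>2c)))
      + ((\<psi>2 \<cdot> Qh \<phi>2 (h 0 1 1) \<beta>2 \<beta>2) + (\<psi>2 \<cdot> Qh \<phi>2c (h 0 2 0) \<beta>2 \<beta>2))"
  shows "(\<forall>N. normal_form S h N \<longrightarrow> (\<exists>R. hot R \<and> (\<forall>x z2 \<alpha>. let z1 = complex_of_real x in
        N x z2 \<alpha> $ 1 = a1 \<alpha> * z1 + a11 * z1\<^sup>2 + a23 * z2 * cnj z2
          + a111 * z1 ^ 3 + a123 * z1 * z2 * cnj z2 + R x z2 \<alpha> $ 1 \<and>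
        N x z2 \<alpha> $ 2 = iw * z2 + b2 \<alpha> * z2 + b12 * z1 * z2
          + b112 * z1\<^sup>2 * z2 + b223 * z2\<^sup>2 * cnj z2 + R x z2 \<alpha> $ 2 \<and>
        N x z2 \<alpha> $ 3 = - iw * cnj z2 + cnj (b2 \<alpha>) * cnj z2 + cnj b12 * z1 * cnj z2
          + cnj b112 * z1\<^sup>2 * cnj z2 + cnj b223 * z2 * (cnj z2)\<^sup>2 + R x z2 \<alpha> $ 3)))
    \<and> h_in_Q1 S h \<and> h_relations S h
    \<and> (\<forall>h'. h_in_Q1 S h' \<and> h_relations S h' \<longrightarrow>
        (\<forall>(a, b, c)\<in>h_index. \<forall>\<theta>\<in>{- delay S..0}. h' a b c \<theta> = h a b c \<theta>))"
proof -
  interpret bifurcation S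
    by unfold_locales fact+
  have names: "\<phi>1 = cphi 1" "\<phi>2 = cphi 2" "\<phi>2c = cphi 3" "\<psi>1 = cpsi 1 0" "\<psi>2 = cpsi 2 0" "\<psi>2c = cpsi 3 0"
    "\<beta>1 = eigf S (cmode 1)" "\<beta>2 = eigf S (cmode 2)" "\<mu>1 = mu S (cmode 1)" "\<mu>2 = mu S (cmode 2)"
    using assms(5-14) by (simp_all add: cphi_def cpsi_def cmode_def beta1_def beta2_def)
  have iw: "iw = \<i> * complex_of_real (om0 S)" by fact
  have q: "qc i j k = ip [eigf S (cmode j), eigf S (cmode k)] (eigf S (cmode i)) * (cpsi i 0 \<cdot> Q (cphi j) (cphi k))" for i j k
    unfolding assms(15,18) qc_def ell_Qc ..
  have c: "cc i j k l = ip [eigf S (cmode j), eigf S (cmode k), eigf S (cmode l)] (eigf S (cmode i))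
      * (cpsi i 0 \<cdot> C (cphi j) (cphi k) (cphi l))" for i j k l
    unfolding assms(16,18) cc_def Cc_def cfun_def C_htens[OF Cspace_cphi Cspace_cphi Cspace_cphi] ell_tens ..
  have hh: "hq h i j a b c = cpsi i 0 \<cdot> Qh (cphi j) (h a b c) (eigf S (cmode j)) (eigf S (cmode i))" for i j a b c
    unfolding assms(17) hq_def ell_def cfun_def ..
  have lam: "a1 \<alpha> = 1/2 * lamc 1 1 \<alpha>" "b2 \<alpha> = 1/2 * lamc 2 2 \<alpha>" for \<alpha>
    unfolding assms(20,21) names lamc_eq by simp_all
  have quadratic: "a11 = 1/2 * qc 1 1 1" "a23 = qc 1 2 3" "b12 = qc 2 1 2"
    unfolding assms(22-24) names q cmode_2(2) by simp_all
  have cubic: "a111 = nf111 h" "a123 = nf123 h" "b112 = nf112 h" "b223 = nf223 h"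
    unfolding assms(25-28) nf111_def nf123_def nf112_def nf223_def names q c hh cmode_2(2) iw[symmetric]
      outer_combination
    by (simp_all add: outer_mult outer_combination rowmul_simps power2_eq_square algebra_simps)
  have nf: "\<exists>R. hot R \<and> (\<forall>x z2 \<alpha>. let z1 = complex_of_real x in
        N x z2 \<alpha> $ 1 = a1 \<alpha> * z1 + a11 * z1\<^sup>2 + a23 * z2 * cnj z2
          + a111 * z1 ^ 3 + a123 * z1 * z2 * cnj z2 + R x z2 \<alpha> $ 1 \<and>
        N x z2 \<alpha> $ 2 = iw * z2 + b2 \<alpha> * z2 + b12 * z1 * z2
          + b112 * z1\<^sup>2 * z2 + b223 * z2\<^sup>2 * cnj z2 + R x z2 \<alpha> $ 2 \<and>
        N x z2 \<alpha> $ 3 = - iw * cnj z2 + cnj (b2 \<alpha>) * cnj z2 + cnj b12 * z1 * cnj z2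
          + cnj b112 * z1\<^sup>2 * cnj z2 + cnj b223 * z2 * (cnj z2)\<^sup>2 + R x z2 \<alpha> $ 3)"
    if "normal_form S h N" for N
  proof -
    define NF where "NF z \<alpha> = Bmat S z + (1/2) *\<^sub>R g21 S z \<alpha> + (1/6) *\<^sub>R g31 S h z" for z \<alpha>
    \<comment> \<open>The normal form leaves precisely this remainder undetermined.\<close>
    define R where "R x z2 \<alpha> = N x z2 \<alpha> - NF (vector [of_real x, z2, cnj z2]) \<alpha>" for x z2 \<alpha>
    have "hot R"
      using that unfolding normal_form_def Let_def R_def[abs_def] NF_def .
    moreover have N: "N x z2 \<alpha> $ i = NF (vector [of_real x, z2, cnj z2]) \<alpha> $ i + R x z2 \<alpha> $ i" for x z2 \<alpha> i
      by (simp add: R_def)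
    ultimately show ?thesis
      unfolding Let_def N NF_def normal_form_components[OF assms(4)] lam quadratic cubic iw
      by (intro exI[of _ R]) simp
  qed
  have Q1: "h_in_Q1 S h" using assms(4) by (simp add: h_solution_def)
  have rel: "h_relations S h" using assms(4) by (rule h_solution_relations)
  have "\<forall>(a, b, c)\<in>h_index. \<forall>\<theta>\<in>{- delay S..0}. h' a b c \<theta> = h a b c \<theta>"
    if "h_in_Q1 S h' \<and> h_relations S h'" for h'
    using h_relations_unique[OF Q1 rel, of h'] that by blast
  with nf Q1 rel show ?thesis by blast
qed

end
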